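(* Let $V$ be a non-trivial irreducible module for $G=\mathrm{SL}_2(t^a)$ over the field $\mathbb{F}_q$, where $t$ is a prime, $t^a\geq 4$, and $q\neq t$ is a prime number. For odd primes $r\in\pi(t^a-1)$ and $s\in\pi(t^a+1)$ (possibly $r=q$ or $s=q$), let $R$ and $S$ be respectively a Sylow $r$-subgroup and a Sylow $s$-subgroup of $G$, and let $T$ be a Sylow $t$-subgroup of $G$. Consider the sets $$V_{I_-}=\{v\in V\mid \text{there exists } z\in G \text{ such that } R^z\trianglelefteq \mathbf{C}_G(v)\},$$ $$V_{I_+}=\{v\in V\mid \text{there exists } z\in G \text{ such that } S^z\trianglelefteq \mathbf{C}_G(v)\},$$ $$V_{II}=\{v\in V\mid \text{there exists } z\in G \text{ such that } T^z\trianglelefteq \mathbf{C}_G(v)\}.$$ Then $V-\{0\}$ strictly contains $V_{I_-}\cup V_{II}$, $V_{I_+}\cup V_{II}$, and $V_{I_-}\cup V_{I_+}$, unless one of the following holds. (a) $G\cong\mathrm{SL}_2(5)$, $s=3$, $|V|=3^4$ and $V-\{0\}=V_{I_+}$. (b) $G\cong\mathrm{SL}_2(13)$, $r=3$, $|V|=3^6$ and $V-\{0\}=V_{I_-}$.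
   Context: For a positive integer $n$, $\pi(n)$ is the set of prime divisors of $n$. $\mathbb{F}_q$ is the field with $q$ elements. $\mathbf{C}_G(v)$ is the stabilizer of $v$ in $G$, and $X^z=z^{-1}Xz$. *)

theory Defs
  imports
    "HOL-Analysis.Determinants"
    "HOL-Algebra.Group_Action"
    "HOL-Computational_Algebra.Primes"
    "HOL-Library.Numeral_Type"
begin

text \<open>Defined over commutative rings so that it also applies to the numeral types \<open>5\<close> and \<open>13\<close>,
  which are the prime fields with modular arithmetic but are only \<open>comm_ring_1\<close> in the library.\<close>

definition SL2 :: "('f::comm_ring_1 ^ 2 ^ 2) monoid" where
  "SL2 = \<lparr>carrier = {A. det A = 1}, mult = (**), one = mat 1\<rparr>"

lemma group_SL2: "group (SL2 :: ('f::field ^ 2 ^ 2) monoid)"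
proof (rule groupI)
  fix A :: "'f ^ 2 ^ 2" assume "A \<in> carrier SL2"
  then have d: "det A = 1" by (simp add: SL2_def)
  then obtain B where B: "B ** A = mat 1"
    using invertible_det_nz[of A] unfolding invertible_def by auto
  then have "det B * det A = 1" by (metis det_I det_mul)
  with B d show "\<exists>B\<in>carrier SL2. B \<otimes>\<^bsub>SL2\<^esub> A = \<one>\<^bsub>SL2\<^esub>"
    by (intro bexI[of _ B]) (auto simp: SL2_def)
qed (auto simp: SL2_def det_mul det_I matrix_mul_assoc)

definition sylow_subgroup :: "('g, 'm) monoid_scheme \<Rightarrow> nat \<Rightarrow> 'g set \<Rightarrow> bool" where
  "sylow_subgroup G p P \<longleftrightarrow> subgroup P G \<and> card P = p ^ multiplicity p (order G)"

text \<open>A module for the group \<open>G\<close> over the field \<open>'k\<close>: the whole type \<open>'v\<close> is the underlying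
  vector space, and \<open>G\<close> acts on it from the left by linear maps.\<close>

locale linear_group_action =
  group_action G "UNIV :: 'v set" \<phi> + vector_space scale
  for G (structure) and \<phi> and scale :: "'k::field \<Rightarrow> 'v::ab_group_add \<Rightarrow> 'v" +
  assumes action_linear: "g \<in> carrier G \<Longrightarrow> Vector_Spaces.linear scale scale (\<phi> g)"

locale irreducible_linear_group_action = linear_group_action G \<phi> scale
  for G (structure) and \<phi> and scale :: "'k::field \<Rightarrow> 'v::ab_group_add \<Rightarrow> 'v" +
  assumes nonzero: "\<exists>v::'v. v \<noteq> 0"
    and irreducible:
      "\<lbrakk>subspace W; \<And>g w. \<lbrakk>g \<in> carrier G; w \<in> W\<rbrakk> \<Longrightarrow> \<phi> g w \<in> W\<rbrakk> \<Longrightarrow> W = {0} \<or> W = UNIV"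

definition trivial_action :: "('g, 'm) monoid_scheme \<Rightarrow> ('g \<Rightarrow> 'v \<Rightarrow> 'v) \<Rightarrow> bool" where
  "trivial_action G \<phi> \<longleftrightarrow> (\<forall>g\<in>carrier G. \<forall>v. \<phi> g v = v)"

definition conj_set :: "('g, 'm) monoid_scheme \<Rightarrow> 'g set \<Rightarrow> 'g \<Rightarrow> 'g set" where
  "conj_set G P z = (\<lambda>x. inv\<^bsub>G\<^esub> z \<otimes>\<^bsub>G\<^esub> x \<otimes>\<^bsub>G\<^esub> z) ` P"

text \<open>With \<open>P\<close> a Sylow \<open>r\<close>-, \<open>s\<close>- or \<open>t\<close>-subgroup, this is the set
  $V_{I_-}$, $V_{I_+}$ or $V_{II}$ respectively.\<close>

definition conj_normal_vectors ::
    "('g, 'm) monoid_scheme \<Rightarrow> ('g \<Rightarrow> 'v \<Rightarrow> 'v) \<Rightarrow> 'g set \<Rightarrow> 'v set" where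
  "conj_normal_vectors G \<phi> P =
     {v. \<exists>z\<in>carrier G. conj_set G P z \<lhd> G\<lparr>carrier := stabilizer G \<phi> v\<rparr>}"

definition odd_prime_divisors :: "nat \<Rightarrow> nat set" where
  "odd_prime_divisors n = {p \<in> prime_factors n. odd p}"

end

theory Submission
  imports Defs "HOL-Algebra.Sylow" "HOL-Number_Theory.Residues" "HOL-Computational_Algebra.Polynomial"
begin

text \<open>Write \<open>n = t ^ a\<close> and let \<open>U\<close> be the group of upper unitriangular matrices. A subgroup of odd prime power
  order outside characteristic \<open>t\<close> has abelian centralizer, a split or nonsplit torus, of index 2 in its
  normalizer. If two of the three sets cover the nonzero vectors, then a vector fixed by some but not
  all of \<open>U\<close> (or, for \<open>t = 2\<close>, a vector negated by an element of \<open>U\<close>) has a stabilizer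
  normalizing none of the Sylow subgroups in question; hence \<open>n\<close> is a prime \<open>\<ge> 5\<close>.

  Decompose \<open>V = W \<oplus> C\<close> with \<open>C\<close> the fixed space of \<open>U\<close>. An annihilating polynomial of a generator of
  \<open>U\<close> on \<open>W\<close> has many conjugate roots, so \<open>q ^ ((n - 1) div 2) \<le> card W\<close>, and a Vandermonde argument
  bounds the fixed space on \<open>W\<close> of a subgroup of the split torus by a cube root of \<open>card W\<close>. Counting
  vectors through the conjugates of the Sylow subgroups turns a cover into an equation between powers
  of \<open>q\<close>; with the lower bound on \<open>card W\<close>, only \<open>n = 5\<close>, \<open>card V = 3 ^ 4\<close> and \<open>n = 13\<close>,
  \<open>card V = 3 ^ 6\<close> survive. For the two tori one also needs upper bounds on \<open>V\<close>, from elements of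
  order \<open>q\<close> in a torus or, for \<open>q = 2\<close>, from a quaternion subgroup.\<close>

subsection \<open>Sylow subgroups and conjugation\<close>

text \<open>No eigenvalues, characters or splitting fields are used. Their substitute is that
  \<open>diag2 x\<close> conjugates \<open>unip u\<close> to \<open>unip (x * x * u)\<close>: a
  relation among powers of one unipotent spreads to all square multiples. Once \<open>n\<close> is
  prime, a vector of \<open>W\<close> fixed by one nontrivial unipotent is fixed by all and hence 0,
  so differences of unipotents are injective on \<open>W\<close>; this is why primality is settled
  before any bound. Counting works because a Sylow subgroup normalizing another one for the same
  prime equals it, so each of the three sets is a disjoint union over conjugates: n + 1 of them for
  \<open>T\<close>, n (n + 1) / 2 for \<open>R\<close>, n (n - 1) / 2 for \<open>S\<close>. The
  obstacle is that \<open>q\<close> may be \<open>r\<close> or \<open>s\<close>: then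
  \<open>V\<close> need not be semisimple under \<open>R\<close> or \<open>S\<close>, and fixed
  spaces are controlled only by inequalities and by divisibility by powers of \<open>q\<close>. For
  two tori that both fix nonzero vectors, reading the equation modulo \<open>q\<close> gives that
  \<open>q\<close> divides n^2 - 1. For odd \<open>q\<close> some torus then contains elements of
  order \<open>q\<close>; they act unipotently on \<open>V\<close>, which gives the missing upper
  bound. For q = 2 the divisibility says nothing, hence the separate argument.\<close>

lemma card_eq_card_fibre_times_card_image:
  assumes "finite A" and "\<And>y. y \<in> f ` A \<Longrightarrow> card {x \<in> A. f x = y} = k"
  shows "card A = k * card (f ` A)"
proof -
  have "card A = (\<Sum>y\<in>f ` A. \<Sum>x | x \<in> A \<and> f x = y. 1)"
    using sum.image_gen[OF assms(1), of "\<lambda>_. 1::nat" f] by simp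
  also have "\<dots> = (\<Sum>y\<in>f ` A. k)"
    using assms(2) by (intro sum.cong) auto
  finally show ?thesis by simp
qed

text \<open>Orbit sizes divide \<open>r ^ m\<close>, so an orbit with more than one point has size
  divisible by \<open>r\<close>. The action is a bare function on \<open>E\<close>, because it is
  applied to conjugation, to right cosets and to subsets of a module.\<close>

lemma p_group_card_fixed_cong:
  fixes G (structure)
  assumes "group G" and r: "prime (r::nat)" "Coset.order G = r ^ m" and fin: "finite E"
    and cl: "\<And>g x. g \<in> carrier G \<Longrightarrow> x \<in> E \<Longrightarrow> \<phi> g x \<in> E"
    and one: "\<And>x. x \<in> E \<Longrightarrow> \<phi> \<one>\<^bsub>G\<^esub> x = x"
    and mult: "\<And>g h x. g \<in> carrier G \<Longrightarrow> h \<in> carrier G \<Longrightarrow> x \<in> E \<Longrightarrow> \<phi> (g \<otimes>\<^bsub>G\<^esub> h) x = \<phi> g (\<phi> h x)"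
  shows "[card E = card {x \<in> E. \<forall>g\<in>carrier G. \<phi> g x = x}] (mod r)"
proof -
  interpret group G by fact
  have finG: "finite (carrier G)" using r by (metis Coset.order_def card_gt_0_iff prime_gt_0_nat zero_less_power)
  define orb where "orb x = (\<lambda>g. \<phi> g x) ` carrier G" for x
  have inv1: "\<phi> (inv g) (\<phi> g x) = x" if "g \<in> carrier G" "x \<in> E" for g x
    using that mult[of "inv g" g x] one by simp
  have self: "x \<in> orb x" if "x \<in> E" for x
    unfolding orb_def using one[OF that] one_closed by (metis image_eqI)
  have sub: "orb x \<subseteq> E" if "x \<in> E" for x using cl that by (auto simp: orb_def)
  have orb_step: "orb y \<subseteq> orb x" if yx: "y \<in> orb x" and "x \<in> E" for x y
  proof -
    obtain k where k: "k \<in> carrier G" "y = \<phi> k x" using yx by (auto simp: orb_def)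
    have "\<phi> g y = \<phi> (g \<otimes> k) x" if "g \<in> carrier G" for g
      using mult[OF that k(1) \<open>x \<in> E\<close>] k(2) by simp
    then show ?thesis unfolding orb_def using k(1) by auto
  qed
  have orb_sym: "x \<in> orb y" if yx: "y \<in> orb x" and xE: "x \<in> E" for x y
  proof -
    obtain k where k: "k \<in> carrier G" "y = \<phi> k x" using yx by (auto simp: orb_def)
    then have "x = \<phi> (inv k) y" using inv1 xE by simp
    then show ?thesis unfolding orb_def using k(1) by (intro image_eqI[of _ _ "inv k"]) auto
  qed
  have orb_eq: "{y \<in> E. orb y = orb x} = orb x" if "x \<in> E" for x
    using that orb_step orb_sym self sub by blast
  have dvd: "card (orb x) dvd r ^ m" if "x \<in> E" for x
  proof -
    let ?S = "{g \<in> carrier G. \<phi> g x = x}"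
    have "card {g \<in> carrier G. \<phi> g x = y} = card ?S" if y: "y \<in> (\<lambda>g. \<phi> g x) ` carrier G" for y
    proof -
      obtain k where k: "k \<in> carrier G" "y = \<phi> k x" using y by auto
      have "bij_betw (\<lambda>g. k \<otimes> g) ?S {g \<in> carrier G. \<phi> g x = y}"
      proof (rule bij_betwI[where g = "\<lambda>g. inv k \<otimes> g"])
        show "(\<lambda>g. k \<otimes> g) \<in> ?S \<rightarrow> {g \<in> carrier G. \<phi> g x = y}"
          using k mult \<open>x \<in> E\<close> by auto
        show "(\<lambda>g. inv k \<otimes> g) \<in> {g \<in> carrier G. \<phi> g x = y} \<rightarrow> ?S"
          using k mult[of "inv k" _ x] \<open>x \<in> E\<close> inv1 by auto
      qed (use k in \<open>auto simp: m_assoc[symmetric]\<close>)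
      then show ?thesis using bij_betw_same_card by fastforce
    qed
    from card_eq_card_fibre_times_card_image[OF finG this]
    have "card (carrier G) = card ?S * card (orb x)" by (simp add: orb_def)
    then show ?thesis using r by (metis dvd_triv_right Coset.order_def)
  qed
  have card1: "[card (orb x) = (if card (orb x) = 1 then 1 else 0)] (mod r)" if xE: "x \<in> E" for x
  proof -
    obtain i where "card (orb x) = r ^ i" using dvd[OF xE] r divides_primepow_nat by blast
    then show ?thesis by (cases i) (auto simp: cong_def)
  qed
  have "card E = (\<Sum>y\<in>orb ` E. \<Sum>x | x \<in> E \<and> orb x = y. 1)"
    using sum.image_gen[OF fin, of "\<lambda>_. 1::nat" orb] by simp
  also have "\<dots> = (\<Sum>y\<in>orb ` E. card y)"
    using orb_eq by (intro sum.cong) auto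
  also have "[\<dots> = (\<Sum>y\<in>orb ` E. if card y = 1 then 1 else 0)] (mod r)"
    using card1 by (intro cong_sum) (force simp del: One_nat_def)
  also have "(\<Sum>y\<in>orb ` E. if card y = 1 then 1 else 0) = card {y \<in> orb ` E. card y = 1}"
    using fin by (simp add: sum.If_cases Int_def conj_commute)
  also have "{y \<in> orb ` E. card y = 1} = (\<lambda>x. {x}) ` {x \<in> E. \<forall>g\<in>carrier G. \<phi> g x = x}"
  proof (intro equalityI subsetI)
    fix y assume "y \<in> {y \<in> orb ` E. card y = 1}"
    then obtain x where x: "x \<in> E" "y = orb x" "card (orb x) = 1" by auto
    then have "orb x = {x}" using self by (metis card_1_singletonE singletonD)
    then show "y \<in> (\<lambda>x. {x}) ` {x \<in> E. \<forall>g\<in>carrier G. \<phi> g x = x}"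
      using x by (auto simp: orb_def)
  next
    fix y assume "y \<in> (\<lambda>x. {x}) ` {x \<in> E. \<forall>g\<in>carrier G. \<phi> g x = x}"
    then obtain x where x: "x \<in> E" "y = {x}" "\<forall>g\<in>carrier G. \<phi> g x = x" by auto
    then have "orb x = {x}" using one_closed by (auto simp: orb_def)
    then show "y \<in> {y \<in> orb ` E. card y = 1}" using x by auto
  qed
  also have "card \<dots> = card {x \<in> E. \<forall>g\<in>carrier G. \<phi> g x = x}"
    by (intro card_image) (auto simp: inj_on_def)
  finally show ?thesis .
qed

context group
begin

lemma order_subgroup: "Coset.order (G\<lparr>carrier := H\<rparr>) = card H"
  by (simp add: Coset.order_def)

text \<open>For conjugation of \<open>P\<close> on itself the fixed points form the center. Its size
  is divisible by \<open>r\<close> and it contains the unit, so it has a further element.\<close>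

lemma p_subgroup_nontrivial_center:
  assumes "prime (r::nat)" "subgroup P G" "card P = r ^ m" "m > 0"
  shows "\<exists>g\<in>P. g \<noteq> \<one> \<and> (\<forall>h\<in>P. h \<otimes> g = g \<otimes> h)"
proof -
  interpret P: subgroup P G by fact
  have fin: "finite P" using assms by (metis card_gt_0_iff prime_gt_0_nat zero_less_power)
  have "[card P = card {x \<in> P. \<forall>g\<in>P. g \<otimes> x \<otimes> inv g = x}] (mod r)"
  proof -
    have "[card P = card {x \<in> P. \<forall>g\<in>carrier (G\<lparr>carrier := P\<rparr>). g \<otimes> x \<otimes> inv g = x}] (mod r)"
      by (rule p_group_card_fixed_cong[OF P.subgroup_is_group[OF is_group] assms(1) _ fin])
        (simp_all add: order_subgroup assms inv_mult_group m_assoc P.mem_carrier)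
    then show ?thesis by simp
  qed
  then have "r dvd card {x \<in> P. \<forall>g\<in>P. g \<otimes> x \<otimes> inv g = x}"
    using assms(3,4) cong_dvd_iff[of "card P" _ r] by simp
  moreover have "card {x \<in> P. \<forall>g\<in>P. g \<otimes> x \<otimes> inv g = x} > 0"
  proof -
    have "\<one> \<in> {x \<in> P. \<forall>g\<in>P. g \<otimes> x \<otimes> inv g = x}" by (simp add: P.mem_carrier)
    moreover have "finite {x \<in> P. \<forall>g\<in>P. g \<otimes> x \<otimes> inv g = x}" using fin by simp
    ultimately show ?thesis by (subst card_gt_0_iff) blast
  qed
  ultimately have "card {x \<in> P. \<forall>g\<in>P. g \<otimes> x \<otimes> inv g = x} \<ge> r" by (simp add: dvd_imp_le)
  then have "\<not> {x \<in> P. \<forall>g\<in>P. g \<otimes> x \<otimes> inv g = x} \<subseteq> {\<one>}"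
    using prime_ge_2_nat[OF assms(1)] card_mono[of "{\<one>}" "{x \<in> P. \<forall>g\<in>P. g \<otimes> x \<otimes> inv g = x}"]
    by auto
  then obtain x where x: "x \<in> P" "x \<noteq> \<one>" "\<forall>g\<in>P. g \<otimes> x \<otimes> inv g = x" by auto
  have "g \<otimes> x = x \<otimes> g" if g: "g \<in> P" for g
  proof -
    have "g \<otimes> x = (g \<otimes> x \<otimes> inv g) \<otimes> g" using g x(1) by (simp add: m_assoc P.mem_carrier)
    then show ?thesis using x(3) g by simp
  qed
  then show ?thesis using x by blast
qed

text \<open>\<open>Q\<close> acts on the right cosets of \<open>P\<close> by multiplication with
  \<open>inv q\<close>. Their number is prime to \<open>r\<close>, so some coset
  \<open>P #> z\<close> is fixed, which says that \<open>z\<close> conjugates \<open>Q\<close> into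
  \<open>P\<close>.\<close>

lemma p_subgroup_conj_into_sylow:
  assumes r: "prime (r::nat)" and fin: "finite (carrier G)"
    and P: "subgroup P G" "card P = r ^ m" and Q: "subgroup Q G" "card Q = r ^ k"
    and ndvd: "\<not> r ^ Suc m dvd Coset.order G"
  shows "\<exists>z\<in>carrier G. \<forall>q\<in>Q. z \<otimes> q \<otimes> inv z \<in> P"
proof -
  interpret P: subgroup P G by fact
  interpret Q: subgroup Q G by fact
  let ?E = "rcosets P"
  have finE: "finite ?E" using fin by (simp add: RCOSETS_def)
  have cl: "C #> g \<in> ?E" if "C \<in> ?E" "g \<in> carrier G" for C g
    using that P.subset by (auto simp: RCOSETS_def coset_mult_assoc)
  have sub: "C \<subseteq> carrier G" if "C \<in> ?E" for C using that P.rcosets_carrier is_group by blast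
  have "[card ?E = card {C \<in> ?E. \<forall>q\<in>Q. C #> inv q = C}] (mod r)"
  proof -
    have "[card ?E = card {C \<in> ?E. \<forall>q\<in>carrier (G\<lparr>carrier := Q\<rparr>). C #> inv q = C}] (mod r)"
      by (rule p_group_card_fixed_cong[OF Q.subgroup_is_group[OF is_group] r _ finE])
        (simp_all add: order_subgroup Q inv_mult_group coset_mult_assoc Q.mem_carrier cl sub)
    then show ?thesis by simp
  qed
  moreover have "\<not> r dvd card ?E"
  proof
    assume "r dvd card ?E"
    then have "r * r ^ m dvd card ?E * card P" unfolding P(2) by (rule mult_dvd_mono) simp
    then have "r ^ Suc m dvd Coset.order G" unfolding lagrange[OF P(1)] by simp
    then show False using ndvd by contradiction
  qed
  ultimately have "card {C \<in> ?E. \<forall>q\<in>Q. C #> inv q = C} \<noteq> 0"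
    by (metis cong_0_iff)
  then have "{C \<in> ?E. \<forall>q\<in>Q. C #> inv q = C} \<noteq> {}" by (metis card.empty)
  then obtain C where C: "C \<in> ?E" "\<forall>q\<in>Q. C #> inv q = C" by blast
  then obtain z where z: "z \<in> carrier G" "C = P #> z" by (auto simp: RCOSETS_def)
  have "z \<otimes> q \<otimes> inv z \<in> P" if q: "q \<in> Q" for q
  proof -
    have "C #> inv (inv q) = C" using C(2) q Q.m_inv_closed by blast
    then have "P #> (z \<otimes> q) = P #> z"
      using z q P.subset by (simp add: coset_mult_assoc Q.mem_carrier)
    then have "z \<otimes> q \<in> P #> z"
      using rcos_self[OF _ P(1), of "z \<otimes> q"] z q by (simp add: Q.mem_carrier)
    then obtain p where p: "p \<in> P" "z \<otimes> q = p \<otimes> z" by (auto simp: r_coset_def)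
    then have "z \<otimes> q \<otimes> inv z = p" using z by (simp add: m_assoc P.mem_carrier)
    then show ?thesis using p by simp
  qed
  then show ?thesis using z by blast
qed

lemma subgroup_of_restrict:
  assumes "subgroup P G" "subgroup N G" "P \<subseteq> N"
  shows "subgroup P (G\<lparr>carrier := N\<rparr>)"
  using assms subgroup_incl by blast

text \<open>Both groups are Sylow in the normalizer \<open>N\<close> of \<open>P\<close>, so an
  element of \<open>N\<close> conjugates \<open>Q\<close> into \<open>P\<close>. As that element
  preserves \<open>P\<close>, already \<open>Q\<close> lies in \<open>P\<close>.\<close>

lemma sylow_normalizing_sylow_eq:
  assumes r: "prime (r::nat)" and fin: "finite (carrier G)"
    and P: "subgroup P G" "card P = r ^ m" and Q: "subgroup Q G" "card Q = r ^ m"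
    and ndvd: "\<not> r ^ Suc m dvd Coset.order G"
    and norm: "\<And>x y. x \<in> Q \<Longrightarrow> y \<in> P \<Longrightarrow> x \<otimes> y \<otimes> inv x \<in> P"
  shows "P = Q"
proof -
  interpret P: subgroup P G by fact
  interpret Q: subgroup Q G by fact
  have finP: "finite P" using fin P.subset finite_subset by blast
  define N where "N = {x \<in> carrier G. \<forall>y\<in>P. x \<otimes> y \<otimes> inv x \<in> P}"
  have inj: "inj_on (\<lambda>y. x \<otimes> y \<otimes> inv x) P" if "x \<in> carrier G" for x
    using that by (auto intro!: inj_onI simp: P.mem_carrier)
  \<comment> \<open>Membership in \<open>N\<close> only gives one inclusion; finiteness of
    \<open>P\<close> makes the injective conjugation map onto.\<close>
  have invN: "inv x \<otimes> y \<otimes> x \<in> P" if x: "x \<in> N" and y: "y \<in> P" for x y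
  proof -
    have "(\<lambda>y. x \<otimes> y \<otimes> inv x) ` P = P"
      using x inj[of x] finP by (intro endo_inj_surj) (auto simp: N_def)
    then obtain u where u: "u \<in> P" "y = x \<otimes> u \<otimes> inv x" using y by blast
    then have "inv x \<otimes> y \<otimes> x = u" using x u by (simp add: N_def m_assoc P.mem_carrier) (simp add: m_assoc[symmetric] P.mem_carrier)
    then show ?thesis using u by simp
  qed
  have N: "subgroup N G"
  proof (rule subgroupI)
    show "N \<subseteq> carrier G" by (auto simp: N_def)
    show "N \<noteq> {}" by (auto simp: N_def P.mem_carrier intro!: exI[of _ \<one>])
    show "inv a \<in> N" if "a \<in> N" for a using that invN by (auto simp: N_def)
    show "a \<otimes> b \<in> N" if "a \<in> N" "b \<in> N" for a b
    proof -
      have "a \<otimes> b \<otimes> y \<otimes> inv (a \<otimes> b) = a \<otimes> (b \<otimes> y \<otimes> inv b) \<otimes> inv a" if "y \<in> P" for y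
        using that \<open>a \<in> N\<close> \<open>b \<in> N\<close> by (simp add: N_def m_assoc inv_mult_group P.mem_carrier)
      then show ?thesis using that by (auto simp: N_def)
    qed
  qed
  interpret N: subgroup N G by fact
  have PN: "P \<subseteq> N" unfolding N_def using P.m_closed P.m_inv_closed P.subset by blast
  have QN: "Q \<subseteq> N" unfolding N_def using norm Q.subset by blast
  have "\<not> r ^ Suc m dvd Coset.order (G\<lparr>carrier := N\<rparr>)"
    unfolding order_subgroup using ndvd lagrange[OF N] dvd_trans by (metis dvd_triv_right)
  then obtain z where z: "z \<in> N" "\<forall>q\<in>Q. z \<otimes> q \<otimes> inv z \<in> P"
    using group.p_subgroup_conj_into_sylow[OF N.subgroup_is_group[OF is_group] r, of P m Q m] P Q PN QN
      subgroup_of_restrict[OF P(1) N PN] subgroup_of_restrict[OF Q(1) N QN]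
      finite_subset[OF N.subset fin] m_inv_consistent[OF N]
    by auto
  have "Q \<subseteq> P"
  proof
    fix q assume q: "q \<in> Q"
    then have "inv z \<otimes> (z \<otimes> q \<otimes> inv z) \<otimes> z \<in> P" using z invN by blast
    moreover have "inv z \<otimes> (z \<otimes> q \<otimes> inv z) \<otimes> z = q"
    proof -
      have zG: "z \<in> carrier G" using z(1) N.subset by blast
      have "inv z \<otimes> (z \<otimes> q \<otimes> inv z) \<otimes> z = (inv z \<otimes> z) \<otimes> q \<otimes> (inv z \<otimes> z)"
        using zG q by (simp only: m_assoc Q.mem_carrier inv_closed m_closed)
      then show ?thesis using zG q by (simp add: Q.mem_carrier)
    qed
    ultimately show "q \<in> P" by simp
  qed
  then show ?thesis using finP P Q by (metis card_subset_eq)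
qed

lemma conj_set_eq_iff:
  assumes "subgroup P G" "finite P" "z \<in> carrier G" "y \<in> carrier G"
  shows "conj_set G P z = conj_set G P y \<longleftrightarrow> (\<forall>g\<in>P. (y \<otimes> inv z) \<otimes> g \<otimes> inv (y \<otimes> inv z) \<in> P)"
proof -
  interpret P: subgroup P G by fact
  have inj: "inj_on (\<lambda>g. inv x \<otimes> g \<otimes> x) P" if "x \<in> carrier G" for x
    using that by (auto intro!: inj_onI simp: P.mem_carrier)
  have card: "card (conj_set G P x) = card P" if "x \<in> carrier G" for x
    unfolding conj_set_def using inj[OF that] by (rule card_image)
  have fin: "finite (conj_set G P x)" for x unfolding conj_set_def using assms(2) by simp
  have eq: "inv z \<otimes> g \<otimes> z \<in> conj_set G P y \<longleftrightarrow> (y \<otimes> inv z) \<otimes> g \<otimes> inv (y \<otimes> inv z) \<in> P"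
    if g: "g \<in> P" for g
  proof
    assume "inv z \<otimes> g \<otimes> z \<in> conj_set G P y"
    then obtain h where h: "h \<in> P" "inv z \<otimes> g \<otimes> z = inv y \<otimes> h \<otimes> y" by (auto simp: conj_set_def)
    have "(y \<otimes> inv z) \<otimes> g \<otimes> inv (y \<otimes> inv z) = y \<otimes> (inv z \<otimes> g \<otimes> z) \<otimes> inv y"
      using assms g by (simp add: inv_mult_group m_assoc P.mem_carrier)
    also have "\<dots> = (y \<otimes> inv y) \<otimes> h \<otimes> (y \<otimes> inv y)"
      unfolding h(2) using assms h(1) by (simp only: m_assoc P.mem_carrier inv_closed m_closed)
    also have "\<dots> = h" using assms h(1) by (simp add: P.mem_carrier)
    finally show "(y \<otimes> inv z) \<otimes> g \<otimes> inv (y \<otimes> inv z) \<in> P" using h(1) by simp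
  next
    assume h: "(y \<otimes> inv z) \<otimes> g \<otimes> inv (y \<otimes> inv z) \<in> P"
    have "inv y \<otimes> ((y \<otimes> inv z) \<otimes> g \<otimes> inv (y \<otimes> inv z)) \<otimes> y = (inv y \<otimes> y) \<otimes> (inv z \<otimes> g \<otimes> z) \<otimes> (inv y \<otimes> y)"
      using assms g by (simp only: inv_mult_group inv_inv m_assoc P.mem_carrier inv_closed m_closed)
    also have "\<dots> = inv z \<otimes> g \<otimes> z" using assms g by (simp add: P.mem_carrier)
    finally show "inv z \<otimes> g \<otimes> z \<in> conj_set G P y" using h unfolding conj_set_def by force
  qed
  have "conj_set G P z = conj_set G P y \<longleftrightarrow> conj_set G P z \<subseteq> conj_set G P y"
    using card_subset_eq[OF fin] card assms(3,4) by (metis subset_refl)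
  also have "\<dots> \<longleftrightarrow> (\<forall>g\<in>P. inv z \<otimes> g \<otimes> z \<in> conj_set G P y)"
    by (auto simp: conj_set_def[of G P z])
  finally show ?thesis using eq by simp
qed

text \<open>The elements taking \<open>P\<close> to one given conjugate form a coset of the
  normalizer.\<close>

lemma card_conjugates_times_normalizer:
  assumes P: "subgroup P G" "finite P" and fin: "finite (carrier G)"
  shows "Coset.order G = card {x \<in> carrier G. \<forall>g\<in>P. x \<otimes> g \<otimes> inv x \<in> P} * card (conj_set G P ` carrier G)"
    (is "_ = card ?N * _")
  unfolding Coset.order_def
proof (rule card_eq_card_fibre_times_card_image[OF fin])
  fix Q assume "Q \<in> conj_set G P ` carrier G"
  then obtain y where y: "y \<in> carrier G" "Q = conj_set G P y" by auto
  have "bij_betw (\<lambda>z. z \<otimes> inv y) {z \<in> carrier G. conj_set G P z = Q} ?N"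
  proof (rule bij_betwI[where g = "\<lambda>x. x \<otimes> y"])
    show "(\<lambda>z. z \<otimes> inv y) \<in> {z \<in> carrier G. conj_set G P z = Q} \<rightarrow> ?N"
      using conj_set_eq_iff[OF P y(1)] y by auto
    show "(\<lambda>x. x \<otimes> y) \<in> ?N \<rightarrow> {z \<in> carrier G. conj_set G P z = Q}"
    proof
      fix x assume x: "x \<in> ?N"
      then have "conj_set G P y = conj_set G P (x \<otimes> y)"
        using conj_set_eq_iff[OF P y(1), of "x \<otimes> y"] y(1) by (simp add: m_assoc)
      then show "x \<otimes> y \<in> {z \<in> carrier G. conj_set G P z = Q}" using x y by simp
    qed
  qed (use y in \<open>auto simp: m_assoc\<close>)
  then show "card {z \<in> carrier G. conj_set G P z = Q} = card ?N" by (rule bij_betw_same_card)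
qed

lemma subgroup_conj_set:
  assumes "subgroup P G" "z \<in> carrier G"
  shows "subgroup (conj_set G P z) G"
proof -
  interpret P: subgroup P G by fact
  show ?thesis
  proof (rule subgroupI)
    show "conj_set G P z \<subseteq> carrier G" using assms(2) by (auto simp: conj_set_def P.mem_carrier)
    show "conj_set G P z \<noteq> {}" unfolding conj_set_def using P.one_closed by blast
  next
    fix a assume "a \<in> conj_set G P z"
    then obtain g where g: "g \<in> P" "a = inv z \<otimes> g \<otimes> z" by (auto simp: conj_set_def)
    then have "inv a = inv z \<otimes> inv g \<otimes> z" using assms(2) by (simp add: inv_mult_group m_assoc P.mem_carrier)
    then show "inv a \<in> conj_set G P z" unfolding conj_set_def using P.m_inv_closed[OF g(1)] by (intro image_eqI[of _ _ "inv g"])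
  next
    fix a b assume "a \<in> conj_set G P z" "b \<in> conj_set G P z"
    then obtain g h where g: "g \<in> P" "a = inv z \<otimes> g \<otimes> z" and h: "h \<in> P" "b = inv z \<otimes> h \<otimes> z"
      by (auto simp: conj_set_def)
    have "a \<otimes> b = inv z \<otimes> g \<otimes> (z \<otimes> inv z) \<otimes> h \<otimes> z"
      unfolding g(2) h(2) using assms(2) g(1) h(1) by (simp only: m_assoc P.mem_carrier inv_closed m_closed)
    also have "\<dots> = inv z \<otimes> (g \<otimes> h) \<otimes> z" using assms(2) g(1) h(1) by (simp add: m_assoc P.mem_carrier)
    finally show "a \<otimes> b \<in> conj_set G P z" unfolding conj_set_def
      using P.m_closed[OF g(1) h(1)] by (intro image_eqI[of _ _ "g \<otimes> h"])
  qed
qed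

lemma card_conj_set:
  assumes "subgroup P G" "z \<in> carrier G"
  shows "card (conj_set G P z) = card P"
proof -
  interpret P: subgroup P G by fact
  show ?thesis unfolding conj_set_def using assms(2)
    by (intro card_image) (auto intro!: inj_onI simp: P.mem_carrier)
qed

lemma conj_set_conj_set:
  assumes "subgroup P G" "z \<in> carrier G" "y \<in> carrier G"
  shows "conj_set G (conj_set G P z) y = conj_set G P (z \<otimes> y)"
proof -
  interpret P: subgroup P G by fact
  show ?thesis unfolding conj_set_def image_image using assms(2,3)
    by (intro image_cong) (auto simp: inv_mult_group m_assoc P.mem_carrier)
qed

end

subsection \<open>Two-by-two matrices\<close>

definition mat2 :: "'a \<Rightarrow> 'a \<Rightarrow> 'a \<Rightarrow> 'a \<Rightarrow> 'a ^ 2 ^ 2" where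
  "mat2 a b c d = (\<chi> i j. if i = 1 then if j = 1 then a else b else if j = 1 then c else d)"

lemma mat2_nth [simp]:
  "mat2 a b c d $ 1 $ 1 = a" "mat2 a b c d $ 1 $ 2 = b"
  "mat2 a b c d $ 2 $ 1 = c" "mat2 a b c d $ 2 $ 2 = d"
  by (simp_all add: mat2_def)

lemma mat2_eq_iff [simp]: "mat2 a b c d = mat2 a' b' c' d' \<longleftrightarrow> a = a' \<and> b = b' \<and> c = c' \<and> d = d'"
  by (metis mat2_nth)

lemma mat2_exhaust: obtains a b c d where "A = mat2 a b c d"
proof
  show "A = mat2 (A $ 1 $ 1) (A $ 1 $ 2) (A $ 2 $ 1) (A $ 2 $ 2)"
    by (simp add: vec_eq_iff forall_2)
qed

lemma mat2_mult [simp]: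
  fixes a :: "'a::semiring_1"
  shows "mat2 a b c d ** mat2 a' b' c' d' = mat2 (a*a' + b*c') (a*b' + b*d') (c*a' + d*c') (c*b' + d*d')"
  by (simp add: vec_eq_iff forall_2 matrix_matrix_mult_def sum_2)

lemma mat_1_eq_mat2: "mat 1 = mat2 1 0 0 (1::'a::zero_neq_one)"
  by (simp add: vec_eq_iff forall_2 mat_def)

lemma det_mat2 [simp]: "det (mat2 a b c d) = a * d - b * (c::'a::comm_ring_1)"
  by (simp add: det_2)

lemma mult_SL2 [simp]: "A \<otimes>\<^bsub>SL2\<^esub> B = A ** B"
  by (simp add: SL2_def)

lemma one_SL2 [simp]: "\<one>\<^bsub>SL2\<^esub> = mat2 1 0 0 (1::'a::comm_ring_1)"
  by (simp add: SL2_def mat_1_eq_mat2)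

lemma mat2_in_SL2 [simp]: "mat2 a b c d \<in> carrier SL2 \<longleftrightarrow> a * d - b * c = (1::'a::comm_ring_1)"
  by (simp add: SL2_def)

interpretation SL2: group "SL2 :: ('f::field ^ 2 ^ 2) monoid"
  by (rule group_SL2)

lemma inv_SL2 [simp]:
  assumes "a * d - b * c = (1::'f::field)"
  shows "inv\<^bsub>SL2\<^esub> (mat2 a b c d) = mat2 d (- b) (- c) a"
  using assms by (intro SL2.inv_equality) (auto simp: algebra_simps)

definition trace2 :: "'a::comm_ring_1 ^ 2 ^ 2 \<Rightarrow> 'a" where
  "trace2 A = A $ 1 $ 1 + A $ 2 $ 2"

lemma trace2_mat2 [simp]: "trace2 (mat2 a b c d) = a + d"
  by (simp add: trace2_def)

lemma trace2_conj:
  assumes "A \<in> carrier (SL2 :: ('f::field ^ 2 ^ 2) monoid)"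
  shows "trace2 (A \<otimes>\<^bsub>SL2\<^esub> B \<otimes>\<^bsub>SL2\<^esub> inv\<^bsub>SL2\<^esub> A) = trace2 B"
proof -
  obtain a b c d where A: "A = mat2 a b c d" by (cases A rule: mat2_exhaust)
  obtain x y z w where B: "B = mat2 x y z w" by (cases B rule: mat2_exhaust)
  have det: "a * d = 1 + b * c" using assms A by (simp add: algebra_simps)
  have inv: "inv\<^bsub>SL2\<^esub> A = mat2 d (- b) (- c) a" using assms A by simp
  have "trace2 (A \<otimes>\<^bsub>SL2\<^esub> B \<otimes>\<^bsub>SL2\<^esub> inv\<^bsub>SL2\<^esub> A) = (a * d - b * c) * (x + w)"
    unfolding inv unfolding A B by (simp add: algebra_simps)
  also have "a * d - b * c = 1" using det by simp
  finally show ?thesis using B by simp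
qed

text \<open>A nonscalar 2 by 2 matrix is cyclic, so its commutant is the algebra it generates,
  spanned by the matrix and the identity. In each of the three cases, \<open>v\<close> is found by
  dividing by an entry, or a difference of entries, that is not 0.\<close>

lemma commute_mat2:
  fixes a :: "'f::field"
  assumes nonscalar: "\<not> (b = 0 \<and> c = 0 \<and> a = d)"
    and comm: "mat2 x y z w ** mat2 a b c d = mat2 a b c d ** mat2 x y z w"
  shows "\<exists>u v. x = u + v * a \<and> y = v * b \<and> z = v * c \<and> w = u + v * d"
proof -
  have e: "y * c = b * z" "b * (x - w) = y * (a - d)" "c * (x - w) = z * (a - d)"
  proof -
    have "x * a + y * c = a * x + b * z" "x * b + y * d = a * y + b * w" "z * a + w * c = c * x + d * z"
      using comm by simp_all
    then show "y * c = b * z" "b * (x - w) = y * (a - d)" "c * (x - w) = z * (a - d)"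
      by (simp_all add: algebra_simps)
  qed
  consider "b \<noteq> 0" | "c \<noteq> 0" | "b = 0" "c = 0" "a - d \<noteq> 0" using nonscalar by auto
  then have "\<exists>v. y = v * b \<and> z = v * c \<and> x - w = v * (a - d)"
  proof cases
    case 1
    then show ?thesis using e by (intro exI[of _ "y / b"]) (auto simp: field_simps)
  next
    case 2
    then show ?thesis using e by (intro exI[of _ "z / c"]) (auto simp: field_simps)
  next
    case 3
    then show ?thesis using e by (intro exI[of _ "(x - w) / (a - d)"]) auto
  qed
  then obtain v where v: "y = v * b" "z = v * c" "x - w = v * (a - d)" by blast
  have "x = (x - v * a) + v * a" "w = (x - v * a) + v * d" using v(3) by (simp_all add: algebra_simps)
  then show ?thesis using v by blast
qed

text \<open>For determinant 1, the square of the trace minus 4 is the discriminant of the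
  characteristic polynomial. That it is nonzero is the form in which "regular semisimple" appears
  throughout.\<close>

lemma nonscalar_if_trace2_sq_neq_4:
  assumes "mat2 a b c d \<in> carrier (SL2 :: ('f::field ^ 2 ^ 2) monoid)" "(a + d)\<^sup>2 \<noteq> 4"
  shows "\<not> (b = 0 \<and> c = 0 \<and> a = d)"
proof
  assume h: "b = 0 \<and> c = 0 \<and> a = d"
  then have "a * a = 1" using assms(1) by simp
  moreover have "(a + d)\<^sup>2 = 4 * (a * a)" using h by (simp add: power2_eq_square algebra_simps)
  ultimately show False using assms(2) by simp
qed

lemma centralizer_abelian:
  assumes g: "g \<in> carrier (SL2 :: ('f::field ^ 2 ^ 2) monoid)" "(trace2 g)\<^sup>2 \<noteq> 4"
    and "A ** g = g ** A" "B ** g = g ** B"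
  shows "A ** B = B ** A"
proof -
  obtain a b c d where g': "g = mat2 a b c d" by (cases g rule: mat2_exhaust)
  obtain x y z w where A: "A = mat2 x y z w" by (cases A rule: mat2_exhaust)
  obtain x' y' z' w' where B: "B = mat2 x' y' z' w'" by (cases B rule: mat2_exhaust)
  have ns: "\<not> (b = 0 \<and> c = 0 \<and> a = d)" using nonscalar_if_trace2_sq_neq_4[of a b c d] g g' by simp
  obtain u v where "x = u + v * a \<and> y = v * b \<and> z = v * c \<and> w = u + v * d"
    using commute_mat2[OF ns] assms(3) A g' by blast
  moreover obtain u' v' where "x' = u' + v' * a \<and> y' = v' * b \<and> z' = v' * c \<and> w' = u' + v' * d"
    using commute_mat2[OF ns] assms(4) B g' by blast
  ultimately show ?thesis using A B by (simp add: algebra_simps)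
qed

text \<open>The conjugate of \<open>g\<close> commutes with \<open>g\<close>, so it has the form u +
  v g. Equal trace and determinant give (1 - v^2) times the discriminant = 0, so v is 1 or -1; the
  second value gives the adjugate of \<open>g\<close>, that is, its inverse.\<close>

lemma normalizes_commutes_or_inverts:
  assumes two: "(2::'f::field) \<noteq> 0"
    and g: "g \<in> carrier (SL2 :: ('f ^ 2 ^ 2) monoid)" "(trace2 g)\<^sup>2 \<noteq> 4" and A: "A \<in> carrier SL2"
    and comm: "(A \<otimes>\<^bsub>SL2\<^esub> g \<otimes>\<^bsub>SL2\<^esub> inv\<^bsub>SL2\<^esub> A) ** g = g ** (A \<otimes>\<^bsub>SL2\<^esub> g \<otimes>\<^bsub>SL2\<^esub> inv\<^bsub>SL2\<^esub> A)"
  shows "A ** g = g ** A \<or> A ** g = inv\<^bsub>SL2\<^esub> g ** A"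
proof -
  define h where "h = A \<otimes>\<^bsub>SL2\<^esub> g \<otimes>\<^bsub>SL2\<^esub> inv\<^bsub>SL2\<^esub> A"
  have hS: "h \<in> carrier SL2" unfolding h_def using g A by blast
  obtain a b c d where g': "g = mat2 a b c d" by (cases g rule: mat2_exhaust)
  obtain x y z w where h': "h = mat2 x y z w" by (cases h rule: mat2_exhaust)
  have ns: "\<not> (b = 0 \<and> c = 0 \<and> a = d)" using nonscalar_if_trace2_sq_neq_4[of a b c d] g g' by simp
  obtain u v where uv: "x = u + v * a" "y = v * b" "z = v * c" "w = u + v * d"
    using commute_mat2[OF ns comm[folded h_def, unfolded h' g']] by blast
  have tr: "x + w = a + d" using trace2_conj[OF A, of g] h' g' unfolding h_def[symmetric] by simp
  have u: "2 * u = (1 - v) * (a + d)" using tr uv by (simp add: algebra_simps)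
  have deth: "x * w - y * z = 1" and detg: "a * d - b * c = 1" using hS h' g g' by auto
  \<comment> \<open>Four times the determinant of u + v g, so that \<open>u\<close> occurs only as
    \<open>2 * u\<close>, whose value is known without division.\<close>
  have "(x * w - y * z) * 4 = (2 * u) * (2 * u) + 2 * v * (2 * u) * (a + d) + 4 * v\<^sup>2 * (a * d - b * c)"
    unfolding uv by (simp add: algebra_simps power2_eq_square)
  then have "(1 - v\<^sup>2) * ((a + d)\<^sup>2 - 4) = 0"
    unfolding u deth detg by (simp add: algebra_simps power2_eq_square)
  moreover have "(a + d)\<^sup>2 - 4 \<noteq> 0" using g g' by simp
  ultimately have "v\<^sup>2 = 1" by simp
  then have "v = 1 \<or> v = -1" by (rule power2_eq_1_iff[THEN iffD1])
  then have "h = g \<or> h = inv\<^bsub>SL2\<^esub> g"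
  proof
    assume "v = 1"
    then show ?thesis using u uv two g' h' by simp
  next
    assume v: "v = -1"
    then have "2 * u = 2 * (a + d)" using u by simp
    then have "u = a + d" using two by (metis mult_cancel_left)
    then show ?thesis using v uv g' h' detg by simp
  qed
  moreover have "A ** g = h ** A"
  proof -
    have "h \<otimes>\<^bsub>SL2\<^esub> A = A \<otimes>\<^bsub>SL2\<^esub> g \<otimes>\<^bsub>SL2\<^esub> (inv\<^bsub>SL2\<^esub> A \<otimes>\<^bsub>SL2\<^esub> A)"
      unfolding h_def using A g(1) by (simp only: SL2.m_assoc SL2.inv_closed SL2.m_closed)
    then have "h \<otimes>\<^bsub>SL2\<^esub> A = A \<otimes>\<^bsub>SL2\<^esub> g" using A g(1) by (simp del: mult_SL2 one_SL2)
    then show ?thesis by simp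
  qed
  ultimately show ?thesis by metis
qed

text \<open>With trace 2 or -2, \<open>g\<close> is plus or minus the identity plus a nilpotent
  matrix. The nilpotent part of its \<open>k\<close>-th power is a nonzero multiple of that of
  \<open>g\<close>, so it vanishes, and odd \<open>k\<close> excludes minus the identity.\<close>

lemma trace2_sq_neq_4_if_odd_order:
  fixes g :: "'f::field ^ 2 ^ 2"
  assumes g: "g \<in> carrier SL2" "g \<noteq> \<one>\<^bsub>SL2\<^esub>"
    and k: "odd k" "of_nat k \<noteq> (0::'f)" "g [^]\<^bsub>SL2\<^esub> k = \<one>\<^bsub>SL2\<^esub>"
  shows "(trace2 g)\<^sup>2 \<noteq> 4"
proof
  assume tr4: "(trace2 g)\<^sup>2 = 4"
  obtain a b c d where g': "g = mat2 a b c d" by (cases g rule: mat2_exhaust)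
  have det: "a * d - b * c = 1" using g g' by simp
  have "(a + d - 2) * (a + d + 2) = 0" using tr4 g' by (simp add: algebra_simps power2_eq_square)
  then obtain e where e: "e = 1 \<or> e = -1" "a + d = 2 * e"
    by (metis add_eq_0_iff2 eq_iff_diff_eq_0 mult.right_neutral mult_eq_0_iff mult_minus_right)
  define \<alpha> where "\<alpha> = a - e"
  have ad: "a = e + \<alpha>" "d = e - \<alpha>" using e(2) by (auto simp: \<alpha>_def algebra_simps)
  have ee: "e * e = 1" using e(1) by auto
  have bc: "\<alpha> * \<alpha> + b * c = 0" using det unfolding ad using ee by (simp add: algebra_simps)
  \<comment> \<open>The nilpotent part has entries \<open>\<alpha>\<close>, \<open>b\<close>,
    \<open>c\<close>, \<open>- \<alpha>\<close> and square 0, so the binomial expansion stops after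
    the linear term.\<close>
  have pow: "g [^]\<^bsub>SL2\<^esub> Suc j = mat2 (e ^ Suc j + of_nat (Suc j) * e ^ j * \<alpha>) (of_nat (Suc j) * e ^ j * b)
     (of_nat (Suc j) * e ^ j * c) (e ^ Suc j - of_nat (Suc j) * e ^ j * \<alpha>)" for j
  proof (induction j)
    case 0
    then show ?case using g' ad by simp
  next
    case (Suc j)
    have "g [^]\<^bsub>SL2\<^esub> Suc (Suc j) = (g [^]\<^bsub>SL2\<^esub> Suc j) ** g" by simp
    also have "\<dots> = mat2 (e ^ Suc (Suc j) + of_nat (Suc (Suc j)) * e ^ Suc j * \<alpha> + of_nat (Suc j) * e ^ j * (\<alpha> * \<alpha> + b * c))
       (of_nat (Suc (Suc j)) * e ^ Suc j * b)
       (of_nat (Suc (Suc j)) * e ^ Suc j * c)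
       (e ^ Suc (Suc j) - of_nat (Suc (Suc j)) * e ^ Suc j * \<alpha> + of_nat (Suc j) * e ^ j * (\<alpha> * \<alpha> + b * c))"
      unfolding Suc.IH unfolding g' ad by (simp add: algebra_simps)
    finally show ?case unfolding bc by simp
  qed
  obtain j where j: "k = Suc j" using k(1) by (cases k) auto
  have e0: "e \<noteq> 0" using e(1) by auto
  have eq: "e ^ k + of_nat k * e ^ j * \<alpha> = 1" "of_nat k * e ^ j * b = 0" "of_nat k * e ^ j * c = 0"
    using pow[of j] k(3) unfolding j[symmetric] by auto
  have "b = 0" "c = 0" using eq e0 k(2) by auto
  then have "\<alpha> = 0" using bc by simp
  then have "e ^ k = 1" using eq by simp
  then have "e = 1" using e(1) k(1) by (metis power_minus_odd power_one)
  then show False using g(2) g' ad \<open>\<alpha> = 0\<close> \<open>b = 0\<close> \<open>c = 0\<close> by simp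
qed

lemma of_nat_eq_0_iff_CARD_prime_power:
  assumes "prime t" "CARD('f::{field,finite}) = t ^ a"
  shows "of_nat k = (0::'f) \<longleftrightarrow> t dvd k"
proof -
  have "CHAR('f) dvd t ^ a" using CHAR_dvd_CARD[where 'a = 'f] assms(2) by simp
  moreover have "prime CHAR('f)" by (intro prime_CHAR_semidom finite_imp_CHAR_pos) simp
  ultimately have "CHAR('f) = t" using assms(1)
    by (metis prime_dvd_power primes_dvd_imp_eq)
  then show ?thesis by (simp add: of_nat_eq_0_iff_char_dvd)
qed

definition unip :: "'a \<Rightarrow> 'a::zero_neq_one ^ 2 ^ 2" where
  "unip x = mat2 1 x 0 1"

lemma unip_in_SL2 [simp]: "unip x \<in> carrier (SL2 :: ('f::field ^ 2 ^ 2) monoid)"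
  by (simp add: unip_def)

lemma unip_mult: "unip x ** unip y = unip (x + y :: 'f::field)"
  by (simp add: unip_def add.commute)

lemma inv_unip: "inv\<^bsub>SL2\<^esub> (unip x) = unip (- x :: 'f::field)"
  by (simp add: unip_def)

text \<open>A nontrivial unipotent commutes with or inverts only upper triangular matrices with
  equal diagonal entries; with determinant 1 these have trace 2 or -2.\<close>

lemma unip_not_normalizing_odd_char:
  assumes two: "(2::'f::field) \<noteq> 0" and x: "(x::'f) \<noteq> 0"
    and g: "g \<in> carrier (SL2 :: ('f ^ 2 ^ 2) monoid)" "(trace2 g)\<^sup>2 \<noteq> 4"
  shows "(unip x \<otimes>\<^bsub>SL2\<^esub> g \<otimes>\<^bsub>SL2\<^esub> inv\<^bsub>SL2\<^esub> (unip x)) ** g \<noteq> g ** (unip x \<otimes>\<^bsub>SL2\<^esub> g \<otimes>\<^bsub>SL2\<^esub> inv\<^bsub>SL2\<^esub> (unip x))"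
proof
  assume "(unip x \<otimes>\<^bsub>SL2\<^esub> g \<otimes>\<^bsub>SL2\<^esub> inv\<^bsub>SL2\<^esub> (unip x)) ** g = g ** (unip x \<otimes>\<^bsub>SL2\<^esub> g \<otimes>\<^bsub>SL2\<^esub> inv\<^bsub>SL2\<^esub> (unip x))"
  from normalizes_commutes_or_inverts[OF two g unip_in_SL2 this]
  have *: "unip x ** g = g ** unip x \<or> unip x ** g = inv\<^bsub>SL2\<^esub> g ** unip x" .
  obtain a b c d where g': "g = mat2 a b c d" by (cases g rule: mat2_exhaust)
  have det: "a * d - b * c = 1" using g g' by simp
  have ca: "c = 0 \<and> a = d"
  proof -
    have "x * c = 0 \<and> x * (a - d) = 0 \<or> 2 * c = 0 \<and> a + x * c = d"
      using * det x unfolding g' unip_def by (auto simp: algebra_simps)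
    then show ?thesis using x two by auto
  qed
  then have "a * a = 1" using det by simp
  then have "(a + d)\<^sup>2 = 4" using ca by (simp add: power2_eq_square algebra_simps)
  then show False using g g' by simp
qed

text \<open>In characteristic 2 unipotents are involutions and can invert tori, so normalizing
  cannot be excluded outright. But the trace of \<open>g\<close> is nonzero here, so the equation
  leaves at most one \<open>x\<close> for a given \<open>g\<close>.\<close>

lemma unip_normalizing_char_2:
  assumes two: "(2::'f::field) = 0" and x: "(x::'f) \<noteq> 0"
    and g: "g \<in> carrier (SL2 :: ('f ^ 2 ^ 2) monoid)" "(trace2 g)\<^sup>2 \<noteq> 4"
    and comm: "(unip x \<otimes>\<^bsub>SL2\<^esub> g \<otimes>\<^bsub>SL2\<^esub> inv\<^bsub>SL2\<^esub> (unip x)) ** g = g ** (unip x \<otimes>\<^bsub>SL2\<^esub> g \<otimes>\<^bsub>SL2\<^esub> inv\<^bsub>SL2\<^esub> (unip x))"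
  shows "x * g $ 2 $ 1 = trace2 g"
proof -
  obtain a b c d where g': "g = mat2 a b c d" by (cases g rule: mat2_exhaust)
  have minus: "- z = z" for z :: 'f using two by (metis add.inverse_unique mult_2 mult_zero_left)
  have tau: "a + d \<noteq> 0"
  proof
    assume "a + d = 0"
    moreover have "(4::'f) = 2 * 2" by simp
    ultimately show False using g g' two by simp
  qed
  define h where "h = unip x \<otimes>\<^bsub>SL2\<^esub> g \<otimes>\<^bsub>SL2\<^esub> inv\<^bsub>SL2\<^esub> (unip x)"
  have h: "h = mat2 (a + x * c) (b + x * d - (a + x * c) * x) c (d - c * x)"
    unfolding h_def g' by (simp add: unip_def algebra_simps)
  have ns: "\<not> (b = 0 \<and> c = 0 \<and> a = d)" using nonscalar_if_trace2_sq_neq_4[of a b c d] g g' by simp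
  obtain u v where uv: "a + x * c = u + v * a" "b + x * d - (a + x * c) * x = v * b" "c = v * c" "d - c * x = u + v * d"
    using commute_mat2[OF ns comm[folded h_def, unfolded h g']] by blast
  \<comment> \<open>Conjugation preserves the trace and 2 u = 0, so v = 1; the upper right entry
    then gives the claim.\<close>
  have "a + d = (a + x * c) + (d - c * x)" by (simp add: mult.commute)
  also have "\<dots> = (u + v * a) + (u + v * d)" using uv(1,4) by (simp only:)
  also have "\<dots> = 2 * u + v * (a + d)" by (simp add: algebra_simps)
  finally have "a + d = 2 * u + v * (a + d)" .
  moreover have "2 * u = 0" unfolding two by (rule mult_zero_left)
  ultimately have "v * (a + d) = 1 * (a + d)" by simp
  then have "v = 1" using tau by (metis mult_right_cancel)
  then have "x * (d - a - x * c) = 0" using uv(2) by (simp add: algebra_simps)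
  then have "d - a = x * c" using x by simp
  moreover have "d - a = d + a" using minus[of a] by (metis diff_conv_add_uminus)
  ultimately show ?thesis using g' by (simp add: add.commute)
qed

subsection \<open>Counting in special linear groups\<close>

text \<open>The first column can be any nonzero vector; the second is then determined up to adding a
  multiple of the first.\<close>

lemma card_SL2: "Coset.order (SL2 :: ('f::{field,finite} ^ 2 ^ 2) monoid) = CARD('f) * ((CARD('f))\<^sup>2 - 1)"
proof -
  let ?f = "\<lambda>A :: 'f ^ 2 ^ 2. (A $ 1 $ 1, A $ 2 $ 1)"
  let ?S = "carrier (SL2 :: ('f ^ 2 ^ 2) monoid)"
  have img: "?f ` ?S = UNIV - {(0, 0)}"
  proof (intro equalityI subsetI)
    fix p assume "p \<in> ?f ` ?S"
    then obtain A where A: "A \<in> ?S" "p = ?f A" by blast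
    obtain a b c d where "A = mat2 a b c d" by (cases A rule: mat2_exhaust)
    then show "p \<in> UNIV - {(0, 0)}" using A by auto
  next
    fix p :: "'f \<times> 'f" assume p: "p \<in> UNIV - {(0, 0)}"
    obtain a c where ac: "p = (a, c)" by (cases p)
    consider "a \<noteq> 0" | "a = 0" "c \<noteq> 0" using p ac by auto
    then show "p \<in> ?f ` ?S"
    proof cases
      case 1
      then show ?thesis using ac by (intro image_eqI[of _ _ "mat2 a 0 c (1 / a)"]) auto
    next
      case 2
      then show ?thesis using ac by (intro image_eqI[of _ _ "mat2 a (- (1 / c)) c 0"]) auto
    qed
  qed
  have "card {A \<in> ?S. ?f A = p} = CARD('f)" if "p \<in> ?f ` ?S" for p
  proof -
    obtain B where B: "B \<in> ?S" "p = ?f B" using \<open>p \<in> ?f ` ?S\<close> by blast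
    obtain a b c d where B': "B = mat2 a b c d" by (cases B rule: mat2_exhaust)
    have det: "a * d - b * c = 1" using B B' by simp
    have "bij_betw (\<lambda>x. mat2 a (b + a * x) c (d + c * x)) UNIV {A \<in> ?S. ?f A = p}"
    proof (rule bij_betwI[where g = "\<lambda>A. d * A $ 1 $ 2 - b * A $ 2 $ 2"])
      show "(\<lambda>x. mat2 a (b + a * x) c (d + c * x)) \<in> UNIV \<rightarrow> {A \<in> ?S. ?f A = p}"
        using B(2) B' det by (auto simp: algebra_simps)
      show "d * mat2 a (b + a * x) c (d + c * x) $ 1 $ 2 - b * mat2 a (b + a * x) c (d + c * x) $ 2 $ 2 = x" for x
      proof -
        have "d * (b + a * x) - b * (d + c * x) = (a * d - b * c) * x" by (simp add: algebra_simps)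
        then show ?thesis using det by simp
      qed
      fix A assume A: "A \<in> {A \<in> ?S. ?f A = p}"
      obtain a' b' c' d' where A': "A = mat2 a' b' c' d'" by (cases A rule: mat2_exhaust)
      have e: "a' = a" "c' = c" using A A' B(2) B' by auto
      have det': "a * d' - b' * c = 1" using A A' e by simp
      have "b + a * (d * b' - b * d') = b * (1 - (a * d' - b' * c)) + b' * (a * d - b * c)"
        "d + c * (d * b' - b * d') = d * (1 - (a * d' - b' * c)) + d' * (a * d - b * c)"
        by (simp_all add: algebra_simps)
      then show "mat2 a (b + a * (d * A $ 1 $ 2 - b * A $ 2 $ 2)) c (d + c * (d * A $ 1 $ 2 - b * A $ 2 $ 2)) = A"
        using A' e det det' by simp
    qed auto
    then show ?thesis using bij_betw_same_card by fastforce
  qed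
  from card_eq_card_fibre_times_card_image[OF _ this]
  have "card ?S = CARD('f) * card (?f ` ?S)" by simp
  also have "card (?f ` ?S) = (CARD('f))\<^sup>2 - 1"
    unfolding img by (subst card_Diff_singleton) (simp_all add: card_cartesian_product power2_eq_square flip: UNIV_Times_UNIV)
  finally show ?thesis by (simp add: Coset.order_def)
qed

lemma card_nonzero_squares:
  assumes two: "(2::'f::{field,finite}) \<noteq> 0"
  shows "CARD('f) - 1 = 2 * card ((\<lambda>x::'f. x\<^sup>2) ` (UNIV - {0}))"
proof -
  have "card {x \<in> UNIV - {0}. x\<^sup>2 = y} = 2" if "y \<in> (\<lambda>x::'f. x\<^sup>2) ` (UNIV - {0})" for y
  proof -
    obtain z :: 'f where z: "z \<noteq> 0" "y = z\<^sup>2" using \<open>y \<in> _\<close> by auto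
    have "{x \<in> UNIV - {0}. x\<^sup>2 = y} = {z, - z}"
      using z by (auto simp: power2_eq_iff)
    moreover have "z \<noteq> - z"
    proof
      assume "z = - z"
      then have "2 * z = 0" by (metis add.right_inverse mult_2)
      then show False using two z by simp
    qed
    ultimately show ?thesis by simp
  qed
  from card_eq_card_fibre_times_card_image[OF _ this] show ?thesis
    by (simp add: card_Diff_singleton)
qed

text \<open>Pigeonhole: more than half of the field consists of squares, so the squares meet their
  image under z |-> c + \<epsilon> z.\<close>

lemma norm_form_surj:
  assumes two: "(2::'f::{field,finite}) \<noteq> 0" and \<epsilon>: "\<epsilon> \<noteq> (0::'f)"
  shows "\<exists>x y. x\<^sup>2 - \<epsilon> * y\<^sup>2 = c"
proof -
  let ?Q = "range (\<lambda>x::'f. x\<^sup>2)"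
  have Q: "?Q = insert 0 ((\<lambda>x::'f. x\<^sup>2) ` (UNIV - {0}))" by (auto simp: image_iff)
  have cQ: "2 * card ?Q = CARD('f) + 1"
  proof -
    have "card (insert 0 ((\<lambda>x::'f. x\<^sup>2) ` (UNIV - {0}))) = Suc (card ((\<lambda>x::'f. x\<^sup>2) ` (UNIV - {0})))"
      by (rule card_insert_disjoint) auto
    moreover have "CARD('f) \<ge> 1" by (simp add: Suc_leI)
    ultimately show ?thesis unfolding Q using card_nonzero_squares[OF two] by linarith
  qed
  have inj: "inj (\<lambda>z. c + \<epsilon> * z)" using \<epsilon> by (auto simp: inj_on_def)
  have "?Q \<inter> (\<lambda>z. c + \<epsilon> * z) ` ?Q \<noteq> {}"
  proof
    assume "?Q \<inter> (\<lambda>z. c + \<epsilon> * z) ` ?Q = {}"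
    then have "card (?Q \<union> (\<lambda>z. c + \<epsilon> * z) ` ?Q) = card ?Q + card ((\<lambda>z. c + \<epsilon> * z) ` ?Q)"
      by (intro card_Un_disjoint) auto
    also have "card ((\<lambda>z. c + \<epsilon> * z) ` ?Q) = card ?Q"
      using inj by (intro card_image) (auto simp: inj_on_def)
    finally have "card (?Q \<union> (\<lambda>z. c + \<epsilon> * z) ` ?Q) = CARD('f) + 1" using cQ by simp
    moreover have "card (?Q \<union> (\<lambda>z. c + \<epsilon> * z) ` ?Q) \<le> CARD('f)" by (intro card_mono) auto
    ultimately show False by simp
  qed
  then obtain x y where "x\<^sup>2 = c + \<epsilon> * y\<^sup>2" by blast
  then have "x\<^sup>2 - \<epsilon> * y\<^sup>2 = c" by simp
  then show ?thesis by blast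
qed

text \<open>The form is the norm of the quadratic extension by a root of \<epsilon>. Being
  multiplicative and onto, it has fibres of one common size k over nonzero values, so n^2 - 1 = k (n
  - 1).\<close>

lemma card_conic_nonsquare:
  assumes two: "(2::'f::{field,finite}) \<noteq> 0" and ns: "\<And>\<delta>::'f. \<epsilon> \<noteq> \<delta>\<^sup>2" and c: "c \<noteq> 0"
  shows "card {(x, y). x\<^sup>2 - \<epsilon> * y\<^sup>2 = (c::'f)} = CARD('f) + 1"
proof -
  let ?N = "\<lambda>(x, y). x\<^sup>2 - \<epsilon> * y\<^sup>2 :: 'f"
  have \<epsilon>0: "\<epsilon> \<noteq> 0" using ns[of 0] by simp
  have N0: "?N p = 0 \<longleftrightarrow> p = (0, 0)" for p
  proof (cases p)
    case (Pair x y)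
    show ?thesis
    proof (cases "y = 0")
      case False
      then have "x\<^sup>2 - \<epsilon> * y\<^sup>2 \<noteq> 0" using ns[of "x / y"] by (auto simp: power_divide field_simps)
      then show ?thesis using Pair False by auto
    qed (use Pair in auto)
  qed
  define k where "k = card {p. ?N p = 1}"
  have fib: "card {p. ?N p = e} = k" if "e \<noteq> 0" for e
  proof -
    obtain u v where uv: "u\<^sup>2 - \<epsilon> * v\<^sup>2 = e" using norm_form_surj[OF two \<epsilon>0] by blast
    \<comment> \<open>Multiplication by the element (u, v) of norm \<open>e\<close>; the inverse
      multiplies by its conjugate and divides by \<open>e\<close>.\<close>
    have "bij_betw (\<lambda>(x, y). (u * x + \<epsilon> * v * y, u * y + v * x)) {p. ?N p = 1} {p. ?N p = e}"
    proof (rule bij_betwI[where g = "\<lambda>(x, y). ((u * x - \<epsilon> * v * y) / e, (u * y - v * x) / e)"])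
      have id: "(u * x + \<epsilon> * v * y)\<^sup>2 - \<epsilon> * (u * y + v * x)\<^sup>2 = (u\<^sup>2 - \<epsilon> * v\<^sup>2) * (x\<^sup>2 - \<epsilon> * y\<^sup>2)" for x y
        by (simp add: algebra_simps power2_eq_square)
      show "(\<lambda>(x, y). (u * x + \<epsilon> * v * y, u * y + v * x)) \<in> {p. ?N p = 1} \<rightarrow> {p. ?N p = e}"
        using id uv by auto
      have id': "((u * x - \<epsilon> * v * y) / e)\<^sup>2 - \<epsilon> * ((u * y - v * x) / e)\<^sup>2 = (x\<^sup>2 - \<epsilon> * y\<^sup>2) / e" for x y
      proof -
        have "((u * x - \<epsilon> * v * y) / e)\<^sup>2 - \<epsilon> * ((u * y - v * x) / e)\<^sup>2
          = (u\<^sup>2 - \<epsilon> * v\<^sup>2) * (x\<^sup>2 - \<epsilon> * y\<^sup>2) / e\<^sup>2"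
          using that by (simp add: field_simps power2_eq_square)
        then show ?thesis unfolding uv using that by (simp add: power2_eq_square)
      qed
      show "(\<lambda>(x, y). ((u * x - \<epsilon> * v * y) / e, (u * y - v * x) / e)) \<in> {p. ?N p = e} \<rightarrow> {p. ?N p = 1}"
        using id' that by auto
      have "u * (u * x + \<epsilon> * v * y) - \<epsilon> * v * (u * y + v * x) = (u\<^sup>2 - \<epsilon> * v\<^sup>2) * x"
        "u * (u * y + v * x) - v * (u * x + \<epsilon> * v * y) = (u\<^sup>2 - \<epsilon> * v\<^sup>2) * y" for x y
        by (simp_all add: algebra_simps power2_eq_square)
      then show "(case case p of (x, y) \<Rightarrow> (u * x + \<epsilon> * v * y, u * y + v * x) of
          (x, y) \<Rightarrow> ((u * x - \<epsilon> * v * y) / e, (u * y - v * x) / e)) = p" for p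
        using uv that by (cases p) simp
      have "u * ((u * x - \<epsilon> * v * y) / e) + \<epsilon> * v * ((u * y - v * x) / e) = (u\<^sup>2 - \<epsilon> * v\<^sup>2) * x / e"
        "u * ((u * y - v * x) / e) + v * ((u * x - \<epsilon> * v * y) / e) = (u\<^sup>2 - \<epsilon> * v\<^sup>2) * y / e" for x y
        using that by (simp_all add: field_simps power2_eq_square)
      then show "(case case p of (x, y) \<Rightarrow> ((u * x - \<epsilon> * v * y) / e, (u * y - v * x) / e) of
          (x, y) \<Rightarrow> (u * x + \<epsilon> * v * y, u * y + v * x)) = p" for p
        using uv that by (cases p) simp
    qed
    then show ?thesis unfolding k_def by (rule bij_betw_same_card[symmetric])
  qed
  have "card {p \<in> UNIV - {(0, 0)}. ?N p = e} = k" if "e \<in> ?N ` (UNIV - {(0, 0)})" for e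
  proof -
    have "e \<noteq> 0" using that N0 by (metis (no_types, lifting) DiffD2 imageE singletonI)
    then have "{p \<in> UNIV - {(0, 0)}. ?N p = e} = {p. ?N p = e}" using N0 by auto
    then show ?thesis using fib[OF \<open>e \<noteq> 0\<close>] by simp
  qed
  from card_eq_card_fibre_times_card_image[OF _ this]
  have eq0: "card (UNIV - {(0::'f, 0::'f)}) = k * card (?N ` (UNIV - {(0, 0)}))" by simp
  have img: "?N ` (UNIV - {(0, 0)}) = UNIV - {0}"
  proof (intro equalityI subsetI)
    fix e :: 'f assume e: "e \<in> UNIV - {0}"
    obtain u v where uv: "u\<^sup>2 - \<epsilon> * v\<^sup>2 = e" using norm_form_surj[OF two \<epsilon>0] by blast
    then have "(u, v) \<in> UNIV - {(0, 0)}" using e by auto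
    then show "e \<in> ?N ` (UNIV - {(0, 0)})" using uv by (intro image_eqI[of _ _ "(u, v)"]) auto
  next
    fix e assume "e \<in> ?N ` (UNIV - {(0, 0)})"
    then obtain p where "p \<noteq> (0, 0)" "e = ?N p" by blast
    then show "e \<in> UNIV - {0}" using N0[of p] by simp
  qed
  have "card (UNIV - {0::'f}) = CARD('f) - 1" by (simp add: card_Diff_singleton)
  moreover have "card (UNIV - {(0::'f, 0::'f)}) = CARD('f) * CARD('f) - 1"
    by (subst card_Diff_singleton) (simp_all add: card_cartesian_product flip: UNIV_Times_UNIV)
  ultimately have eq: "CARD('f) * CARD('f) - 1 = k * (CARD('f) - 1)" using eq0 unfolding img by simp
  have "CARD('f) \<ge> 2" using card_mono[of "UNIV :: 'f set" "{0, 1}"] by simp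
  then obtain m where m: "CARD('f) = m + 2" by (metis le_add_diff_inverse2)
  have "(m + 3) * (m + 1) = k * (m + 1)" using eq unfolding m by (simp add: algebra_simps)
  then have "k = CARD('f) + 1" unfolding m mult_cancel2 by simp
  then show ?thesis using fib[OF c] by (simp add: case_prod_unfold)
qed

text \<open>The form factors, and z = x + \<delta> y parametrizes the hyperbola by the nonzero
  elements, the other factor being 1 / z.\<close>

lemma card_conic_square:
  assumes two: "(2::'f::{field,finite}) \<noteq> 0" and \<delta>: "\<delta> \<noteq> (0::'f)"
  shows "card {(x, y). x\<^sup>2 - \<delta>\<^sup>2 * y\<^sup>2 = 1} = CARD('f) - 1"
proof -
  have "bij_betw (\<lambda>(x, y). x + \<delta> * y) {(x, y). x\<^sup>2 - \<delta>\<^sup>2 * y\<^sup>2 = 1} (UNIV - {0})"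
  proof (rule bij_betwI[where g = "\<lambda>z. ((z + 1 / z) / 2, (z - 1 / z) / (2 * \<delta>))"])
    have fac: "x\<^sup>2 - \<delta>\<^sup>2 * y\<^sup>2 = (x + \<delta> * y) * (x - \<delta> * y)" for x y
      by (simp add: algebra_simps power2_eq_square)
    show "(\<lambda>(x, y). x + \<delta> * y) \<in> {(x, y). x\<^sup>2 - \<delta>\<^sup>2 * y\<^sup>2 = 1} \<rightarrow> UNIV - {0}"
      unfolding fac by auto
    have half: "(z + w) / 2 + \<delta> * ((z - w) / (2 * \<delta>)) = z" "(z + w) / 2 - \<delta> * ((z - w) / (2 * \<delta>)) = w" for z w :: 'f
    proof -
      have "\<delta> * ((z - w) / (2 * \<delta>)) = (z - w) / 2" using \<delta> by simp
      then have "(z + w) / 2 + \<delta> * ((z - w) / (2 * \<delta>)) = ((z + w) + (z - w)) / 2"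
        "(z + w) / 2 - \<delta> * ((z - w) / (2 * \<delta>)) = ((z + w) - (z - w)) / 2"
        by (simp_all only: add_divide_distrib diff_divide_distrib)
      moreover have "(z + w) + (z - w) = 2 * z" "(z + w) - (z - w) = 2 * w" by simp_all
      ultimately have "(z + w) / 2 + \<delta> * ((z - w) / (2 * \<delta>)) = (2 * z) / 2"
        "(z + w) / 2 - \<delta> * ((z - w) / (2 * \<delta>)) = (2 * w) / 2" by simp_all
      then show "(z + w) / 2 + \<delta> * ((z - w) / (2 * \<delta>)) = z" "(z + w) / 2 - \<delta> * ((z - w) / (2 * \<delta>)) = w"
        using two by simp_all
    qed
    show "(\<lambda>z. ((z + 1 / z) / 2, (z - 1 / z) / (2 * \<delta>))) \<in> UNIV - {0} \<rightarrow> {(x, y). x\<^sup>2 - \<delta>\<^sup>2 * y\<^sup>2 = 1}"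
    proof
      fix z :: 'f assume z: "z \<in> UNIV - {0}"
      have "((z + 1 / z) / 2 + \<delta> * ((z - 1 / z) / (2 * \<delta>))) * ((z + 1 / z) / 2 - \<delta> * ((z - 1 / z) / (2 * \<delta>))) = z * (1 / z)"
        by (simp only: half)
      then show "((z + 1 / z) / 2, (z - 1 / z) / (2 * \<delta>)) \<in> {(x, y). x\<^sup>2 - \<delta>\<^sup>2 * y\<^sup>2 = 1}"
        unfolding fac mem_Collect_eq prod.case using z by (simp only:) simp
    qed
    show "(\<lambda>(x, y). x + \<delta> * y) ((z + 1 / z) / 2, (z - 1 / z) / (2 * \<delta>)) = z" for z
      by (simp only: prod.case half)
    fix p assume "p \<in> {(x, y). x\<^sup>2 - \<delta>\<^sup>2 * y\<^sup>2 = 1}"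
    then obtain x y where p: "p = (x, y)" "(x + \<delta> * y) * (x - \<delta> * y) = 1" unfolding fac by auto
    then have inv: "1 / (x + \<delta> * y) = x - \<delta> * y" by (metis mult_eq_0_iff nonzero_eq_divide_eq mult.commute zero_neq_one)
    have "((x + \<delta> * y) + (x - \<delta> * y)) / 2 = (2 * x) / 2" "((x + \<delta> * y) - (x - \<delta> * y)) / (2 * \<delta>) = ((2 * \<delta>) * y) / (2 * \<delta>)"
      by (simp_all add: algebra_simps)
    then have "((x + \<delta> * y) + (x - \<delta> * y)) / 2 = x" "((x + \<delta> * y) - (x - \<delta> * y)) / (2 * \<delta>) = y"
      using two \<delta> by simp_all
    then show "(((case p of (x, y) \<Rightarrow> x + \<delta> * y) + 1 / (case p of (x, y) \<Rightarrow> x + \<delta> * y)) / 2,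
       ((case p of (x, y) \<Rightarrow> x + \<delta> * y) - 1 / (case p of (x, y) \<Rightarrow> x + \<delta> * y)) / (2 * \<delta>)) = p"
      using p inv by simp
  qed
  then have "card {(x, y). x\<^sup>2 - \<delta>\<^sup>2 * y\<^sup>2 = 1} = card (UNIV - {0::'f})" by (rule bij_betw_same_card)
  then show ?thesis by (simp add: card_Diff_singleton)
qed

section \<open>Tori and the elements that invert them\<close>

definition centr :: "'f::field ^ 2 ^ 2 \<Rightarrow> ('f ^ 2 ^ 2) set" where
  "centr g = {A \<in> carrier SL2. A ** g = g ** A}"

definition inverters :: "'f::field ^ 2 ^ 2 \<Rightarrow> ('f ^ 2 ^ 2) set" where
  "inverters g = {A \<in> carrier SL2. A ** g = inv\<^bsub>SL2\<^esub> g ** A}"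

text \<open>\<open>2 * g\<close> minus its trace is traceless with square equal to the discriminant.
  So an element of the commutant, written as x + y times this matrix, has the norm form as its
  determinant.\<close>

lemma card_centr:
  assumes two: "(2::'f::{field,finite}) \<noteq> 0"
    and g: "g \<in> carrier (SL2 :: ('f ^ 2 ^ 2) monoid)" "(trace2 g)\<^sup>2 \<noteq> 4"
  shows "card (centr g) = card {(x, y). x\<^sup>2 - ((trace2 g)\<^sup>2 - 4) * y\<^sup>2 = 1}"
proof -
  obtain a b c d where g': "g = mat2 a b c d" by (cases g rule: mat2_exhaust)
  have det: "a * d - b * c = 1" using g g' by simp
  have ns: "\<not> (b = 0 \<and> c = 0 \<and> a = d)" using nonscalar_if_trace2_sq_neq_4[of a b c d] g g' by simp
  define \<tau> where "\<tau> = a + d"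
  let ?m = "\<lambda>(x, y). mat2 (x - y * \<tau> + 2 * y * a) (2 * y * b) (2 * y * c) (x - y * \<tau> + 2 * y * d)"
  have "bij_betw ?m {(x, y). x\<^sup>2 - (\<tau>\<^sup>2 - 4) * y\<^sup>2 = 1} (centr g)"
  proof (rule bij_betw_imageI)
    show "inj_on ?m {(x, y). x\<^sup>2 - (\<tau>\<^sup>2 - 4) * y\<^sup>2 = 1}"
    proof (rule inj_onI)
      fix p p' assume "?m p = ?m p'"
      moreover obtain x y where p: "p = (x, y)" by (cases p)
      moreover obtain x' y' where p': "p' = (x', y')" by (cases p')
      ultimately have e: "x - y * \<tau> + 2 * y * a = x' - y' * \<tau> + 2 * y' * a" "2 * y * b = 2 * y' * b" "2 * y * c = 2 * y' * c"
        "x - y * \<tau> + 2 * y * d = x' - y' * \<tau> + 2 * y' * d" by (simp_all only: prod.case mat2_eq_iff)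
      have "2 * (y - y') * (a - d) = 0"
      proof -
        have "(x - y * \<tau> + 2 * y * a) - (x - y * \<tau> + 2 * y * d) - ((x' - y' * \<tau> + 2 * y' * a) - (x' - y' * \<tau> + 2 * y' * d)) = 0"
          unfolding e(1) e(4) by simp
        then show ?thesis by (simp add: algebra_simps)
      qed
      then have "y = y'" using e(2,3) ns two by auto
      then show "p = p'" using e(1) p p' by simp
    qed
    have id: "(x - y * \<tau> + 2 * y * a) * (x - y * \<tau> + 2 * y * d) - (2 * y * b) * (2 * y * c)
        = x\<^sup>2 - (\<tau>\<^sup>2 - 4 * (a * d - b * c)) * y\<^sup>2" for x y
      unfolding \<tau>_def by (simp add: algebra_simps power2_eq_square)
    show "?m ` {(x, y). x\<^sup>2 - (\<tau>\<^sup>2 - 4) * y\<^sup>2 = 1} = centr g"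
    proof (intro equalityI subsetI)
      fix A assume "A \<in> ?m ` {(x, y). x\<^sup>2 - (\<tau>\<^sup>2 - 4) * y\<^sup>2 = 1}"
      then obtain x y where xy: "x\<^sup>2 - (\<tau>\<^sup>2 - 4) * y\<^sup>2 = 1" "A = ?m (x, y)" by auto
      then show "A \<in> centr g" using id[of x y] g' det by (simp add: centr_def) (simp add: algebra_simps)
    next
      fix A assume A: "A \<in> centr g"
      obtain x y z w where A': "A = mat2 x y z w" by (cases A rule: mat2_exhaust)
      obtain u v where uv: "x = u + v * a" "y = v * b" "z = v * c" "w = u + v * d"
        using commute_mat2[OF ns, of x y z w] A A' g' unfolding centr_def by blast
      define Y where "Y = v / 2"
      define X where "X = u + Y * \<tau>"
      have v: "v = 2 * Y" using two by (simp add: Y_def)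
      have A'': "A = ?m (X, Y)" unfolding A' uv X_def v by simp
      then have "X\<^sup>2 - (\<tau>\<^sup>2 - 4) * Y\<^sup>2 = 1" using A id[of X Y] det by (simp add: centr_def)
      then show "A \<in> ?m ` {(x, y). x\<^sup>2 - (\<tau>\<^sup>2 - 4) * y\<^sup>2 = 1}" using A'' by blast
    qed
  qed
  then show ?thesis using g' by (simp add: bij_betw_same_card \<tau>_def)
qed

text \<open>The equation for an inverting matrix is linear: its trace is 0 and, as \<open>b\<close>
  is nonzero, its lower left entry is determined by the other two parameters. The determinant is
  minus the norm form, hence the conic at -1.\<close>

lemma card_inverters:
  assumes two: "(2::'f::{field,finite}) \<noteq> 0"
    and g: "g = mat2 a b c d" "a * d - b * c = 1" and b: "b \<noteq> (0::'f)"
  shows "card (inverters g) = card {(x, y). x\<^sup>2 - ((trace2 g)\<^sup>2 - 4) * y\<^sup>2 = - 1}"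
proof -
  define e where "e = a - d"
  have disc: "(trace2 g)\<^sup>2 - 4 = e\<^sup>2 + 4 * b * c"
  proof -
    have "(a + d)\<^sup>2 - 4 * (a * d - b * c) = e\<^sup>2 + 4 * b * c"
      unfolding e_def by (simp add: algebra_simps power2_eq_square)
    then show ?thesis using g by simp
  qed
  have inv: "inv\<^bsub>SL2\<^esub> g = mat2 d (- b) (- c) a" using g by simp
  let ?m = "\<lambda>(x, y). mat2 (x + e * y) (2 * b * y) (- (e * (x + e * y) + c * (2 * b * y)) / b) (- (x + e * y))"
  have "bij_betw ?m {(x, y). x\<^sup>2 - (e\<^sup>2 + 4 * b * c) * y\<^sup>2 = - 1} (inverters g)"
  proof (rule bij_betw_imageI)
    show "inj_on ?m {(x, y). x\<^sup>2 - (e\<^sup>2 + 4 * b * c) * y\<^sup>2 = - 1}"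
      using two b by (auto simp: inj_on_def)
    have id: "(x + e * y) * (- (x + e * y)) - (2 * b * y) * (- (e * (x + e * y) + c * (2 * b * y)) / b)
        = - (x\<^sup>2 - (e\<^sup>2 + 4 * b * c) * y\<^sup>2)" for x y
      using b by (simp add: field_simps power2_eq_square)
    show "?m ` {(x, y). x\<^sup>2 - (e\<^sup>2 + 4 * b * c) * y\<^sup>2 = - 1} = inverters g"
    proof (intro equalityI subsetI)
      fix A assume "A \<in> ?m ` {(x, y). x\<^sup>2 - (e\<^sup>2 + 4 * b * c) * y\<^sup>2 = - 1}"
      then obtain x y where xy: "x\<^sup>2 - (e\<^sup>2 + 4 * b * c) * y\<^sup>2 = - 1" "A = ?m (x, y)" by auto
      have "A \<in> carrier SL2" using xy id[of x y] by simp
      moreover have "A ** g = inv\<^bsub>SL2\<^esub> g ** A"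
        unfolding inv unfolding xy(2) g(1) using b by (simp add: e_def field_simps)
      ultimately show "A \<in> inverters g" by (simp add: inverters_def)
    next
      fix A assume A: "A \<in> inverters g"
      obtain x y z w where A': "A = mat2 x y z w" by (cases A rule: mat2_exhaust)
      have eqs: "x * a + y * c = d * x - b * z" "x * b + y * d = d * y - b * w"
      proof -
        have "A ** g = mat2 d (- b) (- c) a ** A" using A unfolding inverters_def inv by simp
        then show "x * a + y * c = d * x - b * z" "x * b + y * d = d * y - b * w"
          unfolding A' g(1) by simp_all
      qed
      have "b * (w + x) = 0" using eqs(2) by (simp add: algebra_simps)
      then have w: "w = - x" using b by (simp add: eq_neg_iff_add_eq_0)
      have "b * z = - (e * x + c * y)" using eqs(1) unfolding e_def by (simp add: algebra_simps)
      then have z: "z = - (e * x + c * y) / b" using b by (simp add: field_simps)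
      define Y where "Y = y / (2 * b)"
      define X where "X = x - e * Y"
      have y: "y = 2 * b * Y" using two b by (simp add: Y_def)
      have A'': "A = ?m (X, Y)" unfolding A' w z X_def y by simp
      have "- (X\<^sup>2 - (e\<^sup>2 + 4 * b * c) * Y\<^sup>2) = 1"
        unfolding id[symmetric] using A unfolding A'' by (simp only: inverters_def mem_Collect_eq prod.case mat2_in_SL2)
      then have "X\<^sup>2 - (e\<^sup>2 + 4 * b * c) * Y\<^sup>2 = - 1" by (metis minus_minus)
      then show "A \<in> ?m ` {(x, y). x\<^sup>2 - (e\<^sup>2 + 4 * b * c) * y\<^sup>2 = - 1}" using A'' by blast
    qed
  qed
  then show ?thesis unfolding disc by (simp add: bij_betw_same_card)
qed

section \<open>Normalizers, and vectors with a prescribed normal subgroup in the stabilizer\<close>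

definition norm_set :: "('g, 'm) monoid_scheme \<Rightarrow> 'g set \<Rightarrow> 'g set" where
  "norm_set G P = {x \<in> carrier G. \<forall>g\<in>P. x \<otimes>\<^bsub>G\<^esub> g \<otimes>\<^bsub>G\<^esub> inv\<^bsub>G\<^esub> x \<in> P}"

context group
begin

lemma conj_set_one: "subgroup P G \<Longrightarrow> conj_set G P \<one> = P"
proof -
  assume "subgroup P G"
  then have "(\<lambda>x. inv \<one> \<otimes> x \<otimes> \<one>) ` P = (\<lambda>x. x) ` P"
    using subgroup.mem_carrier by (intro image_cong) fastforce+
  then show "conj_set G P \<one> = P" by (simp add: conj_set_def)
qed

lemma mem_conj_set_iff:
  assumes "subgroup P G" "z \<in> carrier G" "g \<in> carrier G"
  shows "g \<in> conj_set G P z \<longleftrightarrow> z \<otimes> g \<otimes> inv z \<in> P"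
proof
  interpret P: subgroup P G by fact
  assume "g \<in> conj_set G P z"
  then obtain h where h: "h \<in> P" "g = inv z \<otimes> h \<otimes> z" by (auto simp: conj_set_def)
  have "z \<otimes> g \<otimes> inv z = (z \<otimes> inv z) \<otimes> h \<otimes> (z \<otimes> inv z)"
    unfolding h(2) using assms h(1) by (simp only: m_assoc P.mem_carrier inv_closed m_closed)
  then show "z \<otimes> g \<otimes> inv z \<in> P" using h(1) assms by (simp add: P.mem_carrier)
next
  assume "z \<otimes> g \<otimes> inv z \<in> P"
  moreover have "g = (inv z \<otimes> z) \<otimes> g \<otimes> (inv z \<otimes> z)" using assms by simp
  then have "g = inv z \<otimes> (z \<otimes> g \<otimes> inv z) \<otimes> z"
    using assms by (simp only: m_assoc inv_closed m_closed)
  ultimately show "g \<in> conj_set G P z" unfolding conj_set_def by (rule image_eqI[rotated])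
qed

lemma mem_norm_set_conj_iff:
  assumes "subgroup P G" "z \<in> carrier G" "x \<in> carrier G"
  shows "x \<in> norm_set G (conj_set G P z) \<longleftrightarrow> z \<otimes> x \<otimes> inv z \<in> norm_set G P"
proof -
  interpret P: subgroup P G by fact
  have eq: "z \<otimes> (x \<otimes> (inv z \<otimes> g \<otimes> z) \<otimes> inv x) \<otimes> inv z = (z \<otimes> x \<otimes> inv z) \<otimes> g \<otimes> inv (z \<otimes> x \<otimes> inv z)"
    if "g \<in> carrier G" for g
    using assms that by (simp add: m_assoc inv_mult_group)
  have "x \<in> norm_set G (conj_set G P z) \<longleftrightarrow> (\<forall>g\<in>P. x \<otimes> (inv z \<otimes> g \<otimes> z) \<otimes> inv x \<in> conj_set G P z)"
    using assms(3) by (simp add: norm_set_def conj_set_def[of G P z])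
  also have "\<dots> \<longleftrightarrow> (\<forall>g\<in>P. z \<otimes> (x \<otimes> (inv z \<otimes> g \<otimes> z) \<otimes> inv x) \<otimes> inv z \<in> P)"
    using assms mem_conj_set_iff[OF assms(1,2)] by (simp add: P.mem_carrier)
  also have "\<dots> \<longleftrightarrow> z \<otimes> x \<otimes> inv z \<in> norm_set G P"
    using assms eq by (simp add: norm_set_def P.mem_carrier)
  finally show ?thesis .
qed

lemma subgroup_subset_norm_set: "subgroup P G \<Longrightarrow> P \<subseteq> norm_set G P"
  unfolding norm_set_def
proof
  fix x assume P: "subgroup P G" and x: "x \<in> P"
  have "x \<otimes> g \<otimes> inv x \<in> P" if "g \<in> P" for g
    using P x that by (intro subgroup.m_closed subgroup.m_inv_closed)
  then show "x \<in> {x \<in> carrier G. \<forall>g\<in>P. x \<otimes> g \<otimes> inv x \<in> P}"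
    using subgroup.mem_carrier[OF P x] by blast
qed

lemma normal_restrict_iff:
  assumes "subgroup P G" "subgroup S G"
  shows "P \<lhd> G\<lparr>carrier := S\<rparr> \<longleftrightarrow> P \<subseteq> S \<and> S \<subseteq> norm_set G P"
proof -
  have SG: "Group.group (G\<lparr>carrier := S\<rparr>)" using subgroup.subgroup_is_group[OF assms(2) is_group] .
  have "subgroup P (G\<lparr>carrier := S\<rparr>) \<longleftrightarrow> P \<subseteq> S"
    using subgroup_incl[OF assms] subgroup.subset[of P "G\<lparr>carrier := S\<rparr>"] by auto
  moreover have "(\<forall>x\<in>S. \<forall>h\<in>P. x \<otimes> h \<otimes> inv\<^bsub>G\<lparr>carrier := S\<rparr>\<^esub> x \<in> P) \<longleftrightarrow> S \<subseteq> norm_set G P"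
    unfolding norm_set_def using m_inv_consistent[OF assms(2)] subgroup.subset[OF assms(2)] by auto
  ultimately show ?thesis
    using group.normal_inv_iff[OF SG, of P] by simp
qed

lemma sylow_ndvd:
  assumes "prime p" "finite (carrier G)" "sylow_subgroup G p P"
  shows "\<exists>m. card P = p ^ m \<and> \<not> p ^ Suc m dvd Coset.order G"
proof -
  have "Coset.order G \<noteq> 0" using assms(2) by (auto simp: Coset.order_def)
  then have "\<not> p ^ Suc (multiplicity p (Coset.order G)) dvd Coset.order G"
    using multiplicity_geI[of "Coset.order G" p "Suc (multiplicity p (Coset.order G))"] assms(1)
    by (metis Suc_n_not_le_n not_prime_unit)
  then show ?thesis using assms(3) unfolding sylow_subgroup_def by blast
qed

lemma sylow_conj_set:
  "sylow_subgroup G p P \<Longrightarrow> z \<in> carrier G \<Longrightarrow> sylow_subgroup G p (conj_set G P z)"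
  by (simp add: sylow_subgroup_def subgroup_conj_set card_conj_set)

lemma sylow_eq_if_normalizing:
  assumes "prime p" "finite (carrier G)" "sylow_subgroup G p P" "sylow_subgroup G p Q" "Q \<subseteq> norm_set G P"
  shows "P = Q"
proof -
  obtain m where "card P = p ^ m" "\<not> p ^ Suc m dvd Coset.order G" using sylow_ndvd[OF assms(1-3)] by blast
  moreover have "card Q = card P" "subgroup P G" "subgroup Q G" using assms(3,4) by (auto simp: sylow_subgroup_def)
  ultimately show ?thesis
    using assms(5) by (intro sylow_normalizing_sylow_eq[OF assms(1,2)]) (auto simp: norm_set_def)
qed

end

text \<open>The contribution of one subgroup, without conjugation, to
  \<open>conj_normal_vectors\<close>. Normality in the stabilizer is split into two inclusions,
  since most arguments need just one of them.\<close>

definition normal_vectors :: "('g, 'm) monoid_scheme \<Rightarrow> ('g \<Rightarrow> 'v \<Rightarrow> 'v) \<Rightarrow> 'g set \<Rightarrow> 'v set" where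
  "normal_vectors G \<phi> P = {v. P \<subseteq> stabilizer G \<phi> v \<and> stabilizer G \<phi> v \<subseteq> norm_set G P}"

context group_action
begin

lemma conj_normal_vectors_eq:
  assumes "E = UNIV" "subgroup P G"
  shows "conj_normal_vectors G \<phi> P = (\<Union>Q\<in>conj_set G P ` carrier G. normal_vectors G \<phi> Q)"
proof -
  interpret G: group G using group_hom by (simp add: group_hom_def)
  have "conj_set G P z \<lhd> G\<lparr>carrier := stabilizer G \<phi> v\<rparr> \<longleftrightarrow> v \<in> normal_vectors G \<phi> (conj_set G P z)"
    if "z \<in> carrier G" for z v
    using G.normal_restrict_iff[OF G.subgroup_conj_set[OF assms(2) that]] stabilizer_subgroup[of v] assms(1)
    by (simp add: normal_vectors_def)
  then show ?thesis unfolding conj_normal_vectors_def by auto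
qed

lemma mem_stabilizer_act:
  assumes "E = UNIV" "z \<in> carrier G" "x \<in> carrier G"
  shows "x \<in> stabilizer G \<phi> (\<phi> z v) \<longleftrightarrow> inv\<^bsub>G\<^esub> z \<otimes>\<^bsub>G\<^esub> x \<otimes>\<^bsub>G\<^esub> z \<in> stabilizer G \<phi> v"
proof -
  interpret G: group G using group_hom by (simp add: group_hom_def)
  have comp: "\<phi> (g \<otimes>\<^bsub>G\<^esub> h) w = \<phi> g (\<phi> h w)" if "g \<in> carrier G" "h \<in> carrier G" for g h w
    using composition_rule[of w g h] that assms(1) by simp
  have one: "\<phi> \<one>\<^bsub>G\<^esub> w = w" for w using id_eq_one assms(1) by (metis UNIV_I restrict_apply')
  have "\<phi> x (\<phi> z v) = \<phi> z v \<longleftrightarrow> \<phi> (inv\<^bsub>G\<^esub> z) (\<phi> x (\<phi> z v)) = \<phi> (inv\<^bsub>G\<^esub> z) (\<phi> z v)"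
    using inj_prop[of "inv\<^bsub>G\<^esub> z"] assms by (auto simp: inj_on_def)
  also have "\<dots> \<longleftrightarrow> \<phi> (inv\<^bsub>G\<^esub> z \<otimes>\<^bsub>G\<^esub> x \<otimes>\<^bsub>G\<^esub> z) v = v"
    using assms by (simp add: comp[symmetric] one G.m_assoc)
  finally show ?thesis using assms by (simp add: stabilizer_def)
qed

lemma act_mem_normal_vectors:
  assumes "E = UNIV" "subgroup P G" "z \<in> carrier G" "v \<in> normal_vectors G \<phi> (conj_set G P z)"
  shows "\<phi> z v \<in> normal_vectors G \<phi> P"
proof -
  interpret G: group G using group_hom by (simp add: group_hom_def)
  interpret P: subgroup P G by fact
  have 1: "conj_set G P z \<subseteq> stabilizer G \<phi> v" and 2: "stabilizer G \<phi> v \<subseteq> norm_set G (conj_set G P z)"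
    using assms(4) by (auto simp: normal_vectors_def)
  have "x \<in> stabilizer G \<phi> (\<phi> z v)" if "x \<in> P" for x
    using that 1 assms P.mem_carrier mem_stabilizer_act[of z x v] by (auto simp: conj_set_def)
  moreover have "x \<in> norm_set G P" if x: "x \<in> stabilizer G \<phi> (\<phi> z v)" for x
  proof -
    have xG: "x \<in> carrier G" using x stabilizer_subset by blast
    have "inv\<^bsub>G\<^esub> z \<otimes>\<^bsub>G\<^esub> x \<otimes>\<^bsub>G\<^esub> z \<in> norm_set G (conj_set G P z)"
      using x mem_stabilizer_act[OF assms(1,3) xG] 2 by blast
    then have "z \<otimes>\<^bsub>G\<^esub> (inv\<^bsub>G\<^esub> z \<otimes>\<^bsub>G\<^esub> x \<otimes>\<^bsub>G\<^esub> z) \<otimes>\<^bsub>G\<^esub> inv\<^bsub>G\<^esub> z \<in> norm_set G P"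
      using G.mem_norm_set_conj_iff[OF assms(2,3)] xG assms(3) by simp
    moreover have "z \<otimes>\<^bsub>G\<^esub> (inv\<^bsub>G\<^esub> z \<otimes>\<^bsub>G\<^esub> x \<otimes>\<^bsub>G\<^esub> z) \<otimes>\<^bsub>G\<^esub> inv\<^bsub>G\<^esub> z = (z \<otimes>\<^bsub>G\<^esub> inv\<^bsub>G\<^esub> z) \<otimes>\<^bsub>G\<^esub> x \<otimes>\<^bsub>G\<^esub> (z \<otimes>\<^bsub>G\<^esub> inv\<^bsub>G\<^esub> z)"
      using xG assms(3) by (simp only: G.m_assoc G.inv_closed G.m_closed)
    ultimately show ?thesis using xG assms(3) by simp
  qed
  ultimately show ?thesis by (auto simp: normal_vectors_def)
qed

text \<open>A vector belonging to two conjugates has a stabilizer that contains one and normalizes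
  the other, so they coincide. Group elements carry the pieces into each other, so these have the
  same size.\<close>

lemma card_conj_normal_vectors:
  assumes E: "E = UNIV" "finite E" and fin: "finite (carrier G)" and p: "prime p" and P: "sylow_subgroup G p P"
  shows "card (conj_normal_vectors G \<phi> P) = card (conj_set G P ` carrier G) * card (normal_vectors G \<phi> P)"
proof -
  interpret G: group G using group_hom by (simp add: group_hom_def)
  have Psub: "subgroup P G" using P by (simp add: sylow_subgroup_def)
  have finV: "finite (normal_vectors G \<phi> Q)" for Q
    using E by (simp add: finite_subset[OF subset_UNIV])
  have disj: "normal_vectors G \<phi> Q \<inter> normal_vectors G \<phi> Q' = {}"
    if Q: "Q \<in> conj_set G P ` carrier G" and Q': "Q' \<in> conj_set G P ` carrier G" and ne: "Q \<noteq> Q'" for Q Q'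
  proof (rule ccontr)
    assume "normal_vectors G \<phi> Q \<inter> normal_vectors G \<phi> Q' \<noteq> {}"
    then have "Q' \<subseteq> norm_set G Q" unfolding normal_vectors_def by blast
    then have "Q = Q'" using G.sylow_eq_if_normalizing[OF p fin] G.sylow_conj_set[OF P] Q Q' by blast
    then show False using ne by simp
  qed
  have card: "card (normal_vectors G \<phi> Q) = card (normal_vectors G \<phi> P)" if Q: "Q \<in> conj_set G P ` carrier G" for Q
  proof -
    obtain z where z: "z \<in> carrier G" "Q = conj_set G P z" using Q by blast
    have inj: "inj_on (\<phi> y) A" if "y \<in> carrier G" for y A
      using inj_prop[OF that] E inj_on_subset by blast
    have 1: "\<phi> z ` normal_vectors G \<phi> Q \<subseteq> normal_vectors G \<phi> P"
      using act_mem_normal_vectors[OF E(1) Psub z(1)] z(2) by blast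
    have 2: "\<phi> (inv\<^bsub>G\<^esub> z) ` normal_vectors G \<phi> P \<subseteq> normal_vectors G \<phi> Q"
    proof -
      have "P = conj_set G Q (inv\<^bsub>G\<^esub> z)"
        unfolding z(2) using G.conj_set_conj_set[OF Psub z(1)] z(1) G.conj_set_one[OF Psub] by simp
      then show ?thesis
        using act_mem_normal_vectors[OF E(1), of Q "inv\<^bsub>G\<^esub> z"] G.subgroup_conj_set[OF Psub z(1)] z by auto
    qed
    have "card (normal_vectors G \<phi> Q) \<le> card (normal_vectors G \<phi> P)"
      by (rule card_inj_on_le[OF inj[OF z(1)] 1 finV])
    moreover have "card (normal_vectors G \<phi> P) \<le> card (normal_vectors G \<phi> Q)"
      by (rule card_inj_on_le[OF inj 2 finV]) (use z(1) in simp)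
    ultimately show ?thesis by simp
  qed
  have "card (conj_normal_vectors G \<phi> P) = (\<Sum>Q\<in>conj_set G P ` carrier G. card (normal_vectors G \<phi> Q))"
    unfolding conj_normal_vectors_eq[OF E(1) Psub] using fin finV disj by (intro card_UN_disjoint) auto
  then show ?thesis using card by simp
qed

text \<open>This permits replacing \<open>R\<close> by a conjugate inside the diagonal torus and
  \<open>T\<close> by \<open>unip_group\<close>.\<close>

lemma conj_normal_vectors_conj_set:
  assumes "E = UNIV" "subgroup P G" "z \<in> carrier G"
  shows "conj_normal_vectors G \<phi> (conj_set G P z) = conj_normal_vectors G \<phi> P"
proof -
  interpret G: group G using group_hom by (simp add: group_hom_def)
  have "conj_set G (conj_set G P z) ` carrier G = conj_set G P ` (\<lambda>y. z \<otimes>\<^bsub>G\<^esub> y) ` carrier G"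
    unfolding image_image using assms by (intro image_cong) (auto simp: G.conj_set_conj_set)
  also have "(\<lambda>y. z \<otimes>\<^bsub>G\<^esub> y) ` carrier G = carrier G"
  proof (intro equalityI subsetI)
    fix y assume "y \<in> carrier G"
    then show "y \<in> (\<lambda>y. z \<otimes>\<^bsub>G\<^esub> y) ` carrier G"
      using assms(3) by (intro image_eqI[of _ _ "inv\<^bsub>G\<^esub> z \<otimes>\<^bsub>G\<^esub> y"]) (auto simp: G.m_assoc[symmetric])
  qed (use assms in auto)
  finally show ?thesis
    using assms by (simp add: conj_normal_vectors_eq G.subgroup_conj_set)
qed

end

subsection \<open>Sylow subgroups in tori\<close>

text \<open>The common shape of the groups \<open>R\<close> and \<open>S\<close>.\<close>

definition odd_sylow :: "nat \<Rightarrow> ('f::{field,finite} ^ 2 ^ 2) set \<Rightarrow> bool" where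
  "odd_sylow r P \<longleftrightarrow> prime r \<and> odd r \<and> r dvd (CARD('f))\<^sup>2 - 1 \<and> sylow_subgroup SL2 r P"

lemma finite_SL2 [simp]: "finite (carrier (SL2 :: ('f::{field,finite} ^ 2 ^ 2) monoid))"
  by simp

lemma card_ge_2: "CARD('f::{field,finite}) \<ge> 2"
  using card_mono[of "UNIV :: 'f set" "{0, 1}"] by simp

lemma order_SL2_pos: "Coset.order (SL2 :: ('f::{field,finite} ^ 2 ^ 2) monoid) > 0"
  using SL2.one_closed[where 'f = 'f] by (auto simp: Coset.order_def card_gt_0_iff simp del: one_SL2)

lemma odd_sylow_conj_set: "odd_sylow r P \<Longrightarrow> z \<in> carrier SL2 \<Longrightarrow> odd_sylow r (conj_set SL2 P z)"
  by (simp add: odd_sylow_def SL2.sylow_conj_set)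

lemma odd_sylow_subgroup: "odd_sylow r P \<Longrightarrow> subgroup P SL2"
  by (simp add: odd_sylow_def sylow_subgroup_def)

lemma odd_sylow_card:
  assumes "odd_sylow r (P :: ('f::{field,finite} ^ 2 ^ 2) set)"
  shows "\<exists>m>0. card P = r ^ m \<and> r ^ m dvd CARD('f) * ((CARD('f))\<^sup>2 - 1)"
proof -
  let ?m = "multiplicity r (Coset.order (SL2 :: ('f ^ 2 ^ 2) monoid))"
  have "r dvd Coset.order (SL2 :: ('f ^ 2 ^ 2) monoid)" using assms by (simp add: odd_sylow_def card_SL2)
  then have "?m > 0" using assms order_SL2_pos[where 'f = 'f] 
    by (simp add: odd_sylow_def prime_multiplicity_gt_zero_iff)
  then show ?thesis using assms multiplicity_dvd[of r "Coset.order (SL2 :: ('f ^ 2 ^ 2) monoid)"]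
    by (auto simp: odd_sylow_def sylow_subgroup_def card_SL2)
qed

lemma card_dvd_imp_not_dvd:
  assumes "prime (r::nat)" "r dvd n\<^sup>2 - 1" "n > 0"
  shows "\<not> r dvd n"
proof
  assume "r dvd n"
  then have "r dvd n\<^sup>2" by (simp add: power2_eq_square)
  then have "r dvd n\<^sup>2 - (n\<^sup>2 - 1)" using assms(2) by (rule dvd_diff_nat)
  moreover have "n\<^sup>2 - (n\<^sup>2 - 1) = 1" using assms(3) by simp
  ultimately show False using assms(1) by (metis nat_dvd_1_iff_1 not_prime_1)
qed

lemma odd_sylow_pow_card:
  assumes "odd_sylow r P" "g \<in> P"
  shows "g [^]\<^bsub>SL2\<^esub> card P = \<one>\<^bsub>SL2\<^esub>"
proof -
  have P: "subgroup P SL2" using odd_sylow_subgroup[OF assms(1)] .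
  interpret PG: group "SL2\<lparr>carrier := P\<rparr>" by (rule subgroup.subgroup_is_group[OF P SL2.is_group])
  have "g [^]\<^bsub>SL2\<lparr>carrier := P\<rparr>\<^esub> Coset.order (SL2\<lparr>carrier := P\<rparr>) = \<one>\<^bsub>SL2\<lparr>carrier := P\<rparr>\<^esub>"
    using assms(2) by (intro PG.pow_order_eq_1) auto
  then show ?thesis by (simp add: Coset.order_def SL2.nat_pow_consistent[symmetric])
qed

text \<open>A nontrivial central element of \<open>P\<close> has odd order prime to the
  characteristic, so it is regular semisimple. Questions about \<open>P\<close> thereby become
  questions about one matrix and the torus centralizing it.\<close>

lemma odd_sylow_regular_center:
  fixes P :: "('f::{field,finite} ^ 2 ^ 2) set"
  assumes P: "odd_sylow r P"
  shows "\<exists>g\<in>P. g \<in> carrier SL2 \<and> (trace2 g)\<^sup>2 \<noteq> 4 \<and> P \<subseteq> centr g"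
proof -
  obtain m where m: "m > 0" "card P = r ^ m" using odd_sylow_card[OF P] by blast
  have r: "prime r" "odd r" "r dvd (CARD('f))\<^sup>2 - 1" using P by (auto simp: odd_sylow_def)
  have sub: "subgroup P SL2" using odd_sylow_subgroup[OF P] .
  obtain g where g: "g \<in> P" "g \<noteq> \<one>\<^bsub>SL2\<^esub>" "\<forall>h\<in>P. h \<otimes>\<^bsub>SL2\<^esub> g = g \<otimes>\<^bsub>SL2\<^esub> h"
    using SL2.p_subgroup_nontrivial_center[OF r(1) sub m(2,1)] by blast
  have gS: "g \<in> carrier SL2" using subgroup.mem_carrier[OF sub g(1)] .
  have "of_nat (r ^ m) \<noteq> (0::'f)"
  proof
    assume "of_nat (r ^ m) = (0::'f)"
    then have "CHAR('f) dvd r ^ m" using of_nat_eq_0_iff_char_dvd by blast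
    moreover have pr: "prime CHAR('f)" by (intro prime_CHAR_semidom finite_imp_CHAR_pos) simp
    ultimately have "CHAR('f) = r" using r(1) by (metis prime_dvd_power primes_dvd_imp_eq)
    then have "r dvd CARD('f)" using CHAR_dvd_CARD[where 'a = 'f] by simp
    then show False using card_dvd_imp_not_dvd[OF r(1,3)] by simp
  qed
  then have "(trace2 g)\<^sup>2 \<noteq> 4"
    using trace2_sq_neq_4_if_odd_order[OF gS g(2), of "r ^ m"] odd_sylow_pow_card[OF P g(1)] r(2) m(2) by simp
  then show ?thesis using g gS sub by (auto simp: centr_def subgroup.mem_carrier)
qed

lemma subgroup_centr:
  assumes "g \<in> carrier (SL2 :: ('f::field ^ 2 ^ 2) monoid)"
  shows "subgroup (centr g) SL2"
proof (rule SL2.subgroupI)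
  show "centr g \<subseteq> carrier SL2" by (auto simp: centr_def)
  show "centr g \<noteq> {}" using assms by (auto simp: centr_def)
next
  fix a assume "a \<in> centr g"
  then have a: "a \<in> carrier SL2" "a \<otimes>\<^bsub>SL2\<^esub> g = g \<otimes>\<^bsub>SL2\<^esub> a" by (simp_all add: centr_def)
  have "inv\<^bsub>SL2\<^esub> a \<otimes>\<^bsub>SL2\<^esub> (a \<otimes>\<^bsub>SL2\<^esub> g) \<otimes>\<^bsub>SL2\<^esub> inv\<^bsub>SL2\<^esub> a = g \<otimes>\<^bsub>SL2\<^esub> inv\<^bsub>SL2\<^esub> a"
    using a(1) assms by (simp add: SL2.m_assoc[symmetric] del: mult_SL2 one_SL2)
  moreover have "inv\<^bsub>SL2\<^esub> a \<otimes>\<^bsub>SL2\<^esub> (g \<otimes>\<^bsub>SL2\<^esub> a) \<otimes>\<^bsub>SL2\<^esub> inv\<^bsub>SL2\<^esub> a = inv\<^bsub>SL2\<^esub> a \<otimes>\<^bsub>SL2\<^esub> g"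
    using a(1) assms by (simp add: SL2.m_assoc del: mult_SL2 one_SL2)
  ultimately have "inv\<^bsub>SL2\<^esub> a \<otimes>\<^bsub>SL2\<^esub> g = g \<otimes>\<^bsub>SL2\<^esub> inv\<^bsub>SL2\<^esub> a" using a(2) by metis
  then show "inv\<^bsub>SL2\<^esub> a \<in> centr g" using a(1) by (simp add: centr_def del: one_SL2)
next
  fix a b assume "a \<in> centr g" "b \<in> centr g"
  then have ab: "a \<in> carrier SL2" "a ** g = g ** a" "b \<in> carrier SL2" "b ** g = g ** b" by (simp_all add: centr_def)
  have "(a ** b) ** g = g ** (a ** b)" using ab by (metis matrix_mul_assoc)
  moreover have "a ** b \<in> carrier SL2" using SL2.m_closed[OF ab(1,3)] by simp
  ultimately show "a \<otimes>\<^bsub>SL2\<^esub> b \<in> centr g" by (simp add: centr_def)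
qed

lemma centr_eq:
  assumes "g \<in> carrier (SL2 :: ('f::field ^ 2 ^ 2) monoid)" "(trace2 g)\<^sup>2 \<noteq> 4"
    and "h \<in> carrier SL2" "(trace2 h)\<^sup>2 \<noteq> 4" "h ** g = g ** h"
  shows "centr g = centr h"
  using centralizer_abelian[OF assms(1,2) _ assms(5)] centralizer_abelian[OF assms(3,4) _ assms(5)[symmetric]]
  by (auto simp: centr_def)

lemma centr_commute:
  assumes "g \<in> carrier (SL2 :: ('f::field ^ 2 ^ 2) monoid)" "(trace2 g)\<^sup>2 \<noteq> 4" "x \<in> centr g" "y \<in> centr g"
  shows "x ** y = y ** x"
  using centralizer_abelian[OF assms(1,2)] assms(3,4) by (simp add: centr_def)

text \<open>The sign records whether the torus \<open>centr g\<close> is split.\<close>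

lemma card_centr_cases:
  fixes g :: "'f::{field,finite} ^ 2 ^ 2"
  assumes two: "(2::'f) \<noteq> 0" and g: "g \<in> carrier SL2" "(trace2 g)\<^sup>2 \<noteq> 4"
  shows "(\<exists>\<delta>. (trace2 g)\<^sup>2 - 4 = \<delta>\<^sup>2) \<and> card (centr g) = CARD('f) - 1 \<or>
    (\<nexists>\<delta>. (trace2 g)\<^sup>2 - 4 = \<delta>\<^sup>2) \<and> card (centr g) = CARD('f) + 1"
proof (cases "\<exists>\<delta>. (trace2 g)\<^sup>2 - 4 = \<delta>\<^sup>2")
  case True
  then obtain \<delta> where \<delta>: "(trace2 g)\<^sup>2 - 4 = \<delta>\<^sup>2" by blast
  then have "\<delta> \<noteq> 0" using g(2) by auto
  then show ?thesis using card_conic_square[OF two] card_centr[OF two g] \<delta> by auto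
next
  case False
  then show ?thesis using card_conic_nonsquare[OF two, of "(trace2 g)\<^sup>2 - 4" 1] card_centr[OF two g] by auto
qed

lemma dvd_card_centr:
  fixes P :: "('f::{field,finite} ^ 2 ^ 2) set"
  assumes P: "odd_sylow r P" and g: "g \<in> carrier SL2" "P \<subseteq> centr g"
  shows "r dvd card (centr g)"
proof -
  have "subgroup P (SL2\<lparr>carrier := centr g\<rparr>)"
    using SL2.subgroup_of_restrict[OF odd_sylow_subgroup[OF P] subgroup_centr[OF g(1)] g(2)] .
  from group.lagrange[OF subgroup.subgroup_is_group[OF subgroup_centr[OF g(1)] SL2.is_group] this]
  have "card P dvd card (centr g)" by (metis SL2.order_subgroup dvd_triv_right)
  moreover obtain m where "m > 0" "card P = r ^ m" using odd_sylow_card[OF P] by blast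
  ultimately show ?thesis by (metis dvd_power dvd_trans)
qed

lemma odd_prime_not_dvd_both:
  assumes "prime r" "odd r" "(r::nat) dvd n - 1" "r dvd n + 1"
  shows False
proof -
  have "n \<ge> 1" using assms by (metis One_nat_def Suc_leI add.commute bot_nat_0.not_eq_extremum nat_dvd_1_iff_1 not_prime_1 plus_1_eq_Suc)
  then have "r dvd 2" using dvd_diff_nat[OF assms(4,3)] by simp
  then show False using assms(1,2) by (metis primes_dvd_imp_eq two_is_prime_nat dvd_refl)
qed

lemma card_centr_minus:
  fixes P :: "('f::{field,finite} ^ 2 ^ 2) set"
  assumes two: "(2::'f) \<noteq> 0" and P: "odd_sylow r P" and r: "r dvd CARD('f) - 1"
    and g: "g \<in> carrier SL2" "(trace2 g)\<^sup>2 \<noteq> 4" "P \<subseteq> centr g"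
  shows "card (centr g) = CARD('f) - 1"
proof -
  have "card (centr g) \<noteq> CARD('f) + 1"
    using dvd_card_centr[OF P g(1,3)] odd_prime_not_dvd_both[of r "CARD('f)"] P r
    by (auto simp: odd_sylow_def)
  then show ?thesis using card_centr_cases[OF two g(1,2)] by argo
qed

lemma card_centr_plus:
  fixes P :: "('f::{field,finite} ^ 2 ^ 2) set"
  assumes two: "(2::'f) \<noteq> 0" and P: "odd_sylow r P" and r: "r dvd CARD('f) + 1"
    and g: "g \<in> carrier SL2" "(trace2 g)\<^sup>2 \<noteq> 4" "P \<subseteq> centr g"
  shows "(\<nexists>\<delta>. (trace2 g)\<^sup>2 - 4 = \<delta>\<^sup>2) \<and> card (centr g) = CARD('f) + 1"
proof -
  have "card (centr g) \<noteq> CARD('f) - 1"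
    using dvd_card_centr[OF P g(1,3)] odd_prime_not_dvd_both[of r "CARD('f)"] P r
    by (auto simp: odd_sylow_def)
  then show ?thesis using card_centr_cases[OF two g(1,2)] by argo
qed

text \<open>\<open>h\<close> is a linear expression u + v g. If \<open>A\<close> takes
  \<open>g\<close> to its adjugate, it takes every such expression to its adjugate, which for
  determinant 1 is the inverse.\<close>

lemma inverters_invert:
  assumes g: "g \<in> carrier (SL2 :: ('f::field ^ 2 ^ 2) monoid)" "(trace2 g)\<^sup>2 \<noteq> 4" "h \<in> centr g" "A \<in> inverters g"
  shows "A ** h = inv\<^bsub>SL2\<^esub> h ** A"
proof -
  obtain a b c d where g': "g = mat2 a b c d" by (cases g rule: mat2_exhaust)
  have ns: "\<not> (b = 0 \<and> c = 0 \<and> a = d)" using nonscalar_if_trace2_sq_neq_4[of a b c d] g g' by simp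
  obtain x y z w where h': "h = mat2 x y z w" by (cases h rule: mat2_exhaust)
  obtain u v where uv: "x = u + v * a" "y = v * b" "z = v * c" "w = u + v * d"
    using commute_mat2[OF ns, of x y z w] g(3) h' g' unfolding centr_def by blast
  obtain p q r s where A: "A = mat2 p q r s" by (cases A rule: mat2_exhaust)
  have invg: "inv\<^bsub>SL2\<^esub> g = mat2 d (- b) (- c) a" using g(1) g' by simp
  have invh: "inv\<^bsub>SL2\<^esub> h = mat2 w (- y) (- z) x" using g(3) h' by (simp add: centr_def)
  have "A ** g = mat2 d (- b) (- c) a ** A" using g(4) unfolding inverters_def invg by simp
  then have e: "p * a + q * c = d * p - b * r" "p * b + q * d = d * q - b * s" "r * a + s * c = a * r - c * p"
    "r * b + s * d = a * s - c * q" unfolding A g' by simp_all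
  have "p * (u + v * a) + q * (v * c) = u * p + v * (p * a + q * c)"
    "p * (v * b) + q * (u + v * d) = u * q + v * (p * b + q * d)"
    "r * (u + v * a) + s * (v * c) = u * r + v * (r * a + s * c)"
    "r * (v * b) + s * (u + v * d) = u * s + v * (r * b + s * d)"
    by (simp_all add: algebra_simps)
  then show ?thesis unfolding invh unfolding A h' uv e by (simp add: algebra_simps)
qed

text \<open>An element normalizing \<open>P\<close> moves \<open>g\<close> within its abelian
  centralizer, so it centralizes or inverts \<open>g\<close>; conversely, what it does to
  \<open>g\<close> it does to all of \<open>P\<close>.\<close>

lemma norm_set_eq:
  fixes P :: "('f::{field,finite} ^ 2 ^ 2) set"
  assumes two: "(2::'f) \<noteq> 0" and P: "subgroup P SL2"
    and g: "g \<in> P" "(trace2 g)\<^sup>2 \<noteq> 4" "P \<subseteq> centr g"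
  shows "norm_set SL2 P = centr g \<union> inverters g"
proof (intro equalityI subsetI)
  have gS: "g \<in> carrier SL2" by (rule subgroup.mem_carrier[OF P g(1)])
  {
    fix A assume A: "A \<in> norm_set SL2 P"
    then have "A \<otimes>\<^bsub>SL2\<^esub> g \<otimes>\<^bsub>SL2\<^esub> inv\<^bsub>SL2\<^esub> A \<in> P" and AS: "A \<in> carrier SL2"
      using g(1) unfolding norm_set_def by blast+
    then have "(A \<otimes>\<^bsub>SL2\<^esub> g \<otimes>\<^bsub>SL2\<^esub> inv\<^bsub>SL2\<^esub> A) ** g = g ** (A \<otimes>\<^bsub>SL2\<^esub> g \<otimes>\<^bsub>SL2\<^esub> inv\<^bsub>SL2\<^esub> A)"
      using g(3) unfolding centr_def by blast
    from normalizes_commutes_or_inverts[OF two gS g(2) AS this]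
    show "A \<in> centr g \<union> inverters g" using AS by (auto simp: centr_def inverters_def)
  }
  fix A assume A: "A \<in> centr g \<union> inverters g"
  then have AS: "A \<in> carrier SL2" by (auto simp: centr_def inverters_def)
  have "A \<otimes>\<^bsub>SL2\<^esub> h \<otimes>\<^bsub>SL2\<^esub> inv\<^bsub>SL2\<^esub> A \<in> P" if h: "h \<in> P" for h
  proof -
    have hS: "h \<in> carrier SL2" by (rule subgroup.mem_carrier[OF P h])
    have "A \<otimes>\<^bsub>SL2\<^esub> h = h \<otimes>\<^bsub>SL2\<^esub> A \<or> A \<otimes>\<^bsub>SL2\<^esub> h = inv\<^bsub>SL2\<^esub> h \<otimes>\<^bsub>SL2\<^esub> A"
      using A inverters_invert[OF gS g(2)] centr_commute[OF gS g(2)] g(3) h by auto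
    then have "A \<otimes>\<^bsub>SL2\<^esub> h \<otimes>\<^bsub>SL2\<^esub> inv\<^bsub>SL2\<^esub> A = h \<or> A \<otimes>\<^bsub>SL2\<^esub> h \<otimes>\<^bsub>SL2\<^esub> inv\<^bsub>SL2\<^esub> A = inv\<^bsub>SL2\<^esub> h"
    proof
      assume e: "A \<otimes>\<^bsub>SL2\<^esub> h = h \<otimes>\<^bsub>SL2\<^esub> A"
      show ?thesis unfolding e using AS hS by (simp add: SL2.m_assoc del: mult_SL2 one_SL2)
    next
      assume e: "A \<otimes>\<^bsub>SL2\<^esub> h = inv\<^bsub>SL2\<^esub> h \<otimes>\<^bsub>SL2\<^esub> A"
      show ?thesis unfolding e using AS hS by (simp add: SL2.m_assoc del: mult_SL2 one_SL2)
    qed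
    then show ?thesis using h subgroup.m_inv_closed[OF P] by metis
  qed
  then show "A \<in> norm_set SL2 P" using AS unfolding norm_set_def by blast
qed

lemma centr_inverters_disjoint:
  assumes two: "(2::'f::field) \<noteq> 0" and g: "g \<in> carrier (SL2 :: ('f ^ 2 ^ 2) monoid)" "(trace2 g)\<^sup>2 \<noteq> 4"
  shows "centr g \<inter> inverters g = {}"
proof (rule ccontr)
  assume "centr g \<inter> inverters g \<noteq> {}"
  then obtain A where "A \<in> centr g" "A \<in> inverters g" by blast
  then have A: "A \<in> carrier SL2" and "A ** g = g ** A" "A ** g = inv\<^bsub>SL2\<^esub> g ** A"
    by (auto simp: centr_def inverters_def)
  then have "g \<otimes>\<^bsub>SL2\<^esub> A = inv\<^bsub>SL2\<^esub> g \<otimes>\<^bsub>SL2\<^esub> A" by simp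
  then have e: "g = inv\<^bsub>SL2\<^esub> g"
    by (rule SL2.right_cancel[THEN iffD1, OF A g(1) SL2.inv_closed[OF g(1)]])
  obtain a b c d where g': "g = mat2 a b c d" by (cases g rule: mat2_exhaust)
  have "inv\<^bsub>SL2\<^esub> g = mat2 d (- b) (- c) a" using g(1) g' by simp
  then have "mat2 a b c d = mat2 d (- b) (- c) a" by (rule trans[OF g'[symmetric] trans[OF e]])
  then have "a = d" and bc: "b = - b" "c = - c" unfolding mat2_eq_iff by blast+
  have "y = 0" if "y = - y" for y :: 'f
  proof -
    have "y + y = 0" using that by (metis add.right_inverse)
    then have "2 * y = 0" by (simp only: mult_2)
    then show ?thesis using two by simp
  qed
  then have "b = 0" "c = 0" using bc by blast+
  then have "b = 0 \<and> c = 0 \<and> a = d" using \<open>a = d\<close> by blast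
  then show False using nonscalar_if_trace2_sq_neq_4[of a b c d] g g' by simp
qed

lemma card_norm_set_nonsplit:
  fixes P :: "('f::{field,finite} ^ 2 ^ 2) set"
  assumes two: "(2::'f) \<noteq> 0" and P: "odd_sylow r P" and r: "r dvd CARD('f) + 1"
  shows "card (norm_set SL2 P) = 2 * (CARD('f) + 1)"
proof -
  obtain g where g: "g \<in> P" "g \<in> carrier SL2" "(trace2 g)\<^sup>2 \<noteq> 4" "P \<subseteq> centr g"
    using odd_sylow_regular_center[OF P] by blast
  have ns: "\<nexists>\<delta>. (trace2 g)\<^sup>2 - 4 = \<delta>\<^sup>2" and c: "card (centr g) = CARD('f) + 1"
    using card_centr_plus[OF two P r g(2-4)] by auto
  obtain a b c d where g': "g = mat2 a b c d" by (cases g rule: mat2_exhaust)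
  have det: "a * d - b * c = 1" using g g' by simp
  \<comment> \<open>A triangular \<open>g\<close> would have the square of \<open>a - d\<close> as
    its discriminant.\<close>
  have "b \<noteq> 0"
  proof
    assume "b = 0"
    then have "(a + d)\<^sup>2 - 4 = (a - d)\<^sup>2" using det by (simp add: power2_eq_square algebra_simps)
    then show False using ns g' by auto
  qed
  then have "card (inverters g) = CARD('f) + 1"
    using card_inverters[OF two g' det] card_conic_nonsquare[OF two, of "(trace2 g)\<^sup>2 - 4" "-1"] ns by auto
  then show ?thesis
    unfolding norm_set_eq[OF two odd_sylow_subgroup[OF P] g(1,3,4)]
    using c card_Un_disjoint[OF _ _ centr_inverters_disjoint[OF two g(2,3)]] by simp
qed

section \<open>The split torus\<close>

definition diag2 :: "'f::field \<Rightarrow> 'f ^ 2 ^ 2" where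
  "diag2 x = mat2 x 0 0 (1 / x)"

definition split_torus :: "('f::field ^ 2 ^ 2) set" where
  "split_torus = diag2 ` (UNIV - {0})"

lemma diag2_in_SL2 [simp]: "x \<noteq> 0 \<Longrightarrow> diag2 x \<in> carrier SL2"
  by (simp add: diag2_def)

lemma diag2_mult: "diag2 x ** diag2 y = diag2 (x * y)"
  by (simp add: diag2_def)

lemma inv_diag2: "x \<noteq> 0 \<Longrightarrow> inv\<^bsub>SL2\<^esub> (diag2 x) = diag2 (1 / x)"
  by (simp add: diag2_def)

lemma subgroup_split_torus: "subgroup split_torus (SL2 :: ('f::field ^ 2 ^ 2) monoid)"
proof (rule SL2.subgroupI)
  show "(split_torus :: ('f ^ 2 ^ 2) set) \<noteq> {}" unfolding split_torus_def using one_neq_zero by blast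
  show "(split_torus :: ('f ^ 2 ^ 2) set) \<subseteq> carrier SL2" using diag2_in_SL2 unfolding split_torus_def by blast
next
  fix a b :: "'f ^ 2 ^ 2" assume "a \<in> split_torus" "b \<in> split_torus"
  then show "a \<otimes>\<^bsub>SL2\<^esub> b \<in> split_torus" by (auto simp: split_torus_def diag2_mult)
next
  fix a :: "'f ^ 2 ^ 2" assume "a \<in> split_torus"
  then obtain x where "x \<noteq> 0" "a = diag2 x" by (auto simp: split_torus_def)
  then show "inv\<^bsub>SL2\<^esub> a \<in> split_torus" by (auto simp: split_torus_def inv_diag2)
qed

lemma card_split_torus: "card (split_torus :: ('f::{field,finite} ^ 2 ^ 2) set) = CARD('f) - 1"
proof -
  have "inj_on diag2 (UNIV - {0::'f})" by (auto simp: inj_on_def diag2_def)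
  then show ?thesis by (simp add: split_torus_def card_image card_Diff_singleton)
qed

text \<open>An odd prime \<open>r\<close> dividing n - 1 is prime to n (n + 1), so the whole
  \<open>r\<close>-part of the group order divides the order n - 1 of the diagonal torus. A Sylow
  subgroup of the torus is then one of the whole group.\<close>

lemma conj_into_split_torus:
  fixes P :: "('f::{field,finite} ^ 2 ^ 2) set"
  assumes P: "odd_sylow r P" and r: "r dvd CARD('f) - 1"
  shows "\<exists>z\<in>carrier SL2. conj_set SL2 P z \<subseteq> split_torus"
proof -
  have pr: "prime r" "odd r" "r dvd (CARD('f))\<^sup>2 - 1" and syl: "sylow_subgroup SL2 r P"
    using P by (auto simp: odd_sylow_def)
  obtain m where m: "card P = r ^ m" "\<not> r ^ Suc m dvd Coset.order (SL2 :: ('f ^ 2 ^ 2) monoid)"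
    using SL2.sylow_ndvd[OF pr(1) finite_SL2 syl] by blast
  have "r ^ m dvd CARD('f) * ((CARD('f))\<^sup>2 - 1)" using odd_sylow_card[OF P] m(1) by auto
  moreover have "n\<^sup>2 - 1 = (n + 1) * (n - 1)" for n :: nat
    by (cases n) (simp_all add: power2_eq_square)
  ultimately have "r ^ m dvd (CARD('f) * (CARD('f) + 1)) * (CARD('f) - 1)" by (simp only: mult.assoc)
  moreover have "coprime (r ^ m) (CARD('f) * (CARD('f) + 1))"
  proof -
    have "\<not> r dvd CARD('f)" using card_dvd_imp_not_dvd[OF pr(1,3)] by simp
    moreover have "\<not> r dvd CARD('f) + 1" using odd_prime_not_dvd_both[OF pr(1,2) r] by blast
    ultimately have "\<not> r dvd CARD('f) * (CARD('f) + 1)" using pr(1) prime_dvd_mult_iff by blast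
    then show ?thesis using pr(1) by (metis coprime_power_left_iff prime_imp_coprime)
  qed
  ultimately have "r ^ m dvd CARD('f) - 1" by (metis coprime_dvd_mult_right_iff)
  then obtain k where k: "CARD('f) - 1 = r ^ m * k" by blast
  let ?H = "SL2\<lparr>carrier := split_torus :: ('f ^ 2 ^ 2) set\<rparr>"
  have "\<exists>Q. subgroup Q ?H \<and> card Q = r ^ m"
    using subgroup.subgroup_is_group[OF subgroup_split_torus SL2.is_group] k
    by (intro sylow_thm[OF pr(1), of _ m k]) (simp_all add: SL2.order_subgroup card_split_torus)
  then obtain Q where Q: "subgroup Q ?H" "card Q = r ^ m" by blast
  have Q': "subgroup Q SL2" using SL2.incl_subgroup[OF subgroup_split_torus Q(1)] .
  have QH: "Q \<subseteq> split_torus" using subgroup.subset[OF Q(1)] by simp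
  obtain z where z: "z \<in> carrier SL2" "\<forall>q\<in>P. z \<otimes>\<^bsub>SL2\<^esub> q \<otimes>\<^bsub>SL2\<^esub> inv\<^bsub>SL2\<^esub> z \<in> Q"
    using SL2.p_subgroup_conj_into_sylow[OF pr(1) finite_SL2 Q' Q(2) odd_sylow_subgroup[OF P] m(1) m(2)] by blast
  have "conj_set SL2 P (inv\<^bsub>SL2\<^esub> z) \<subseteq> Q" using z by (auto simp: conj_set_def simp del: mult_SL2)
  then show ?thesis using z(1) QH by (intro bexI[of _ "inv\<^bsub>SL2\<^esub> z"]) (auto simp del: mult_SL2)
qed

subsection \<open>The unipotent subgroup\<close>

lemma right_inverse_unique_field: "a * d = (1::'f::field) \<Longrightarrow> a \<noteq> 0 \<and> d = 1 / a"
  by (metis mult.commute mult_zero_left nonzero_eq_divide_eq zero_neq_one)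

text \<open>\<open>card_inverters\<close> requires a nonzero upper right entry, so for diagonal
  matrices the inverting elements are listed directly.\<close>

lemma inverters_diag2:
  assumes x: "x \<noteq> 0" "x * x \<noteq> (1::'f::{field,finite})"
  shows "inverters (diag2 x) = (\<lambda>y. mat2 0 y (- (1 / y)) 0) ` (UNIV - {0})"
proof (intro equalityI subsetI)
  fix A assume A: "A \<in> inverters (diag2 x)"
  obtain a b c d where A': "A = mat2 a b c d" by (cases A rule: mat2_exhaust)
  have "A ** diag2 x = diag2 (1 / x) ** A" using A x(1) by (simp add: inverters_def inv_diag2)
  then have e: "a * x = a / x" "d / x = x * d" unfolding A' diag2_def by simp_all
  have "a * (x * x - 1) = 0" "d * (x * x - 1) = 0" using e x(1) by (simp_all add: field_simps)
  then have "a = 0" "d = 0" using x(2) by simp_all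
  moreover have "a * d - b * c = 1" using A A' by (simp add: inverters_def)
  ultimately have "b * (- c) = 1" by simp
  then have "b \<noteq> 0" "c = - (1 / b)" using right_inverse_unique_field[of b "- c"] by (auto, metis minus_minus)
  then show "A \<in> (\<lambda>y. mat2 0 y (- (1 / y)) 0) ` (UNIV - {0})" using A' \<open>a = 0\<close> \<open>d = 0\<close> by blast
next
  fix A assume "A \<in> (\<lambda>y. mat2 0 y (- (1 / y)) 0) ` (UNIV - {0::'f})"
  then obtain y where y: "y \<noteq> 0" "A = mat2 0 y (- (1 / y)) 0" by blast
  have "A ** diag2 x = diag2 (1 / x) ** A" unfolding y(2) diag2_def using x(1) by simp
  then show "A \<in> inverters (diag2 x)" using y x(1) by (simp add: inverters_def inv_diag2)
qed

lemma card_norm_set_split: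
  fixes P :: "('f::{field,finite} ^ 2 ^ 2) set"
  assumes two: "(2::'f) \<noteq> 0" and P: "odd_sylow r P" and r: "r dvd CARD('f) - 1" and sub: "P \<subseteq> split_torus"
  shows "card (norm_set SL2 P) = 2 * (CARD('f) - 1)"
proof -
  obtain g where g: "g \<in> P" "g \<in> carrier SL2" "(trace2 g)\<^sup>2 \<noteq> 4" "P \<subseteq> centr g"
    using odd_sylow_regular_center[OF P] by blast
  obtain x where x: "x \<noteq> 0" "g = diag2 x" using g(1) sub by (auto simp: split_torus_def)
  have "x * x \<noteq> 1"
  proof
    assume xx: "x * x = 1"
    then have "1 / x = x" using x(1) by (metis nonzero_eq_divide_eq)
    then have "(trace2 g)\<^sup>2 = 4 * (x * x)" using x(2) by (simp add: diag2_def power2_eq_square algebra_simps)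
    then show False using xx g(3) by simp
  qed
  then have "inverters g = (\<lambda>y. mat2 0 y (- (1 / y)) 0) ` (UNIV - {0})" using inverters_diag2 x by blast
  moreover have "inj_on (\<lambda>y. mat2 0 y (- (1 / y)) 0) (UNIV - {0::'f})" by (auto simp: inj_on_def)
  ultimately have "card (inverters g) = CARD('f) - 1" by (simp add: card_image card_Diff_singleton)
  then show ?thesis
    unfolding norm_set_eq[OF two odd_sylow_subgroup[OF P] g(1,3,4)]
    using card_centr_minus[OF two P r g(2-4)] card_Un_disjoint[OF _ _ centr_inverters_disjoint[OF two g(2,3)]] by simp
qed

lemma card_conjugates_SL2:
  fixes P :: "('f::{field,finite} ^ 2 ^ 2) set"
  assumes "subgroup P SL2"
  shows "CARD('f) * ((CARD('f))\<^sup>2 - 1) = card (norm_set SL2 P) * card (conj_set SL2 P ` carrier SL2)"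
  using SL2.card_conjugates_times_normalizer[OF assms finite finite_SL2] card_SL2[where 'f = 'f]
  unfolding norm_set_def by simp

lemma square_minus_1_nat: "n\<^sup>2 - 1 = (n + 1) * (n - 1 :: nat)"
  by (cases n) (simp_all add: power2_eq_square)

lemma card_conjugates_split:
  fixes P :: "('f::{field,finite} ^ 2 ^ 2) set"
  assumes "(2::'f) \<noteq> 0" "odd_sylow r P" "r dvd CARD('f) - 1" "P \<subseteq> split_torus"
  shows "2 * card (conj_set SL2 P ` carrier SL2) = CARD('f) * (CARD('f) + 1)"
proof -
  have "(CARD('f) - 1) * (CARD('f) * (CARD('f) + 1)) = (CARD('f) - 1) * (2 * card (conj_set SL2 P ` carrier SL2))"
    using card_conjugates_SL2[OF odd_sylow_subgroup[OF assms(2)]]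
    unfolding card_norm_set_split[OF assms] square_minus_1_nat by (simp only: ac_simps)
  then show ?thesis using card_ge_2[where 'f = 'f] by simp
qed

lemma card_conjugates_nonsplit:
  fixes P :: "('f::{field,finite} ^ 2 ^ 2) set"
  assumes "(2::'f) \<noteq> 0" "odd_sylow r P" "r dvd CARD('f) + 1"
  shows "2 * card (conj_set SL2 P ` carrier SL2) = CARD('f) * (CARD('f) - 1)"
proof -
  have "(CARD('f) + 1) * (CARD('f) * (CARD('f) - 1)) = (CARD('f) + 1) * (2 * card (conj_set SL2 P ` carrier SL2))"
    using card_conjugates_SL2[OF odd_sylow_subgroup[OF assms(2)]]
    unfolding card_norm_set_nonsplit[OF assms] square_minus_1_nat by (simp only: ac_simps)
  then show ?thesis by (simp only: mult_cancel1) simp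
qed

abbreviation unip_group :: "('f::field ^ 2 ^ 2) set" where
  "unip_group \<equiv> range unip"

lemma subgroup_unip_group: "subgroup unip_group (SL2 :: ('f::field ^ 2 ^ 2) monoid)"
  by (rule SL2.subgroupI) (auto simp: inv_unip unip_mult)

lemma card_unip_group: "card (unip_group :: ('f::{field,finite} ^ 2 ^ 2) set) = CARD('f)"
  by (intro card_image) (auto simp: inj_on_def unip_def)

lemma sylow_unip_group:
  assumes "prime t" "CARD('f::{field,finite}) = t ^ a"
  shows "sylow_subgroup SL2 t (unip_group :: ('f ^ 2 ^ 2) set)"
proof -
  have "a > 0" using card_ge_2[where 'f = 'f] assms(2) by (cases a) auto
  have "\<not> t dvd (t ^ a)\<^sup>2 - 1"
  proof
    assume "t dvd (t ^ a)\<^sup>2 - 1"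
    then have "\<not> t dvd t ^ a" by (rule card_dvd_imp_not_dvd[OF assms(1)]) (use prime_gt_0_nat[OF assms(1)] in simp)
    then show False using \<open>a > 0\<close> by simp
  qed
  moreover have "multiplicity t (t ^ a * ((t ^ a)\<^sup>2 - 1)) = a + multiplicity t ((t ^ a)\<^sup>2 - 1)"
  proof (cases "(t ^ a)\<^sup>2 - 1 = 0")
    case True
    then show ?thesis using calculation by simp
  next
    case False
    then show ?thesis using assms(1) prime_gt_0_nat[OF assms(1)]
      by (subst prime_elem_multiplicity_mult_distrib) (auto simp: prime_elem_nat_iff)
  qed
  ultimately have "multiplicity t (Coset.order (SL2 :: ('f ^ 2 ^ 2) monoid)) = a"
    unfolding card_SL2 assms(2) by (simp add: not_dvd_imp_multiplicity_0)
  then show ?thesis by (simp add: sylow_subgroup_def subgroup_unip_group card_unip_group assms(2))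
qed

lemma sylow_conj_unip_group:
  fixes T :: "('f::{field,finite} ^ 2 ^ 2) set"
  assumes t: "prime t" "CARD('f) = t ^ a" and T: "sylow_subgroup SL2 t T"
  shows "\<exists>z\<in>carrier SL2. T = conj_set SL2 unip_group z"
proof -
  have U: "sylow_subgroup SL2 t (unip_group :: ('f ^ 2 ^ 2) set)" by (rule sylow_unip_group[OF t])
  obtain m where m: "card (unip_group :: ('f ^ 2 ^ 2) set) = t ^ m" "\<not> t ^ Suc m dvd Coset.order (SL2 :: ('f ^ 2 ^ 2) monoid)"
    using SL2.sylow_ndvd[OF t(1) finite_SL2 U] by blast
  have cT: "card T = t ^ m" and Ts: "subgroup T SL2" using m(1) U T by (auto simp: sylow_subgroup_def)
  obtain z where z: "z \<in> carrier SL2" "\<forall>q\<in>T. z \<otimes>\<^bsub>SL2\<^esub> q \<otimes>\<^bsub>SL2\<^esub> inv\<^bsub>SL2\<^esub> z \<in> unip_group"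
    using SL2.p_subgroup_conj_into_sylow[OF t(1) finite_SL2 subgroup_unip_group m(1) Ts cT m(2)] by blast
  have "T \<subseteq> conj_set SL2 unip_group z"
  proof
    fix q assume q: "q \<in> T"
    show "q \<in> conj_set SL2 unip_group z"
      using SL2.mem_conj_set_iff[OF subgroup_unip_group z(1) subgroup.mem_carrier[OF Ts q]] z(2) q by simp
  qed
  moreover have "card T = card (conj_set SL2 unip_group z)"
    using SL2.card_conj_set[OF subgroup_unip_group z(1)] cT m(1) by simp
  ultimately have "T = conj_set SL2 unip_group z" by (intro card_subset_eq) auto
  then show ?thesis using z(1) by blast
qed

lemma conj_unip:
  assumes "a * d - b * c = (1::'f::field)"
  shows "mat2 a b c d \<otimes>\<^bsub>SL2\<^esub> unip x \<otimes>\<^bsub>SL2\<^esub> inv\<^bsub>SL2\<^esub> (mat2 a b c d)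
    = mat2 (1 - a * c * x) (a * a * x) (- (c * c * x)) (1 + a * c * x)"
proof -
  have "mat2 a b c d \<otimes>\<^bsub>SL2\<^esub> unip x \<otimes>\<^bsub>SL2\<^esub> inv\<^bsub>SL2\<^esub> (mat2 a b c d)
    = mat2 ((a * d - b * c) - a * c * x) (a * a * x) (- (c * c * x)) ((a * d - b * c) + a * c * x)"
    unfolding inv_SL2[OF assms] by (simp add: unip_def algebra_simps)
  then show ?thesis unfolding assms .
qed

text \<open>This is the Borel subgroup. The conjugate of \<open>unip 1\<close> alone already forces
  the lower left entry to vanish.\<close>

lemma norm_set_unip_group:
  "norm_set SL2 (unip_group :: ('f::field ^ 2 ^ 2) set) = (\<lambda>(a, b). mat2 a b 0 (1 / a)) ` ((UNIV - {0}) \<times> UNIV)"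
proof (intro equalityI subsetI)
  fix A :: "'f ^ 2 ^ 2" assume A: "A \<in> norm_set SL2 unip_group"
  obtain a b c d where A': "A = mat2 a b c d" by (cases A rule: mat2_exhaust)
  have det: "a * d - b * c = 1" using A A' by (simp add: norm_set_def)
  have "A \<otimes>\<^bsub>SL2\<^esub> unip 1 \<otimes>\<^bsub>SL2\<^esub> inv\<^bsub>SL2\<^esub> A \<in> unip_group" using A unfolding norm_set_def by blast
  then have "c * c = 0" unfolding A' conj_unip[OF det] by (auto simp: unip_def)
  then have "c = 0" by simp
  then have "a \<noteq> 0" "d = 1 / a" using det right_inverse_unique_field[of a d] by auto
  then show "A \<in> (\<lambda>(a, b). mat2 a b 0 (1 / a)) ` ((UNIV - {0}) \<times> UNIV)" using A' \<open>c = 0\<close> by force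
next
  fix A :: "'f ^ 2 ^ 2" assume "A \<in> (\<lambda>(a, b). mat2 a b 0 (1 / a)) ` ((UNIV - {0}) \<times> UNIV)"
  then obtain a b where ab: "a \<noteq> 0" "A = mat2 a b 0 (1 / a)" by auto
  have det: "a * (1 / a) - b * 0 = 1" using ab by simp
  have "A \<otimes>\<^bsub>SL2\<^esub> unip x \<otimes>\<^bsub>SL2\<^esub> inv\<^bsub>SL2\<^esub> A = unip (a * a * x)" for x
    unfolding ab(2) conj_unip[OF det] by (simp add: unip_def)
  then show "A \<in> norm_set SL2 unip_group" using ab by (auto simp: norm_set_def)
qed

lemma card_conjugates_unip_group:
  "card (conj_set SL2 unip_group ` carrier (SL2 :: ('f::{field,finite} ^ 2 ^ 2) monoid)) = CARD('f) + 1"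
proof -
  have "inj_on (\<lambda>(a, b). mat2 a b 0 (1 / a)) ((UNIV - {0::'f}) \<times> UNIV)" by (auto simp: inj_on_def)
  then have "card (norm_set SL2 (unip_group :: ('f ^ 2 ^ 2) set)) = (CARD('f) - 1) * CARD('f)"
    unfolding norm_set_unip_group by (simp add: card_image card_cartesian_product card_Diff_singleton)
  then have "(CARD('f) * (CARD('f) - 1)) * (CARD('f) + 1) =
      (CARD('f) * (CARD('f) - 1)) * card (conj_set SL2 unip_group ` carrier (SL2 :: ('f ^ 2 ^ 2) monoid))"
    using card_conjugates_SL2[where 'f = 'f, OF subgroup_unip_group] unfolding square_minus_1_nat by (simp only: ac_simps)
  moreover have "CARD('f) * (CARD('f) - 1) \<noteq> 0" using card_ge_2[where 'f = 'f] by simp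
  ultimately show ?thesis by (metis mult_left_cancel)
qed

text \<open>A nontrivial unipotent has a single fixed point on the projective line, so it lies in
  only one Borel subgroup.\<close>

lemma unip_normalizes_conj_unip_group:
  assumes "z \<in> carrier (SL2 :: ('f::field ^ 2 ^ 2) monoid)" "x \<noteq> 0" "unip x \<in> norm_set SL2 (conj_set SL2 unip_group z)"
  shows "conj_set SL2 unip_group z = unip_group"
proof -
  obtain a b c d where z: "z = mat2 a b c d" by (cases z rule: mat2_exhaust)
  have det: "a * d - b * c = 1" using assms(1) z by simp
  have "z \<otimes>\<^bsub>SL2\<^esub> unip x \<otimes>\<^bsub>SL2\<^esub> inv\<^bsub>SL2\<^esub> z \<in> norm_set SL2 unip_group"
    using assms(3) SL2.mem_norm_set_conj_iff[OF subgroup_unip_group assms(1) unip_in_SL2] by blast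
  then have "c * c * x = 0" unfolding norm_set_unip_group z conj_unip[OF det] by auto
  then have "c = 0" using assms(2) by simp
  then have az: "a \<noteq> 0" "d = 1 / a" using det right_inverse_unique_field[of a d] by auto
  have invz: "inv\<^bsub>SL2\<^esub> z = mat2 d (- b) (- c) a" using z det by simp
  have "inv\<^bsub>SL2\<^esub> z \<otimes>\<^bsub>SL2\<^esub> unip y \<otimes>\<^bsub>SL2\<^esub> z = unip (d * d * y)" for y
    unfolding invz unfolding z using \<open>c = 0\<close> az by (simp add: unip_def diff_divide_distrib)
  then have "conj_set SL2 unip_group z = (\<lambda>y. unip (d * d * y)) ` UNIV"
    unfolding conj_set_def image_image by (simp del: mult_SL2)
  also have "\<dots> = unip_group"
  proof (intro equalityI subsetI)
    fix u :: "'f ^ 2 ^ 2" assume "u \<in> unip_group"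
    then obtain y where "u = unip y" by blast
    then have "u = unip (d * d * (y / (d * d)))" using az by simp
    then show "u \<in> range (\<lambda>y. unip (d * d * y))" by blast
  qed auto
  finally show ?thesis .
qed

definition weyl :: "'f::field ^ 2 ^ 2" where
  "weyl = mat2 0 (- 1) 1 0"

lemma weyl_in_SL2 [simp]: "weyl \<in> carrier SL2"
  by (simp add: weyl_def)

text \<open>A diagonal matrix other than plus or minus the identity has exactly two fixed points on
  the projective line, so it lies in the Borel subgroups of the upper and of the lower unipotents
  only.\<close>

lemma diag2_normalizes_conj_unip_group:
  assumes z: "z \<in> carrier (SL2 :: ('f::field ^ 2 ^ 2) monoid)" and x: "x \<noteq> 0" "x * x \<noteq> 1"
    and n: "diag2 x \<in> norm_set SL2 (conj_set SL2 unip_group z)"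
  shows "conj_set SL2 unip_group z = unip_group \<or> conj_set SL2 unip_group z = conj_set SL2 unip_group weyl"
proof -
  obtain a b c d where z': "z = mat2 a b c d" by (cases z rule: mat2_exhaust)
  have det: "a * d - b * c = 1" using z z' by simp
  have invz: "inv\<^bsub>SL2\<^esub> z = mat2 d (- b) (- c) a" using z' det by simp
  have "z \<otimes>\<^bsub>SL2\<^esub> diag2 x \<otimes>\<^bsub>SL2\<^esub> inv\<^bsub>SL2\<^esub> z \<in> norm_set SL2 unip_group"
    using n SL2.mem_norm_set_conj_iff[OF subgroup_unip_group z diag2_in_SL2[OF x(1)]] by blast
  then have "c * x * d - d * c / x = 0"
    unfolding norm_set_unip_group invz unfolding z' by (auto simp: diag2_def)
  then have "c * d * (x * x - 1) = 0" using x(1) by (simp add: field_simps)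
  then consider "c = 0" | "d = 0" using x(2) by auto
  then show ?thesis
  proof cases
    case 1
    have "z \<in> norm_set SL2 unip_group"
      unfolding norm_set_unip_group z' using 1 det right_inverse_unique_field[of a d]
      by (intro image_eqI[of _ _ "(a, b)"]) auto
    then have "z \<otimes>\<^bsub>SL2\<^esub> unip 1 \<otimes>\<^bsub>SL2\<^esub> inv\<^bsub>SL2\<^esub> z \<in> norm_set SL2 unip_group"
      using SL2.subgroup_subset_norm_set[OF subgroup_unip_group] unfolding norm_set_def by blast
    then have "unip 1 \<in> norm_set SL2 (conj_set SL2 unip_group z)"
      using SL2.mem_norm_set_conj_iff[OF subgroup_unip_group z unip_in_SL2] by blast
    then show ?thesis using unip_normalizes_conj_unip_group[OF z, of 1] by simp
  next
    case 2
    then have bc: "b * c = - 1" using det by (simp add: minus_equation_iff)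
    then have b0: "b \<noteq> 0" "c \<noteq> 0" by auto
    have 1: "inv\<^bsub>SL2\<^esub> z \<otimes>\<^bsub>SL2\<^esub> unip y \<otimes>\<^bsub>SL2\<^esub> z = mat2 1 0 (- (c * c * y)) 1" for y
    proof -
      have "inv\<^bsub>SL2\<^esub> z \<otimes>\<^bsub>SL2\<^esub> unip y \<otimes>\<^bsub>SL2\<^esub> z = mat2 (- (b * c)) 0 (- (c * c * y)) (- (b * c))"
        unfolding invz unfolding z' 2 unip_def by (simp add: algebra_simps)
      then show ?thesis unfolding bc by simp
    qed
    have 2: "inv\<^bsub>SL2\<^esub> weyl \<otimes>\<^bsub>SL2\<^esub> unip y \<otimes>\<^bsub>SL2\<^esub> weyl = mat2 1 0 (- y) (1::'f)" for y
      by (simp add: weyl_def unip_def)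
    have "conj_set SL2 unip_group z = range (\<lambda>y. mat2 1 0 (- (c * c * y)) 1)"
      unfolding conj_set_def image_image using 1 by (simp del: mult_SL2)
    also have "\<dots> = range (\<lambda>y. mat2 1 0 (- y) (1::'f))"
    proof (intro equalityI subsetI)
      fix u :: "'f ^ 2 ^ 2" assume "u \<in> range (\<lambda>y. mat2 1 0 (- y) 1)"
      then obtain y where "u = mat2 1 0 (- y) 1" by blast
      then have "u = mat2 1 0 (- (c * c * (y / (c * c)))) 1" using b0 by simp
      then show "u \<in> range (\<lambda>y. mat2 1 0 (- (c * c * y)) 1)" by blast
    qed auto
    also have "\<dots> = conj_set SL2 unip_group weyl"
      unfolding conj_set_def image_image using 2 by (simp del: mult_SL2)
    finally show ?thesis by simp
  qed
qed

text \<open>The torus has index at most 2 in the normalizer. Concretely, the square of an inverting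
  element \<open>x\<close> centralizes \<open>g\<close>, and if \<open>x\<close> has odd order it is
  the inverse of a power of its square.\<close>

lemma odd_order_normalizer_centralizes:
  fixes P :: "('f::{field,finite} ^ 2 ^ 2) set"
  assumes two: "(2::'f) \<noteq> 0" and P: "odd_sylow r P"
    and x: "x \<in> norm_set SL2 P" "odd (k::nat)" "x [^]\<^bsub>SL2\<^esub> k = \<one>\<^bsub>SL2\<^esub>" and h: "h \<in> P"
  shows "x ** h = h ** x"
proof -
  obtain g where g: "g \<in> P" "g \<in> carrier SL2" "(trace2 g)\<^sup>2 \<noteq> 4" "P \<subseteq> centr g"
    using odd_sylow_regular_center[OF P] by blast
  have xS: "x \<in> carrier SL2" using x(1) by (simp add: norm_set_def)
  have C: "subgroup (centr g) SL2" by (rule subgroup_centr[OF g(2)])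
  have "x \<in> centr g \<union> inverters g"
    using x(1) norm_set_eq[OF two odd_sylow_subgroup[OF P] g(1,3,4)] by simp
  then have xc: "x \<in> centr g"
  proof
    assume "x \<in> inverters g"
    then have e: "x \<otimes>\<^bsub>SL2\<^esub> g = inv\<^bsub>SL2\<^esub> g \<otimes>\<^bsub>SL2\<^esub> x" by (simp add: inverters_def)
    have "x \<otimes>\<^bsub>SL2\<^esub> inv\<^bsub>SL2\<^esub> g = g \<otimes>\<^bsub>SL2\<^esub> x"
    proof -
      have "g \<otimes>\<^bsub>SL2\<^esub> (x \<otimes>\<^bsub>SL2\<^esub> g) \<otimes>\<^bsub>SL2\<^esub> inv\<^bsub>SL2\<^esub> g = g \<otimes>\<^bsub>SL2\<^esub> x"
        using xS g(2) by (simp add: SL2.m_assoc del: mult_SL2 one_SL2)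
      moreover have "g \<otimes>\<^bsub>SL2\<^esub> (inv\<^bsub>SL2\<^esub> g \<otimes>\<^bsub>SL2\<^esub> x) \<otimes>\<^bsub>SL2\<^esub> inv\<^bsub>SL2\<^esub> g = x \<otimes>\<^bsub>SL2\<^esub> inv\<^bsub>SL2\<^esub> g"
        using xS g(2) by (simp add: SL2.m_assoc[symmetric] del: mult_SL2 one_SL2)
      ultimately show ?thesis using e by metis
    qed
    then have "x \<otimes>\<^bsub>SL2\<^esub> (x \<otimes>\<^bsub>SL2\<^esub> g) = (g \<otimes>\<^bsub>SL2\<^esub> x) \<otimes>\<^bsub>SL2\<^esub> x"
      unfolding e using xS g(2) by (metis SL2.inv_closed SL2.m_assoc)
    then have "(x \<otimes>\<^bsub>SL2\<^esub> x) \<otimes>\<^bsub>SL2\<^esub> g = g \<otimes>\<^bsub>SL2\<^esub> (x \<otimes>\<^bsub>SL2\<^esub> x)"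
      using xS g(2) by (simp only: SL2.m_assoc)
    then have xx: "x \<otimes>\<^bsub>SL2\<^esub> x \<in> centr g" using SL2.m_closed[OF xS xS] unfolding centr_def by simp
    obtain j where j: "k = 2 * j + 1" using x(2) by (rule oddE)
    have pow: "(x \<otimes>\<^bsub>SL2\<^esub> x) [^]\<^bsub>SL2\<^esub> i \<in> centr g" for i :: nat
    proof (induction i)
      case 0
      show ?case using subgroup.one_closed[OF C] by simp
    next
      case (Suc i)
      then show ?case using subgroup.m_closed[OF C _ xx] by simp
    qed
    have "x [^]\<^bsub>SL2\<^esub> (2::nat) = x \<otimes>\<^bsub>SL2\<^esub> x" using xS by (simp add: numeral_2_eq_2 del: mult_SL2 one_SL2)
    then have "x [^]\<^bsub>SL2\<^esub> k = (x \<otimes>\<^bsub>SL2\<^esub> x) [^]\<^bsub>SL2\<^esub> j \<otimes>\<^bsub>SL2\<^esub> x"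
    proof -
      have "(x \<otimes>\<^bsub>SL2\<^esub> x) [^]\<^bsub>SL2\<^esub> j = x [^]\<^bsub>SL2\<^esub> (2 * j)"
        using SL2.nat_pow_pow[OF xS, of 2 j] \<open>x [^]\<^bsub>SL2\<^esub> (2::nat) = x \<otimes>\<^bsub>SL2\<^esub> x\<close> by (simp only:)
      moreover have "k = Suc (2 * j)" using j by simp
      ultimately show ?thesis by (simp only: nat_pow_Suc)
    qed
    then have "x = inv\<^bsub>SL2\<^esub> ((x \<otimes>\<^bsub>SL2\<^esub> x) [^]\<^bsub>SL2\<^esub> j)"
      using x(3) xS by (metis SL2.inv_equality SL2.inv_inv SL2.inv_closed SL2.m_closed SL2.nat_pow_closed)
    then show ?thesis using subgroup.m_inv_closed[OF C pow] by metis
  qed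
  show ?thesis using centr_commute[OF g(2,3) xc] g(4) h by blast
qed

text \<open>Commuting regular elements have the same centralizer, but the two tori have n - 1 and n
  + 1 elements.\<close>

lemma split_nonsplit_not_commuting:
  fixes P Q :: "('f::{field,finite} ^ 2 ^ 2) set"
  assumes two: "(2::'f) \<noteq> 0" and P: "odd_sylow r P" "r dvd CARD('f) - 1" and Q: "odd_sylow s Q" "s dvd CARD('f) + 1"
    and comm: "\<And>x y. x \<in> P \<Longrightarrow> y \<in> Q \<Longrightarrow> x ** y = y ** x"
  shows False
proof -
  obtain g where g: "g \<in> P" "g \<in> carrier SL2" "(trace2 g)\<^sup>2 \<noteq> 4" "P \<subseteq> centr g"
    using odd_sylow_regular_center[OF P(1)] by blast
  obtain h where h: "h \<in> Q" "h \<in> carrier SL2" "(trace2 h)\<^sup>2 \<noteq> 4" "Q \<subseteq> centr h"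
    using odd_sylow_regular_center[OF Q(1)] by blast
  have "centr g = centr h" using centr_eq[OF g(2,3) h(2,3)] comm[OF g(1) h(1)] by simp
  then show False
    using card_centr_minus[OF two P g(2-4)] card_centr_plus[OF two Q h(2-4)] by simp
qed

lemma unip_not_in_norm_set:
  fixes P :: "('f::{field,finite} ^ 2 ^ 2) set"
  assumes two: "(2::'f) \<noteq> 0" and P: "odd_sylow r P" and x: "x \<noteq> 0"
  shows "unip x \<notin> norm_set SL2 P"
proof
  assume u: "unip x \<in> norm_set SL2 P"
  obtain g where g: "g \<in> P" "g \<in> carrier SL2" "(trace2 g)\<^sup>2 \<noteq> 4" "P \<subseteq> centr g"
    using odd_sylow_regular_center[OF P] by blast
  have "unip x \<otimes>\<^bsub>SL2\<^esub> g \<otimes>\<^bsub>SL2\<^esub> inv\<^bsub>SL2\<^esub> (unip x) \<in> centr g" using u g(1,4) unfolding norm_set_def by blast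
  then show False using unip_not_normalizing_odd_char[OF two x g(2,3)] unfolding centr_def by blast
qed

lemma conj_unip_group_not_normalizing:
  fixes P :: "('f::{field,finite} ^ 2 ^ 2) set"
  assumes two: "(2::'f) \<noteq> 0" and P: "odd_sylow r P" and z: "z \<in> carrier SL2"
  shows "\<not> conj_set SL2 unip_group z \<subseteq> norm_set SL2 P"
proof
  assume sub: "conj_set SL2 unip_group z \<subseteq> norm_set SL2 P"
  have Ps: "subgroup P SL2" using odd_sylow_subgroup[OF P] .
  define Q where "Q = conj_set SL2 P (inv\<^bsub>SL2\<^esub> z)"
  have Q: "odd_sylow r Q" using odd_sylow_conj_set[OF P] z by (simp add: Q_def)
  have PQ: "P = conj_set SL2 Q z"
    unfolding Q_def using SL2.conj_set_conj_set[OF Ps SL2.inv_closed[OF z] z] z SL2.conj_set_one[OF Ps]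
    by (simp del: mult_SL2 one_SL2)
  have "inv\<^bsub>SL2\<^esub> z \<otimes>\<^bsub>SL2\<^esub> unip 1 \<otimes>\<^bsub>SL2\<^esub> z \<in> norm_set SL2 (conj_set SL2 Q z)"
    using sub unfolding conj_set_def[of _ unip_group] PQ[symmetric] by blast
  then have "z \<otimes>\<^bsub>SL2\<^esub> (inv\<^bsub>SL2\<^esub> z \<otimes>\<^bsub>SL2\<^esub> unip 1 \<otimes>\<^bsub>SL2\<^esub> z) \<otimes>\<^bsub>SL2\<^esub> inv\<^bsub>SL2\<^esub> z \<in> norm_set SL2 Q"
    using SL2.mem_norm_set_conj_iff[OF odd_sylow_subgroup[OF Q] z] z by (metis SL2.inv_closed SL2.m_closed unip_in_SL2)
  moreover have "z \<otimes>\<^bsub>SL2\<^esub> (inv\<^bsub>SL2\<^esub> z \<otimes>\<^bsub>SL2\<^esub> unip 1 \<otimes>\<^bsub>SL2\<^esub> z) \<otimes>\<^bsub>SL2\<^esub> inv\<^bsub>SL2\<^esub> z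
      = (z \<otimes>\<^bsub>SL2\<^esub> inv\<^bsub>SL2\<^esub> z) \<otimes>\<^bsub>SL2\<^esub> unip 1 \<otimes>\<^bsub>SL2\<^esub> (z \<otimes>\<^bsub>SL2\<^esub> inv\<^bsub>SL2\<^esub> z)"
    using z unip_in_SL2[where 'f = 'f, of 1] by (simp only: SL2.m_assoc SL2.inv_closed SL2.m_closed)
  ultimately have "unip 1 \<in> norm_set SL2 Q" using z by (simp del: mult_SL2 one_SL2)
  then show False using unip_not_in_norm_set[OF two Q, of 1] by simp
qed

lemma unips_not_in_norm_set_char_2:
  fixes P :: "('f::{field,finite} ^ 2 ^ 2) set"
  assumes two: "(2::'f) = 0" and P: "odd_sylow r P" and x: "x \<noteq> 0" "y \<noteq> 0" "x \<noteq> y"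
    and u: "unip x \<in> norm_set SL2 P" "unip y \<in> norm_set SL2 P"
  shows False
proof -
  obtain g where g: "g \<in> P" "g \<in> carrier SL2" "(trace2 g)\<^sup>2 \<noteq> 4" "P \<subseteq> centr g"
    using odd_sylow_regular_center[OF P] by blast
  have "w * g $ 2 $ 1 = trace2 g" if "w \<noteq> 0" "unip w \<in> norm_set SL2 P" for w
  proof -
    have "unip w \<otimes>\<^bsub>SL2\<^esub> g \<otimes>\<^bsub>SL2\<^esub> inv\<^bsub>SL2\<^esub> (unip w) \<in> centr g" using that(2) g(1,4) unfolding norm_set_def by blast
    then show ?thesis using unip_normalizing_char_2[OF two that(1) g(2,3)] unfolding centr_def by blast
  qed
  then have "x * g $ 2 $ 1 = trace2 g" "y * g $ 2 $ 1 = trace2 g" using x u by auto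
  then have "(x - y) * g $ 2 $ 1 = 0" by (simp add: algebra_simps)
  then have "g $ 2 $ 1 = 0" using x by simp
  then have "trace2 g = 0" using \<open>x * g $ 2 $ 1 = trace2 g\<close> by simp
  moreover have "(4::'f) = 2 * 2" by simp
  then have "(4::'f) = 0" unfolding two by simp
  ultimately show False using g(3) by simp
qed

text \<open>A regular element of \<open>P\<close> would be conjugate to a triangular matrix, with
  trace a + 1 / a and therefore a square discriminant.\<close>

lemma nonsplit_not_normalizing_conj_unip_group:
  fixes P :: "('f::{field,finite} ^ 2 ^ 2) set"
  assumes two: "(2::'f) \<noteq> 0" and P: "odd_sylow r P" "r dvd CARD('f) + 1" and z: "z \<in> carrier SL2"
  shows "\<not> P \<subseteq> norm_set SL2 (conj_set SL2 unip_group z)"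
proof
  assume sub: "P \<subseteq> norm_set SL2 (conj_set SL2 unip_group z)"
  obtain g where g: "g \<in> P" "g \<in> carrier SL2" "(trace2 g)\<^sup>2 \<noteq> 4" "P \<subseteq> centr g"
    using odd_sylow_regular_center[OF P(1)] by blast
  have "z \<otimes>\<^bsub>SL2\<^esub> g \<otimes>\<^bsub>SL2\<^esub> inv\<^bsub>SL2\<^esub> z \<in> norm_set SL2 unip_group"
    using sub g(1) SL2.mem_norm_set_conj_iff[OF subgroup_unip_group z g(2)] by blast
  then obtain a b where ab: "a \<noteq> 0" "z \<otimes>\<^bsub>SL2\<^esub> g \<otimes>\<^bsub>SL2\<^esub> inv\<^bsub>SL2\<^esub> z = mat2 a b 0 (1 / a)"
    unfolding norm_set_unip_group by auto
  then have "trace2 g = a + 1 / a" using trace2_conj[OF z, of g] by simp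
  moreover have "(a + 1 / a)\<^sup>2 - 4 = (a - 1 / a)\<^sup>2" using ab(1) by (simp add: power2_eq_square algebra_simps)
  ultimately show False using card_centr_plus[OF two P g(2-4)] by metis
qed

lemma unip_group_not_normal:
  "\<not> carrier (SL2 :: ('f::field ^ 2 ^ 2) monoid) \<subseteq> norm_set SL2 unip_group"
proof
  assume "carrier (SL2 :: ('f ^ 2 ^ 2) monoid) \<subseteq> norm_set SL2 unip_group"
  moreover have "mat2 1 0 1 (1::'f) \<in> carrier SL2" by simp
  ultimately have "mat2 1 0 1 (1::'f) \<in> norm_set SL2 unip_group" by blast
  then show False unfolding norm_set_unip_group by auto
qed

subsection \<open>Modules in cross characteristic\<close>

lemma card_eq_card_kernel_times_card_image:
  fixes f :: "'v::ab_group_add \<Rightarrow> 'w::ab_group_add"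
  assumes "finite S" and S: "\<And>x y. x \<in> S \<Longrightarrow> y \<in> S \<Longrightarrow> x - y \<in> S" "\<And>x y. x \<in> S \<Longrightarrow> y \<in> S \<Longrightarrow> x + y \<in> S"
    and f: "\<And>x y. x \<in> S \<Longrightarrow> y \<in> S \<Longrightarrow> f (x + y) = f x + f y"
  shows "card S = card {x \<in> S. f x = 0} * card (f ` S)"
proof (rule card_eq_card_fibre_times_card_image[OF assms(1)])
  fix y assume "y \<in> f ` S"
  then obtain z where z: "z \<in> S" "y = f z" by blast
  have diff: "f (x - z) = f x - f z" if "x \<in> S" for x
    using f[of "x - z" z] S(1)[OF that z(1)] z(1) by simp
  have "bij_betw (\<lambda>x. x - z) {x \<in> S. f x = y} {x \<in> S. f x = 0}"
    by (rule bij_betwI[where g = "\<lambda>x. x + z"]) (use z S f diff in auto)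
  then show "card {x \<in> S. f x = y} = card {x \<in> S. f x = 0}" by (rule bij_betw_same_card)
qed

context vector_space
begin

lemma finite_span:
  assumes "finite (UNIV :: 'a set)" "finite B"
  shows "finite (span B)"
  using assms(2)
proof (induction B rule: finite_induct)
  case (insert b B)
  have "span (insert b B) \<subseteq> (\<lambda>(k, x). k *s b + x) ` (UNIV \<times> span B)"
  proof
    fix x assume "x \<in> span (insert b B)"
    then obtain k where "x - k *s b \<in> span B" by (auto simp: span_insert)
    then show "x \<in> (\<lambda>(k, x). k *s b + x) ` (UNIV \<times> span B)"
      by (intro image_eqI[of _ _ "(k, x - k *s b)"]) auto
  qed
  then show ?case using insert.IH assms(1) by (meson finite_SigmaI finite_imageI finite_subset)
qed simp

lemma card_span_independent:
  assumes "finite (UNIV :: 'a set)" "finite B" "independent B"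
  shows "card (span B) = CARD('a) ^ card B"
  using assms(2,3)
proof (induction B rule: finite_induct)
  case (insert b B)
  have ind: "independent B" "b \<notin> span B" using insert.hyps(2) insert.prems by (auto simp: independent_insert)
  have "bij_betw (\<lambda>(k, x). k *s b + x) (UNIV \<times> span B) (span (insert b B))"
  proof (rule bij_betw_imageI)
    show "inj_on (\<lambda>(k, x). k *s b + x) (UNIV \<times> span B)"
    proof (rule inj_onI)
      fix p p' assume p: "p \<in> UNIV \<times> span B" "p' \<in> UNIV \<times> span B"
        and eq: "(case p of (k, x) \<Rightarrow> k *s b + x) = (case p' of (k, x) \<Rightarrow> k *s b + x)"
      obtain k x where kx: "p = (k, x)" by (cases p)
      obtain k' x' where kx': "p' = (k', x')" by (cases p')
      have "(k - k') *s b = x' - x" using eq kx kx' by (simp add: scale_left_diff_distrib algebra_simps)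
      then have "(k - k') *s b \<in> span B" using p kx kx' span_diff by auto
      then have "k = k'" using ind(2) span_scale[of "(k - k') *s b" B "inverse (k - k')"] by (cases "k = k'") auto
      then show "p = p'" using eq kx kx' by simp
    qed
    show "(\<lambda>(k, x). k *s b + x) ` (UNIV \<times> span B) = span (insert b B)"
    proof (intro equalityI subsetI)
      fix y assume "y \<in> span (insert b B)"
      then obtain k where "y - k *s b \<in> span B" by (auto simp: span_insert)
      then show "y \<in> (\<lambda>(k, x). k *s b + x) ` (UNIV \<times> span B)"
        by (intro image_eqI[of _ _ "(k, y - k *s b)"]) auto
    next
      fix y assume "y \<in> (\<lambda>(k, x). k *s b + x) ` (UNIV \<times> span B)"
      then obtain k x where "x \<in> span B" "y = k *s b + x" by auto
      then show "y \<in> span (insert b B)" by (auto simp: span_insert intro!: exI[of _ k])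
    qed
  qed
  from bij_betw_same_card[OF this] have "card (span (insert b B)) = CARD('a) * card (span B)"
    by (simp add: card_cartesian_product)
  then show ?case using insert.IH[OF ind(1)] insert.hyps by simp
qed simp

lemma card_subspace_power:
  assumes "finite (UNIV :: 'a set)" "subspace S" "finite S"
  shows "\<exists>e. card S = CARD('a) ^ e"
proof -
  obtain B where B: "B \<subseteq> S" "independent B" "S \<subseteq> span B" by (meson basis_exists)
  have "span B = S" using B assms(2) span_minimal by blast
  moreover have "finite B" using B(1) assms(3) finite_subset by blast
  ultimately show ?thesis using card_span_independent[OF assms(1) _ B(2)] by metis
qed

end

section \<open>The module and its fixed spaces\<close>

locale sl2_module = irreducible_linear_group_action SL2 act scale
  for act :: "'f::{field,finite} ^ 2 ^ 2 \<Rightarrow> 'v::ab_group_add \<Rightarrow> 'v"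
    and scale :: "'k::{field,finite} \<Rightarrow> 'v \<Rightarrow> 'v" +
  fixes t a q :: nat
  assumes prime_t: "prime t" and card_f: "CARD('f) = t ^ a" and card_f_ge: "CARD('f) \<ge> 4"
    and prime_q: "prime q" and q_neq_t: "q \<noteq> t" and card_k: "CARD('k) = q"
    and nontrivial: "\<not> trivial_action SL2 act"
begin

lemma act_mult: "A \<in> carrier SL2 \<Longrightarrow> B \<in> carrier SL2 \<Longrightarrow> act (A ** B) v = act A (act B v)"
  using composition_rule[of v A B] by simp

lemma act_one [simp]: "act (mat2 1 0 0 1) v = v"
  using id_eq_one by (metis UNIV_I one_SL2 restrict_apply')

lemma act_inv: "A \<in> carrier SL2 \<Longrightarrow> act (inv\<^bsub>SL2\<^esub> A) (act A v) = v"
  using act_mult[of "inv\<^bsub>SL2\<^esub> A" A v] SL2.l_inv[of A] by simp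

lemma act_hom: "A \<in> carrier SL2 \<Longrightarrow> module_hom scale scale (act A)"
  using action_linear[of A] by (simp add: linear_iff_module_hom)

lemma act_add: "A \<in> carrier SL2 \<Longrightarrow> act A (v + w) = act A v + act A w"
  using act_hom module_hom.add by metis

lemma act_scale: "A \<in> carrier SL2 \<Longrightarrow> act A (scale c v) = scale c (act A v)"
  using act_hom module_hom.scale by metis

lemma act_0 [simp]: "A \<in> carrier SL2 \<Longrightarrow> act A 0 = 0"
  using act_hom module_hom.zero by metis

lemma act_diff: "A \<in> carrier SL2 \<Longrightarrow> act A (v - w) = act A v - act A w"
  using act_hom module_hom.diff by metis

lemma act_neg: "A \<in> carrier SL2 \<Longrightarrow> act A (- v) = - act A v"
  using act_hom module_hom.neg by metis

lemma act_sum: "A \<in> carrier SL2 \<Longrightarrow> act A (\<Sum>i\<in>I. f i) = (\<Sum>i\<in>I. act A (f i))"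
  using act_hom module_hom.sum by metis

definition Fix :: "('f ^ 2 ^ 2) set \<Rightarrow> 'v set" where
  "Fix X = {v. \<forall>x\<in>X. act x v = v}"

lemma subspace_Fix: "X \<subseteq> carrier SL2 \<Longrightarrow> subspace (Fix X)"
  by (rule subspaceI) (auto simp: Fix_def act_add act_scale subsetD)

lemma stabilizer_iff: "x \<in> stabilizer SL2 act v \<longleftrightarrow> x \<in> carrier SL2 \<and> act x v = v"
  by (simp add: stabilizer_def)

lemma subset_stabilizer_iff: "X \<subseteq> carrier SL2 \<Longrightarrow> X \<subseteq> stabilizer SL2 act v \<longleftrightarrow> v \<in> Fix X"
  by (auto simp: Fix_def stabilizer_iff)

text \<open>The span of one nonzero orbit is invariant, hence everything, and finitely many vectors
  over a finite field span a finite set.\<close>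

lemma finite_V [simp]: "finite (A :: 'v set)"
proof -
  obtain v :: 'v where v: "v \<noteq> 0" using nonzero by blast
  let ?O = "(\<lambda>g. act g v) ` carrier SL2"
  have "span ?O = {0} \<or> span ?O = UNIV"
  proof (rule irreducible)
    fix g :: "'f ^ 2 ^ 2" and w assume g: "g \<in> carrier SL2" and w: "w \<in> span ?O"
    show "act g w \<in> span ?O"
      using w
    proof (induction rule: span_induct_alt)
      case base
      then show ?case using g span_zero by simp
    next
      case (step c x y)
      then obtain h where h: "h \<in> carrier SL2" "x = act h v" by blast
      have "act g x = act (g ** h) v" using act_mult g h by simp
      moreover have "g ** h \<in> carrier SL2" using SL2.m_closed[OF g h(1)] by simp
      then have "act (g ** h) v \<in> span ?O" by (intro span_base imageI)
      ultimately have "act g x \<in> span ?O" by (simp only:)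
      then show ?case using step.IH g by (simp add: act_add act_scale span_add span_scale)
    qed
  qed simp
  moreover have "act (mat2 1 0 0 1) v \<in> ?O" by (intro imageI) simp
  then have "v \<in> span ?O" unfolding act_one by (rule span_base)
  then have "span ?O \<noteq> {0}" using v by auto
  ultimately have "span ?O = UNIV" by blast
  then have "finite (UNIV :: 'v set)" using finite_span[OF finite, of ?O] by simp
  then show ?thesis using finite_subset subset_UNIV by blast
qed

lemma card_subspace: "subspace S \<Longrightarrow> \<exists>e. card S = q ^ e"
  using card_subspace_power[OF finite _ finite_V] card_k by metis

lemma Fix_carrier: "Fix (carrier SL2) = {0}"
proof -
  have "Fix (carrier SL2) = {0} \<or> Fix (carrier SL2) = UNIV"
  proof (rule irreducible)
    fix g :: "'f ^ 2 ^ 2" and w assume "g \<in> carrier SL2" "w \<in> Fix (carrier SL2)"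
    then show "act g w \<in> Fix (carrier SL2)" by (simp add: Fix_def)
  qed (simp add: subspace_Fix)
  moreover have "Fix (carrier SL2) \<noteq> UNIV" using nontrivial by (auto simp: trivial_action_def Fix_def)
  ultimately show ?thesis by blast
qed

lemma of_nat_scale_eq_0:
  assumes "\<not> q dvd m" "scale (of_nat m) v = 0"
  shows "v = 0"
proof -
  have "of_nat m \<noteq> (0::'k)" using of_nat_eq_0_iff_CARD_prime_power[OF prime_q, of 1 m] card_k assms(1) by simp
  then show ?thesis using assms(2) by simp
qed

lemma q_not_dvd_t_power: "\<not> q dvd t ^ i"
  using prime_q prime_t q_neq_t by (metis prime_dvd_power primes_dvd_imp_eq)

lemma act_unip_add: "act (unip (x + y)) v = act (unip x) (act (unip y) v)"
  using act_mult[of "unip x" "unip y" v] by (simp add: unip_mult)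

text \<open>The upper and the lower unipotents generate the group, and only 0 is fixed by the whole
  group.\<close>

lemma Fix_opposite_unip:
  assumes "v \<in> Fix unip_group" "v \<in> Fix (conj_set SL2 unip_group weyl)"
  shows "v = 0"
proof -
  have up: "act (mat2 1 x 0 1) v = v" for x using assms(1) by (simp add: Fix_def unip_def)
  have lo: "act (mat2 1 0 x 1) v = v" for x
  proof -
    have "inv\<^bsub>SL2\<^esub> weyl \<otimes>\<^bsub>SL2\<^esub> unip (- x) \<otimes>\<^bsub>SL2\<^esub> weyl = mat2 1 0 x 1" by (simp add: weyl_def unip_def)
    then have "mat2 1 0 x 1 \<in> conj_set SL2 unip_group weyl" unfolding conj_set_def by (metis image_eqI rangeI)
    then show ?thesis using assms(2) by (simp add: Fix_def)
  qed
  have c: "act (mat2 a b c d) v = v" if "c \<noteq> 0" "a * d - b * c = 1" for a b c d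
  proof -
    \<comment> \<open>Upper times lower times upper unipotent.\<close>
    have eq: "mat2 a b c d = mat2 1 ((a - 1) / c) 0 1 ** (mat2 1 0 c 1 ** mat2 1 ((d - 1) / c) 0 1)"
    proof -
      have "b = (d - 1) / c + (a - 1) / c * (c * ((d - 1) / c) + 1)"
      proof -
        have "b * c = (d - 1) + (a - 1) * ((d - 1) + 1)" using that(2) by (simp add: algebra_simps)
        then have "b = ((d - 1) + (a - 1) * ((d - 1) + 1)) / c" using that(1) by (simp add: eq_divide_eq)
        then show ?thesis using that(1) by (simp add: add_divide_distrib)
      qed
      then show ?thesis using that(1) by simp
    qed
    have "mat2 1 0 c 1 ** mat2 1 ((d - 1) / c) 0 1 \<in> carrier SL2" by simp
    then have "act (mat2 a b c d) v = act (mat2 1 ((a - 1) / c) 0 1) (act (mat2 1 0 c 1 ** mat2 1 ((d - 1) / c) 0 1) v)"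
      unfolding eq by (intro act_mult) simp
    also have "act (mat2 1 0 c 1 ** mat2 1 ((d - 1) / c) 0 1) v = act (mat2 1 0 c 1) (act (mat2 1 ((d - 1) / c) 0 1) v)"
      by (intro act_mult) simp_all
    finally show ?thesis by (simp only: up lo)
  qed
  have "v \<in> Fix (carrier SL2)"
    unfolding Fix_def
  proof (intro CollectI ballI)
    fix A :: "'f ^ 2 ^ 2" assume A: "A \<in> carrier SL2"
    obtain a b c d where A': "A = mat2 a b c d" by (cases A rule: mat2_exhaust)
    show "act A v = v"
    proof (cases "c = 0")
      case False
      then show ?thesis using c A A' by simp
    next
      case True
      then have "a \<noteq> 0" using A A' by auto
      \<comment> \<open>Adding the first row to the second makes the lower left entry the nonzero
        \<open>a\<close>.\<close>
      then have "act (mat2 a b a (b + d)) v = v" using A A' True by (intro c) (simp_all add: algebra_simps)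
      moreover have "mat2 a b a (b + d) = mat2 1 0 1 1 ** A" using A' True by simp
      ultimately have "act (mat2 1 0 1 1) (act A v) = act (mat2 1 0 1 1) v" using act_mult[of "mat2 1 0 1 1" A v] A lo by simp
      then show ?thesis using act_inv[of "mat2 1 0 1 1"] by (metis mat2_in_SL2 diff_zero mult_cancel_left1 mult_zero_left)
    qed
  qed
  then show ?thesis unfolding Fix_carrier by simp
qed

lemma Fix_conj_set:
  assumes "z \<in> carrier SL2" "X \<subseteq> carrier SL2"
  shows "v \<in> Fix (conj_set SL2 X z) \<longleftrightarrow> act z v \<in> Fix X"
proof -
  have "act (inv\<^bsub>SL2\<^esub> z \<otimes>\<^bsub>SL2\<^esub> x \<otimes>\<^bsub>SL2\<^esub> z) v = v \<longleftrightarrow> act x (act z v) = act z v" if "x \<in> X" for x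
  proof -
    have x: "x \<in> carrier SL2" using that assms(2) by blast
    have iz: "inv\<^bsub>SL2\<^esub> z \<in> carrier SL2" using assms(1) by simp
    have "inv\<^bsub>SL2\<^esub> z ** x \<in> carrier SL2" using SL2.m_closed[OF iz x] by simp
    then have eq: "act (inv\<^bsub>SL2\<^esub> z \<otimes>\<^bsub>SL2\<^esub> x \<otimes>\<^bsub>SL2\<^esub> z) v = act (inv\<^bsub>SL2\<^esub> z) (act x (act z v))"
      using act_mult assms(1) x iz by simp
    show ?thesis
      unfolding eq using act_inv[OF assms(1)] act_inv[OF iz] assms(1) by (metis SL2.inv_inv)
  qed
  then show ?thesis by (auto simp: Fix_def conj_set_def simp del: mult_SL2)
qed

text \<open>Since \<open>q \<noteq> t\<close>, the module is the direct sum of the fixed space of the unipotent group and the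
  kernel \<open>W\<close> of its norm map \<open>Nm\<close>.\<close>

definition Nm :: "'v \<Rightarrow> 'v" where
  "Nm v = (\<Sum>x\<in>UNIV. act (unip x) v)"

definition W :: "'v set" where
  "W = {v. Nm v = 0}"

lemma Nm_add: "Nm (v + w) = Nm v + Nm w"
  by (simp add: Nm_def act_add sum.distrib)

lemma Nm_scale: "Nm (scale c v) = scale c (Nm v)"
  by (simp add: Nm_def act_scale scale_sum_right)

lemma subspace_W: "subspace W"
  by (rule subspaceI) (simp_all add: W_def Nm_add Nm_scale, simp add: Nm_def)

lemma act_unip_Nm: "act (unip y) (Nm v) = Nm v"
proof -
  have "act (unip y) (Nm v) = (\<Sum>x\<in>UNIV. act (unip (y + x)) v)"
    by (simp add: Nm_def act_sum act_unip_add)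
  also have "\<dots> = (\<Sum>x\<in>(\<lambda>x. y + x) ` UNIV. act (unip x) v)"
    by (subst sum.reindex) (auto simp: inj_on_def)
  also have "(\<lambda>x. y + x) ` UNIV = UNIV" by (metis surj_plus)
  finally show ?thesis by (simp add: Nm_def)
qed

lemma Nm_in_Fix: "Nm v \<in> Fix unip_group"
  by (auto simp: Fix_def act_unip_Nm)

lemma Nm_act_unip: "Nm (act (unip y) v) = Nm v"
proof -
  have "Nm (act (unip y) v) = (\<Sum>x\<in>UNIV. act (unip (y + x)) v)"
    by (simp add: Nm_def act_unip_add[symmetric] add.commute)
  also have "\<dots> = act (unip y) (Nm v)" by (simp add: Nm_def act_sum act_unip_add)
  finally show ?thesis using act_unip_Nm by simp
qed

lemma act_unip_W: "v \<in> W \<Longrightarrow> act (unip y) v \<in> W"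
  by (simp add: W_def Nm_act_unip)

lemma sum_const_scale: "(\<Sum>i\<in>I. v) = scale (of_nat (card I)) (v :: 'v)"
  by (induction I rule: infinite_finite_induct) (simp_all add: scale_left_distrib)

lemma Nm_Fix: "v \<in> Fix unip_group \<Longrightarrow> Nm v = scale (of_nat CARD('f)) v"
  using sum_const_scale[of v UNIV] by (simp add: Nm_def Fix_def)

lemma W_Fix_unip: "v \<in> W \<Longrightarrow> v \<in> Fix unip_group \<Longrightarrow> v = 0"
  using Nm_Fix[of v] of_nat_scale_eq_0[of "CARD('f)" v] q_not_dvd_t_power card_f by (simp add: W_def)

text \<open>\<open>n\<close> is invertible in the scalars, so up to this factor \<open>Nm\<close>
  projects onto the vectors fixed by the unipotent group. The lemma admits subspaces because it is
  used for the fixed space of a torus subgroup as well as for the whole module.\<close>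

lemma card_W_times_Fix:
  assumes S: "subspace S" "\<And>v. v \<in> S \<Longrightarrow> Nm v \<in> S"
  shows "card S = card (S \<inter> W) * card (S \<inter> Fix unip_group)"
proof -
  have "Nm ` S = S \<inter> Fix unip_group"
  proof (intro equalityI subsetI)
    fix v assume "v \<in> S \<inter> Fix unip_group"
    then have v: "v \<in> S" "v \<in> Fix unip_group" by auto
    have ne: "of_nat CARD('f) \<noteq> (0::'k)"
      using of_nat_eq_0_iff_CARD_prime_power[OF prime_q, of 1 "CARD('f)"] card_k q_not_dvd_t_power card_f by simp
    have "Nm (scale (inverse (of_nat CARD('f))) v) = v"
      using Nm_Fix[OF v(2)] ne by (simp add: Nm_scale)
    moreover have "scale (inverse (of_nat CARD('f))) v \<in> S" using S(1) v(1) subspace_scale by blast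
    ultimately show "v \<in> Nm ` S" by (metis imageI)
  qed (use S(2) Nm_in_Fix in auto)
  moreover have "card S = card {x \<in> S. Nm x = 0} * card (Nm ` S)"
    by (rule card_eq_card_kernel_times_card_image) (simp_all add: subspace_diff[OF S(1)] subspace_add[OF S(1)] Nm_add)
  moreover have "{x \<in> S. Nm x = 0} = S \<inter> W" by (auto simp: W_def)
  ultimately show ?thesis by simp
qed

lemma card_V: "CARD('v) = card W * card (Fix unip_group)"
  using card_W_times_Fix[OF subspace_UNIV] by simp

lemma unip_group_carrier: "unip_group \<subseteq> carrier (SL2 :: ('f ^ 2 ^ 2) monoid)"
  by auto

text \<open>Otherwise the unipotent group and its opposite would both act trivially.\<close>

lemma W_nonzero: "\<exists>v\<in>W. v \<noteq> 0"
proof (rule ccontr)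
  assume "\<not> (\<exists>v\<in>W. v \<noteq> 0)"
  moreover have "0 \<in> W" using subspace_0[OF subspace_W] .
  ultimately have "W = {0}" by auto
  then have "card (Fix unip_group) = CARD('v)" using card_V by simp
  then have eq: "Fix unip_group = UNIV" by (metis card_subset_eq finite_V subset_UNIV)
  obtain v :: 'v where v: "v \<noteq> 0" using nonzero by blast
  have "v \<in> Fix (conj_set SL2 unip_group weyl)"
    using Fix_conj_set[OF weyl_in_SL2 unip_group_carrier] eq by simp
  then show False using Fix_opposite_unip[of v] eq v by simp
qed

lemma p_group_fixed_cong:
  assumes P: "subgroup P SL2" "prime r" "card P = r ^ m" and S: "\<And>x v. x \<in> P \<Longrightarrow> v \<in> S \<Longrightarrow> act x v \<in> S"
  shows "[card S = card (S \<inter> Fix P)] (mod r)"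
proof -
  have "[card S = card {v \<in> S. \<forall>x\<in>carrier (SL2\<lparr>carrier := P\<rparr>). act x v = v}] (mod r)"
    using S subgroup.mem_carrier[OF P(1)]
    by (intro p_group_card_fixed_cong[OF subgroup.subgroup_is_group[OF P(1) SL2.is_group] P(2)])
      (simp_all add: SL2.order_subgroup P(3) act_mult)
  moreover have "{v \<in> S. \<forall>x\<in>carrier (SL2\<lparr>carrier := P\<rparr>). act x v = v} = S \<inter> Fix P" by (auto simp: Fix_def)
  ultimately show ?thesis by simp
qed

lemma card_W_cong_1: "[card W = 1] (mod t)"
proof -
  have "[card W = card (W \<inter> Fix unip_group)] (mod t)"
    by (rule p_group_fixed_cong[OF subgroup_unip_group prime_t, of a])
      (auto simp: card_unip_group card_f act_unip_W)
  moreover have "W \<inter> Fix unip_group = {0}"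
    using W_Fix_unip subspace_0[OF subspace_W] subspace_0[OF subspace_Fix[OF unip_group_carrier]] by auto
  ultimately show ?thesis by simp
qed

end

subsection \<open>Annihilating polynomials over finite fields\<close>

lemma CHAR_poly_eq: "CHAR('k::comm_ring_1 poly) = CHAR('k)"
  by (rule CHAR_eqI) (auto simp: of_nat_poly of_nat_eq_0_iff_char_dvd)

locale finite_module_endo = vector_space scale
  for scale :: "'k::field \<Rightarrow> 'v::ab_group_add \<Rightarrow> 'v" +
  fixes f :: "'v \<Rightarrow> 'v"
  assumes finite_scalars: "finite (UNIV :: 'k set)"
    and f_add: "f (v + w) = f v + f w"
    and f_scale: "f (scale c v) = scale c (f v)"
begin

lemma f_0: "f 0 = 0"
  using f_scale[of 0 0] by simp

lemma f_sum: "f (\<Sum>i\<in>I. h i) = (\<Sum>i\<in>I. f (h i))"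
  by (induction I rule: infinite_finite_induct) (simp_all add: f_0 f_add)

lemma funpow_add': "(f ^^ n) (v + w) = (f ^^ n) v + (f ^^ n) w"
  by (induction n) (simp_all add: f_add)

lemma funpow_scale: "(f ^^ n) (scale c v) = scale c ((f ^^ n) v)"
  by (induction n) (simp_all add: f_scale)

text \<open>The action of a polynomial in the module structure where the indeterminate acts as
  \<open>f\<close>.\<close>

definition pact :: "'k poly \<Rightarrow> 'v \<Rightarrow> 'v" where
  "pact p v = (\<Sum>i\<le>degree p. scale (coeff p i) ((f ^^ i) v))"

lemma pact_bound: "degree p \<le> n \<Longrightarrow> pact p v = (\<Sum>i\<le>n. scale (coeff p i) ((f ^^ i) v))"
  unfolding pact_def by (rule sum.mono_neutral_left) (auto simp: coeff_eq_0)

lemma pact_0 [simp]: "pact 0 v = 0"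
  by (simp add: pact_def)

lemma pact_pCons: "pact (pCons c p) v = scale c v + f (pact p v)"
proof (cases "pCons c p = 0")
  case True
  then show ?thesis by (simp add: f_0)
next
  case False
  have "pact (pCons c p) v = (\<Sum>i\<le>Suc (degree p). scale (coeff (pCons c p) i) ((f ^^ i) v))"
    by (rule pact_bound) (rule degree_pCons_le)
  also have "\<dots> = scale c v + (\<Sum>i\<le>degree p. scale (coeff p i) (f ((f ^^ i) v)))"
    by (simp add: sum.atMost_Suc_shift del: sum.atMost_Suc)
  also have "\<dots> = scale c v + f (pact p v)" by (simp add: pact_def f_sum f_scale)
  finally show ?thesis .
qed

lemma pact_add_vec: "pact p (v + w) = pact p v + pact p w"
  by (simp add: pact_def funpow_add' scale_right_distrib sum.distrib)

lemma pact_scale: "pact p (scale c v) = scale c (pact p v)"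
  by (simp add: pact_def funpow_scale scale_sum_right mult.commute)

lemma pact_add: "pact (p + p') v = pact p v + pact p' v"
  by (induction p p' rule: poly_induct2) (simp_all add: pact_pCons scale_left_distrib f_add algebra_simps)

lemma pact_smult: "pact (smult c p) v = scale c (pact p v)"
  by (induction p) (simp_all add: pact_pCons scale_right_distrib f_scale)

lemma pact_f: "pact p (f v) = f (pact p v)"
  by (induction p) (simp_all add: pact_pCons f_0 f_add f_scale)

lemma pact_mult: "pact (p * p') v = pact p (pact p' v)"
  by (induction p) (simp_all add: pact_pCons pact_add pact_smult mult_pCons_left)

lemma pact_1 [simp]: "pact 1 v = v"
  by (simp add: pact_def)

lemma pact_monom: "pact (monom c n) v = scale c ((f ^^ n) v)"
proof -
  have "pact (monom c n) v = (\<Sum>i\<le>n. scale (coeff (monom c n) i) ((f ^^ i) v))"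
    by (rule pact_bound) (rule degree_monom_le)
  also have "\<dots> = (\<Sum>i\<le>n. if i = n then scale c ((f ^^ i) v) else 0)"
    by (intro sum.cong) auto
  finally show ?thesis by simp
qed

text \<open>Induction on the size of \<open>S\<close>. The minimal polynomial of one vector has a
  kernel at least as large as the cyclic subspace of that vector; its image is smaller, and a
  polynomial for the image is multiplied on. Degrees add while kernel and image sizes
  multiply.\<close>

lemma annihilating_poly:
  assumes "finite S" "subspace S" "\<And>v. v \<in> S \<Longrightarrow> f v \<in> S"
  shows "\<exists>p. p \<noteq> 0 \<and> CARD('k) ^ degree p \<le> card S \<and> (\<forall>v\<in>S. pact p v = 0)"
  using assms
proof (induction "card S" arbitrary: S rule: less_induct)
  case less
  note S = less.prems
  show ?case
  proof (cases "S = {0}")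
    case True
    then have "pact 1 v = 0" if "v \<in> S" for v using that by simp
    then show ?thesis using True by (intro exI[of _ 1]) simp
  next
    case False
    then obtain y where y: "y \<in> S" "y \<noteq> 0" using subspace_0[OF S(2)] by blast
    have fy: "(f ^^ i) y \<in> S" for i by (induction i) (use y S in auto)
    have "\<exists>p. p \<noteq> 0 \<and> pact p y = 0"
    proof -
      have "\<not> inj (\<lambda>i. (f ^^ i) y)"
      proof
        assume "inj (\<lambda>i. (f ^^ i) y)"
        then have "infinite (range (\<lambda>i. (f ^^ i) y))" using finite_imageD by blast
        moreover have "range (\<lambda>i. (f ^^ i) y) \<subseteq> S" using fy by blast
        ultimately show False using S(1) finite_subset by blast
      qed
      then obtain i j where ij: "i \<noteq> j" "(f ^^ i) y = (f ^^ j) y" by (auto simp: inj_def)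
      have "coeff (monom 1 i + monom (- 1) j :: 'k poly) i = 1" using ij(1) by simp
      then have "monom 1 i + monom (- 1) j \<noteq> (0 :: 'k poly)" by (metis coeff_0 zero_neq_one)
      moreover have "pact (monom 1 i + monom (- 1) j) y = 0" using ij(2) by (simp add: pact_add pact_monom)
      ultimately show ?thesis by blast
    qed
    then obtain p0 where p0: "p0 \<noteq> 0" "pact p0 y = 0"
      and min: "\<And>p. p \<noteq> 0 \<Longrightarrow> pact p y = 0 \<Longrightarrow> degree p0 \<le> degree p"
      using ex_has_least_nat[of "\<lambda>p. p \<noteq> 0 \<and> pact p y = 0" _ degree] by blast
    let ?m = "degree p0"
    let ?K = "{v \<in> S. pact p0 v = 0}"
    let ?h = "\<lambda>c :: nat \<Rightarrow> 'k. \<Sum>i<?m. scale (c i) ((f ^^ i) y)"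
    \<comment> \<open>By minimality of \<open>p0\<close> the first \<open>?m\<close> iterates of
      \<open>y\<close> are linearly independent; all their combinations are killed by
      \<open>p0\<close>.\<close>
    have "inj_on ?h ({..<?m} \<rightarrow>\<^sub>E UNIV)"
    proof (rule inj_onI)
      fix c d assume cd: "c \<in> {..<?m} \<rightarrow>\<^sub>E UNIV" "d \<in> {..<?m} \<rightarrow>\<^sub>E UNIV" and eq: "?h c = ?h d"
      define p where "p = (\<Sum>i<?m. monom (c i - d i) i)"
      have coeff: "coeff p j = (if j < ?m then c j - d j else 0)" for j
        by (simp add: p_def coeff_sum if_distrib cong: if_cong)
      have "p = 0"
      proof (rule ccontr)
        assume "p \<noteq> 0"
        then have "coeff p (degree p) \<noteq> 0" by simp
        then have deg: "degree p < ?m" using coeff by metis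
        have "pact p y = (\<Sum>i\<le>?m. scale (coeff p i) ((f ^^ i) y))" using deg by (intro pact_bound) simp
        also have "\<dots> = (\<Sum>i<?m. scale (c i - d i) ((f ^^ i) y))"
          by (simp add: coeff lessThan_Suc_atMost[symmetric])
        also have "\<dots> = 0" using eq by (simp add: scale_left_diff_distrib sum_subtractf)
        finally show False using min[OF \<open>p \<noteq> 0\<close>] deg by simp
      qed
      then have "c j = d j" if "j < ?m" for j using coeff[of j] that by simp
      then show "c = d" using cd by (intro PiE_ext) auto
    qed
    moreover have "?h ` ({..<?m} \<rightarrow>\<^sub>E UNIV) \<subseteq> ?K"
    proof (rule image_subsetI, intro CollectI conjI)
      fix c :: "nat \<Rightarrow> 'k"
      show "?h c \<in> S" using fy S(2) by (intro subspace_sum subspace_scale) auto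
      have *: "pact p0 ((f ^^ i) y) = 0" for i by (induction i) (simp_all add: p0 pact_f f_0)
      have "pact p0 (\<Sum>i\<in>I. scale (c i) ((f ^^ i) y)) = 0" for I :: "nat set"
      proof (induction I rule: infinite_finite_induct)
        case (insert i I)
        then show ?case using * by (simp add: pact_add_vec pact_scale)
      qed (use pact_scale[of p0 0 0] in simp_all)
      then show "pact p0 (?h c) = 0" .
    qed
    ultimately have "card ({..<?m} \<rightarrow>\<^sub>E (UNIV :: 'k set)) \<le> card ?K"
      using S(1) by (intro card_inj_on_le) auto
    then have K: "CARD('k) ^ ?m \<le> card ?K" by (simp add: card_PiE)
    let ?S2 = "pact p0 ` S"
    have cardS: "card S = card ?K * card ?S2"
      by (rule card_eq_card_kernel_times_card_image)
        (simp_all add: S(1) subspace_diff[OF S(2)] subspace_add[OF S(2)] pact_add_vec)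
    have S2sub: "subspace ?S2"
    proof (rule subspaceI)
      show "0 \<in> ?S2" using pact_scale[of p0 0 0] subspace_0[OF S(2)] by (intro image_eqI[of _ _ 0]) auto
    next
      fix x y assume "x \<in> ?S2" "y \<in> ?S2"
      then obtain x' y' where "x' \<in> S" "y' \<in> S" "x = pact p0 x'" "y = pact p0 y'" by blast
      then show "x + y \<in> ?S2" using subspace_add[OF S(2)] by (intro image_eqI[of _ _ "x' + y'"]) (auto simp: pact_add_vec)
    next
      fix c x assume "x \<in> ?S2"
      then obtain x' where "x' \<in> S" "x = pact p0 x'" by blast
      then show "scale c x \<in> ?S2" using subspace_scale[OF S(2)] by (intro image_eqI[of _ _ "scale c x'"]) (auto simp: pact_scale)
    qed
    have S2f: "f v \<in> ?S2" if "v \<in> ?S2" for v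
    proof -
      obtain u where u: "u \<in> S" "v = pact p0 u" using \<open>v \<in> ?S2\<close> by blast
      then have "f v = pact p0 (f u)" by (simp add: pact_f)
      then show ?thesis using S(3)[OF u(1)] by blast
    qed
    have "?m \<noteq> 0"
    proof
      assume "?m = 0"
      then have "pact p0 y = scale (coeff p0 0) y" by (simp add: pact_def)
      moreover have "coeff p0 0 \<noteq> 0" using p0(1) \<open>?m = 0\<close> by (metis leading_coeff_0_iff)
      ultimately show False using p0(2) y(2) by simp
    qed
    moreover have "CARD('k) \<ge> 2" using card_mono[OF finite_scalars, of "{0, 1}"] by simp
    ultimately have "card ?K \<ge> 2" using K self_le_power[of "CARD('k)" ?m] by linarith
    moreover have "card ?S2 > 0" using S(1) y(1) by (auto simp: card_gt_0_iff)
    ultimately have "card ?S2 < card S" unfolding cardS by simp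
    then obtain p2 where p2: "p2 \<noteq> 0" "CARD('k) ^ degree p2 \<le> card ?S2" "\<forall>v\<in>?S2. pact p2 v = 0"
      using less.hyps[OF _ _ S2sub S2f] S(1) by blast
    have "CARD('k) ^ degree (p2 * p0) \<le> card S"
      unfolding degree_mult_eq[OF p2(1) p0(1)] power_add cardS
      using mult_le_mono[OF p2(2) K] by (simp add: mult.commute)
    moreover have "\<forall>v\<in>S. pact (p2 * p0) v = 0" using p2(3) by (simp add: pact_mult)
    ultimately show ?thesis using p2(1) p0(1) by (intro exI[of _ "p2 * p0"]) simp
  qed
qed

text \<open>In characteristic \<open>r\<close> the \<open>r\<close>-th power of f - 1 is f^r - 1,
  which is 0 on \<open>S\<close>. The kernel of the next power of f - 1 is larger by a factor of at
  most the size of the kernel of f - 1, and \<open>r\<close> such steps exhaust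
  \<open>S\<close>.\<close>

lemma card_le_card_fixed_power:
  assumes S: "finite S" "subspace S" "\<And>v. v \<in> S \<Longrightarrow> f v \<in> S"
    and r: "CHAR('k) = r" "prime r" and per: "\<And>v. v \<in> S \<Longrightarrow> (f ^^ r) v = v"
  shows "card S \<le> card {v \<in> S. f v = v} ^ r"
proof -
  define D where "D v = f v - v" for v
  have D: "D (v + w) = D v + D w" for v w by (simp add: D_def f_add)
  have DS: "D v \<in> S" if "v \<in> S" for v using S that by (simp add: D_def subspace_diff)
  have pactD: "pact ([:- 1, 1:] ^ n) v = (D ^^ n) v" for n v
  proof (induction n)
    case (Suc n)
    have "pact [:- 1, 1:] w = D w" for w by (simp add: pact_pCons D_def f_0)
    then show ?case using Suc.IH by (simp only: power_Suc pact_mult funpow.simps o_apply)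
  qed simp
  have X: "[:0, 1:] = [:- 1, 1:] + (1 :: 'k poly)" by (simp add: one_pCons)
  have "prime CHAR('k poly)" "r = CHAR('k poly)" using r by (simp_all add: CHAR_poly_eq)
  \<comment> \<open>The Frobenius identity is applied in the polynomial ring, because the
    endomorphisms themselves do not form a type.\<close>
  then have "([:- 1, 1:] + 1 :: 'k poly) ^ r = [:- 1, 1:] ^ r + 1 ^ r" by (rule freshmans_dream)
  then have "[:- 1, 1:] ^ r + 1 = monom (1::'k) r"
    unfolding X[symmetric] monom_altdef by (simp only: smult_1_left power_one)
  then have pv: "pact ([:- 1, 1:] ^ r) v + v = (f ^^ r) v" for v
    using pact_add[of "[:- 1, 1:] ^ r" 1 v] pact_monom[of 1 r v] by simp
  have nil: "(D ^^ r) v = 0" if "v \<in> S" for v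
    using pv[of v] unfolding pactD per[OF that] by simp
  have Dk: "(D ^^ n) v \<in> S" if "v \<in> S" for n v using that DS by (induction n) auto
  have D0: "D 0 = 0" by (simp add: D_def f_0)
  have Dadd: "(D ^^ n) (v + w) = (D ^^ n) v + (D ^^ n) w" for n v w by (induction n) (simp_all add: D)
  have Ddiff: "(D ^^ n) (v - w) = (D ^^ n) v - (D ^^ n) w" for n v w
    using Dadd[of n "v - w" w] by simp
  have Ddiff1: "D (v - w) = D v - D w" for v w using Ddiff[of 1] by simp
  have Dn0: "(D ^^ n) 0 = 0" for n by (induction n) (simp_all add: D0)
  have le: "card {v \<in> S. (D ^^ n) v = 0} \<le> card {v \<in> S. f v = v} ^ n" for n
  proof (induction n)
    case 0
    have "{v \<in> S. (D ^^ 0) v = 0} = {0}" using subspace_0[OF S(2)] by auto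
    then show ?case by simp
  next
    case (Suc n)
    let ?A = "{v \<in> S. (D ^^ Suc n) v = 0}"
    have "card ?A = card {v \<in> ?A. D v = 0} * card (D ` ?A)"
      by (rule card_eq_card_kernel_times_card_image)
        (simp_all add: S(1) subspace_diff[OF S(2)] subspace_add[OF S(2)] D Dadd Ddiff Ddiff1 flip: funpow_Suc_right)
    also have "{v \<in> ?A. D v = 0} = {v \<in> S. f v = v}"
      by (auto simp: D_def funpow_swap1 Dn0[unfolded D_def])
        (metis D_def Dn0 eq_iff_diff_eq_0)
    also have "card (D ` ?A) \<le> card {v \<in> S. (D ^^ n) v = 0}"
      using S(1) DS by (intro card_mono) (auto simp: funpow_swap1)
    also have "\<dots> \<le> card {v \<in> S. f v = v} ^ n" by (rule Suc.IH)
    finally show ?case by simp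
  qed
  have "{v \<in> S. (D ^^ r) v = 0} = S" using nil by blast
  then show ?thesis using le[of r] by (simp only:)
qed

end

subsection \<open>Reduction to prime fields\<close>

context sl2_module
begin

lemma endo: "g \<in> carrier SL2 \<Longrightarrow> finite_module_endo scale (act g)"
  by unfold_locales (simp_all add: act_add act_scale)

lemma funpow_act: "g \<in> carrier SL2 \<Longrightarrow> (act g ^^ n) v = act (g [^]\<^bsub>SL2\<^esub> n) v"
proof (induction n)
  case (Suc n)
  have "g [^]\<^bsub>SL2\<^esub> Suc n = g \<otimes>\<^bsub>SL2\<^esub> g [^]\<^bsub>SL2\<^esub> n" using SL2.nat_pow_Suc2[OF Suc.prems] .
  then show ?case using Suc act_mult[OF Suc.prems SL2.nat_pow_closed[OF Suc.prems]] by simp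
qed simp

lemma CHAR_k: "CHAR('k) = q"
proof -
  have "of_nat q = (0::'k)" using of_nat_eq_0_iff_CARD_prime_power[OF prime_q, of 1 q] card_k by simp
  then have "CHAR('k) dvd q" using of_nat_eq_0_iff_char_dvd by blast
  moreover have "CHAR('k) \<noteq> 1" by simp
  ultimately show ?thesis using prime_q by (metis prime_nat_iff)
qed

lemma card_le_card_Fix_power:
  assumes g: "g \<in> carrier SL2" and S: "subspace S" "\<And>v. v \<in> S \<Longrightarrow> act g v \<in> S"
    and pow: "\<And>v. v \<in> S \<Longrightarrow> act (g [^]\<^bsub>SL2\<^esub> q) v = v"
  shows "card S \<le> card {v \<in> S. act g v = v} ^ q"
  using finite_module_endo.card_le_card_fixed_power[OF endo[OF g] finite_V S CHAR_k prime_q]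
    pow funpow_act[OF g] by simp

lemma diag2_mult_unip: "x \<noteq> 0 \<Longrightarrow> diag2 x ** unip u = unip (x * x * u) ** diag2 (x::'f)"
  by (simp add: diag2_def unip_def)

lemma act_diag2_unip: "x \<noteq> 0 \<Longrightarrow> act (diag2 x) (act (unip u) v) = act (unip (x * x * u)) (act (diag2 x) v)"
  using diag2_mult_unip[of x u] act_mult[of "diag2 x" "unip u" v] act_mult[of "unip (x * x * u)" "diag2 x" v] by simp

lemma Nm_act_diag2:
  assumes "x \<noteq> 0"
  shows "Nm (act (diag2 x) v) = act (diag2 x) (Nm v)"
proof -
  have "act (diag2 x) (Nm v) = (\<Sum>u\<in>UNIV. act (unip (x * x * u)) (act (diag2 x) v))"
    using assms by (simp add: Nm_def act_sum act_diag2_unip)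
  also have "\<dots> = (\<Sum>u\<in>(\<lambda>u. x * x * u) ` UNIV. act (unip u) (act (diag2 x) v))"
    using assms by (subst sum.reindex) (auto simp: inj_on_def)
  also have "(\<lambda>u. x * x * u) ` UNIV = UNIV"
  proof -
    have "u = x * x * (u / (x * x))" for u using assms by simp
    then show ?thesis by blast
  qed
  finally show ?thesis by (simp add: Nm_def)
qed

lemma act_diag2_W: "x \<noteq> 0 \<Longrightarrow> v \<in> W \<Longrightarrow> act (diag2 x) v \<in> W"
  by (simp add: W_def Nm_act_diag2)

lemma act_diag2_mult: "x \<noteq> 0 \<Longrightarrow> y \<noteq> 0 \<Longrightarrow> act (diag2 (x * y)) v = act (diag2 x) (act (diag2 y) v)"
  using act_mult[of "diag2 x" "diag2 y" v] by (simp add: diag2_mult)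

text \<open>Averaging over the conjugates of \<open>K\<close> under the unipotent group gives a nonzero multiple of the
  identity on \<open>W\<close>, because every other element of \<open>U K\<close> contributes a multiple of the norm map.\<close>

lemma exists_torus_fixed_in_W:
  assumes K: "finite K" "1 \<in> K" "0 \<notin> K" "\<And>x y. x \<in> K \<Longrightarrow> y \<in> K \<Longrightarrow> x * y \<in> K" "\<And>x. x \<in> K \<Longrightarrow> x * x = 1 \<Longrightarrow> x = 1"
  shows "\<exists>v\<in>W. v \<noteq> 0 \<and> (\<forall>x\<in>K. act (diag2 x) v = v)"
proof -
  obtain w where w: "w \<in> W" "w \<noteq> 0" using W_nonzero by blast
  define c where "c u = (\<Sum>x\<in>K. act (diag2 x) (act (unip u) w))" for u
  have cW: "c u \<in> W" for u
    unfolding c_def using K(3) w(1) by (intro subspace_sum[OF subspace_W] act_diag2_W act_unip_W) auto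
  have cK: "act (diag2 x) (c u) = c u" if x: "x \<in> K" for x u
  proof -
    have x0: "x \<noteq> 0" using x K(3) by auto
    have "act (diag2 x) (c u) = (\<Sum>y\<in>K. act (diag2 (x * y)) (act (unip u) w))"
    proof -
      have "y \<noteq> 0" if "y \<in> K" for y using that K(3) by auto
      then show ?thesis unfolding c_def using x0 by (simp add: act_sum act_diag2_mult cong: sum.cong)
    qed
    also have "\<dots> = (\<Sum>y\<in>(\<lambda>y. x * y) ` K. act (diag2 y) (act (unip u) w))"
      using x0 by (subst sum.reindex) (auto simp: inj_on_def)
    also have "(\<lambda>y. x * y) ` K = K"
      using K(1,4) x x0 by (intro endo_inj_surj) (auto simp: inj_on_def)
    finally show ?thesis by (simp add: c_def)
  qed
  have "\<exists>u. c u \<noteq> 0"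
  proof (rule ccontr)
    assume "\<nexists>u. c u \<noteq> 0"
    then have "0 = (\<Sum>u\<in>UNIV. act (unip (- u)) (c u))" by simp
    also have "\<dots> = (\<Sum>x\<in>K. \<Sum>u\<in>UNIV. act (unip (- u)) (act (diag2 x) (act (unip u) w)))"
      by (simp add: c_def act_sum sum.swap[of _ K])
    also have "\<dots> = (\<Sum>x\<in>K. if x = 1 then scale (of_nat CARD('f)) w else 0)"
    proof (rule sum.cong[OF refl])
      fix x assume x: "x \<in> K"
      then have x0: "x \<noteq> 0" using K(3) by auto
      have eq: "act (unip (- u)) (act (diag2 x) (act (unip u) w)) = act (unip ((x * x - 1) * u)) (act (diag2 x) w)" for u
      proof -
        have "act (unip (- u)) (act (diag2 x) (act (unip u) w)) = act (unip (- u + x * x * u)) (act (diag2 x) w)"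
          by (simp only: act_diag2_unip[OF x0] act_unip_add)
        then show ?thesis by (simp add: algebra_simps)
      qed
      show "(\<Sum>u\<in>UNIV. act (unip (- u)) (act (diag2 x) (act (unip u) w))) = (if x = 1 then scale (of_nat CARD('f)) w else 0)"
      proof (cases "x = 1")
        case True
        have "act (unip 0) v = v" "act (diag2 1) v = v" for v by (simp_all add: unip_def diag2_def)
        then show ?thesis unfolding eq using True by (simp add: sum_const_scale)
      next
        case False
        then have xx: "x * x - 1 \<noteq> 0" using K(5)[OF x] by auto
        have "(\<Sum>u\<in>UNIV. act (unip ((x * x - 1) * u)) (act (diag2 x) w)) = (\<Sum>u\<in>(\<lambda>u. (x * x - 1) * u) ` UNIV. act (unip u) (act (diag2 x) w))"
          using xx by (subst sum.reindex) (auto simp: inj_on_def)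
        also have "(\<lambda>u. (x * x - 1) * u) ` UNIV = UNIV"
        proof -
          have "u = (x * x - 1) * (u / (x * x - 1))" for u using xx by simp
          then show ?thesis by blast
        qed
        also have "(\<Sum>u\<in>UNIV. act (unip u) (act (diag2 x) w)) = 0"
          using act_diag2_W[OF x0 w(1)] by (simp add: W_def Nm_def)
        finally show ?thesis unfolding eq using False by simp
      qed
    qed
    also have "\<dots> = scale (of_nat CARD('f)) w" using K(1,2) by simp
    finally show False using of_nat_scale_eq_0[of "CARD('f)" w] w(2) q_not_dvd_t_power card_f by simp
  qed
  then show ?thesis using cW cK by blast
qed

text \<open>Summing a vector of \<open>W\<close> over a subgroup of order \<open>t\<close> gives a
  vector fixed by that subgroup, hence 0. In a larger field there are subgroups of order
  \<open>t * t\<close>; covering one by its subgroups of order \<open>t\<close> and adding up yields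
  \<open>t\<close> times the vector, which is not 0.\<close>

lemma W_fixed_unip_trivial_imp_prime:
  assumes fpf: "\<And>x w. x \<noteq> 0 \<Longrightarrow> w \<in> W \<Longrightarrow> act (unip x) w = w \<Longrightarrow> w = 0"
  shows "CARD('f) = t"
proof (rule ccontr)
  assume ne: "CARD('f) \<noteq> t"
  obtain w where w: "w \<in> W" "w \<noteq> 0" using W_nonzero by blast
  have t0: "of_nat t = (0::'f)" using of_nat_eq_0_iff_CARD_prime_power[OF prime_t card_f, of t] by simp
  have tpos: "t > 0" using prime_t prime_gt_0_nat by blast
  define M where "M x v = (\<Sum>i<t. act (unip (of_nat i * x)) v)" for x :: 'f and v
  have M: "M x v = 0" if "x \<noteq> 0" "v \<in> W" for x v
  proof (rule fpf[OF that(1)])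
    show "M x v \<in> W" unfolding M_def using that(2) by (intro subspace_sum[OF subspace_W] act_unip_W)
    have "act (unip x) (M x v) = (\<Sum>i<t. act (unip (of_nat (Suc i) * x)) v)"
      unfolding M_def by (simp add: act_sum act_unip_add[symmetric] algebra_simps)
    also have "\<dots> = (\<Sum>i<Suc t. act (unip (of_nat i * x)) v) - act (unip (of_nat 0 * x)) v"
      unfolding sum.lessThan_Suc_shift by simp
    also have "\<dots> = M x v" by (simp add: M_def t0)
    finally show "act (unip x) (M x v) = M x v" .
  qed
  have "card ((of_nat :: nat \<Rightarrow> 'f) ` {..<t}) \<le> t" using card_image_le[of "{..<t}" "of_nat :: nat \<Rightarrow> 'f"] by simp
  moreover have "t < CARD('f)"
  proof -
    have "a \<noteq> 0" using card_f card_f_ge by (cases a) auto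
    then have "t dvd CARD('f)" using card_f by simp
    then show ?thesis using ne dvd_imp_le[of t "CARD('f)"] by simp
  qed
  ultimately have "(of_nat :: nat \<Rightarrow> 'f) ` {..<t} \<noteq> UNIV" by auto
  then obtain \<gamma> :: 'f where \<gamma>: "\<gamma> \<notin> of_nat ` {..<t}" by blast
  have \<gamma>j: "\<gamma> + of_nat j \<noteq> 0" if "j < t" for j
  proof
    assume "\<gamma> + of_nat j = 0"
    then have "\<gamma> = of_nat t - of_nat j" using t0 by (simp add: eq_neg_iff_add_eq_0)
    \<comment> \<open>The reduction modulo \<open>t\<close> keeps the representative below
      \<open>t\<close> when j = 0.\<close>
    then have "\<gamma> = of_nat ((t - j) mod t)"
      using that t0 by (cases "j = 0") (simp_all add: of_nat_diff)
    then show False using \<gamma> tpos by auto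
  qed
  \<comment> \<open>Regrouped by \<open>i\<close>, the double sum consists of translates of the
    vanishing sums \<open>M (of_nat i) w\<close>, except that i = 0 contributes \<open>w\<close>
    exactly \<open>t\<close> times.\<close>
  have "0 = (\<Sum>j<t. M (\<gamma> + of_nat j) w)" using M \<gamma>j w(1) by simp
  also have "\<dots> = (\<Sum>i<t. \<Sum>j<t. act (unip (of_nat i * (\<gamma> + of_nat j))) w)"
    unfolding M_def by (rule sum.swap)
  also have "\<dots> = (\<Sum>i<t. act (unip (of_nat i * \<gamma>)) (M (of_nat i) w))"
    unfolding M_def by (simp add: act_sum act_unip_add[symmetric] algebra_simps)
  also have "\<dots> = (\<Sum>i<t. if i = 0 then scale (of_nat t) w else 0)"
  proof (rule sum.cong[OF refl])
    fix i assume i: "i \<in> {..<t}"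
    have u0: "act (unip 0) v = v" for v by (simp add: unip_def)
    show "act (unip (of_nat i * \<gamma>)) (M (of_nat i) w) = (if i = 0 then scale (of_nat t) w else 0)"
    proof (cases "i = 0")
      case True
      then show ?thesis by (simp add: M_def u0 sum_const_scale)
    next
      case False
      then have "\<not> t dvd i" using i by (auto dest: dvd_imp_le)
      then have "of_nat i \<noteq> (0::'f)" using of_nat_eq_0_iff_CARD_prime_power[OF prime_t card_f] by blast
      then show ?thesis using M[OF _ w(1)] False by simp
    qed
  qed
  also have "\<dots> = scale (of_nat t) w" using tpos by simp
  finally show False using of_nat_scale_eq_0[of t w] w(2) q_not_dvd_t_power[of 1] by simp
qed

lemma normal_vectors_D:
  assumes "v \<in> normal_vectors SL2 act P" "g \<in> carrier SL2" "act g v = v"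
  shows "g \<in> norm_set SL2 P"
  using assms by (auto simp: normal_vectors_def stabilizer_iff)

text \<open>The single unipotent identifies the conjugate as \<open>unip_group\<close> itself, which
  then fixes \<open>v\<close>.\<close>

lemma normal_vectors_conj_unip_group:
  assumes "z \<in> carrier SL2" "v \<in> normal_vectors SL2 act (conj_set SL2 unip_group z)"
    and "x \<noteq> 0" "act (unip x) v = v"
  shows "v \<in> Fix unip_group"
proof -
  have "conj_set SL2 unip_group z = unip_group"
    using unip_normalizes_conj_unip_group[OF assms(1,3)] normal_vectors_D[OF assms(2) unip_in_SL2 assms(4)] by blast
  then have "unip_group \<subseteq> stabilizer SL2 act v" using assms(2) by (simp add: normal_vectors_def)
  then show ?thesis using subset_stabilizer_iff[OF unip_group_carrier] by blast
qed

text \<open>The hypothesis allows arbitrary odd primes, so it follows from each of the three covers.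
  In odd characteristic a vector of \<open>W\<close> with a nontrivial unipotent in its stabilizer
  contradicts it; in characteristic 2 one takes a vector fixed by one unipotent and negated by
  another, so that two different involutions normalize the same \<open>P\<close>.\<close>

theorem prime_field_if_covered:
  assumes cover: "\<And>v. v \<noteq> 0 \<Longrightarrow> (\<exists>r P. odd_sylow r P \<and> v \<in> normal_vectors SL2 act P) \<or>
     (\<exists>z\<in>carrier SL2. v \<in> normal_vectors SL2 act (conj_set SL2 unip_group z))"
  shows "CARD('f) = t \<and> (2::'f) \<noteq> 0"
proof -
  have two: "(2::'f) \<noteq> 0"
  proof
    assume two: "(2::'f) = 0"
    then have "t dvd 2" using of_nat_eq_0_iff_CARD_prime_power[OF prime_t card_f, of 2] by simp
    then have "t = 2" using prime_t by (metis primes_dvd_imp_eq two_is_prime_nat)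
    then have two_k: "scale (of_nat 2) v = 0 \<Longrightarrow> v = 0" for v
      using of_nat_scale_eq_0[of 2 v] q_not_dvd_t_power[of 1] by simp
    have xx: "x + x = 0" for x :: 'f using two by (metis mult_2 mult_zero_left)
    have u0: "act (unip 0) v = v" for v by (simp add: unip_def)
    have invol: "act (unip x) (act (unip x) v) = v" for x v using act_unip_add[of x x v] by (simp add: xx u0)
    obtain w where w: "w \<in> W" "w \<noteq> 0" using W_nonzero by blast
    then have "w \<notin> Fix unip_group" using W_Fix_unip by blast
    then obtain x where x: "act (unip x) w \<noteq> w" by (auto simp: Fix_def)
    define v1 where "v1 = w - act (unip x) w"
    have v1: "v1 \<noteq> 0" "act (unip x) v1 = - v1" using x by (auto simp: v1_def act_diff invol)
    have x0: "x \<noteq> 0" using x u0 by auto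
    have "\<not> UNIV \<subseteq> {0, x}" using card_mono[of "{0, x}" UNIV] card_f_ge x0 by auto
    then obtain y where y: "y \<noteq> 0" "y \<noteq> x" by blast
    have comm: "act (unip x) (act (unip y) v) = act (unip y) (act (unip x) v)" for v
      using act_unip_add[of x y v] act_unip_add[of y x v] by (simp add: add.commute)
    \<comment> \<open>Either the \<open>y\<close>-symmetrization of \<open>v1\<close> is nonzero and
      serves as \<open>v\<close>, or \<open>y\<close> also negates \<open>v1\<close>, and then
      \<open>x + y\<close> fixes it.\<close>
    obtain v y where v: "v \<noteq> 0" "act (unip x) v = - v" "act (unip y) v = v" "y \<noteq> 0" "y \<noteq> x"
    proof (cases "v1 + act (unip y) v1 = 0")
      case False
      show ?thesis
        by (rule that[of "v1 + act (unip y) v1" y]) (use False y v1 in \<open>simp_all add: act_add act_neg comm invol add.commute\<close>)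
    next
      case True
      then have "act (unip y) v1 = - v1" by (metis minus_unique)
      then have "act (unip (x + y)) v1 = v1" by (simp add: act_unip_add act_neg v1)
      moreover have "x + y \<noteq> 0" using y xx by (metis add_left_cancel)
      ultimately show ?thesis using that[of v1 "x + y"] v1 y by simp
    qed
    have "- v \<noteq> v"
    proof
      assume "- v = v"
      then have "v + v = 0" by (metis add.left_inverse)
      then have "scale (of_nat 2) v = 0" using scale_left_distrib[of 1 1 v] by simp
      then show False using two_k v(1) by blast
    qed
    have vF: "v \<notin> Fix unip_group"
    proof
      assume "v \<in> Fix unip_group"
      then have "act (unip x) v = v" by (simp add: Fix_def)
      then show False using v(2) \<open>- v \<noteq> v\<close> by simp
    qed
    obtain r P where P: "odd_sylow r P" "v \<in> normal_vectors SL2 act P"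
      using cover[OF v(1)] normal_vectors_conj_unip_group[OF _ _ v(4,3)] vF by blast
    have Ps: "subgroup P SL2" using odd_sylow_subgroup[OF P(1)] .
    \<comment> \<open>A vector and its negative have the same stabilizer, so the conjugate of
      \<open>P\<close> by \<open>unip x\<close> still fixes \<open>v\<close>; this makes
      \<open>unip x\<close> normalize \<open>P\<close>.\<close>
    have "conj_set SL2 P (unip x) \<subseteq> norm_set SL2 P"
    proof
      fix h assume h: "h \<in> conj_set SL2 P (unip x)"
      have hS: "h \<in> carrier SL2" using h subgroup.subset[OF SL2.subgroup_conj_set[OF Ps unip_in_SL2]] by blast
      have "unip x \<otimes>\<^bsub>SL2\<^esub> h \<otimes>\<^bsub>SL2\<^esub> inv\<^bsub>SL2\<^esub> (unip x) \<in> P"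
        using SL2.mem_conj_set_iff[OF Ps unip_in_SL2 hS] h by blast
      then have "h \<in> conj_set SL2 P (unip x)" "P \<subseteq> stabilizer SL2 act v" using h P(2) by (auto simp: normal_vectors_def)
      then have "v \<in> Fix P" by (auto simp: Fix_def stabilizer_iff)
      moreover have "v \<in> Fix P \<Longrightarrow> - v \<in> Fix P"
        using subspace_neg[OF subspace_Fix[OF subgroup.subset[OF Ps]]] by blast
      ultimately have "act (unip x) v \<in> Fix P" using v(2) by simp
      then have "v \<in> Fix (conj_set SL2 P (unip x))"
        using Fix_conj_set[OF unip_in_SL2 subgroup.subset[OF Ps]] by blast
      then have "act h v = v" using h by (simp add: Fix_def)
      then show "h \<in> norm_set SL2 P" using normal_vectors_D[OF P(2) hS] by blast
    qed
    then have eq: "P = conj_set SL2 P (unip x)"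
      using P(1) by (intro SL2.sylow_eq_if_normalizing[of r]) (auto simp: odd_sylow_def SL2.sylow_conj_set)
    have "unip x \<in> norm_set SL2 P"
      unfolding norm_set_def
    proof (intro CollectI conjI ballI)
      fix g assume g: "g \<in> P"
      then have "g \<in> conj_set SL2 P (unip x)" using eq by blast
      then show "unip x \<otimes>\<^bsub>SL2\<^esub> g \<otimes>\<^bsub>SL2\<^esub> inv\<^bsub>SL2\<^esub> (unip x) \<in> P"
        using SL2.mem_conj_set_iff[OF Ps unip_in_SL2 subgroup.mem_carrier[OF Ps g]] by blast
    qed simp
    then show False
      using unips_not_in_norm_set_char_2[OF two P(1) x0 v(4)] normal_vectors_D[OF P(2) unip_in_SL2 v(3)] v(5) by blast
  qed
  moreover have "CARD('f) = t"
  proof (rule W_fixed_unip_trivial_imp_prime, rule ccontr)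
    fix x :: 'f and w assume w: "x \<noteq> 0" "w \<in> W" "act (unip x) w = w" "w \<noteq> 0"
    then have "w \<notin> Fix unip_group" using W_Fix_unip by blast
    then obtain r P where P: "odd_sylow r P" "w \<in> normal_vectors SL2 act P"
      using cover[OF w(4)] normal_vectors_conj_unip_group[OF _ _ w(1,3)] by blast
    then show False using unip_not_in_norm_set[OF two P(1) w(1)] normal_vectors_D[OF P(2) unip_in_SL2 w(3)] by blast
  qed
  ultimately show ?thesis by blast
qed

end

subsection \<open>Lower bounds for modules over prime fields\<close>

locale sl2_prime_module = sl2_module act scale t a q
  for act :: "'f::{field,finite} ^ 2 ^ 2 \<Rightarrow> 'v::ab_group_add \<Rightarrow> 'v"
    and scale :: "'k::{field,finite} \<Rightarrow> 'v \<Rightarrow> 'v" and t a q +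
  assumes card_t: "CARD('f) = t" and two: "(2::'f) \<noteq> 0"
begin

lemma surj_of_nat: "\<exists>i. x = (of_nat i :: 'f)"
proof -
  have "inj_on (of_nat :: nat \<Rightarrow> 'f) {..<t}"
  proof (rule linorder_inj_onI')
    fix i j assume ij: "i \<in> {..<t}" "j \<in> {..<t}" "i < j"
    show "of_nat i \<noteq> (of_nat j :: 'f)"
    proof
      assume "of_nat i = (of_nat j :: 'f)"
      then have "of_nat (j - i) = (0::'f)" using ij by (simp add: of_nat_diff)
      then have "t dvd j - i" using of_nat_eq_0_iff_CARD_prime_power[OF prime_t card_f] by blast
      then show False using ij by (auto dest: dvd_imp_le)
    qed
  qed
  then have "card ((of_nat :: nat \<Rightarrow> 'f) ` {..<t}) = CARD('f)" by (simp add: card_image card_t)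
  then have "(of_nat :: nat \<Rightarrow> 'f) ` {..<t} = UNIV" by (intro card_subset_eq) auto
  then show ?thesis by blast
qed

lemma unip_fixed_W:
  assumes "x \<noteq> 0" "w \<in> W" "act (unip x) w = w"
  shows "w = 0"
proof -
  have "act (unip (of_nat i * x)) w = w" for i
  proof (induction i)
    case 0
    then show ?case by (simp add: unip_def)
  next
    case (Suc i)
    then show ?case using assms(3) act_unip_add[of x "of_nat i * x" w] by (simp add: algebra_simps)
  qed
  moreover have "\<exists>i. y = of_nat i * x" for y
    using surj_of_nat[of "y / x"] assms(1) by (metis nonzero_eq_divide_eq)
  ultimately have "act (unip y) w = w" for y by metis
  then have "w \<in> Fix unip_group" by (auto simp: Fix_def)
  then show ?thesis using W_Fix_unip assms(2) by blast
qed

text \<open>A Vandermonde argument: the commuting operators \<open>act (unip m)\<close> have differences that are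
  injective on \<open>W\<close>, so a polynomial of degree less than \<open>card M\<close> with coefficients in \<open>W\<close> and all
  these operators as roots vanishes.\<close>

lemma vandermonde:
  assumes "finite M" "\<And>i. y i \<in> W"
    and "\<And>m. m \<in> M \<Longrightarrow> (\<Sum>i<card M. act (unip (of_nat i * m)) (y i)) = 0"
    and "i < card M"
  shows "y i = 0"
  using assms
proof (induction M arbitrary: y i rule: finite_induct)
  case (insert m0 M)
  let ?k = "card M"
  have ck: "card (insert m0 M) = Suc ?k" using insert.hyps by simp
  \<comment> \<open>Synthetic division by the root \<open>m0\<close>: these are the coefficients of
    the quotient. The shift \<open>i - 1 - j\<close> starts at 0 for
    \<open>i = Suc j\<close>.\<close>
  define b where "b j = (\<Sum>i=Suc j..?k. act (unip (of_nat (i - 1 - j) * m0)) (y i))" for j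
  have bW: "b j \<in> W" for j
    unfolding b_def using insert.prems(1) by (intro subspace_sum[OF subspace_W] act_unip_W)
  have y0: "(\<Sum>i\<le>?k. act (unip (of_nat i * m)) (y i)) = 0" if "m \<in> insert m0 M" for m
    using insert.prems(2)[OF that] unfolding ck lessThan_Suc_atMost .
  have "b j = 0" if "j < ?k" for j
  proof (rule insert.IH[OF bW _ that])
    fix m assume m: "m \<in> M"
    let ?D = "\<Sum>j<?k. act (unip (of_nat j * m)) (b j)"
    \<comment> \<open>The factorization of a difference of \<open>i\<close>-th powers for the two
      commuting operators \<open>act (unip m)\<close> and \<open>act (unip m0)\<close>.\<close>
    have tel: "act (unip m) (\<Sum>j<i. act (unip (of_nat j * m + of_nat (i - 1 - j) * m0)) w)
        - act (unip m0) (\<Sum>j<i. act (unip (of_nat j * m + of_nat (i - 1 - j) * m0)) w)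
        = act (unip (of_nat i * m)) w - act (unip (of_nat i * m0)) w" for i w
    proof -
      define g where "g j = act (unip (of_nat j * m + of_nat (i - j) * m0)) w" for j
      have 1: "act (unip m) (act (unip (of_nat j * m + of_nat (i - 1 - j) * m0)) w) = g (Suc j)" for j
        unfolding g_def act_unip_add[symmetric] by (simp add: algebra_simps)
      have 2: "act (unip m0) (act (unip (of_nat j * m + of_nat (i - 1 - j) * m0)) w) = g j" if "j < i" for j
      proof -
        have "i - j = Suc (i - 1 - j)" using that by simp
        then have "m0 + (of_nat j * m + of_nat (i - 1 - j) * m0) = of_nat j * m + of_nat (i - j) * m0"
          by (simp add: algebra_simps)
        then show ?thesis unfolding g_def act_unip_add[symmetric] by (simp only:)
      qed
      have "act (unip m) (\<Sum>j<i. act (unip (of_nat j * m + of_nat (i - 1 - j) * m0)) w)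
        - act (unip m0) (\<Sum>j<i. act (unip (of_nat j * m + of_nat (i - 1 - j) * m0)) w)
        = (\<Sum>j<i. g (Suc j)) - (\<Sum>j<i. g j)"
      proof -
        have "act (unip m) (\<Sum>j<i. act (unip (of_nat j * m + of_nat (i - 1 - j) * m0)) w) = (\<Sum>j<i. g (Suc j))"
          unfolding act_sum[OF unip_in_SL2] by (rule sum.cong[OF refl]) (rule 1)
        moreover have "act (unip m0) (\<Sum>j<i. act (unip (of_nat j * m + of_nat (i - 1 - j) * m0)) w) = (\<Sum>j<i. g j)"
          unfolding act_sum[OF unip_in_SL2] by (rule sum.cong[OF refl]) (rule 2, simp)
        ultimately show ?thesis by (simp only:)
      qed
      also have "\<dots> = g i - g 0" by (simp add: sum_subtractf[symmetric] sum_lessThan_telescope)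
      finally show ?thesis by (simp add: g_def)
    qed
    have "?D = (\<Sum>j<?k. \<Sum>i=Suc j..?k. act (unip (of_nat j * m + of_nat (i - 1 - j) * m0)) (y i))"
      unfolding b_def by (simp add: act_sum act_unip_add)
    also have "\<dots> = (\<Sum>i\<le>?k. \<Sum>j<i. act (unip (of_nat j * m + of_nat (i - 1 - j) * m0)) (y i))"
      by (rule sum.nested_swap'[symmetric])
    finally have D: "?D = (\<Sum>i\<le>?k. \<Sum>j<i. act (unip (of_nat j * m + of_nat (i - 1 - j) * m0)) (y i))" .
    have "act (unip m) ?D - act (unip m0) ?D
       = (\<Sum>i\<le>?k. act (unip (of_nat i * m)) (y i)) - (\<Sum>i\<le>?k. act (unip (of_nat i * m0)) (y i))"
      unfolding D act_sum[OF unip_in_SL2, where I = "{..?k}"] sum_subtractf[symmetric]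
      by (rule sum.cong[OF refl]) (rule tel)
    also have "\<dots> = 0" using y0 m by simp
    finally have "act (unip (- m0)) (act (unip m) ?D) = act (unip (- m0)) (act (unip m0) ?D)" by simp
    moreover have "act (unip (- m0)) (act (unip m0) ?D) = ?D"
      unfolding act_unip_add[symmetric] by (simp add: unip_def)
    ultimately have "act (unip (- m0 + m)) ?D = ?D" unfolding act_unip_add by simp
    moreover have "- m0 + m \<noteq> 0" using m insert.hyps(2) by (auto simp: neg_eq_iff_add_eq_0)
    moreover have "?D \<in> W" using bW by (intro subspace_sum[OF subspace_W] act_unip_W)
    ultimately show "?D = 0" using unip_fixed_W by blast
  qed
  then have b0: "b j = 0" if "j < ?k" for j using that .
  \<comment> \<open>The recursion of synthetic division, read backwards: a vanishing quotient makes
    all coefficients but the constant one vanish.\<close>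
  have ySuc: "y (Suc j) = 0" if j: "j < ?k" for j
  proof -
    have "b j = (\<Sum>i=Suc j..?k. act (unip (of_nat (i - 1 - j) * m0)) (y i))" by (simp add: b_def)
    also have "\<dots> = y (Suc j) + (\<Sum>i=Suc (Suc j)..?k. act (unip (of_nat (i - 1 - j) * m0)) (y i))"
      using j by (subst sum.atLeast_Suc_atMost) (simp_all add: unip_def)
    also have "(\<Sum>i=Suc (Suc j)..?k. act (unip (of_nat (i - 1 - j) * m0)) (y i)) = act (unip m0) (b (Suc j))"
      unfolding b_def act_sum[OF unip_in_SL2]
    proof (rule sum.cong[OF refl])
      fix i assume "i \<in> {Suc (Suc j)..?k}"
      then have "i - 1 - j = Suc (i - 1 - Suc j)" by auto
      then show "act (unip (of_nat (i - 1 - j) * m0)) (y i) = act (unip m0) (act (unip (of_nat (i - 1 - Suc j) * m0)) (y i))"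
        unfolding act_unip_add[symmetric] by (simp add: algebra_simps)
    qed
    also have "b (Suc j) = 0"
    proof (cases "Suc j < ?k")
      case False
      then show ?thesis by (simp add: b_def)
    qed (rule b0)
    finally show ?thesis using b0[OF j] by simp
  qed
  have "(\<Sum>i\<le>?k. act (unip (of_nat i * m0)) (y i)) = (\<Sum>i\<le>?k. if i = 0 then y 0 else 0)"
  proof (rule sum.cong[OF refl])
    fix i assume "i \<in> {..?k}"
    then show "act (unip (of_nat i * m0)) (y i) = (if i = 0 then y 0 else 0)"
      using ySuc by (cases i) (simp_all add: unip_def)
  qed
  then have "y 0 = 0" using y0[of m0] by simp
  then show ?case using insert.prems(3) ySuc unfolding ck by (cases i) auto
qed simp

text \<open>Sending a tuple of fixed vectors to the sum of the \<open>unip (of_nat i)\<close>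
  applied to its entries is injective into \<open>W\<close>: applying \<open>diag2 x\<close> to a
  relation replaces \<open>of_nat i\<close> by \<open>of_nat i * (x * x)\<close>, so every square
  from \<open>K\<close> is a root and \<open>vandermonde\<close> applies.\<close>

lemma torus_fixed_power_le:
  assumes K: "finite K" "0 \<notin> K"
  shows "card {w \<in> W. \<forall>x\<in>K. act (diag2 x) w = w} ^ card ((\<lambda>x. x * x) ` K) \<le> card W"
proof -
  let ?C = "{w \<in> W. \<forall>x\<in>K. act (diag2 x) w = w}"
  let ?M = "(\<lambda>x. x * x) ` K"
  let ?k = "card ?M"
  let ?h = "\<lambda>y :: nat \<Rightarrow> 'v. \<Sum>i<?k. act (unip (of_nat i)) (y i)"
  have K0: "x \<noteq> 0" if "x \<in> K" for x using that K(2) by auto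
  have "inj_on ?h ({..<?k} \<rightarrow>\<^sub>E ?C)"
  proof (rule inj_onI)
    fix y z assume yz: "y \<in> {..<?k} \<rightarrow>\<^sub>E ?C" "z \<in> {..<?k} \<rightarrow>\<^sub>E ?C" and eq: "?h y = ?h z"
    \<comment> \<open>Padded by 0, since \<open>vandermonde\<close> asks for coefficients in
      \<open>W\<close> at every index.\<close>
    define d where "d i = (if i < ?k then y i - z i else 0)" for i
    have dC: "d i \<in> ?C" for i
    proof (cases "i < ?k")
      case True
      then have "y i \<in> ?C" "z i \<in> ?C" using yz by auto
      then show ?thesis using True K0 by (simp add: d_def act_diff subspace_diff[OF subspace_W])
    next
      case False
      then show ?thesis using K0 by (simp add: d_def subspace_0[OF subspace_W])
    qed
    have d0: "(\<Sum>i<?k. act (unip (of_nat i)) (d i)) = 0"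
      using eq by (simp add: d_def act_diff sum_subtractf)
    have "d i = 0" if i: "i < ?k" for i
    proof (rule vandermonde[of ?M d i])
      fix m assume "m \<in> ?M"
      then obtain x where x: "x \<in> K" "m = x * x" by blast
      then have x0: "x \<noteq> 0" using K(2) by auto
      have "act (diag2 x) (\<Sum>i<?k. act (unip (of_nat i)) (d i)) = (\<Sum>i<?k. act (unip (of_nat i * m)) (d i))"
        unfolding act_sum[OF diag2_in_SL2[OF x0]]
      proof (rule sum.cong[OF refl])
        fix i
        have "act (diag2 x) (d i) = d i" using dC[of i] x(1) by blast
        then show "act (diag2 x) (act (unip (of_nat i)) (d i)) = act (unip (of_nat i * m)) (d i)"
          using act_diag2_unip[OF x0, of "of_nat i" "d i"] x(2) by (simp add: mult.commute)
      qed
      then show "(\<Sum>i<?k. act (unip (of_nat i * m)) (d i)) = 0" using d0 x0 by simp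
    qed (use K(1) dC i in auto)
    then have "y i = z i" if "i < ?k" for i using that by (auto simp: d_def)
    then show "y = z" using yz by (intro PiE_ext) auto
  qed
  moreover have "?h ` ({..<?k} \<rightarrow>\<^sub>E ?C) \<subseteq> W"
  proof (rule image_subsetI)
    fix y assume y: "y \<in> {..<?k} \<rightarrow>\<^sub>E ?C"
    have "act (unip (of_nat i)) (y i) \<in> W" if "i \<in> {..<?k}" for i
    proof -
      have "y i \<in> ?C" using PiE_mem[OF y that] .
      then show ?thesis by (intro act_unip_W) blast
    qed
    then show "?h y \<in> W" by (intro subspace_sum[OF subspace_W])
  qed
  ultimately have "card ({..<?k} \<rightarrow>\<^sub>E ?C) \<le> card W" by (intro card_inj_on_le) auto
  then show ?thesis by (simp add: card_PiE)
qed

text \<open>An annihilating polynomial of \<open>act (unip 1)\<close> on \<open>W\<close> also annihilates the conjugates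
  \<open>act (unip m)\<close> for all nonzero squares \<open>m\<close>, so its degree is at least their number.\<close>

lemma card_W_ge: "q ^ ((t - 1) div 2) \<le> card W"
proof -
  interpret E: finite_module_endo scale "act (unip 1)" by (rule endo) simp
  obtain p where p: "p \<noteq> 0" "q ^ degree p \<le> card W" "\<And>v. v \<in> W \<Longrightarrow> E.pact p v = 0"
    using E.annihilating_poly[OF finite_V subspace_W act_unip_W] card_k by auto
  let ?M = "(\<lambda>x::'f. x * x) ` (UNIV - {0})"
  have cM: "2 * card ?M = t - 1"
    using card_nonzero_squares[OF two] card_t by (simp add: power2_eq_square)
  have un: "(act (unip 1) ^^ i) v = act (unip (of_nat i)) v" for i v
  proof (induction i)
    case 0
    then show ?case by (simp add: unip_def)
  next
    case (Suc i)
    then show ?case by (simp add: act_unip_add)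
  qed
  have "card ?M \<le> degree p"
  proof (rule ccontr)
    assume "\<not> card ?M \<le> degree p"
    then have deg: "degree p < card ?M" by simp
    obtain w where w: "w \<in> W" "w \<noteq> 0" using W_nonzero by blast
    have "scale (coeff p i) w = 0" if "i < card ?M" for i
    proof (rule vandermonde[of ?M "\<lambda>i. scale (coeff p i) w", OF _ _ _ that])
      fix m assume "m \<in> ?M"
      then obtain x where x: "x \<noteq> 0" "m = x * x" by blast
      \<comment> \<open>Annihilating this vector and then applying \<open>diag2 x\<close> gives the
        relation at \<open>w\<close> itself, with \<open>unip 1\<close> replaced by
        \<open>unip (x * x)\<close>.\<close>
      define v where "v = act (inv\<^bsub>SL2\<^esub> (diag2 x)) w"
      have ix: "inv\<^bsub>SL2\<^esub> (diag2 x) = diag2 (1 / x)" by (rule inv_diag2[OF x(1)])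
      have vW: "v \<in> W" unfolding v_def ix using x(1) w(1) by (intro act_diag2_W) auto
      have dv: "act (diag2 x) v = w"
        unfolding v_def ix using x(1) act_diag2_mult[of x "1 / x" w] by (simp add: diag2_def)
      have "E.pact p v = (\<Sum>i\<le>card ?M - 1. scale (coeff p i) (act (unip (of_nat i)) v))"
        using deg by (subst E.pact_bound[of _ "card ?M - 1"]) (auto simp: un)
      also have "{..card ?M - 1} = {..<card ?M}" using deg by auto
      finally have "(\<Sum>i<card ?M. scale (coeff p i) (act (unip (of_nat i)) v)) = 0" using p(3)[OF vW] by simp
      then have "0 = act (diag2 x) (\<Sum>i<card ?M. scale (coeff p i) (act (unip (of_nat i)) v))" using x(1) by simp
      also have "\<dots> = (\<Sum>i<card ?M. act (unip (of_nat i * m)) (scale (coeff p i) w))"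
      proof -
        have "of_nat i * m = x * x * of_nat i" for i by (simp add: x(2) mult.commute)
        then show ?thesis
          unfolding act_sum[OF diag2_in_SL2[OF x(1)]]
          by (intro sum.cong[OF refl])
            (simp only: act_scale[OF diag2_in_SL2[OF x(1)]] act_diag2_unip[OF x(1)] dv act_scale[OF unip_in_SL2])
      qed
      finally show "(\<Sum>i<card ?M. act (unip (of_nat i * m)) (scale (coeff p i) w)) = 0" by simp
    qed (use w(1) subspace_scale[OF subspace_W] in auto)
    then have "coeff p (degree p) = 0" using deg w(2) by auto
    then show False using p(1) by simp
  qed
  moreover have "(t - 1) div 2 = card ?M" using cM by simp
  ultimately have "(t - 1) div 2 \<le> degree p" by simp
  then have "q ^ ((t - 1) div 2) \<le> q ^ degree p"
    using prime_q prime_gt_0_nat by (intro power_increasing) (auto simp: Suc_leI)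
  then show ?thesis using p(2) by simp
qed

end

subsection \<open>Exponential Diophantine equations\<close>

lemma odd_prime_dvd_power_2: "prime (p::nat) \<Longrightarrow> odd p \<Longrightarrow> p dvd 2 ^ k \<Longrightarrow> False"
  by (metis dvd_refl prime_dvd_power primes_dvd_imp_eq two_is_prime_nat)

lemma power_2_if_no_odd_prime_divisor:
  assumes "(m::nat) > 0" "\<And>p. prime p \<Longrightarrow> odd p \<Longrightarrow> \<not> p dvd m"
  shows "\<exists>k. m = 2 ^ k"
proof -
  obtain j where kj: "m = 2 ^ multiplicity 2 m * j" "odd j"
    using multiplicity_decompose'[of m 2] assms(1) by auto
  have "j = 1"
  proof (rule ccontr)
    assume "j \<noteq> 1"
    then obtain p where p: "prime p" "p dvd j" using prime_factor_nat by blast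
    then have "odd p" using kj(2) dvd_trans by blast
    moreover have "j dvd m" using kj(1) by (metis dvd_triv_right)
    then have "p dvd m" using p(2) dvd_trans by blast
    ultimately show False using assms(2) p(1) by blast
  qed
  then show ?thesis using kj(1) by (metis mult.right_neutral)
qed

text \<open>For n = 2 m + 1 the base is n (n + 1) / 2, the number of conjugates of \<open>R\<close>.
  From m to m + 1 its cube grows at most by 64 / 27, which is below 4.\<close>

lemma four_power_ge: "m \<ge> 14 \<Longrightarrow> ((2 * m + 1) * (m + 1)) ^ 3 \<le> 4 ^ (m::nat)"
proof (induction m rule: nat_induct_at_least)
  case base
  show ?case by simp
next
  case (Suc m)
  have "(2 * Suc m + 1) * (Suc m + 1) * 3 \<le> (2 * m + 1) * (m + 1) * 4"
  proof -
    obtain i where "m = 14 + i" using Suc.hyps le_Suc_ex by blast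
    then show ?thesis by (simp add: algebra_simps)
  qed
  then have "((2 * Suc m + 1) * (Suc m + 1) * 3) ^ 3 \<le> ((2 * m + 1) * (m + 1) * 4) ^ 3" by (rule power_mono) simp
  then have "((2 * Suc m + 1) * (Suc m + 1)) ^ 3 * 3 ^ 3 \<le> ((2 * m + 1) * (m + 1)) ^ 3 * 4 ^ 3"
    unfolding power_mult_distrib .
  also have "((2 * m + 1) * (m + 1)) ^ 3 * 4 ^ 3 \<le> 4 ^ m * 4 ^ 3" using Suc.IH by (rule mult_le_mono1)
  finally have "((2 * Suc m + 1) * (Suc m + 1)) ^ 3 * 3 ^ 3 \<le> 4 ^ m * 4 ^ 3" .
  moreover have "X * 3 ^ 3 \<le> Z * 4 ^ 3 \<Longrightarrow> X \<le> Z * 4" for X Z :: nat by simp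
  ultimately have "((2 * Suc m + 1) * (Suc m + 1)) ^ 3 \<le> 4 ^ m * 4" by blast
  then show ?case by (simp only: power_Suc2)
qed

text \<open>With its companion for the base, this turns one numerical bound on
  \<open>q ^ (2 * w)\<close> into a short list of pairs (q, w).\<close>

lemma exponent_less_if_power_less:
  assumes "q ^ (2 * w) < B" "B \<le> k ^ (2 * j)" "k \<le> q" "(k::nat) \<ge> 1"
  shows "w < j"
proof (rule ccontr)
  assume "\<not> w < j"
  then have "q ^ (2 * j) \<le> q ^ (2 * w)" using assms(3,4) by (intro power_increasing) auto
  moreover have "k ^ (2 * j) \<le> q ^ (2 * j)" using assms(3) by (rule power_mono) simp
  ultimately show False using assms(1,2) by simp
qed

lemma base_less_if_power_less:
  assumes "q ^ (2 * w) < B" "B \<le> k ^ (2 * j)" "j \<le> w" "(k::nat) \<ge> 1"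
  shows "q < k"
proof (rule ccontr)
  assume "\<not> q < k"
  then have "w < j" using exponent_less_if_power_less[OF assms(1,2)] assms(4) by simp
  then show False using assms(3) by simp
qed

lemma prime_odd_half: "prime (n::nat) \<Longrightarrow> n \<ge> 5 \<Longrightarrow> \<exists>m\<ge>2. n = 2 * m + 1"
  using prime_odd_nat[of n] by (auto elim!: oddE)

text \<open>Here \<open>q ^ w\<close>, \<open>q ^ f\<close>, \<open>q ^ y\<close> are the sizes of
  \<open>W\<close>, of the fixed space of \<open>U\<close>, and of the part of \<open>W\<close>
  fixed by \<open>R\<close>; \<open>F0\<close> counts the vectors fixed by \<open>R\<close> and
  \<open>U\<close>, \<open>M\<close> those belonging to \<open>R\<close> alone, and \<open>N\<close>
  the conjugates of \<open>R\<close>. The equation forces q^(w - y) < N, and 3 y \<le> w turns this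
  into q^(2 w) < N^3: exponential in \<open>n\<close> on the left, polynomial on the right.\<close>

lemma split_equation_solution:
  fixes n q r w y f F0 M N :: nat
  assumes n: "prime n" "n \<ge> 5" and r: "prime r" "odd r" "r dvd n - 1" and q: "prime q"
    and N: "2 * N = n * (n + 1)"
    and eq: "q ^ w * q ^ f = 1 + N * M + (n + 1) * (q ^ f - 1)"
    and M: "M + 2 * F0 \<le> q ^ y * F0 + 1" and F0: "1 \<le> F0" "F0 \<le> q ^ f"
    and y: "1 \<le> y" "3 * y \<le> w" and w: "(n - 1) div 2 \<le> w" and cong: "q ^ w mod n = 1"
  shows "n = 13 \<and> q = 3 \<and> w = 6 \<and> f = 0"
proof -
  obtain m where m: "m \<ge> 2" "n = 2 * m + 1" using prime_odd_half[OF n] by blast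
  have Nm: "N = (2 * m + 1) * (m + 1)" using N m(2) by simp
  have wm: "m \<le> w" using w m(2) by simp
  have q2: "q \<ge> 2" using q by (rule prime_ge_2_nat)
  have Y2: "q ^ y \<ge> 2" using y(1) q2 self_le_power[of q y] by simp
  have F1: "q ^ f \<ge> 1" using q2 by simp
  \<comment> \<open>The bound on \<open>M\<close> is inserted with \<open>F0\<close> enlarged to
    \<open>q ^ f\<close>. The second summand on the left is kept because it excludes positive
    \<open>f\<close> when n = 13.\<close>
  have key: "int (q ^ f) * (int (q ^ w) - 1) + (int (q ^ f) - 1) * (int N - int n) \<le> int (q ^ f) * (int N * (int (q ^ y) - 1))"
  proof -
    define W Y F where "W = int (q ^ w)" and "Y = int (q ^ y)" and "F = int (q ^ f)"
    have "int (q ^ f - 1) = F - 1" using F1 by (simp only: F_def of_nat_diff of_nat_1)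
    moreover have "W * F = int (1 + N * M + (n + 1) * (q ^ f - 1))"
      unfolding W_def F_def of_nat_mult[symmetric] eq ..
    ultimately have e: "W * F = 1 + int N * int M + (int n + 1) * (F - 1)"
      by (simp only: of_nat_add of_nat_mult of_nat_1)
    have "int (M + 2 * F0) \<le> int (q ^ y * F0 + 1)" using M by (simp only: of_nat_le_iff)
    then have "int M \<le> int F0 * (Y - 2) + 1" by (simp add: Y_def algebra_simps)
    also have "int F0 * (Y - 2) \<le> F * (Y - 2)"
      using F0(2) Y2 by (intro mult_right_mono) (simp_all add: F_def Y_def flip: of_nat_power)
    finally have "int N * int M \<le> int N * (F * (Y - 2) + 1)" by (intro mult_left_mono) simp_all
    then have "W * F \<le> 1 + int N * (F * (Y - 2) + 1) + (int n + 1) * (F - 1)" using e by simp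
    then have "F * (W - 1) + (F - 1) * (int N - int n) \<le> F * (int N * (Y - 1))" by (simp add: algebra_simps)
    then show ?thesis by (simp only: W_def Y_def F_def)
  qed
  have Nn: "int N - int n \<ge> 1" 
  proof -
    obtain i where "m = 2 + i" using m(1) le_Suc_ex by blast
    then have "n + 1 \<le> N" unfolding Nm m(2) by (simp add: algebra_simps)
    then show ?thesis by linarith
  qed
  have WY: "int (q ^ w) - 1 \<le> int N * (int (q ^ y) - 1)"
  proof -
    have "0 \<le> (int (q ^ f) - 1) * (int N - int n)" using F1 Nn by (intro mult_nonneg_nonneg) linarith+
    then have "int (q ^ f) * (int (q ^ w) - 1) \<le> int (q ^ f) * (int N * (int (q ^ y) - 1))" using key by linarith
    moreover have "0 < int (q ^ f)" using F1 by linarith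
    ultimately show ?thesis by (rule mult_left_le_imp_le)
  qed
  \<comment> \<open>Otherwise N q^y would be at most q^w, and the preceding inequality would give N
    \<le> 1.\<close>
  have ZN: "q ^ (w - y) < N"
  proof (rule ccontr)
    assume "\<not> q ^ (w - y) < N"
    then have "int N \<le> int (q ^ (w - y))" by (simp only: of_nat_le_iff not_less)
    then have "int N * int (q ^ y) \<le> int (q ^ (w - y)) * int (q ^ y)" by (intro mult_right_mono) simp_all
    also have "\<dots> = int (q ^ w)" using y by (simp flip: power_add of_nat_mult)
    finally have "int N * int (q ^ y) - 1 \<le> int N * (int (q ^ y) - 1)" using WY by linarith
    then have "int N \<le> 1" by (simp add: algebra_simps)
    then show False using Nn n(2) by linarith
  qed
  have B: "q ^ (2 * w) < N ^ 3"
  proof -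
    have "q ^ (2 * w) \<le> q ^ (3 * (w - y))" using y q2 by (intro power_increasing) auto
    also have "\<dots> = (q ^ (w - y)) ^ 3" by (simp add: power_mult[symmetric] mult.commute)
    also have "\<dots> < N ^ 3" using ZN by (intro power_strict_mono) auto
    finally show ?thesis .
  qed
  have m13: "m \<le> 13"
  proof (rule ccontr)
    assume "\<not> m \<le> 13"
    then have "((2 * m + 1) * (m + 1)) ^ 3 \<le> 4 ^ m" by (intro four_power_ge) simp
    also have "\<dots> = 2 ^ (2 * m)" by (simp add: power_mult)
    also have "\<dots> \<le> q ^ (2 * m)" using q2 by (rule power_mono) simp
    also have "\<dots> \<le> q ^ (2 * w)" using wm q2 by (intro power_increasing) auto
    finally show False using B unfolding Nm by simp
  qed
  \<comment> \<open>For odd \<open>m\<close> both \<open>N\<close> and n + 1 are even, so the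
    right-hand side of the equation is odd.\<close>
  have parity: "odd m \<Longrightarrow> q \<noteq> 2"
  proof
    assume "odd m" "q = 2"
    then have "even N" "even (n + 1)" unfolding Nm m(2) by simp_all
    then have "odd (1 + N * M + (n + 1) * (q ^ f - 1))" by simp
    moreover have "even (q ^ w * q ^ f)" using \<open>q = 2\<close> wm m(1) by simp
    ultimately show False using eq by simp
  qed
  have r_no: "n - 1 \<noteq> 2 ^ k" for k using odd_prime_dvd_power_2[of r k] r by metis
  \<comment> \<open>These give composite \<open>n\<close>. Next, n = 5 and n = 17 fall because n - 1
    is a power of 2; what remains is 7, 11, 13, 19, 23.\<close>
  have "m \<noteq> 4" "m \<noteq> 7" "m \<noteq> 10" "m \<noteq> 12" "m \<noteq> 13"
    using n(1) m(2) by (auto simp: prime_nat_numeral_eq)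
  moreover have "m \<noteq> 2" "m \<noteq> 8" using r_no[of 2] r_no[of 4] m(2) by auto
  ultimately have "m = 3 \<or> m = 5 \<or> m = 6 \<or> m = 9 \<or> m = 11" using m(1) m13 by presburger
  then consider "m = 3" | "m = 5" | "m = 6" | "m = 9" | "m = 11" by blast
  then show ?thesis
  proof cases
    case 1
    \<comment> \<open>The numeral is the cube of N = 28; the other cases likewise use the cubes of
      66, 91, 190 and 276.\<close>
    then have B': "q ^ (2 * w) < 21952" using B Nm by simp
    have "q < 6" using base_less_if_power_less[OF B', of 6 3] wm 1 by simp
    moreover have "q \<noteq> 2" using parity 1 by simp
    moreover have "q \<noteq> 4" using q by auto
    ultimately consider "q = 3" | "q = 5" using q2 by linarith
    then show ?thesis
    proof cases
      case a: 1
      have "w < 5" using exponent_less_if_power_less[OF B', of 3 5] a by simp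
      then have "w = 3 \<or> w = 4" using wm 1 by auto
      then show ?thesis using cong a m(2) 1 by auto
    next
      case a: 2
      have "w < 4" using exponent_less_if_power_less[OF B', of 5 4] a by simp
      then have "w = 3" using wm 1 by auto
      then show ?thesis using cong a m(2) 1 by auto
    qed
  next
    case 2
    then have B': "q ^ (2 * w) < 287496" using B Nm by simp
    have "q < 4" using base_less_if_power_less[OF B', of 4 5] wm 2 by simp
    moreover have "q \<noteq> 2" using parity 2 by simp
    ultimately have q3: "q = 3" using q2 by linarith
    have "w < 6" using exponent_less_if_power_less[OF B', of 3 6] q3 by simp
    then have "w = 5" "y = 1" using wm 2 y by auto
    \<comment> \<open>The congruence does not help, as 3^5 = 243 is 1 modulo 11, but 242 exceeds 66
      * 2.\<close>
    then show ?thesis using WY q3 Nm 2 by simp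
  next
    case 3
    then have B': "q ^ (2 * w) < 753571" using B Nm by simp
    have "q < 4" using base_less_if_power_less[OF B', of 4 6] wm 3 by simp
    then consider "q = 2" | "q = 3" using q2 by linarith
    then show ?thesis
    proof cases
      case a: 1
      have "w < 10" using exponent_less_if_power_less[OF B', of 2 10] a by simp
      then have "w = 6 \<or> w = 7 \<or> w = 8 \<or> w = 9" using wm 3 by auto
      then show ?thesis using cong a m(2) 3 by auto
    next
      case q3: 2
      have "w < 7" using exponent_less_if_power_less[OF B', of 3 7] q3 by simp
      then have w6: "w = 6" using wm 3 by auto
      then have "y = 1 \<or> y = 2" using y by auto
      \<comment> \<open>The surviving case is the equality 3^6 - 1 = 91 * (3^2 - 1), which leaves no
        room for a positive \<open>f\<close>.\<close>
      then have y2: "y = 2" using WY q3 Nm 3 w6 by auto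
      have "f = 0"
      proof (rule ccontr)
        assume "f \<noteq> 0"
        then have "(3::nat) ^ f \<ge> 3" using self_le_power[of 3 f] by simp
        then have "int (3 ^ f) \<ge> 3" by linarith
        moreover have "int (3 ^ f) * 728 + (int (3 ^ f) - 1) * 78 \<le> int (3 ^ f) * 728"
          using key unfolding q3 w6 y2 Nm m(2) 3 by simp
        moreover have "X * 728 + (X - 1) * 78 \<le> X * 728 \<Longrightarrow> X \<ge> 3 \<Longrightarrow> False" for X :: int
          by presburger
        ultimately show False by blast
      qed
      then show ?thesis using q3 w6 m(2) 3 by simp
    qed
  next
    case 4
    then have B': "q ^ (2 * w) < 6859000" using B Nm by simp
    have "q < 3" using base_less_if_power_less[OF B', of 3 9] wm 4 by simp
    then show ?thesis using parity 4 q2 by auto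
  next
    case 5
    then have B': "q ^ (2 * w) < 21024576" using B Nm by simp
    have "q < 3" using base_less_if_power_less[OF B', of 3 11] wm 5 by simp
    then show ?thesis using parity 5 q2 by auto
  qed
qed

text \<open>From m to m + 1 the fourth power grows by less than (11 / 10)^4, which is below 3. The
  start at 16 suits m being half of a power of 2.\<close>

lemma three_power_ge: "m \<ge> 16 \<Longrightarrow> (2 * m + 1) ^ 4 \<le> 3 ^ (m::nat)"
proof (induction m rule: nat_induct_at_least)
  case base
  show ?case by simp
next
  case (Suc m)
  have "(2 * Suc m + 1) * 10 \<le> (2 * m + 1) * 11" using Suc.hyps by simp
  then have "((2 * Suc m + 1) * 10) ^ 4 \<le> ((2 * m + 1) * 11) ^ 4" by (rule power_mono) simp
  then have "(2 * Suc m + 1) ^ 4 * 10 ^ 4 \<le> (2 * m + 1) ^ 4 * 11 ^ 4" unfolding power_mult_distrib .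
  also have "(2 * m + 1) ^ 4 * 11 ^ 4 \<le> 3 ^ m * 11 ^ 4" using Suc.IH by (rule mult_le_mono1)
  finally have "(2 * Suc m + 1) ^ 4 * 10 ^ 4 \<le> 3 ^ m * 11 ^ 4" .
  moreover have "X * 10 ^ 4 \<le> Z * 11 ^ 4 \<Longrightarrow> X \<le> Z * 3" for X Z :: nat by simp
  ultimately have "(2 * Suc m + 1) ^ 4 \<le> 3 ^ m * 3" by blast
  then show ?case by (simp only: power_Suc2)
qed

text \<open>\<open>q ^ e\<close> is the size of the fixed space of \<open>S\<close>, and it divides
  the left-hand side. Hence it divides (2 m - 1) (m + 1) if f = 0, and m + 1 otherwise, where n = 2
  m + 1. This bounds the right-hand side polynomially, while \<open>q ^ w\<close> is at least
  3^m.\<close>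

lemma nonsplit_equation_solution:
  fixes n q w f e N k :: nat
  assumes n: "prime n" "n \<ge> 5" "n - 1 = 2 ^ k" and q: "prime q" "q \<noteq> n"
    and N: "2 * N = n * (n - 1)"
    and eq: "q ^ w * q ^ f = 1 + N * (q ^ e - 1) + (n + 1) * (q ^ f - 1)"
    and ew: "e \<le> w + f" and w: "(n - 1) div 2 \<le> w"
  shows "n = 5 \<and> q ^ w = 81 \<and> f = 0"
proof -
  obtain m where m: "m \<ge> 2" "n = 2 * m + 1" using prime_odd_half[OF n(1,2)] by blast
  have Nm: "N = m * (2 * m + 1)" using N m(2) by simp
  have wm: "m \<le> w" using w m(2) by simp
  have q2: "q \<ge> 2" using q(1) by (rule prime_ge_2_nat)
  have m2: "2 * m = 2 ^ k" using n(3) m(2) by simp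
  have "k \<ge> 2"
  proof (rule ccontr)
    assume "\<not> k \<ge> 2"
    then have "k = 0 \<or> k = 1" by auto
    then show False using m2 m(1) by auto
  qed
  then obtain j where j: "k = Suc (Suc j)" by (metis add_2_eq_Suc le_Suc_ex)
  have mj: "m = 2 * 2 ^ j" using m2 j by simp
  \<comment> \<open>As n - 1 is a power of 2, the values j = 0, 1, 2 belong to n = 5, 9, 17; from j
    = 3 on the growth estimate applies.\<close>
  have "j \<noteq> 1" using n(1) m(2) mj by (auto simp: prime_nat_numeral_eq)
  have jcases: "j = 0 \<or> j = 2 \<or> j \<ge> 3" using \<open>j \<noteq> 1\<close> by auto
  have m16: "m \<ge> 16" if "j \<ge> 3"
  proof -
    have "(2::nat) ^ 3 \<le> 2 ^ j" using that by (intro power_increasing) auto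
    then show ?thesis using mj by simp
  qed
  have EF: "q ^ e dvd q ^ w * q ^ f" using ew by (simp add: le_imp_power_dvd flip: power_add)
  have pos: "q ^ e \<ge> 1" "q ^ f \<ge> 1" using q2 by simp_all
  have eqi: "int (q ^ w) * int (q ^ f) = 1 + int N * (int (q ^ e) - 1) + (int n + 1) * (int (q ^ f) - 1)"
  proof -
    have "int (q ^ w) * int (q ^ f) = int (1 + N * (q ^ e - 1) + (n + 1) * (q ^ f - 1))"
      unfolding of_nat_mult[symmetric] eq ..
    moreover have "int (q ^ e - 1) = int (q ^ e) - 1" "int (q ^ f - 1) = int (q ^ f) - 1"
      using pos by (simp_all only: of_nat_diff of_nat_1)
    ultimately show ?thesis by (simp only: of_nat_add of_nat_mult of_nat_1)
  qed
  have nq: "\<not> q dvd n" using n(1) q primes_dvd_imp_eq by blast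
  show ?thesis
  proof (cases "f = 0")
    case True
    have eq1: "int (q ^ w) + int ((2 * m - 1) * (m + 1)) = int N * int (q ^ e)"
    proof -
      have "int ((2 * m - 1) * (m + 1)) = int N - 1" using m(1) unfolding Nm by (simp add: of_nat_diff algebra_simps)
      then show ?thesis using eqi True by (simp add: algebra_simps)
    qed
    have eq2: "q ^ w + (2 * m - 1) * (m + 1) = N * q ^ e"
      using eq1 by (simp only: of_nat_add[symmetric] of_nat_mult[symmetric] of_nat_eq_iff)
    have "e \<noteq> 0"
    proof
      assume "e = 0"
      then have "int (q ^ w) = 1" using eqi True by simp
      then have "q ^ w = 1" by (simp only: of_nat_eq_1_iff)
      moreover have "q ^ w \<ge> 2" using self_le_power[of q w] q2 wm m(1) by simp
      ultimately show False by linarith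
    qed
    have Ed: "q ^ e dvd (2 * m - 1) * (m + 1)"
    proof -
      have "q ^ e dvd q ^ w" using EF True by simp
      moreover have "q ^ e dvd q ^ w + (2 * m - 1) * (m + 1)" unfolding eq2 by simp
      ultimately show ?thesis using dvd_add_right_iff by blast
    qed
    have "even m" using mj by simp
    have "q dvd (2 * m - 1) * (m + 1)" using Ed \<open>e \<noteq> 0\<close> by (meson dvd_power dvd_trans bot_nat_0.not_eq_extremum)
    moreover have "odd ((2 * m - 1) * (m + 1))" using \<open>even m\<close> m(1) by simp
    ultimately have q3: "q \<ge> 3" using q2 by (cases "q = 2") auto
    have Ele: "q ^ e \<le> (2 * m - 1) * (m + 1)" using Ed m(1) by (intro dvd_imp_le) auto
    have "3 ^ m \<le> q ^ m" using q3 by (rule power_mono) simp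
    also have "q ^ m \<le> q ^ w" using wm q2 by (intro power_increasing) auto
    finally have W3: "3 ^ m \<le> q ^ w" .
    consider "j = 0" | "j = 2" | "j \<ge> 3" using jcases by blast
    then show ?thesis
    proof cases
      case 1
      then have m2: "m = 2" using mj by simp
      have "q ^ e dvd 9" using Ed m2 by simp
      then have "q dvd 3 ^ 2" using \<open>e \<noteq> 0\<close> by (simp add: dvd_trans[OF dvd_power[of e q]])
      then have "q dvd 3" using q(1) prime_dvd_power by blast
      then have "q = 3" using q3 by (auto dest: dvd_imp_le)
      have "e = 1 \<or> e = 2"
      proof -
        have "(3::nat) ^ e \<le> 9" using Ele m2 \<open>q = 3\<close> by simp
        moreover have "(3::nat) ^ 3 \<le> 3 ^ e" if "e \<ge> 3" using that by (intro power_increasing) auto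
        ultimately show ?thesis using \<open>e \<noteq> 0\<close> by (cases "e \<ge> 3") auto
      qed
      then show ?thesis
      proof
        assume "e = 1"
        then have "3 ^ w = (21::nat)" using eq2 m2 \<open>q = 3\<close> Nm by simp
        moreover have "(3::nat) ^ 2 dvd 3 ^ w" using wm m2 by (intro le_imp_power_dvd) simp
        ultimately show ?thesis by simp
      next
        \<comment> \<open>The exceptional solution: 81 + 9 = 10 * 9.\<close>
        assume "e = 2"
        then show ?thesis using eq2 m2 \<open>q = 3\<close> Nm True m(2) by simp
      qed
    next
      case 2
      then have m8: "m = 8" using mj by simp
      \<comment> \<open>For n = 17 one has N = 136 and (2 m - 1) (m + 1) = 135. Size leaves q = 3,
        and 81 does not divide 135, so e is at most 3 and the right-hand side is smaller than
        3^8.\<close>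
      have e8: "q ^ w + 135 = 136 * q ^ e" "q ^ e \<le> 135" using eq2 Nm m8 Ele by simp_all
      have "q = 3"
      proof (rule ccontr)
        assume "q \<noteq> 3"
        moreover have "q \<noteq> 4" using q(1) by auto
        ultimately have "5 \<le> q" using q3 by simp
        then have "5 ^ 8 \<le> q ^ 8" by (rule power_mono) simp
        also have "q ^ 8 \<le> q ^ w" using wm m8 q2 by (intro power_increasing) auto
        finally show False using e8 by simp
      qed
      have "e < 5"
      proof (rule ccontr)
        assume "\<not> e < 5"
        then have "(3::nat) ^ 5 \<le> 3 ^ e" by (intro power_increasing) auto
        then show False using e8 \<open>q = 3\<close> by simp
      qed
      moreover have "e \<noteq> 4" using Ed m8 \<open>q = 3\<close> by auto
      ultimately have "(3::nat) ^ e \<le> 3 ^ 3" by (intro power_increasing) auto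
      moreover have "(3::nat) ^ 8 \<le> 3 ^ w" using wm m8 by (intro power_increasing) auto
      ultimately show ?thesis using e8 \<open>q = 3\<close> by simp
    next
      case 3
      have "(2 * m + 1) ^ 4 \<le> 3 ^ m" using three_power_ge[OF m16[OF 3]] .
      also have "\<dots> \<le> q ^ w" by (rule W3)
      also have "\<dots> \<le> N * q ^ e" using eq2 by simp
      also have "\<dots> \<le> N * ((2 * m - 1) * (m + 1))" using Ele by (rule mult_le_mono2)
      also have "\<dots> < (2 * m + 1) ^ 4"
      proof -
        have "N < (2 * m + 1)\<^sup>2" unfolding Nm power2_eq_square using m(1) by simp
        moreover have "(2 * m - 1) * (m + 1) \<le> (2 * m + 1)\<^sup>2"
          unfolding power2_eq_square by (intro mult_le_mono) auto
        ultimately have "N * ((2 * m - 1) * (m + 1)) < (2 * m + 1)\<^sup>2 * (2 * m + 1)\<^sup>2"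
          using m(1) by (intro mult_less_le_imp_less) auto
        then show ?thesis by (simp flip: power_add)
      qed
      finally show ?thesis by simp
    qed
  next
    case False
    have eq1: "int (q ^ w * q ^ f) = int N * int (q ^ e) + int (m + 1) * (2 * int (q ^ f) - int n)"
      using eqi unfolding Nm m(2) by (simp add: algebra_simps)
    have "e \<noteq> 0"
    proof
      assume "e = 0"
      then have "int (q ^ w) * int (q ^ f) = int (q ^ f) * (int n + 1) - int n" using eqi by (simp add: algebra_simps)
      then have "int n = int (q ^ f) * (int n + 1 - int (q ^ w))" by (simp add: algebra_simps)
      then have "int (q ^ f) dvd int n" by (rule dvdI)
      then have "q ^ f dvd n" by (simp only: int_dvd_int_iff)
      then show False using nq False by (meson dvd_power dvd_trans bot_nat_0.not_eq_extremum)
    qed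
    \<comment> \<open>Since \<open>q\<close> divides \<open>q ^ f\<close> but not \<open>n\<close>,
      it is prime to the factor 2 q^f - n.\<close>
    have E: "q ^ e dvd m + 1"
    proof -
      have "int (q ^ e) dvd int N * int (q ^ e) + int (m + 1) * (2 * int (q ^ f) - int n)"
        unfolding eq1[symmetric] int_dvd_int_iff by (rule EF)
      then have d: "int (q ^ e) dvd int (m + 1) * (2 * int (q ^ f) - int n)"
        by (meson dvd_add_right_iff dvd_triv_right)
      have "\<not> int q dvd 2 * int (q ^ f) - int n"
      proof
        assume "int q dvd 2 * int (q ^ f) - int n"
        moreover have "int q dvd 2 * int (q ^ f)" using False by (simp add: dvd_power)
        ultimately have "int q dvd int n" using dvd_diff[of "int q" "2 * int (q ^ f)" "2 * int (q ^ f) - int n"] by simp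
        then show False using nq by simp
      qed
      then have "coprime (int (q ^ e)) (2 * int (q ^ f) - int n)"
        using q(1) prime_imp_coprime[of "int q"] by (simp add: coprime_power_left_iff)
      then have "int (q ^ e) dvd int (m + 1)" using d coprime_dvd_mult_left_iff by blast
      then show ?thesis by (simp only: int_dvd_int_iff)
    qed
    have "even m" using mj by simp
    have "q dvd m + 1" using E \<open>e \<noteq> 0\<close> by (meson dvd_power dvd_trans bot_nat_0.not_eq_extremum)
    then have q3: "q \<ge> 3" using q2 \<open>even m\<close> by (cases "q = 2") auto
    have Ele: "q ^ e \<le> m + 1" using E by (intro dvd_imp_le) auto
    have "3 ^ m \<le> q ^ m" using q3 by (rule power_mono) simp
    also have "q ^ m \<le> q ^ w" using wm q2 by (intro power_increasing) auto
    finally have W3: "3 ^ m \<le> q ^ w" .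
    have bound: "int (q ^ f) * (int (q ^ w) - 2 * int (m + 1)) \<le> (int m - 1) * int (2 * m + 1) * int (m + 1)"
    proof -
      have "int N * int (q ^ e) \<le> int N * int (m + 1)" using Ele by (intro mult_left_mono) (simp_all only: of_nat_le_iff of_nat_0_le_iff)
      then have "int (q ^ w * q ^ f) \<le> int N * int (m + 1) + int (m + 1) * (2 * int (q ^ f) - int n)" using eq1 by linarith
      then show ?thesis unfolding Nm m(2) by (simp add: algebra_simps)
    qed
    have Fq: "q ^ f \<ge> 3" using self_le_power[of q f] q3 False by simp
    have big: False if "int (q ^ w) - 2 * int (m + 1) > (int m - 1) * int (2 * m + 1) * int (m + 1)" "m \<ge> 2"
    proof -
      have "0 \<le> (int m - 1) * int (2 * m + 1) * int (m + 1)" using that(2) by simp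
      then have "0 \<le> int (q ^ w) - 2 * int (m + 1)" using that(1) by linarith
      then have "1 * (int (q ^ w) - 2 * int (m + 1)) \<le> int (q ^ f) * (int (q ^ w) - 2 * int (m + 1))"
        using pos(2) by (intro mult_right_mono) (metis of_nat_1 of_nat_le_iff)
      also have "\<dots> \<le> (int m - 1) * int (2 * m + 1) * int (m + 1)" by (rule bound)
      also have "\<dots> < int (q ^ w) - 2 * int (m + 1)" by (rule that(1))
      finally show False by simp
    qed
    consider "j = 0" | "j = 2" | "j \<ge> 3" using jcases by blast
    then show ?thesis
    proof cases
      case 1
      then have m2: "m = 2" using mj by simp
      have "q dvd 3" using \<open>q dvd m + 1\<close> m2 by simp
      then have "q = 3" using q3 by (auto dest: dvd_imp_le)
      have "(3::int) ^ 2 \<le> 3 ^ w" using wm m2 by (intro power_increasing) auto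
      then have w9: "(3::int) ^ w \<ge> 9" by simp
      have Ee: "q ^ e = 3" using Ele self_le_power[of q e] q3 \<open>e \<noteq> 0\<close> m2 by simp
      have "(3::int) ^ w * 3 ^ f = 15 + 6 * 3 ^ f"
        using eq1 unfolding Ee unfolding Nm m(2) m2 \<open>q = 3\<close> by simp
      \<comment> \<open>With w \<ge> 2 and f \<ge> 1 only 3^w = 9 is small enough, and then 3^f
        would be 5.\<close>
      then have e15: "(3::int) ^ f * (3 ^ w - 6) = 15" by (simp add: algebra_simps)
      have f3: "(3::int) ^ f \<ge> 3" using self_le_power[of "3::int" f] False by simp
      have "3 * ((3::int) ^ w - 6) \<le> 3 ^ f * (3 ^ w - 6)"
        using f3 w9 by (intro mult_right_mono) simp_all
      then have w11: "(3::int) ^ w \<le> 11" unfolding e15 by simp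
      have "w < 3"
      proof (rule ccontr)
        assume "\<not> w < 3"
        then have "(3::int) ^ 3 \<le> 3 ^ w" by (intro power_increasing) auto
        then show False using w11 by simp
      qed
      then have "w = 2" using wm m2 by simp
      then have "(3::int) ^ f = 5" using e15 by simp
      moreover have "(3::int) dvd 3 ^ f" using False by (simp add: dvd_power)
      ultimately have "(3::int) dvd 5" by simp
      then show ?thesis by simp
    next
      case 2
      then have m8: "m = 8" using mj by simp
      have "int (3 ^ 8) \<le> int (q ^ w)" using W3 unfolding m8 of_nat_le_iff .
      then have "int (q ^ w) \<ge> 6561" by simp
      then show ?thesis using big m8 by simp
    next
      case 3
      have m16': "m \<ge> 16" using m16[OF 3] .
      have "int ((2 * m + 1) ^ 4) \<le> int (q ^ w)" using three_power_ge[OF m16'] W3 by (simp only: of_nat_le_iff)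
      moreover have "(int m - 1) * int (2 * m + 1) * int (m + 1) + 2 * int (m + 1) < int ((2 * m + 1) ^ 4)"
      proof -
        have "(m - 1) * (2 * m + 1) * (m + 1) + 2 * (m + 1) < (2 * m + 1) ^ 4"
        proof -
          let ?x = "2 * m + 1"
          have "(m - 1) * ?x * (m + 1) \<le> ?x * ?x * ?x" by (intro mult_le_mono) auto
          moreover have "2 * (m + 1) \<le> ?x * ?x * ?x" using m16' by (simp add: algebra_simps)
          moreover have "2 * (?x * ?x * ?x) < ?x * (?x * ?x * ?x)" using m16' by (intro mult_strict_right_mono) auto
          moreover have "?x ^ 4 = ?x * (?x * ?x * ?x)" by (simp add: power4_eq_xxxx ac_simps)
          ultimately show ?thesis by linarith
        qed
        then have "int ((m - 1) * (2 * m + 1) * (m + 1) + 2 * (m + 1)) < int ((2 * m + 1) ^ 4)" by (simp only: of_nat_less_iff)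
        moreover have "int (m - 1) = int m - 1" using m16' by simp
        ultimately show ?thesis by (simp only: of_nat_add of_nat_mult of_nat_numeral)
      qed
      ultimately have "(int m - 1) * int (2 * m + 1) * int (m + 1) + 2 * int (m + 1) < int (q ^ w)"
        by (rule less_le_trans[rotated])
      then have "(int m - 1) * int (2 * m + 1) * int (m + 1) < int (q ^ w) - 2 * int (m + 1)" by (simp only: less_diff_eq)
      then show ?thesis using big m(1) by blast
    qed
  qed
qed

section \<open>The equation for a split and a nonsplit torus\<close>

lemma power_le_mult_imp_1: "(q::nat) \<ge> 3 \<Longrightarrow> q ^ e \<le> q * e + 1 \<Longrightarrow> e \<le> 1"
proof (rule ccontr)
  assume q: "q \<ge> 3" "q ^ e \<le> q * e + 1" and "\<not> e \<le> 1"
  then obtain i where i: "e = Suc (Suc i)" by (metis One_nat_def Suc_leI not_less_eq_eq le_Suc_ex add_Suc numeral_nat(7) plus_1_eq_Suc)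
  have "q ^ Suc (Suc i) > q * Suc (Suc i) + 1"
  proof (induction i)
    case 0
    have "3 * q \<le> q * q" using q(1) by (rule mult_le_mono1)
    moreover have "q ^ Suc (Suc 0) = q * q" "q * Suc (Suc 0) + 1 = 2 * q + 1" by simp_all
    ultimately show ?case using q(1) by linarith
  next
    case (Suc i)
    have "q ^ Suc (Suc (Suc i)) = q * q ^ Suc (Suc i)" by simp
    also have "\<dots> \<ge> 3 * q ^ Suc (Suc i)" using q(1) by (rule mult_le_mono1)
    finally have "3 * q ^ Suc (Suc i) \<le> q ^ Suc (Suc (Suc i))" .
    moreover have "q * Suc (Suc (Suc i)) + 1 = (q * Suc (Suc i) + 1) + q" by simp
    moreover have "q \<le> q * Suc (Suc i)" by simp
    ultimately show ?case using Suc.IH by linarith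
  qed
  then show False using q(2) i by simp
qed

text \<open>With n = 2 m + 1, reduction modulo \<open>q\<close> shows that \<open>q\<close> divides
  exactly one of m and m + 1, hence the order of one of the tori. By coprimality q^e divides m + 1,
  or q^c divides m, while the upper bound on \<open>w\<close> gives m \<le> q e or m \<le> q c. So
  this exponent is 1 and q = m + 1 or q = m; reducing once more gives q = 5, n = 9 or q = 3, n =
  7.\<close>

lemma mixed_equation_no_solution_odd:
  fixes n q r s w c e N N' :: nat
  assumes n: "prime n" "n \<ge> 5" and r: "prime r" "odd r" "r dvd n - 1" and s: "prime s" "odd s" "s dvd n + 1"
    and q: "prime q" "odd q" "q \<noteq> n"
    and N: "2 * N = n * (n + 1)" "2 * N' = n * (n - 1)"
    and eq: "q ^ w = 1 + N * (q ^ c - 1) + N' * (q ^ e - 1)"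
    and ce: "c \<ge> 1" "e \<ge> 1" "c \<le> w" "e \<le> w" and w: "(n - 1) div 2 \<le> w"
    and b: "q dvd n + 1 \<Longrightarrow> w \<le> q * e" "q dvd n - 1 \<Longrightarrow> w \<le> q * c"
  shows False
proof -
  obtain m where m: "m \<ge> 2" "n = 2 * m + 1" using prime_odd_half[OF n] by blast
  have Nm: "N = (2 * m + 1) * (m + 1)" "N' = m * (2 * m + 1)" using N m(2) by simp_all
  have wm: "m \<le> w" using w m(2) by simp
  have q3: "q \<ge> 3" using prime_ge_2_nat[OF q(1)] q(2) by (cases "q = 2") auto
  have pos: "q ^ e \<ge> 1" "q ^ c \<ge> 1" using q3 by simp_all
  \<comment> \<open>The constant is N + N' - 1 = n^2 - 1.\<close>
  have eqi: "int (q ^ w) + 4 * int m * int (m + 1) = int N * int (q ^ c) + int N' * int (q ^ e)"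
  proof -
    have "int (q ^ w) = int (1 + N * (q ^ c - 1) + N' * (q ^ e - 1))" unfolding eq ..
    moreover have "int (q ^ e - 1) = int (q ^ e) - 1" "int (q ^ c - 1) = int (q ^ c) - 1"
      using pos by (simp_all only: of_nat_diff of_nat_1)
    ultimately have "int (q ^ w) = 1 + int N * (int (q ^ c) - 1) + int N' * (int (q ^ e) - 1)"
      by (simp only: of_nat_add of_nat_mult of_nat_1)
    then show ?thesis unfolding Nm by (simp add: algebra_simps)
  qed
  have qd: "int q dvd int (q ^ i)" if "i \<ge> 1" for i using that by (simp add: dvd_power)
  have pq: "prime (int q)" using q(1) by simp
  have q2: "\<not> int q dvd 2"
  proof
    assume "int q dvd 2"
    then have "int q \<le> 2" by (rule zdvd_imp_le) simp
    then show False using q3 by simp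
  qed
  have q4: "\<not> int q dvd 4"
  proof
    assume "int q dvd 4"
    then have "int q dvd 2 * 2" by simp
    then show False using q2 pq prime_dvd_mult_iff by blast
  qed
  have not_both: "\<not> (int q dvd int m \<and> int q dvd int (m + 1))"
  proof
    assume "int q dvd int m \<and> int q dvd int (m + 1)"
    then have "int q dvd int (m + 1) - int m" using dvd_diff by blast
    then show False using q3 by simp
  qed
  have "int q dvd 4 * int m * int (m + 1)"
  proof -
    have "int q dvd int N * int (q ^ c) + int N' * int (q ^ e) - int (q ^ w)"
      using qd[OF ce(1)] qd[OF ce(2)] qd[of w] ce by (intro dvd_diff dvd_add dvd_mult) auto
    then show ?thesis using eqi by (metis add_diff_cancel_left')
  qed
  then consider (plus) "int q dvd int (m + 1)" "\<not> int q dvd int m" | (minus) "int q dvd int m" "\<not> int q dvd int (m + 1)"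
    using q4 pq not_both prime_dvd_mult_iff by blast
  then show False
  proof cases
    case plus
    have qm: "q dvd m + 1" using plus(1) by (simp only: int_dvd_int_iff)
    have we: "w \<le> q * e" 
    proof (rule b(1))
      have "n + 1 = (m + 1) * 2" using m(2) by simp
      then show "q dvd n + 1" using qm by (simp only: dvd_mult2)
    qed
    have "int (q ^ e) dvd int (m + 1) * (int n * int (q ^ c) - 4 * int m)"
    proof -
      have "int (m + 1) * (int n * int (q ^ c) - 4 * int m) = int (q ^ w) - int N' * int (q ^ e)"
        using eqi unfolding Nm m(2) by (simp add: algebra_simps)
      moreover have "int (q ^ e) dvd int (q ^ w) - int N' * int (q ^ e)"
        using ce(4) by (intro dvd_diff dvd_triv_right) (simp only: int_dvd_int_iff le_imp_power_dvd)
      ultimately show ?thesis by simp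
    qed
    moreover have "coprime (int (q ^ e)) (int n * int (q ^ c) - 4 * int m)"
    proof -
      have "\<not> int q dvd int n * int (q ^ c) - 4 * int m"
      proof
        assume h: "int q dvd int n * int (q ^ c) - 4 * int m"
        have "int q dvd int n * int (q ^ c) - (int n * int (q ^ c) - 4 * int m)"
          by (rule dvd_diff[OF dvd_mult[OF qd[OF ce(1)]] h])
        then have "int q dvd 4 * int m" by simp
        then show False using q4 pq plus(2) prime_dvd_mult_iff by blast
      qed
      then show ?thesis using prime_imp_coprime[OF pq] by (simp add: coprime_power_left_iff)
    qed
    ultimately have "int (q ^ e) dvd int (m + 1)" using coprime_dvd_mult_left_iff by blast
    then have "q ^ e dvd m + 1" by (simp only: int_dvd_int_iff)
    then have "q ^ e \<le> m + 1" by (rule dvd_imp_le) simp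
    also have "\<dots> \<le> q * e + 1" using wm we by simp
    finally have "e \<le> 1" by (rule power_le_mult_imp_1[OF q3])
    then have e1: "e = 1" using ce(2) by simp
    obtain j where j: "m + 1 = q * j" using qm by blast
    have "q * j \<le> q + 1" using wm we e1 j by simp
    moreover have "j \<noteq> 0" using j by (cases j) auto
    moreover have "j < 2"
    proof (rule ccontr)
      assume "\<not> j < 2"
      then have "q * 2 \<le> q * j" by (intro mult_le_mono2) simp
      then show False using \<open>q * j \<le> q + 1\<close> q3 by linarith
    qed
    ultimately have "j = 1" by linarith
    then have mq: "int m = int q - 1" using j by simp
    obtain w' where w': "w = Suc w'" "w' \<ge> 1" using wm m(1) by (cases w) auto
    have "int q * int (q ^ w') + 4 * (int q - 1) * int q = (2 * int q - 1) * int q * int (q ^ c) + (int q - 1) * (2 * int q - 1) * int q"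
      using eqi unfolding Nm w'(1) e1 of_nat_mult of_nat_add of_nat_numeral of_nat_1 mq by (simp add: algebra_simps)
    then have "int q * (int (q ^ w') + 4 * (int q - 1)) = int q * ((2 * int q - 1) * int (q ^ c) + (int q - 1) * (2 * int q - 1))"
      by (simp add: algebra_simps)
    then have "int (q ^ w') + 4 * (int q - 1) = (2 * int q - 1) * int (q ^ c) + (int q - 1) * (2 * int q - 1)"
      using q3 by (simp only: mult_cancel_left) simp
    \<comment> \<open>One factor \<open>q\<close> has been cancelled; since w \<ge> 2, every term on
      the right is still divisible by \<open>q\<close>.\<close>
    then have "5 = int (q ^ w') + int q * (7 - 2 * int q) - (2 * int q - 1) * int (q ^ c)" by (simp add: algebra_simps)
    moreover have "int q dvd int (q ^ w') + int q * (7 - 2 * int q) - (2 * int q - 1) * int (q ^ c)"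
      by (rule dvd_diff[OF dvd_add[OF qd[OF w'(2)] dvd_triv_left] dvd_mult[OF qd[OF ce(1)]]])
    ultimately have "int q dvd int 5" by simp
    then have q5: "q dvd 5" by (simp only: int_dvd_int_iff)
    then have "q \<le> 5" by (rule dvd_imp_le) simp
    then have "q = 3 \<or> q = 4 \<or> q = 5" using q3 by linarith
    then have "q = 5" using q5 by auto
    then have "n = 9" using mq m(2) by simp
    then show False using n(1) by (simp add: prime_nat_numeral_eq)
  next
    case minus
    have qm: "q dvd m" using minus(1) by (simp only: int_dvd_int_iff)
    have wc: "w \<le> q * c" using b(2) qm m(2) by simp
    have "int (q ^ c) dvd int m * (int n * int (q ^ e) - 4 * int (m + 1))"
    proof -
      have "int m * (int n * int (q ^ e) - 4 * int (m + 1)) = int (q ^ w) - int N * int (q ^ c)"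
        using eqi unfolding Nm m(2) by (simp add: algebra_simps)
      moreover have "int (q ^ c) dvd int (q ^ w) - int N * int (q ^ c)"
        using ce(3) by (intro dvd_diff dvd_triv_right) (simp only: int_dvd_int_iff le_imp_power_dvd)
      ultimately show ?thesis by simp
    qed
    moreover have "coprime (int (q ^ c)) (int n * int (q ^ e) - 4 * int (m + 1))"
    proof -
      have "\<not> int q dvd int n * int (q ^ e) - 4 * int (m + 1)"
      proof
        assume h: "int q dvd int n * int (q ^ e) - 4 * int (m + 1)"
        have "int q dvd int n * int (q ^ e) - (int n * int (q ^ e) - 4 * int (m + 1))"
          by (rule dvd_diff[OF dvd_mult[OF qd[OF ce(2)]] h])
        then have "int q dvd 4 * int (m + 1)" by simp
        then show False using q4 pq minus(2) prime_dvd_mult_iff by blast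
      qed
      then show ?thesis using prime_imp_coprime[OF pq] by (simp add: coprime_power_left_iff)
    qed
    ultimately have "int (q ^ c) dvd int m" using coprime_dvd_mult_left_iff by blast
    then have "q ^ c dvd m" by (simp only: int_dvd_int_iff)
    then have "q ^ c \<le> m" using m(1) by (intro dvd_imp_le) auto
    also have "\<dots> \<le> q * c + 1" using wm wc by simp
    finally have "c \<le> 1" by (rule power_le_mult_imp_1[OF q3])
    then have c1: "c = 1" using ce(1) by simp
    have "q \<le> m" using qm m(1) by (intro dvd_imp_le) auto
    then have mq: "m = q" "w = q" using wm wc c1 by auto
    obtain w' where w': "q = Suc w'" "w' \<ge> 1" using q3 by (cases q) auto
    have "int q * int (q ^ w') + 4 * int q * (int q + 1) = (2 * int q + 1) * (int q + 1) * int q + int q * (2 * int q + 1) * int (q ^ e)"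
      using eqi unfolding Nm mq c1 using power_Suc[of "int q" w'] w'(1) by (simp add: algebra_simps)
    then have "int q * (int (q ^ w') + 4 * (int q + 1)) = int q * ((2 * int q + 1) * (int q + 1) + (2 * int q + 1) * int (q ^ e))"
      by (simp add: algebra_simps)
    then have "int (q ^ w') + 4 * (int q + 1) = (2 * int q + 1) * (int q + 1) + (2 * int q + 1) * int (q ^ e)"
      using q3 by (simp only: mult_cancel_left) simp
    then have "3 = (2 * int q + 1) * int (q ^ e) + int q * (2 * int q - 1) - int (q ^ w')" by (simp add: algebra_simps)
    moreover have "int q dvd (2 * int q + 1) * int (q ^ e) + int q * (2 * int q - 1) - int (q ^ w')"
      by (rule dvd_diff[OF dvd_add[OF dvd_mult[OF qd[OF ce(2)]] dvd_triv_left] qd[OF w'(2)]])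
    ultimately have "int q dvd int 3" by simp
    then have "q dvd 3" by (simp only: int_dvd_int_iff)
    then have "q = 3" using q3 by (auto dest: dvd_imp_le)
    \<comment> \<open>Then n + 1 has no odd prime divisor, contrary to the choice of
      \<open>s\<close>.\<close>
    then have "n + 1 = 2 ^ 3" using mq m(2) by simp
    then show False using s odd_prime_dvd_power_2[of s 3] by simp
  qed
qed

text \<open>The bound 256 gives w \<le> 8 and n \<le> 17. Here 5, 7 and 17 lack an odd prime divisor
  of n - 1 or n + 1, and 9 and 15 are composite. Modulo 11 and 13 the order of 2 is 10 and 12, so no
  admissible power is 1.\<close>

lemma mixed_equation_no_solution_2:
  fixes n r s w :: nat
  assumes n: "prime n" "n \<ge> 5" and r: "prime r" "odd r" "r dvd n - 1" and s: "prime s" "odd s" "s dvd n + 1"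
    and w: "(n - 1) div 2 \<le> w" and le: "(2::nat) ^ w \<le> 256" and cong: "2 ^ w mod n = 1"
  shows False
proof -
  obtain m where m: "m \<ge> 2" "n = 2 * m + 1" using prime_odd_half[OF n] by blast
  have wm: "m \<le> w" using w m(2) by simp
  have w8: "w \<le> 8"
  proof (rule ccontr)
    assume "\<not> w \<le> 8"
    then have "(2::nat) ^ 9 \<le> 2 ^ w" by (intro power_increasing) auto
    then show False using le by simp
  qed
  have r_no: "n - 1 \<noteq> 2 ^ k" for k using odd_prime_dvd_power_2[of r k] r by metis
  have s_no: "n + 1 \<noteq> 2 ^ k" for k using odd_prime_dvd_power_2[of s k] s by metis
  have "m \<noteq> 4" "m \<noteq> 7" using n(1) m(2) by (auto simp: prime_nat_numeral_eq)
  moreover have "m \<noteq> 2" "m \<noteq> 8" "m \<noteq> 3" using r_no[of 2] r_no[of 4] s_no[of 3] m(2) by auto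
  ultimately have "m = 5 \<or> m = 6" using m(1) wm w8 by auto
  moreover have "w = 5 \<or> w = 6 \<or> w = 7 \<or> w = 8" using wm w8 calculation by auto
  ultimately show False using cong m(2) wm by auto
qed

subsection \<open>Covers involving the unipotent subgroup\<close>

lemma diag2_pow: "x \<noteq> 0 \<Longrightarrow> diag2 x [^]\<^bsub>SL2\<^esub> (n::nat) = diag2 (x ^ n)"
proof (induction n)
  case 0
  then show ?case by (simp add: diag2_def)
next
  case (Suc n)
  then show ?case by (simp add: diag2_mult mult.commute)
qed

lemma odd_sylow_odd_card: "odd_sylow r P \<Longrightarrow> odd (card P)"
  by (auto simp: odd_sylow_def sylow_subgroup_def)

lemma odd_sylow_card_ge_3:
  assumes "odd_sylow r P"
  shows "card P \<ge> 3"
proof -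
  obtain m where m: "m > 0" "card P = r ^ m" using odd_sylow_card[OF assms] by blast
  have "prime r" "odd r" using assms by (auto simp: odd_sylow_def)
  then have "r \<ge> 3" using prime_ge_2_nat[of r] by (cases "r = 2") auto
  then show ?thesis using self_le_power[of r m] m by simp
qed

lemma odd_power_eq_1_imp:
  assumes "odd (n::nat)" "x ^ n = 1" "x * x = (1::'a::comm_monoid_mult)"
  shows "x = 1"
proof -
  obtain j where "n = 2 * j + 1" using assms(1) by (rule oddE)
  then have "x ^ n = (x * x) ^ j * x" by (simp add: power_mult power2_eq_square power_mult_distrib mult.commute)
  then show ?thesis using assms(2,3) by simp
qed

context sl2_module
begin

abbreviation NV :: "('f ^ 2 ^ 2) set \<Rightarrow> 'v set" where
  "NV \<equiv> normal_vectors SL2 act"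

abbreviation CNV :: "('f ^ 2 ^ 2) set \<Rightarrow> 'v set" where
  "CNV \<equiv> conj_normal_vectors SL2 act"

lemma CNV_eq: "subgroup P SL2 \<Longrightarrow> CNV P = (\<Union>Q\<in>conj_set SL2 P ` carrier SL2. NV Q)"
  by (rule conj_normal_vectors_eq) simp

lemma CNV_odd_sylowE:
  assumes "odd_sylow r P" "v \<in> CNV P"
  obtains Q where "odd_sylow r Q" "v \<in> NV Q"
  using assms CNV_eq[OF odd_sylow_subgroup[OF assms(1)]] odd_sylow_conj_set[OF assms(1)] by blast

lemma CNV_unipE:
  assumes "v \<in> CNV unip_group"
  obtains z where "z \<in> carrier SL2" "v \<in> NV (conj_set SL2 unip_group z)"
  using assms CNV_eq[OF subgroup_unip_group] by blast

lemma NV_Fix: "P \<subseteq> carrier SL2 \<Longrightarrow> v \<in> NV P \<Longrightarrow> v \<in> Fix P"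
  using subset_stabilizer_iff by (auto simp: normal_vectors_def)

lemma Fix_subset_norm_set: "X \<subseteq> carrier SL2 \<Longrightarrow> v \<in> Fix X \<Longrightarrow> v \<in> NV P \<Longrightarrow> X \<subseteq> norm_set SL2 P"
proof -
  assume "X \<subseteq> carrier SL2" "v \<in> Fix X" "v \<in> NV P"
  then have "X \<subseteq> stabilizer SL2 act v" "stabilizer SL2 act v \<subseteq> norm_set SL2 P"
    using subset_stabilizer_iff by (simp_all add: normal_vectors_def)
  then show "X \<subseteq> norm_set SL2 P" by (rule subset_trans)
qed

lemma zero_in_NV_iff: "0 \<in> NV P \<longleftrightarrow> P \<subseteq> carrier SL2 \<and> carrier SL2 \<subseteq> norm_set SL2 P"
proof -
  have "stabilizer SL2 act 0 = carrier SL2" by (auto simp: stabilizer_def)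
  then show ?thesis by (simp add: normal_vectors_def)
qed

text \<open>The stabilizer of 0 is the whole group, and its unipotents do not all normalize
  \<open>P\<close>. As none of the three sets contains 0, failing to be strictly contained in the
  nonzero vectors means covering them.\<close>

lemma zero_notin_NV_odd_sylow:
  assumes P: "odd_sylow r P"
  shows "0 \<notin> NV P"
proof
  assume "0 \<in> NV P"
  then have sub: "carrier SL2 \<subseteq> norm_set SL2 P" using zero_in_NV_iff by blast
  have u: "unip x \<in> norm_set SL2 P" for x by (rule subsetD[OF sub unip_in_SL2])
  show False
  proof (cases "(2::'f) = 0")
    case True
    have "\<not> (UNIV :: 'f set) \<subseteq> {0, 1}"
    proof
      assume "(UNIV :: 'f set) \<subseteq> {0, 1}"
      then have "CARD('f) \<le> card {0, 1 :: 'f}" by (intro card_mono) auto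
      also have "\<dots> \<le> 2" by (simp add: card_insert_if)
      finally show False using card_f_ge by simp
    qed
    then obtain y :: 'f where "y \<noteq> 0" "1 \<noteq> y" by blast
    then show False using unips_not_in_norm_set_char_2[OF True P one_neq_zero _ _ u u] by blast
  next
    case False
    then show False using unip_not_in_norm_set[OF False P one_neq_zero] u by blast
  qed
qed

lemma zero_notin_NV_unip: "0 \<notin> NV unip_group"
  using zero_in_NV_iff unip_group_not_normal by blast

lemma zero_notin_CNV:
  assumes "subgroup P SL2" "0 \<notin> NV P"
  shows "0 \<notin> CNV P"
proof
  assume "0 \<in> CNV P"
  then obtain z where z: "z \<in> carrier SL2" "0 \<in> NV (conj_set SL2 P z)" using CNV_eq[OF assms(1)] by blast
  have "act z 0 \<in> NV P" by (rule act_mem_normal_vectors[OF refl assms(1) z])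
  then show False using assms(2) z(1) by simp
qed

end

context sl2_prime_module
begin

lemma CNV_odd_unip_disjoint:
  assumes "odd_sylow r P"
  shows "CNV P \<inter> CNV unip_group = {}"
proof (rule ccontr)
  assume "CNV P \<inter> CNV unip_group \<noteq> {}"
  then obtain v where v: "v \<in> CNV P" "v \<in> CNV unip_group" by blast
  obtain Q where Q: "odd_sylow r Q" "v \<in> NV Q" using CNV_odd_sylowE[OF assms v(1)] by blast
  obtain z where z: "z \<in> carrier SL2" "v \<in> NV (conj_set SL2 unip_group z)" using CNV_unipE[OF v(2)] by blast
  have "conj_set SL2 unip_group z \<subseteq> norm_set SL2 Q" using z(2) Q(2) unfolding normal_vectors_def by blast
  then show False using conj_unip_group_not_normalizing[OF two Q(1) z(1)] by blast
qed

lemma Fix_unip_not_NV_odd_sylow: "odd_sylow r Q \<Longrightarrow> v \<in> NV Q \<Longrightarrow> v \<in> Fix unip_group \<Longrightarrow> False"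
  using Fix_subset_norm_set[OF unip_group_carrier, of v Q] unip_not_in_norm_set[OF two, of r Q 1]
  by (metis one_neq_zero rangeI subsetD)

text \<open>A vector fixed by the unipotent group cannot belong to an odd Sylow subgroup, so the
  cover assigns it to a conjugate of \<open>unip_group\<close>, which must be
  \<open>unip_group\<close>.\<close>

lemma NV_unip_eq:
  assumes P: "odd_sylow r P" and cover: "UNIV - {0} \<subseteq> CNV P \<union> CNV unip_group"
  shows "NV unip_group = Fix unip_group - {0}"
proof (intro equalityI subsetI)
  fix v assume "v \<in> NV unip_group"
  then show "v \<in> Fix unip_group - {0}" using NV_Fix[OF unip_group_carrier] zero_notin_NV_unip by blast
next
  fix v assume v: "v \<in> Fix unip_group - {0}"
  have "v \<notin> CNV P" using CNV_odd_sylowE[OF P] Fix_unip_not_NV_odd_sylow v by blast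
  then have "v \<in> CNV unip_group" using cover v by blast
  then obtain z where z: "z \<in> carrier SL2" "v \<in> NV (conj_set SL2 unip_group z)" by (rule CNV_unipE)
  have "unip 1 \<in> norm_set SL2 (conj_set SL2 unip_group z)"
    using Fix_subset_norm_set[OF unip_group_carrier _ z(2)] v by blast
  then have "conj_set SL2 unip_group z = unip_group" using unip_normalizes_conj_unip_group[OF z(1), of 1] by simp
  then show "v \<in> NV unip_group" using z(2) by simp
qed

lemma card_CNV_odd_sylow:
  assumes "odd_sylow r P"
  shows "card (CNV P) = card (conj_set SL2 P ` carrier SL2) * card (NV P)"
  using assms by (intro card_conj_normal_vectors[of r]) (auto simp: odd_sylow_def)

lemma card_CNV_unip: "card (CNV unip_group) = (t + 1) * card (NV unip_group)"
  using card_conj_normal_vectors[OF refl finite_V finite_SL2 prime_t sylow_unip_group[OF prime_t card_f]]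
    card_conjugates_unip_group[where 'f = 'f] card_t by simp

lemma card_V_covered_unip:
  assumes P: "odd_sylow r P" and cover: "UNIV - {0} \<subseteq> CNV P \<union> CNV unip_group"
  shows "CARD('v) = 1 + card (conj_set SL2 P ` carrier SL2) * card (NV P) + (t + 1) * (card (Fix unip_group) - 1)"
proof -
  have "0 \<notin> CNV P" "0 \<notin> CNV unip_group"
    using zero_notin_CNV[OF odd_sylow_subgroup[OF P] zero_notin_NV_odd_sylow[OF P]]
      zero_notin_CNV[OF subgroup_unip_group zero_notin_NV_unip] by auto
  then have "UNIV = insert 0 (CNV P \<union> CNV unip_group)" using cover by blast
  then have "CARD('v) = card (insert 0 (CNV P \<union> CNV unip_group))" by simp
  also have "\<dots> = Suc (card (CNV P \<union> CNV unip_group))"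
    using \<open>0 \<notin> CNV P\<close> \<open>0 \<notin> CNV unip_group\<close> by (intro card_insert_disjoint) auto
  also have "card (CNV P \<union> CNV unip_group) = card (CNV P) + card (CNV unip_group)"
    using CNV_odd_unip_disjoint[OF P] by (intro card_Un_disjoint) auto
  also have "card (NV unip_group) = card (Fix unip_group) - 1"
    unfolding NV_unip_eq[OF P cover] using subspace_0[OF subspace_Fix[OF unip_group_carrier]] by (rule card_Diff_singleton)
  then have "card (CNV unip_group) = (t + 1) * (card (Fix unip_group) - 1)" using card_CNV_unip by simp
  finally show ?thesis using card_CNV_odd_sylow[OF P] by simp
qed

lemma CNV_all_if_Fix_unip_trivial:
  assumes P: "odd_sylow r P" and cover: "UNIV - {0} \<subseteq> CNV P \<union> CNV unip_group" and F: "card (Fix unip_group) = 1"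
  shows "CNV P = UNIV - {0}"
proof -
  have "card (CNV unip_group) = 0"
    using card_CNV_unip NV_unip_eq[OF P cover] F subspace_0[OF subspace_Fix[OF unip_group_carrier]]
    by (simp add: card_Diff_singleton)
  then have "CNV unip_group = {}" by simp
  moreover have "0 \<notin> CNV P" using zero_notin_CNV[OF odd_sylow_subgroup[OF P] zero_notin_NV_odd_sylow[OF P]] .
  ultimately show ?thesis using cover by blast
qed

lemma weyl_diag2: "x \<noteq> 0 \<Longrightarrow> weyl ** diag2 x = diag2 (1 / x) ** (weyl :: 'f ^ 2 ^ 2)"
  by (simp add: weyl_def diag2_def)

lemma act_weyl_diag2: "x \<noteq> 0 \<Longrightarrow> act (diag2 x) (act weyl v) = act weyl (act (diag2 (1 / x)) v)"
  using weyl_diag2[of "1 / x"] act_mult[of weyl "diag2 (1 / x)" v] act_mult[of "diag2 x" weyl v] by simp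

lemma t_ge_5: "t \<ge> 5"
proof -
  have "t \<noteq> 4" using prime_t by auto
  then show ?thesis using card_f_ge card_t by simp
qed

lemma exponents:
  obtains w f where "card W = q ^ w" "card (Fix unip_group) = q ^ f" "CARD('v) = q ^ w * q ^ f" "(t - 1) div 2 \<le> w" "q ^ w mod t = 1"
proof -
  obtain w where w: "card W = q ^ w" using card_subspace[OF subspace_W] by blast
  obtain f where f: "card (Fix unip_group) = q ^ f" using card_subspace[OF subspace_Fix[OF unip_group_carrier]] by blast
  have "(t - 1) div 2 \<le> w"
    using card_W_ge unfolding w using prime_gt_1_nat[OF prime_q] by simp
  moreover have "q ^ w mod t = 1"
    using card_W_cong_1 t_ge_5 unfolding w cong_def by simp
  ultimately show ?thesis using that w f card_V by simp
qed

text \<open>Inside the diagonal torus \<open>R\<close> is described by the set \<open>K\<close> of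
  first diagonal entries. The point is to supply the hypotheses of
  \<open>split_equation_solution\<close>, whose bound on \<open>M\<close> comes from discarding
  vectors of \<open>Fix R\<close> that a unipotent group also fixes.\<close>

lemma split_case_torus:
  assumes R: "odd_sylow r R" "r dvd t - 1" "R \<subseteq> split_torus"
    and cover: "UNIV - {0} \<subseteq> CNV R \<union> CNV unip_group"
  shows "t = 13 \<and> CARD('v) = 3 ^ 6 \<and> CNV R = UNIV - {0}"
proof -
  have Rs: "subgroup R SL2" by (rule odd_sylow_subgroup[OF R(1)])
  have RS: "R \<subseteq> carrier SL2" by (rule subgroup.subset[OF Rs])
  define K where "K = {x. x \<noteq> 0 \<and> diag2 x \<in> R}"
  have RK: "R = diag2 ` K" using R(3) by (auto simp: K_def split_torus_def)
  have K1: "1 \<in> K" using subgroup.one_closed[OF Rs] by (simp add: K_def diag2_def)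
  have K0: "0 \<notin> K" by (simp add: K_def)
  have Km: "x * y \<in> K" if "x \<in> K" "y \<in> K" for x y
  proof -
    have "diag2 x \<otimes>\<^bsub>SL2\<^esub> diag2 y \<in> R" using that by (intro subgroup.m_closed[OF Rs]) (auto simp: K_def)
    then show ?thesis using that by (simp add: K_def diag2_mult)
  qed
  have Ki: "1 / x \<in> K" if "x \<in> K" for x
  proof -
    have "inv\<^bsub>SL2\<^esub> (diag2 x) \<in> R" using that by (intro subgroup.m_inv_closed[OF Rs]) (auto simp: K_def)
    then show ?thesis using that by (simp add: K_def inv_diag2)
  qed
  have Ksq: "x = 1" if "x \<in> K" "x * x = 1" for x
  proof -
    have "diag2 x \<in> R" "x \<noteq> 0" using that by (auto simp: K_def)
    then have "diag2 (x ^ card R) = mat2 1 0 0 1" using odd_sylow_pow_card[OF R(1)] diag2_pow[of x "card R"] by simp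
    then have "x ^ card R = 1" by (simp add: diag2_def)
    then show ?thesis using odd_power_eq_1_imp[OF odd_sylow_odd_card[OF R(1)]] that(2) by blast
  qed
  have FixR: "Fix R = {v. \<forall>x\<in>K. act (diag2 x) v = v}" unfolding RK by (auto simp: Fix_def)
  let ?C = "{w \<in> W. \<forall>x\<in>K. act (diag2 x) w = w}"
  have C: "?C = Fix R \<inter> W" unfolding FixR by blast
  have subR: "subspace (Fix R)" by (rule subspace_Fix[OF RS])
  obtain y where y: "card (Fix R \<inter> W) = q ^ y" using card_subspace[OF subspace_inter[OF subR subspace_W]] by blast
  obtain v0 where v0: "v0 \<in> Fix R \<inter> W" "v0 \<noteq> 0"
    using exists_torus_fixed_in_W[OF finite K1 K0 Km Ksq] C by blast
  have "y \<noteq> 0"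
  proof
    assume "y = 0"
    then have "card (Fix R \<inter> W) = 1" using y by simp
    then obtain u where "Fix R \<inter> W = {u}" by (rule card_1_singletonE)
    moreover have "0 \<in> Fix R \<inter> W" using subspace_0[OF subR] subspace_0[OF subspace_W] by blast
    ultimately show False using v0 by (metis singletonD)
  qed
  \<comment> \<open>\<open>K\<close> has odd order, so squaring is injective on it and yields at
    least three squares; this is the source of the cube root bound.\<close>
  have "inj_on (\<lambda>x. x * x) K"
  proof (rule inj_onI)
    fix x y assume xy: "x \<in> K" "y \<in> K" "x * x = y * y"
    have "y \<noteq> 0" using xy(2) by (simp add: K_def)
    have "x * (1 / y) \<in> K" using Km Ki xy by blast
    moreover have "(x * (1 / y)) * (x * (1 / y)) = 1" using xy(3) \<open>y \<noteq> 0\<close> by simp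
    ultimately have "x * (1 / y) = 1" by (rule Ksq)
    then show "x = y" using \<open>y \<noteq> 0\<close> by simp
  qed
  then have "card ((\<lambda>x. x * x) ` K) = card K" by (rule card_image)
  moreover have "card K = card R"
    unfolding RK by (intro card_image[symmetric]) (auto simp: inj_on_def diag2_def)
  ultimately have ck: "card ((\<lambda>x. x * x) ` K) \<ge> 3" using odd_sylow_card_ge_3[OF R(1)] by simp
  obtain w f where wf: "card W = q ^ w" "card (Fix unip_group) = q ^ f" "CARD('v) = q ^ w * q ^ f" "(t - 1) div 2 \<le> w" "q ^ w mod t = 1"
    by (rule exponents)
  have q1: "q > 1" using prime_q by (rule prime_gt_1_nat)
  have "(q ^ y) ^ 3 \<le> (q ^ y) ^ card ((\<lambda>x. x * x) ` K)" using q1 ck by (intro power_increasing) auto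
  also have "\<dots> \<le> q ^ w" using torus_fixed_power_le[OF finite K0] unfolding C y wf(1) .
  finally have "q ^ (y * 3) \<le> q ^ w" by (simp add: power_mult)
  then have y3: "3 * y \<le> w" using q1 by simp
  define F0 where "F0 = card (Fix R \<inter> Fix unip_group)"
  have cR: "card (Fix R) = q ^ y * F0"
    unfolding F0_def y[symmetric]
  proof (rule card_W_times_Fix[OF subR])
    fix v assume v: "v \<in> Fix R"
    have "act (diag2 x) (Nm v) = Nm v" if x: "x \<in> K" for x
    proof -
      have "x \<noteq> 0" using x K0 by blast
      moreover have "act (diag2 x) v = v" using v x unfolding FixR by blast
      ultimately show ?thesis using Nm_act_diag2[of x v] by simp
    qed
    then show "Nm v \<in> Fix R" unfolding FixR by blast
  qed
  \<comment> \<open>\<open>weyl\<close> inverts the torus and exchanges the two unipotent groups, so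
    \<open>?A\<close> and \<open>?B\<close> have the same size; they meet only in 0 and both avoid
    \<open>NV R\<close>.\<close>
  let ?A = "Fix R \<inter> Fix unip_group"
  let ?B = "Fix R \<inter> Fix (conj_set SL2 unip_group weyl)"
  have Fw: "v \<in> Fix (conj_set SL2 unip_group weyl) \<longleftrightarrow> act weyl v \<in> Fix unip_group" for v
    by (rule Fix_conj_set[OF weyl_in_SL2 unip_group_carrier])
  have wR: "act weyl v \<in> Fix R" if v: "v \<in> Fix R" for v
  proof -
    have "act (diag2 x) (act weyl v) = act weyl v" if x: "x \<in> K" for x
    proof -
      have "x \<noteq> 0" using x K0 by blast
      moreover have "act (diag2 (1 / x)) v = v" using v Ki[OF x] unfolding FixR by blast
      ultimately show ?thesis using act_weyl_diag2[of x v] by simp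
    qed
    then show ?thesis unfolding FixR by blast
  qed
  have "bij_betw (act weyl) ?B ?A"
  proof (rule bij_betw_imageI)
    have inj: "inj (act weyl)" using act_inv[OF weyl_in_SL2] by (metis injI)
    then show "inj_on (act weyl) ?B" by (rule inj_on_subset) simp
    have surjR: "act weyl ` Fix R = Fix R"
      using wR inj_on_subset[OF inj] by (intro endo_inj_surj) auto
    show "act weyl ` ?B = ?A"
    proof (intro equalityI subsetI)
      fix u assume u: "u \<in> ?A"
      then obtain v where "v \<in> Fix R" "u = act weyl v" using surjR by blast
      then show "u \<in> act weyl ` ?B" using u Fw by blast
    qed (use wR Fw in auto)
  qed
  then have cB: "card ?B = F0" unfolding F0_def by (rule bij_betw_same_card)
  have zA: "0 \<in> ?A" using subspace_0[OF subR] subspace_0[OF subspace_Fix[OF unip_group_carrier]] by blast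
  have zB: "0 \<in> ?B" using subspace_0[OF subR] Fw zA by simp
  have "?A \<inter> ?B = {0}" using Fix_opposite_unip zA zB by blast
  then have cAB: "card (?A \<union> ?B) + 1 = 2 * F0"
    using card_Un_Int[of ?A ?B] cB unfolding F0_def by simp
  have NVsub: "NV R \<subseteq> Fix R - (?A \<union> ?B)"
  proof
    fix v assume v: "v \<in> NV R"
    have "v \<notin> ?A" using Fix_unip_not_NV_odd_sylow[OF R(1) v] by blast
    moreover have "v \<notin> ?B"
      using Fix_subset_norm_set[OF _ _ v, of "conj_set SL2 unip_group weyl"] conj_unip_group_not_normalizing[OF two R(1) weyl_in_SL2]
        subgroup.subset[OF SL2.subgroup_conj_set[OF subgroup_unip_group weyl_in_SL2]] by blast
    ultimately show "v \<in> Fix R - (?A \<union> ?B)" using NV_Fix[OF RS v] by blast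
  qed
  have "card (NV R) \<le> card (Fix R - (?A \<union> ?B))" by (rule card_mono[OF finite_V NVsub])
  also have "\<dots> = card (Fix R) - card (?A \<union> ?B)" by (intro card_Diff_subset) auto
  finally have "card (NV R) + card (?A \<union> ?B) \<le> card (Fix R)"
    using card_mono[OF finite_V, of "?A \<union> ?B" "Fix R"] by auto
  then have M: "card (NV R) + 2 * F0 \<le> q ^ y * F0 + 1" using cAB cR by simp
  have F01: "1 \<le> F0" using zA unfolding F0_def by (metis One_nat_def Suc_leI card_gt_0_iff empty_iff finite_V)
  have F0F: "F0 \<le> q ^ f" unfolding F0_def wf(2)[symmetric] by (intro card_mono) auto
  have eq: "q ^ w * q ^ f = 1 + card (conj_set SL2 R ` carrier SL2) * card (NV R) + (t + 1) * (q ^ f - 1)"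
    using card_V_covered_unip[OF R(1) cover] unfolding wf(2,3) .
  have N: "2 * card (conj_set SL2 R ` carrier SL2) = t * (t + 1)"
    using card_conjugates_split[OF two R(1) _ R(3)] R(2) card_t by simp
  have r: "prime r" "odd r" using R(1) by (auto simp: odd_sylow_def)
  have "t = 13 \<and> q = 3 \<and> w = 6 \<and> f = 0"
    by (rule split_equation_solution[OF prime_t t_ge_5 r R(2) prime_q N eq M F01 F0F _ y3 wf(4,5)]) (use \<open>y \<noteq> 0\<close> in simp)
  then show ?thesis using wf(2,3) CNV_all_if_Fix_unip_trivial[OF R(1) cover] by simp
qed

lemma split_case:
  assumes R: "odd_sylow r R" "r dvd t - 1" and cover: "UNIV - {0} \<subseteq> CNV R \<union> CNV unip_group"
  shows "t = 13 \<and> CARD('v) = 3 ^ 6 \<and> CNV R = UNIV - {0}"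
proof -
  obtain z where z: "z \<in> carrier SL2" "conj_set SL2 R z \<subseteq> split_torus"
    using conj_into_split_torus[OF R(1)] R(2) card_t by auto
  have "CNV (conj_set SL2 R z) = CNV R"
    by (rule conj_normal_vectors_conj_set[OF refl odd_sylow_subgroup[OF R(1)] z(1)])
  then show ?thesis
    using split_case_torus[OF odd_sylow_conj_set[OF R(1) z(1)] R(2) z(2)] cover by simp
qed

lemma trace2_diag2_sq_neq_4:
  assumes "x \<noteq> 0" "x * x \<noteq> (1::'f)"
  shows "(trace2 (diag2 x))\<^sup>2 \<noteq> 4" "(trace2 (diag2 x))\<^sup>2 - 4 = (x - 1 / x)\<^sup>2"
proof -
  show eq: "(trace2 (diag2 x))\<^sup>2 - 4 = (x - 1 / x)\<^sup>2"
    using assms(1) by (simp add: diag2_def power2_eq_square algebra_simps)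
  have "x - 1 / x \<noteq> 0" using assms by (simp add: field_simps)
  then show "(trace2 (diag2 x))\<^sup>2 \<noteq> 4" using eq by auto
qed

text \<open>An odd prime dividing n - 1 would give a diagonal element fixing some nonzero
  \<open>v\<close> in \<open>W\<close>, whose sum with its \<open>weyl\<close> image cannot be
  covered; so n - 1 is a power of 2. Counting then uses that all nonzero vectors fixed by
  \<open>S\<close> belong to \<open>S\<close>.\<close>

lemma nonsplit_case:
  assumes S: "odd_sylow s S" "s dvd t + 1" and cover: "UNIV - {0} \<subseteq> CNV S \<union> CNV unip_group"
  shows "t = 5 \<and> CARD('v) = 3 ^ 4 \<and> CNV S = UNIV - {0}"
proof -
  have s: "prime s" "odd s" using S(1) by (auto simp: odd_sylow_def)
  have Ss: "subgroup S SL2" by (rule odd_sylow_subgroup[OF S(1)])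
  have SS: "S \<subseteq> carrier SL2" by (rule subgroup.subset[OF Ss])
  have sC: "s dvd CARD('f) + 1" using S(2) card_t by simp
  have no_odd: "\<not> p dvd t - 1" if p: "prime p" "odd p" for p
  proof
    assume pd: "p dvd t - 1"
    let ?H = "SL2\<lparr>carrier := split_torus :: ('f ^ 2 ^ 2) set\<rparr>"
    have Hg: "group ?H" by (rule subgroup.subgroup_is_group[OF subgroup_split_torus SL2.is_group])
    obtain k where k: "t - 1 = p * k" using pd by blast
    have "\<exists>Q. subgroup Q ?H \<and> card Q = p ^ 1"
      by (rule sylow_thm[OF p(1) Hg, of 1 k]) (use k in \<open>simp_all add: SL2.order_subgroup card_split_torus card_t\<close>)
    then obtain Q where Q: "subgroup Q ?H" "card Q = p" by auto
    have Qsub: "Q \<subseteq> split_torus" using subgroup.subset[OF Q(1)] by simp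
    have "card Q > 1" using Q(2) prime_gt_1_nat[OF p(1)] by simp
    then have "\<not> Q \<subseteq> {mat2 1 0 0 1}" using card_mono[of "{mat2 1 0 0 (1::'f)}" Q] by auto
    then obtain h where h: "h \<in> Q" "h \<noteq> mat2 1 0 0 1" by blast
    obtain y where y: "y \<noteq> 0" "h = diag2 y" using h(1) Qsub by (auto simp: split_torus_def)
    have y1: "y \<noteq> 1" using h(2) y(2) by (auto simp: diag2_def)
    have "h [^]\<^bsub>SL2\<^esub> p = mat2 1 0 0 1"
    proof -
      interpret QG: group "?H\<lparr>carrier := Q\<rparr>" by (rule subgroup.subgroup_is_group[OF Q(1) Hg])
      have "h [^]\<^bsub>?H\<lparr>carrier := Q\<rparr>\<^esub> Coset.order (?H\<lparr>carrier := Q\<rparr>) = \<one>\<^bsub>?H\<lparr>carrier := Q\<rparr>\<^esub>"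
        using h(1) by (intro QG.pow_order_eq_1) simp
      then show ?thesis using Q(2) by (simp add: Coset.order_def SL2.nat_pow_consistent[symmetric])
    qed
    then have yp: "y ^ p = 1" using diag2_pow[OF y(1), of p] y(2) by (simp add: diag2_def)
    have yy: "y * y \<noteq> 1" using odd_power_eq_1_imp[OF p(2) yp] y1 by blast
    define K where "K = {x::'f. x ^ p = 1}"
    have pp: "p > 0" using p(1) prime_gt_0_nat by blast
    obtain v where v: "v \<in> W" "v \<noteq> 0" "\<forall>x\<in>K. act (diag2 x) v = v"
    proof -
      have "\<exists>v\<in>W. v \<noteq> 0 \<and> (\<forall>x\<in>K. act (diag2 x) v = v)"
        by (rule exists_torus_fixed_in_W)
          (use pp odd_power_eq_1_imp[OF p(2)] in \<open>auto simp: K_def power_mult_distrib zero_power\<close>)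
      then show ?thesis using that by blast
    qed
    have yK: "y \<in> K" "1 / y \<in> K" using yp by (simp_all add: K_def power_divide)
    \<comment> \<open>An odd order element cannot normalize a Sylow subgroup of a nonsplit torus
      unless it centralizes it, which a regular diagonal element cannot do. Only the two unipotent
      groups normalized by the diagonal element remain.\<close>
    have key: "u \<in> Fix unip_group \<or> u \<in> Fix (conj_set SL2 unip_group weyl)" if u: "u \<noteq> 0" "act (diag2 y) u = u" for u
    proof (cases "u \<in> CNV S")
      case True
      then obtain Q where Q: "odd_sylow s Q" "u \<in> NV Q" by (rule CNV_odd_sylowE[OF S(1)])
      have n: "diag2 y \<in> norm_set SL2 Q" by (rule normal_vectors_D[OF Q(2) diag2_in_SL2[OF y(1)] u(2)])
      have pow: "diag2 y [^]\<^bsub>SL2\<^esub> p = \<one>\<^bsub>SL2\<^esub>" using \<open>h [^]\<^bsub>SL2\<^esub> p = mat2 1 0 0 1\<close> y(2) by simp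
      obtain g where g: "g \<in> Q" "g \<in> carrier SL2" "(trace2 g)\<^sup>2 \<noteq> 4" "Q \<subseteq> centr g"
        using odd_sylow_regular_center[OF Q(1)] by blast
      have "diag2 y ** g = g ** diag2 y" by (rule odd_order_normalizer_centralizes[OF two Q(1) n p(2) pow g(1)])
      then have "centr g = centr (diag2 y)"
        using centr_eq[OF g(2,3) diag2_in_SL2[OF y(1)] trace2_diag2_sq_neq_4(1)[OF y(1) yy]] by simp
      moreover have "card (centr (diag2 y)) = CARD('f) - 1"
        using card_centr_cases[OF two diag2_in_SL2[OF y(1)] trace2_diag2_sq_neq_4(1)[OF y(1) yy]]
          trace2_diag2_sq_neq_4(2)[OF y(1) yy] by metis
      moreover have "card (centr g) = CARD('f) + 1" using card_centr_plus[OF two Q(1) sC g(2-4)] by blast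
      ultimately have "CARD('f) - 1 = CARD('f) + 1" by simp
      then show ?thesis by arith
    next
      case False
      then have "u \<in> CNV unip_group" using cover u(1) by blast
      then obtain z where z: "z \<in> carrier SL2" "u \<in> NV (conj_set SL2 unip_group z)" by (rule CNV_unipE)
      have "diag2 y \<in> norm_set SL2 (conj_set SL2 unip_group z)"
        by (rule normal_vectors_D[OF z(2) diag2_in_SL2[OF y(1)] u(2)])
      from diag2_normalizes_conj_unip_group[OF z(1) y(1) yy this]
      show ?thesis
        using NV_Fix[OF _ z(2)] subgroup.subset[OF SL2.subgroup_conj_set[OF subgroup_unip_group z(1)]] by metis
    qed
    have Fw: "u \<in> Fix (conj_set SL2 unip_group weyl) \<longleftrightarrow> act weyl u \<in> Fix unip_group" for u
      by (rule Fix_conj_set[OF weyl_in_SL2 unip_group_carrier])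
    have subF: "subspace (Fix unip_group)" by (rule subspace_Fix[OF unip_group_carrier])
    have vnF: "v \<notin> Fix unip_group" using W_Fix_unip v by blast
    define v' where "v' = act weyl v"
    have v'F: "v' \<in> Fix unip_group" using key[OF v(2)] v(3) yK(1) vnF Fw unfolding v'_def by blast
    have v'fix: "act (diag2 y) v' = v'" unfolding v'_def using act_weyl_diag2[OF y(1)] v(3) yK(2) by simp
    have v'0: "v' \<noteq> 0" unfolding v'_def using act_inv[OF weyl_in_SL2, of v] v(2) by auto
    \<comment> \<open>\<open>v\<close> is fixed by the lower and \<open>v'\<close> by the upper
      unipotents only, so their sum is fixed by neither, although the diagonal element fixes
      it.\<close>
    have "v + v' \<noteq> 0"
    proof
      assume "v + v' = 0"
      then have "v = - v'" by (simp add: eq_neg_iff_add_eq_0)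
      then show False using vnF v'F subspace_neg[OF subF] by simp
    qed
    moreover have "act (diag2 y) (v + v') = v + v'" using v(3) yK(1) v'fix y(1) by (simp add: act_add)
    ultimately consider "v + v' \<in> Fix unip_group" | "v + v' \<in> Fix (conj_set SL2 unip_group weyl)" using key by blast
    then show False
    proof cases
      case 1
      then have "v + v' - v' \<in> Fix unip_group" using v'F subspace_diff[OF subF] by blast
      then show False using vnF by simp
    next
      case 2
      have "v \<in> Fix (conj_set SL2 unip_group weyl)" using v'F Fw by (simp add: v'_def)
      then have "v + v' - v \<in> Fix (conj_set SL2 unip_group weyl)"
        using 2 subspace_diff[OF subspace_Fix[OF subgroup.subset[OF SL2.subgroup_conj_set[OF subgroup_unip_group weyl_in_SL2]]]] by blast
      then have "v' = 0" using Fix_opposite_unip[OF v'F] by simp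
      then show False using v'0 by blast
    qed
  qed
  obtain k where k: "t - 1 = 2 ^ k" using power_2_if_no_odd_prime_divisor[of "t - 1"] no_odd t_ge_5 by auto
  have NVS: "NV S = Fix S - {0}"
  proof (intro equalityI subsetI)
    fix v assume "v \<in> NV S"
    then show "v \<in> Fix S - {0}" using NV_Fix[OF SS] zero_notin_NV_odd_sylow[OF S(1)] by blast
  next
    fix v assume v: "v \<in> Fix S - {0}"
    have "v \<notin> CNV unip_group"
    proof
      assume "v \<in> CNV unip_group"
      then obtain z where z: "z \<in> carrier SL2" "v \<in> NV (conj_set SL2 unip_group z)" by (rule CNV_unipE)
      then show False
        using nonsplit_not_normalizing_conj_unip_group[OF two S(1) sC z(1)] Fix_subset_norm_set[OF SS _ z(2)] v by blast
    qed
    then have "v \<in> CNV S" using cover v by blast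
    then obtain Q where Q: "odd_sylow s Q" "v \<in> NV Q" by (rule CNV_odd_sylowE[OF S(1)])
    have "S \<subseteq> norm_set SL2 Q" using Fix_subset_norm_set[OF SS _ Q(2)] v by blast
    then have "Q = S" using Q(1) S(1) by (intro SL2.sylow_eq_if_normalizing[OF s(1) finite_SL2]) (auto simp: odd_sylow_def)
    then show "v \<in> NV S" using Q(2) by simp
  qed
  obtain e where e: "card (Fix S) = q ^ e" using card_subspace[OF subspace_Fix[OF SS]] by blast
  have cNV: "card (NV S) = q ^ e - 1"
    unfolding NVS e[symmetric] using subspace_0[OF subspace_Fix[OF SS]] by (rule card_Diff_singleton)
  obtain w f where wf: "card W = q ^ w" "card (Fix unip_group) = q ^ f" "CARD('v) = q ^ w * q ^ f" "(t - 1) div 2 \<le> w" "q ^ w mod t = 1"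
    by (rule exponents)
  have eq: "q ^ w * q ^ f = 1 + card (conj_set SL2 S ` carrier SL2) * (q ^ e - 1) + (t + 1) * (q ^ f - 1)"
    using card_V_covered_unip[OF S(1) cover] unfolding wf(2,3) cNV .
  have N: "2 * card (conj_set SL2 S ` carrier SL2) = t * (t - 1)"
    using card_conjugates_nonsplit[OF two S(1) sC] card_t by simp
  have "q ^ e \<le> q ^ (w + f)"
    using card_mono[OF finite_V subset_UNIV, of "Fix S"] unfolding e wf(3) power_add .
  then have ew: "e \<le> w + f" using prime_gt_1_nat[OF prime_q] by simp
  have "t = 5 \<and> q ^ w = 81 \<and> f = 0"
    by (rule nonsplit_equation_solution[OF prime_t t_ge_5 k prime_q q_neq_t N eq ew wf(4)])
  then show ?thesis using wf(2,3) CNV_all_if_Fix_unip_trivial[OF S(1) cover] by simp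
qed

end

subsection \<open>Covers by split and nonsplit tori\<close>

text \<open>For checking ring identities modulo the one relation m = -1: the two sides differ by an
  explicit multiple \<open>h\<close> of \<open>1 + m\<close>.\<close>

lemma eq_if_diff: "m = - 1 \<Longrightarrow> x - y = h * (1 + m) \<Longrightarrow> x = (y :: 'a::comm_ring_1)"
  by simp

text \<open>A solution of \<alpha>^2 + \<beta>^2 = -1 makes the matrix algebra contain the
  quaternion units. The element \<open>x\<close> is the Hurwitz unit (1 + i + j + ij) / 2, which
  permutes \<open>i\<close>, \<open>j\<close> and \<open>i ** j\<close> cyclically by
  conjugation.\<close>

lemma exists_quaternion_group:
  assumes two: "(2::'f::{field,finite}) \<noteq> 0"
  obtains i j x :: "'f::{field,finite} ^ 2 ^ 2" where "i \<in> carrier SL2" "j \<in> carrier SL2" "x \<in> carrier SL2"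
    "i ** i = mat2 (- 1) 0 0 (- 1)" "j ** j = mat2 (- 1) 0 0 (- 1)" "j ** i = mat2 (- 1) 0 0 (- 1) ** (i ** j)"
    "x ** i = j ** x" "x ** j = (i ** j) ** x" "x ** (i ** j) = i ** x"
    "trace2 i = 0" "trace2 j = 0" "trace2 (i ** j) = 0"
proof -
  obtain \<alpha> \<beta> :: 'f where "\<alpha>\<^sup>2 - (- 1) * \<beta>\<^sup>2 = - 1" using norm_form_surj[OF two, of "- 1" "- 1"] by auto
  then have ab: "\<alpha> * \<alpha> + \<beta> * \<beta> = - 1" by (simp add: power2_eq_square)
  define h where "h = 1 / (2::'f)"
  have h: "2 * h = 1" using two by (simp add: h_def)
  let ?i = "mat2 0 (- 1) 1 0 :: 'f ^ 2 ^ 2" and ?j = "mat2 \<alpha> \<beta> \<beta> (- \<alpha>)"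
    and ?x = "mat2 (h * (1 + \<alpha> - \<beta>)) (h * (\<alpha> + \<beta> - 1)) (h * (1 + \<alpha> + \<beta>)) (h * (1 - \<alpha> + \<beta>))"
  show ?thesis
  proof (rule that[of ?i ?j ?x])
    have "h * (1 + \<alpha> - \<beta>) * (h * (1 - \<alpha> + \<beta>)) - h * (\<alpha> + \<beta> - 1) * (h * (1 + \<alpha> + \<beta>)) = 1"
    proof -
      have "4 * (h * h) = (2 * h) * (2 * h)" by (simp add: algebra_simps)
      then have hh: "4 * (h * h) = 1" using h by simp
      have "h * (1 + \<alpha> - \<beta>) * (h * (1 - \<alpha> + \<beta>)) - h * (\<alpha> + \<beta> - 1) * (h * (1 + \<alpha> + \<beta>))
        = 2 * (h * h) * (1 - (\<alpha> * \<alpha> + \<beta> * \<beta>))" by (simp add: algebra_simps)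
      also have "\<dots> = 4 * (h * h)" unfolding ab by simp
      finally show ?thesis using hh by simp
    qed
    then show "?x \<in> carrier SL2" by (simp only: mat2_in_SL2)
    have "- (\<alpha> * \<alpha>) - \<beta> * \<beta> = - (\<alpha> * \<alpha> + \<beta> * \<beta>)" by simp
    then have "- (\<alpha> * \<alpha>) - \<beta> * \<beta> = 1" unfolding ab by simp
    then show "?j \<in> carrier SL2" by simp
    show "?j ** ?j = mat2 (- 1) 0 0 (- 1)" using ab by (simp add: algebra_simps)
    show "?x ** ?i = ?j ** ?x"
      by (simp only: mat2_mult mat2_eq_iff, intro conjI)
        ((rule eq_if_diff[where h = h], rule ab, (simp add: algebra_simps; fail)) |
         (rule eq_if_diff[where h = "- h"], rule ab, (simp add: algebra_simps; fail)) |
         (rule eq_if_diff[where h = 0], rule ab, (simp add: algebra_simps; fail)))+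
    show "?x ** ?j = (?i ** ?j) ** ?x"
      by (simp only: mat2_mult mat2_eq_iff, intro conjI)
        ((rule eq_if_diff[where h = h], rule ab, (simp add: algebra_simps; fail)) |
         (rule eq_if_diff[where h = "- h"], rule ab, (simp add: algebra_simps; fail)) |
         (rule eq_if_diff[where h = 0], rule ab, (simp add: algebra_simps; fail)))+
    show "?x ** (?i ** ?j) = ?i ** ?x"
      by (simp only: mat2_mult mat2_eq_iff, intro conjI)
        ((rule eq_if_diff[where h = h], rule ab, (simp add: algebra_simps; fail)) |
         (rule eq_if_diff[where h = "- h"], rule ab, (simp add: algebra_simps; fail)) |
         (rule eq_if_diff[where h = 0], rule ab, (simp add: algebra_simps; fail)))+
  qed (simp_all add: algebra_simps)
qed

text \<open>Modulo 4, the two sides disagree as soon as m \<ge> 2 and d \<ge> 3.\<close>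

lemma power_2_eq_3_power_2_minus_2:
  assumes "(2::nat) ^ d + 2 = 3 * 2 ^ m"
  shows "(2::nat) ^ d \<le> 4"
proof (cases "m \<le> 1")
  case True
  then have "m = 0 \<or> m = 1" by auto
  then show ?thesis using assms by auto
next
  case False
  then obtain m' where m: "m = m' + 2" using le_Suc_ex[of 2 m] by auto
  show ?thesis
  proof (cases "d \<le> 2")
    case True
    then have "(2::nat) ^ d \<le> 2 ^ 2" by (intro power_increasing) auto
    then show ?thesis by simp
  next
    case False
    then obtain d' where "d = d' + 2" using le_Suc_ex[of 2 d] by auto
    then have "4 * 2 ^ d' + 2 = 4 * (3 * 2 ^ m' :: nat)" using assms m by simp
    then show ?thesis by presburger
  qed
qed

locale sl2_mixed_cover = sl2_prime_module act scale t a q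
  for act :: "'f::{field,finite} ^ 2 ^ 2 \<Rightarrow> 'v::ab_group_add \<Rightarrow> 'v"
    and scale :: "'k::{field,finite} \<Rightarrow> 'v \<Rightarrow> 'v" and t a q +
  fixes r s :: nat and R S :: "('f ^ 2 ^ 2) set"
  assumes R: "odd_sylow r R" "r dvd t - 1" and S: "odd_sylow s S" "s dvd t + 1"
    and cover: "UNIV - {0} \<subseteq> CNV R \<union> CNV S"
begin

definition good :: "('f ^ 2 ^ 2) set \<Rightarrow> bool" where
  "good P \<longleftrightarrow> odd_sylow r P \<or> odd_sylow s P"

lemma good_odd_sylow: "good P \<Longrightarrow> \<exists>p. odd_sylow p P"
  by (auto simp: good_def)

lemma good_subgroup: "good P \<Longrightarrow> subgroup P SL2"
  using good_odd_sylow odd_sylow_subgroup by blast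

lemma good_carrier: "good P \<Longrightarrow> P \<subseteq> carrier SL2"
  using good_subgroup subgroup.subset by blast

lemma good_conj_set: "good P \<Longrightarrow> z \<in> carrier SL2 \<Longrightarrow> good (conj_set SL2 P z)"
  using odd_sylow_conj_set by (auto simp: good_def)

lemma cover_good: "v \<noteq> 0 \<Longrightarrow> \<exists>P. good P \<and> v \<in> NV P"
proof -
  assume "v \<noteq> 0"
  then consider "v \<in> CNV R" | "v \<in> CNV S" using cover by blast
  then show ?thesis
  proof cases
    case 1
    show ?thesis by (rule CNV_odd_sylowE[OF R(1) 1]) (auto simp: good_def)
  next
    case 2
    show ?thesis by (rule CNV_odd_sylowE[OF S(1) 2]) (auto simp: good_def)
  qed
qed

lemma odd_sylow_normalizing_commute:
  fixes P Q :: "('f ^ 2 ^ 2) set"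
  assumes "odd_sylow p P" "odd_sylow p' Q" "Q \<subseteq> norm_set SL2 P" "x \<in> P" "y \<in> Q"
  shows "x ** y = y ** x"
  using odd_order_normalizer_centralizes[OF two assms(1) subsetD[OF assms(3,5)] odd_sylow_odd_card[OF assms(2)]
      odd_sylow_pow_card[OF assms(2,5)] assms(4)] by (rule sym)

text \<open>\<open>Q\<close> has odd order, so normalizing \<open>P\<close> means centralizing it.
  Different primes would thus give a split and a nonsplit torus that commute; for equal primes two
  Sylow subgroups coincide.\<close>

lemma good_eq:
  assumes "good P" "good Q" "Q \<subseteq> norm_set SL2 P"
  shows "P = Q" "\<not> (odd_sylow r P \<and> odd_sylow s Q)" "\<not> (odd_sylow s P \<and> odd_sylow r Q)"
proof -
  have dvd: "r dvd CARD('f) - 1" "s dvd CARD('f) + 1" using R(2) S(2) card_t by simp_all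
  show rs: "\<not> (odd_sylow r P \<and> odd_sylow s Q)"
  proof
    assume *: "odd_sylow r P \<and> odd_sylow s Q"
    show False
      by (rule split_nonsplit_not_commuting[OF two _ dvd(1) _ dvd(2)])
        (use * odd_sylow_normalizing_commute assms(3) in blast)+
  qed
  show sr: "\<not> (odd_sylow s P \<and> odd_sylow r Q)"
  proof
    assume *: "odd_sylow s P \<and> odd_sylow r Q"
    show False
    proof (rule split_nonsplit_not_commuting[OF two _ dvd(1) _ dvd(2)])
      show "odd_sylow r Q" "odd_sylow s P" using * by simp_all
      fix x y assume "x \<in> Q" "y \<in> P"
      then show "x ** y = y ** x" using odd_sylow_normalizing_commute[OF _ _ assms(3), of s r y x] * by simp
    qed
  qed
  obtain p where p: "odd_sylow p P" "odd_sylow p Q" using assms(1,2) rs sr by (auto simp: good_def)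
  then show "P = Q"
    using assms(3) by (intro SL2.sylow_eq_if_normalizing[of p]) (auto simp: odd_sylow_def)
qed

lemma good_commuting_eq:
  assumes "good P" "good Q" "\<And>x y. x \<in> P \<Longrightarrow> y \<in> Q \<Longrightarrow> x ** y = y ** x"
  shows "P = Q"
proof (rule good_eq(1)[OF assms(1,2)])
  show "Q \<subseteq> norm_set SL2 P"
  proof
    fix y assume y: "y \<in> Q"
    have yc: "y \<in> carrier SL2" using good_carrier[OF assms(2)] y by blast
    have "y \<otimes>\<^bsub>SL2\<^esub> x \<otimes>\<^bsub>SL2\<^esub> inv\<^bsub>SL2\<^esub> y = x" if x: "x \<in> P" for x
    proof -
      have xc: "x \<in> carrier SL2" using good_carrier[OF assms(1)] x by blast
      have "y \<otimes>\<^bsub>SL2\<^esub> x = x \<otimes>\<^bsub>SL2\<^esub> y" using assms(3)[OF x y] by simp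
      then show ?thesis using xc yc by (simp add: SL2.m_assoc del: mult_SL2 one_SL2)
    qed
    then show "y \<in> norm_set SL2 P" using yc by (simp add: norm_set_def del: mult_SL2 one_SL2)
  qed
qed

lemma zero_notin_NV_good: "good P \<Longrightarrow> 0 \<notin> NV P"
  using good_odd_sylow zero_notin_NV_odd_sylow by blast

lemma NV_good:
  assumes "good P"
  shows "NV P = Fix P - {0}"
proof (intro equalityI subsetI)
  fix v assume "v \<in> NV P"
  then show "v \<in> Fix P - {0}" using NV_Fix[OF good_carrier[OF assms]] zero_notin_NV_good[OF assms] by blast
next
  fix v assume v: "v \<in> Fix P - {0}"
  obtain Q where Q: "good Q" "v \<in> NV Q" using cover_good v by blast
  have "P \<subseteq> norm_set SL2 Q" using Fix_subset_norm_set[OF good_carrier[OF assms] _ Q(2)] v by blast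
  then have "Q = P" by (rule good_eq(1)[OF Q(1) assms])
  then show "v \<in> NV P" using Q(2) by simp
qed

lemma good_Fix_unique:
  assumes "good P" "good Q" "v \<in> Fix P" "v \<in> Fix Q" "v \<noteq> 0"
  shows "P = Q"
proof -
  have "v \<in> NV P" using NV_good assms by blast
  then have "Q \<subseteq> norm_set SL2 P" by (rule Fix_subset_norm_set[OF good_carrier[OF assms(2)] assms(4)])
  then show ?thesis by (rule good_eq(1)[OF assms(1,2)])
qed

lemma Fix_unip_trivial: "Fix unip_group = {0}"
proof -
  have "v = 0" if v: "v \<in> Fix unip_group" for v
  proof (rule ccontr)
    assume "v \<noteq> 0"
    then obtain P where "good P" "v \<in> NV P" using cover_good by blast
    then show False using Fix_unip_not_NV_odd_sylow v good_odd_sylow by blast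
  qed
  then show ?thesis using subspace_0[OF subspace_Fix[OF unip_group_carrier]] by blast
qed

lemma CNV_disjoint: "CNV R \<inter> CNV S = {}"
proof (rule ccontr)
  assume "CNV R \<inter> CNV S \<noteq> {}"
  then obtain v where v: "v \<in> CNV R" "v \<in> CNV S" by blast
  obtain P where P: "odd_sylow r P" "v \<in> NV P" using CNV_odd_sylowE[OF R(1) v(1)] by blast
  obtain Q where Q: "odd_sylow s Q" "v \<in> NV Q" using CNV_odd_sylowE[OF S(1) v(2)] by blast
  have g: "good P" "good Q" using P Q by (simp_all add: good_def)
  have "Q \<subseteq> norm_set SL2 P"
    by (rule Fix_subset_norm_set[OF good_carrier[OF g(2)] NV_Fix[OF good_carrier[OF g(2)] Q(2)] P(2)])
  then show False using good_eq(2)[OF g] P(1) Q(1) by blast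
qed

lemma good_RS: "good R" "good S"
  using R(1) S(1) by (simp_all add: good_def)

lemma card_NV_good: "good P \<Longrightarrow> card (NV P) = card (Fix P) - 1"
  unfolding NV_good using subspace_0[OF subspace_Fix[OF good_carrier]] by (rule card_Diff_singleton)

lemma card_V_mixed:
  "CARD('v) = 1 + card (conj_set SL2 R ` carrier SL2) * (card (Fix R) - 1)
    + card (conj_set SL2 S ` carrier SL2) * (card (Fix S) - 1)"
proof -
  have 0: "0 \<notin> CNV R" "0 \<notin> CNV S"
    using zero_notin_CNV good_subgroup zero_notin_NV_good good_RS by blast+
  then have "UNIV = insert 0 (CNV R \<union> CNV S)" using cover by blast
  then have "CARD('v) = card (insert 0 (CNV R \<union> CNV S))" by simp
  also have "\<dots> = Suc (card (CNV R \<union> CNV S))" using 0 by (intro card_insert_disjoint) auto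
  also have "card (CNV R \<union> CNV S) = card (CNV R) + card (CNV S)"
    using CNV_disjoint by (intro card_Un_disjoint) auto
  finally show ?thesis using card_CNV_odd_sylow[OF R(1)] card_CNV_odd_sylow[OF S(1)] card_NV_good good_RS by simp
qed

lemma good_subset_centr_if_centralizing:
  assumes P: "good P" and k: "k \<in> carrier SL2" "(trace2 k)\<^sup>2 \<noteq> 4"
    and comm: "\<And>h. h \<in> P \<Longrightarrow> k ** h = h ** k"
  shows "P \<subseteq> centr k"
  using comm good_carrier[OF P] by (auto simp: centr_def)

lemma good_in_centr_eq:
  assumes "good P" "good Q" "k \<in> carrier SL2" "(trace2 k)\<^sup>2 \<noteq> 4" "P \<subseteq> centr k" "Q \<subseteq> centr k"
  shows "P = Q"
  using centr_commute[OF assms(3,4)] assms(5,6) by (intro good_commuting_eq[OF assms(1,2)]) blast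

text \<open>The torus contains an element \<open>k\<close> of order \<open>q\<close>, which is
  unipotent on \<open>V\<close>, so the size of \<open>V\<close> is at most the \<open>q\<close>-th
  power of that of its fixed space. A nonzero vector fixed by \<open>k\<close> belongs to some good
  group normalized, hence centralized, by \<open>k\<close>; it lies in the same torus and is
  therefore \<open>P\<close>.\<close>

lemma card_V_le_Fix_power:
  assumes P: "good P" and g: "g \<in> carrier SL2" "(trace2 g)\<^sup>2 \<noteq> 4" "P \<subseteq> centr g"
    and q: "odd q" "q dvd card (centr g)"
  shows "CARD('v) \<le> card (Fix P) ^ q"
proof -
  let ?H = "SL2\<lparr>carrier := centr g\<rparr>"
  have Hg: "group ?H" by (rule subgroup.subgroup_is_group[OF subgroup_centr[OF g(1)] SL2.is_group])
  obtain m where m: "card (centr g) = q * m" using q(2) by blast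
  have fin: "finite (centr g)" using finite_subset[OF _ finite_SL2] by (auto simp: centr_def)
  have "\<exists>Q. subgroup Q ?H \<and> card Q = q ^ 1"
    by (rule sylow_thm[OF prime_q Hg, of 1 m]) (use m fin in \<open>simp_all add: SL2.order_subgroup\<close>)
  then obtain Q where Q: "subgroup Q ?H" "card Q = q" by auto
  have Qsub: "Q \<subseteq> centr g" using subgroup.subset[OF Q(1)] by simp
  have "card Q > 1" using Q(2) prime_gt_1_nat[OF prime_q] by simp
  then have "\<not> Q \<subseteq> {\<one>\<^bsub>SL2\<^esub>}" using card_mono[of "{\<one>\<^bsub>SL2\<^esub>}" Q] by auto
  then obtain k where k: "k \<in> Q" "k \<noteq> \<one>\<^bsub>SL2\<^esub>" by blast
  have kg: "k \<in> centr g" using k(1) Qsub by blast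
  then have kc: "k \<in> carrier SL2" by (simp add: centr_def)
  have pow: "k [^]\<^bsub>SL2\<^esub> q = \<one>\<^bsub>SL2\<^esub>"
  proof -
    interpret QG: group "?H\<lparr>carrier := Q\<rparr>" by (rule subgroup.subgroup_is_group[OF Q(1) Hg])
    have "k [^]\<^bsub>?H\<lparr>carrier := Q\<rparr>\<^esub> Coset.order (?H\<lparr>carrier := Q\<rparr>) = \<one>\<^bsub>?H\<lparr>carrier := Q\<rparr>\<^esub>"
      using k(1) by (intro QG.pow_order_eq_1) simp
    then show ?thesis using Q(2) by (simp add: Coset.order_def SL2.nat_pow_consistent[symmetric])
  qed
  have "\<not> t dvd q" using primes_dvd_imp_eq[OF prime_t prime_q] q_neq_t by blast
  then have "of_nat q \<noteq> (0::'f)" using of_nat_eq_0_iff_CARD_prime_power[OF prime_t card_f] by simp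
  from trace2_sq_neq_4_if_odd_order[OF kc k(2) q(1) this pow] have kr: "(trace2 k)\<^sup>2 \<noteq> 4" .
  have kgc: "centr g = centr k" by (rule centr_eq[OF g(1,2) kc kr]) (use kg in \<open>simp add: centr_def\<close>)
  have "CARD('v) \<le> card {v \<in> UNIV. act k v = v} ^ q"
    by (rule card_le_card_Fix_power[OF kc subspace_UNIV]) (use pow act_one in simp_all)
  also have "{v \<in> UNIV. act k v = v} \<subseteq> Fix P"
  proof
    fix v assume "v \<in> {v \<in> UNIV. act k v = v}"
    then have v: "act k v = v" by simp
    show "v \<in> Fix P"
    proof (cases "v = 0")
      case True
      then show ?thesis using subspace_0[OF subspace_Fix[OF good_carrier[OF P]]] by simp
    next
      case False
      then obtain P' where P': "good P'" "v \<in> NV P'" using cover_good by blast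
      obtain p where p: "odd_sylow p P'" using good_odd_sylow[OF P'(1)] by blast
      have n: "k \<in> norm_set SL2 P'" by (rule normal_vectors_D[OF P'(2) kc v])
      have "P' \<subseteq> centr k"
        by (rule good_subset_centr_if_centralizing[OF P'(1) kc kr])
          (rule odd_order_normalizer_centralizes[OF two p n q(1) pow])
      then have "P = P'" using good_in_centr_eq[OF P P'(1) kc kr] g(3) kgc by simp
      then show ?thesis using NV_Fix[OF good_carrier[OF P]] P'(2) by simp
    qed
  qed
  then have "card {v \<in> UNIV. act k v = v} ^ q \<le> card (Fix P) ^ q" by (intro power_mono card_mono) auto
  finally show ?thesis .
qed

text \<open>The vectors of \<open>D\<close> fixed by the good subgroup of the torus of
  \<open>k\<close>. Adding 0 by hand keeps this a subspace when the torus contains no good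
  subgroup.\<close>

definition torus_fixed :: "'v set \<Rightarrow> 'f ^ 2 ^ 2 \<Rightarrow> 'v set" where
  "torus_fixed D k = {v \<in> D. v = 0 \<or> (\<exists>P. good P \<and> P \<subseteq> centr k \<and> v \<in> Fix P)}"

lemma subspace_torus_fixed:
  assumes D: "subspace D" and k: "k \<in> carrier SL2" "(trace2 k)\<^sup>2 \<noteq> 4"
  shows "subspace (torus_fixed D k)"
proof (cases "\<exists>P. good P \<and> P \<subseteq> centr k")
  case True
  then obtain P where P: "good P" "P \<subseteq> centr k" by blast
  have sub: "subspace (Fix P)" by (rule subspace_Fix[OF good_carrier[OF P(1)]])
  have "torus_fixed D k = D \<inter> Fix P"
  proof (intro equalityI subsetI)
    fix v assume "v \<in> torus_fixed D k"
    then have v: "v \<in> D" "v = 0 \<or> (\<exists>P. good P \<and> P \<subseteq> centr k \<and> v \<in> Fix P)"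
      unfolding torus_fixed_def by blast+
    from v(2) have "v \<in> Fix P" using good_in_centr_eq[OF _ P(1) k _ P(2)] subspace_0[OF sub] by blast
    then show "v \<in> D \<inter> Fix P" using v(1) by blast
  next
    fix v assume "v \<in> D \<inter> Fix P"
    then show "v \<in> torus_fixed D k" using P unfolding torus_fixed_def by blast
  qed
  then show ?thesis using subspace_inter[OF D sub] by simp
next
  case False
  then have "torus_fixed D k = {0}" using subspace_0[OF D] by (auto simp: torus_fixed_def)
  then show ?thesis by simp
qed

text \<open>A common nonzero vector would have one good group in both centralizers; a regular
  element of it commutes with \<open>k\<close> and \<open>l\<close>, which then commute with each
  other.\<close>

lemma torus_fixed_disjoint:
  assumes D: "subspace D" and k: "k \<in> carrier SL2" "(trace2 k)\<^sup>2 \<noteq> 4" and l: "l \<in> carrier SL2" "(trace2 l)\<^sup>2 \<noteq> 4"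
    and kl: "k ** l \<noteq> l ** k"
  shows "torus_fixed D k \<inter> torus_fixed D l = {0}"
proof -
  have "v = 0" if v: "v \<in> torus_fixed D k" "v \<in> torus_fixed D l" for v
  proof (rule ccontr)
    assume v0: "v \<noteq> 0"
    obtain P where P: "good P" "P \<subseteq> centr k" "v \<in> Fix P" using v(1) v0 unfolding torus_fixed_def by blast
    obtain Q where Q: "good Q" "Q \<subseteq> centr l" "v \<in> Fix Q" using v(2) v0 unfolding torus_fixed_def by blast
    have PQ: "P = Q" by (rule good_Fix_unique[OF P(1) Q(1) P(3) Q(3) v0])
    obtain p where p: "odd_sylow p P" using good_odd_sylow[OF P(1)] by blast
    obtain g where g: "g \<in> P" "g \<in> carrier SL2" "(trace2 g)\<^sup>2 \<noteq> 4"
      using odd_sylow_regular_center[OF p] by blast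
    have gc: "g \<in> centr k" "g \<in> centr l" using g(1) P(2) Q(2) PQ by auto
    have "k \<in> centr g" "l \<in> centr g" using gc k(1) l(1) by (auto simp: centr_def)
    then show False using centr_commute[OF g(2,3)] kl by blast
  qed
  moreover have "0 \<in> torus_fixed D k" "0 \<in> torus_fixed D l" using subspace_0[OF D] by (auto simp: torus_fixed_def)
  ultimately show ?thesis by blast
qed

lemma card_torus_fixed_le:
  assumes x: "x \<in> carrier SL2" and D: "\<And>v. v \<in> D \<Longrightarrow> act x v \<in> D"
    and k: "k \<in> carrier SL2" and l: "l \<in> carrier SL2" and xk: "x ** k = l ** x"
  shows "card (torus_fixed D k) \<le> card (torus_fixed D l)"
proof (rule card_inj_on_le)
  have "inj (act x)" by (rule inj_on_inverseI[of _ "act (inv\<^bsub>SL2\<^esub> x)"]) (rule act_inv[OF x])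
  then show "inj_on (act x) (torus_fixed D k)" by (rule inj_on_subset) simp
  show "act x ` torus_fixed D k \<subseteq> torus_fixed D l"
  proof
    fix u assume "u \<in> act x ` torus_fixed D k"
    then obtain v where v: "v \<in> torus_fixed D k" "u = act x v" by blast
    have uD: "u \<in> D" using v D by (simp add: torus_fixed_def)
    have ix: "inv\<^bsub>SL2\<^esub> x \<in> carrier SL2" using x by simp
    show "u \<in> torus_fixed D l"
    proof (cases "v = 0")
      case True
      then show ?thesis using uD v(2) x by (simp add: torus_fixed_def)
    next
      case False
      then obtain P where P: "good P" "P \<subseteq> centr k" "v \<in> Fix P" using v(1) False unfolding torus_fixed_def by blast
      have "act (inv\<^bsub>SL2\<^esub> x) u = v" using act_inv[OF x] v(2) by simp
      then have "u \<in> Fix (conj_set SL2 P (inv\<^bsub>SL2\<^esub> x))" using Fix_conj_set[OF ix good_carrier[OF P(1)]] P(3) by simp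
      moreover have "conj_set SL2 P (inv\<^bsub>SL2\<^esub> x) \<subseteq> centr l"
      proof
        fix y assume "y \<in> conj_set SL2 P (inv\<^bsub>SL2\<^esub> x)"
        then obtain p where p: "p \<in> P" "y = inv\<^bsub>SL2\<^esub> (inv\<^bsub>SL2\<^esub> x) \<otimes>\<^bsub>SL2\<^esub> p \<otimes>\<^bsub>SL2\<^esub> inv\<^bsub>SL2\<^esub> x"
          unfolding conj_set_def by blast
        have pc: "p \<in> carrier SL2" using p(1) good_carrier[OF P(1)] by blast
        have pk: "p \<otimes>\<^bsub>SL2\<^esub> k = k \<otimes>\<^bsub>SL2\<^esub> p" using p(1) P(2) by (auto simp: centr_def)
        have y: "y = x \<otimes>\<^bsub>SL2\<^esub> p \<otimes>\<^bsub>SL2\<^esub> inv\<^bsub>SL2\<^esub> x" using p(2) x by (simp del: mult_SL2 one_SL2)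
        then have yc: "y \<in> carrier SL2" using x pc ix by (simp del: mult_SL2 one_SL2)
        have xk': "x \<otimes>\<^bsub>SL2\<^esub> k = l \<otimes>\<^bsub>SL2\<^esub> x" using xk by simp
        have "inv\<^bsub>SL2\<^esub> x \<otimes>\<^bsub>SL2\<^esub> l = inv\<^bsub>SL2\<^esub> x \<otimes>\<^bsub>SL2\<^esub> (l \<otimes>\<^bsub>SL2\<^esub> x) \<otimes>\<^bsub>SL2\<^esub> inv\<^bsub>SL2\<^esub> x"
          using x l by (simp add: SL2.m_assoc del: mult_SL2 one_SL2)
        also have "\<dots> = k \<otimes>\<^bsub>SL2\<^esub> inv\<^bsub>SL2\<^esub> x"
          using x k by (simp add: xk'[symmetric] SL2.m_assoc[symmetric] del: mult_SL2 one_SL2)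
        finally have "y \<otimes>\<^bsub>SL2\<^esub> l = x \<otimes>\<^bsub>SL2\<^esub> (p \<otimes>\<^bsub>SL2\<^esub> k) \<otimes>\<^bsub>SL2\<^esub> inv\<^bsub>SL2\<^esub> x"
          unfolding y using x l k pc by (simp add: SL2.m_assoc del: mult_SL2 one_SL2)
        also have "\<dots> = (x \<otimes>\<^bsub>SL2\<^esub> k) \<otimes>\<^bsub>SL2\<^esub> p \<otimes>\<^bsub>SL2\<^esub> inv\<^bsub>SL2\<^esub> x"
          unfolding pk using x k pc by (simp add: SL2.m_assoc del: mult_SL2 one_SL2)
        also have "\<dots> = l \<otimes>\<^bsub>SL2\<^esub> y"
          unfolding xk' y using x l pc by (simp add: SL2.m_assoc del: mult_SL2 one_SL2)
        finally show "y \<in> centr l" using yc by (simp add: centr_def)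
      qed
      ultimately show ?thesis using uD good_conj_set[OF P(1) ix] unfolding torus_fixed_def by blast
    qed
  qed
qed simp

text \<open>The central involution and two noncommuting elements of order 4 of a quaternion group bound \<open>V\<close> by
  the fixed space \<open>D\<close> of that group. The quaternion group normalizes the good group fixing a
  vector of \<open>D\<close>, and one of \<open>i\<close>, \<open>j\<close>, \<open>i ** j\<close> centralizes it, so \<open>D\<close> is a union of three subspaces with trivial
  pairwise intersections; \<open>x\<close> permutes them cyclically.\<close>

lemma card_V_le_256:
  assumes "q = 2"
  shows "CARD('v) \<le> 256"
proof -
  obtain i j x :: "'f ^ 2 ^ 2" where ijx: "i \<in> carrier SL2" "j \<in> carrier SL2" "x \<in> carrier SL2"
    and sq: "i ** i = mat2 (- 1) 0 0 (- 1)" "j ** j = mat2 (- 1) 0 0 (- 1)" "j ** i = mat2 (- 1) 0 0 (- 1) ** (i ** j)"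
    and x: "x ** i = j ** x" "x ** j = (i ** j) ** x" "x ** (i ** j) = i ** x"
    and tr: "trace2 i = 0" "trace2 j = 0" "trace2 (i ** j) = 0"
    by (rule exists_quaternion_group[OF two])
  let ?m = "mat2 (- 1) 0 0 (- 1) :: 'f ^ 2 ^ 2"
  have m: "?m \<in> carrier SL2" by simp
  have mm: "?m ** ?m = mat2 1 0 0 1" by simp
  have ij: "i ** j \<in> carrier SL2" using SL2.m_closed[OF ijx(1,2)] by simp
  have mc: "?m ** A = A ** ?m" for A :: "'f ^ 2 ^ 2"
    by (cases A rule: mat2_exhaust) simp
  have square_pow: "g [^]\<^bsub>SL2\<^esub> q = g ** g" if "g \<in> carrier SL2" for g :: "'f ^ 2 ^ 2"
    using that SL2.l_one[OF that] unfolding assms numeral_2_eq_2 by simp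
  let ?F = "{v \<in> UNIV. act ?m v = v}"
  \<comment> \<open>In characteristic 2 the involution is unipotent, so its fixed space is nonzero;
    being central, it makes this space invariant, hence all of \<open>V\<close>.\<close>
  have le: "CARD('v) \<le> card ?F ^ q"
    by (rule card_le_card_Fix_power[OF m subspace_UNIV]) (simp_all add: square_pow act_one)
  have fs: "subspace ?F" using subspace_Fix[of "{?m}"] m by (simp add: Fix_def)
  have "?F = {0} \<or> ?F = UNIV"
  proof (rule irreducible[OF fs])
    fix g :: "'f ^ 2 ^ 2" and w assume g: "g \<in> carrier SL2" "w \<in> ?F"
    have "act ?m (act g w) = act (?m ** g) w" by (rule act_mult[OF m g(1), symmetric])
    also have "\<dots> = act g (act ?m w)" unfolding mc by (rule act_mult[OF g(1) m])
    also have "\<dots> = act g w" using g(2) by simp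
    finally show "act g w \<in> ?F" by simp
  qed
  moreover have "?F \<noteq> {0}"
  proof
    assume "?F = {0}"
    then have "CARD('v) \<le> 1" using le by simp
    moreover obtain v0 :: 'v where "v0 \<noteq> 0" using nonzero by blast
    then have "CARD('v) \<ge> 2" using card_mono[OF finite_V subset_UNIV, of "{0, v0}"] by simp
    ultimately show False by simp
  qed
  ultimately have F: "?F = UNIV" by blast
  have mtriv: "act ?m v = v" for v
  proof -
    have "v \<in> ?F" unfolding F by simp
    then show ?thesis by simp
  qed
  let ?D = "Fix {i, j}"
  have subD: "subspace ?D" using subspace_Fix ijx by simp
  \<comment> \<open>Modulo the center \<open>i\<close> and \<open>j\<close> are commuting
    involutions on \<open>V\<close>; passing to the fixed space of each costs at most a square root,
    so \<open>V\<close> has at most the fourth power of the size of \<open>?D\<close>.\<close>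
  have "CARD('v) \<le> card {v \<in> UNIV. act i v = v} ^ q"
    by (rule card_le_card_Fix_power[OF ijx(1) subspace_UNIV]) (simp_all add: square_pow ijx sq mtriv)
  then have V1: "CARD('v) \<le> card (Fix {i}) ^ 2" using assms by (simp add: Fix_def)
  have "card (Fix {i}) \<le> card {v \<in> Fix {i}. act j v = v} ^ q"
  proof (rule card_le_card_Fix_power[OF ijx(2)])
    show "subspace (Fix {i})" using subspace_Fix ijx by simp
    fix v assume v: "v \<in> Fix {i}"
    have "act j (act i v) = act (i ** j) v" using act_mult[OF ijx(2,1)] act_mult[OF m ij] sq(3) mtriv by simp
    then have "act i (act j v) = act j v" using act_mult[OF ijx(1,2)] v by (simp add: Fix_def)
    then show "act j v \<in> Fix {i}" by (simp add: Fix_def)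
  qed (simp add: square_pow ijx sq mtriv)
  moreover have "{v \<in> Fix {i}. act j v = v} = ?D" by (auto simp: Fix_def)
  ultimately have "card (Fix {i}) \<le> card ?D ^ 2" using assms by simp
  then have "card (Fix {i}) ^ 2 \<le> (card ?D ^ 2) ^ 2" by (rule power_mono) simp
  then have V4: "CARD('v) \<le> card ?D ^ 4" using V1 by simp
  have nc: "i ** j \<noteq> j ** i"
  proof
    assume eq: "i ** j = j ** i"
    obtain a b c d where abcd: "i ** j = mat2 a b c d" by (rule mat2_exhaust)
    have "mat2 a b c d = ?m ** mat2 a b c d" using eq sq(3) abcd by simp
    then have "a = - a" "b = - b" "c = - c" "d = - d" by (simp_all add: mat2_eq_iff)
    then have "2 * a = 0" "2 * b = 0" by (simp_all add: eq_neg_iff_add_eq_0)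
    then have "a = 0" "b = 0" using two by auto
    then show False using ij abcd by simp
  qed
  have reg: "(trace2 i)\<^sup>2 \<noteq> 4" "(trace2 j)\<^sup>2 \<noteq> 4" "(trace2 (i ** j))\<^sup>2 \<noteq> 4"
  proof -
    have "(4::'f) = 2 * 2" by simp
    then have "(4::'f) \<noteq> 0" using two by (simp only: mult_eq_0_iff) simp
    then show "(trace2 i)\<^sup>2 \<noteq> 4" "(trace2 j)\<^sup>2 \<noteq> 4" "(trace2 (i ** j))\<^sup>2 \<noteq> 4" using tr by auto
  qed
  have nc2: "i ** (i ** j) \<noteq> (i ** j) ** i" "j ** (i ** j) \<noteq> (i ** j) ** j"
  proof -
    show "i ** (i ** j) \<noteq> (i ** j) ** i"
    proof
      assume "i ** (i ** j) = (i ** j) ** i"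
      then have "i \<otimes>\<^bsub>SL2\<^esub> (i ** j) = i \<otimes>\<^bsub>SL2\<^esub> (j ** i)" by (simp add: matrix_mul_assoc)
      then have "i ** j = j ** i" using SL2.Units_l_cancel[of i "i ** j" "j ** i"] SL2.Units_eq ijx ij SL2.m_closed[OF ijx(2,1)] by simp
      then show False using nc by blast
    qed
    show "j ** (i ** j) \<noteq> (i ** j) ** j"
    proof
      assume "j ** (i ** j) = (i ** j) ** j"
      then have "(j ** i) \<otimes>\<^bsub>SL2\<^esub> j = (i ** j) \<otimes>\<^bsub>SL2\<^esub> j" by (simp add: matrix_mul_assoc)
      then have "j ** i = i ** j" using SL2.right_cancel[of j "j ** i" "i ** j"] ijx ij SL2.m_closed[OF ijx(2,1)] by simp
      then show False using nc by simp
    qed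
  qed
  have Dx: "act x v \<in> ?D" if "v \<in> ?D" for v
  proof -
    have v: "act i v = v" "act j v = v" using that by (simp_all add: Fix_def)
    then have "act (i ** j) v = v" using act_mult[OF ijx(1,2)] by simp
    then have "act i (act x v) = act x v" "act j (act x v) = act x v"
      using v act_mult[OF ijx(1,3)] act_mult[OF ijx(3) ij] x(3) act_mult[OF ijx(2,3)] act_mult[OF ijx(3,1)] x(1) by simp_all
    then show ?thesis by (simp add: Fix_def)
  qed
  let ?A = "torus_fixed ?D"
  have "card (?A i) \<le> card (?A j)" "card (?A j) \<le> card (?A (i ** j))" "card (?A (i ** j)) \<le> card (?A i)"
    using card_torus_fixed_le[OF ijx(3) Dx] ijx ij x by simp_all
  then have eqc: "card (?A j) = card (?A i)" "card (?A (i ** j)) = card (?A i)" by simp_all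
  have disj: "?A i \<inter> ?A j = {0}" "?A i \<inter> ?A (i ** j) = {0}" "?A j \<inter> ?A (i ** j) = {0}"
    using torus_fixed_disjoint[OF subD] ijx ij reg nc nc2 by simp_all
  have cov: "?D = ?A i \<union> (?A j \<union> ?A (i ** j))"
  proof (intro equalityI subsetI)
    fix v assume v: "v \<in> ?D"
    show "v \<in> ?A i \<union> (?A j \<union> ?A (i ** j))"
    proof (cases "v = 0")
      case True
      then show ?thesis using v by (simp add: torus_fixed_def)
    next
      case False
      then obtain P where P: "good P" "v \<in> NV P" using cover_good by blast
      have FP: "v \<in> Fix P" by (rule NV_Fix[OF good_carrier[OF P(1)] P(2)])
      obtain p where p: "odd_sylow p P" using good_odd_sylow[OF P(1)] by blast
      obtain g where g: "g \<in> P" "g \<in> carrier SL2" "(trace2 g)\<^sup>2 \<noteq> 4" "P \<subseteq> centr g"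
        using odd_sylow_regular_center[OF p] by blast
      have n: "norm_set SL2 P = centr g \<union> inverters g"
        by (rule norm_set_eq[OF two good_subgroup[OF P(1)] g(1,3,4)])
      have vij: "act i v = v" "act j v = v" using v by (simp_all add: Fix_def)
      have nij: "i \<in> centr g \<union> inverters g" "j \<in> centr g \<union> inverters g"
        unfolding n[symmetric] using normal_vectors_D[OF P(2)] ijx vij by blast+
      \<comment> \<open>Two elements inverting \<open>g\<close> have a product centralizing it, so
        one of the three units always lies in the torus.\<close>
      have "i ** j \<in> centr g" if "i \<in> inverters g" "j \<in> inverters g"
      proof -
        have ig: "inv\<^bsub>SL2\<^esub> g \<in> carrier SL2" using g(2) by simp
        have 1: "i \<otimes>\<^bsub>SL2\<^esub> g = inv\<^bsub>SL2\<^esub> g \<otimes>\<^bsub>SL2\<^esub> i" "j \<otimes>\<^bsub>SL2\<^esub> g = inv\<^bsub>SL2\<^esub> g \<otimes>\<^bsub>SL2\<^esub> j"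
          using that by (auto simp: inverters_def)
        have "i \<otimes>\<^bsub>SL2\<^esub> inv\<^bsub>SL2\<^esub> g = g \<otimes>\<^bsub>SL2\<^esub> (inv\<^bsub>SL2\<^esub> g \<otimes>\<^bsub>SL2\<^esub> i) \<otimes>\<^bsub>SL2\<^esub> inv\<^bsub>SL2\<^esub> g"
          using g(2) ig ijx by (simp add: SL2.m_assoc[symmetric] del: mult_SL2 one_SL2)
        also have "\<dots> = g \<otimes>\<^bsub>SL2\<^esub> i"
          unfolding 1(1)[symmetric] using g(2) ig ijx by (simp add: SL2.m_assoc del: mult_SL2 one_SL2)
        finally have 2: "i \<otimes>\<^bsub>SL2\<^esub> inv\<^bsub>SL2\<^esub> g = g \<otimes>\<^bsub>SL2\<^esub> i" .
        have "i \<otimes>\<^bsub>SL2\<^esub> j \<otimes>\<^bsub>SL2\<^esub> g = i \<otimes>\<^bsub>SL2\<^esub> inv\<^bsub>SL2\<^esub> g \<otimes>\<^bsub>SL2\<^esub> j"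
          using g(2) ig ijx by (simp add: SL2.m_assoc 1(2) del: mult_SL2 one_SL2)
        also have "\<dots> = g \<otimes>\<^bsub>SL2\<^esub> (i \<otimes>\<^bsub>SL2\<^esub> j)"
          unfolding 2 using g(2) ijx by (simp add: SL2.m_assoc del: mult_SL2 one_SL2)
        finally show ?thesis using ij by (simp add: centr_def)
      qed
      then consider "i \<in> centr g" | "j \<in> centr g" | "i ** j \<in> centr g" using nij by blast
      moreover have "v \<in> ?A k" if k: "k \<in> carrier SL2" "(trace2 k)\<^sup>2 \<noteq> 4" "k \<in> centr g" for k
      proof -
        have "centr g = centr k" by (rule centr_eq[OF g(2,3) k(1,2)]) (use k(3) in \<open>simp add: centr_def\<close>)
        then show ?thesis using v FP P(1) g(4) unfolding torus_fixed_def by blast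
      qed
      ultimately show ?thesis using ijx ij reg by cases blast+
    qed
  qed (use torus_fixed_def in blast)
  obtain a where a: "card (?A i) = 2 ^ a" using card_subspace[OF subspace_torus_fixed[OF subD ijx(1) reg(1)]] assms by blast
  obtain d where d: "card ?D = 2 ^ d" using card_subspace[OF subD] assms by blast
  have "?A i \<inter> (?A j \<union> ?A (i ** j)) = {0}" using disj by blast
  then have "card (?A i) + card (?A j \<union> ?A (i ** j)) = card ?D + 1"
    using card_Un_Int[of "?A i" "?A j \<union> ?A (i ** j)"] cov by simp
  moreover have "card (?A j) + card (?A (i ** j)) = card (?A j \<union> ?A (i ** j)) + 1"
    using card_Un_Int[of "?A j" "?A (i ** j)"] disj(3) by simp
  \<comment> \<open>Three subspaces of equal size, sharing only 0, cover \<open>?D\<close>.\<close>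
  ultimately have "2 ^ d + 2 = 3 * (2::nat) ^ a" using eqc a d by simp
  then have "card ?D \<le> 4" unfolding d by (rule power_2_eq_3_power_2_minus_2)
  then have "card ?D ^ 4 \<le> 4 ^ 4" by (rule power_mono) simp
  then show ?thesis using V4 by simp
qed

text \<open>If one of the two Sylow subgroups fixes only 0, its set is empty and the other set alone
  covers, so the cases with the unipotent subgroup apply; both exceptions come from there. If both
  fix nonzero vectors, the equation has no solution.\<close>

theorem mixed_case:
  "t = 13 \<and> CARD('v) = 3 ^ 6 \<and> CNV R = UNIV - {0} \<or> t = 5 \<and> CARD('v) = 3 ^ 4 \<and> CNV S = UNIV - {0}"
proof -
  obtain c where c: "card (Fix R) = q ^ c" using card_subspace[OF subspace_Fix[OF good_carrier[OF good_RS(1)]]] by blast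
  obtain e where e: "card (Fix S) = q ^ e" using card_subspace[OF subspace_Fix[OF good_carrier[OF good_RS(2)]]] by blast
  have r: "prime r" "odd r" and s: "prime s" "odd s" using R(1) S(1) by (auto simp: odd_sylow_def)
  have dvd: "r dvd CARD('f) - 1" "s dvd CARD('f) + 1" using R(2) S(2) card_t by simp_all
  obtain w f where wf: "card W = q ^ w" "card (Fix unip_group) = q ^ f" "CARD('v) = q ^ w * q ^ f"
    "(t - 1) div 2 \<le> w" "q ^ w mod t = 1" by (rule exponents)
  have cV: "CARD('v) = q ^ w" using wf(2,3) Fix_unip_trivial by simp
  have q1: "q > 1" by (rule prime_gt_1_nat[OF prime_q])
  have cw: "c \<le> w"
    using card_mono[OF finite_V subset_UNIV, of "Fix R"] q1 unfolding c cV by simp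
  have ew: "e \<le> w"
    using card_mono[OF finite_V subset_UNIV, of "Fix S"] q1 unfolding e cV by simp
  consider "c = 0" | "e = 0" | "c \<ge> 1" "e \<ge> 1" by linarith
  then show ?thesis
  proof cases
    case 1
    then have "card (CNV R) = 0" using card_CNV_odd_sylow[OF R(1)] card_NV_good[OF good_RS(1)] c by simp
    then have "CNV R = {}" by simp
    then show ?thesis using nonsplit_case[OF S] cover by blast
  next
    case 2
    then have "card (CNV S) = 0" using card_CNV_odd_sylow[OF S(1)] card_NV_good[OF good_RS(2)] e by simp
    then have "CNV S = {}" by simp
    then show ?thesis using split_case[OF R] cover by blast
  next
    case 3
    show ?thesis
    proof (cases "q = 2")
      case True
      have "(2::nat) ^ w \<le> 256" using card_V_le_256[OF True] cV True by simp
      moreover have "2 ^ w mod t = 1" using wf(5) True by simp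
      ultimately have False by (rule mixed_equation_no_solution_2[OF prime_t t_ge_5 r R(2) s S(2) wf(4)])
      then show ?thesis ..
    next
      case False
      then have q: "odd q" using prime_q prime_odd_nat prime_ge_2_nat[of q] by force
      obtain z where z: "z \<in> carrier SL2" "conj_set SL2 R z \<subseteq> split_torus"
        using conj_into_split_torus[OF R(1) dvd(1)] by blast
      \<comment> \<open>The number of conjugates was computed for subgroups of the diagonal torus,
        so it is transferred along one conjugation.\<close>
      have "conj_set SL2 (conj_set SL2 R z) ` carrier SL2 = conj_set SL2 R ` carrier SL2"
      proof (intro equalityI subsetI)
        fix X assume "X \<in> conj_set SL2 (conj_set SL2 R z) ` carrier SL2"
        then obtain y where y: "y \<in> carrier SL2" "X = conj_set SL2 (conj_set SL2 R z) y" by blast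
        then show "X \<in> conj_set SL2 R ` carrier SL2"
          using SL2.conj_set_conj_set[OF good_subgroup[OF good_RS(1)] z(1) y(1)] SL2.m_closed[OF z(1) y(1)] by blast
      next
        fix X assume "X \<in> conj_set SL2 R ` carrier SL2"
        then obtain y where y: "y \<in> carrier SL2" "X = conj_set SL2 R y" by blast
        have iy: "inv\<^bsub>SL2\<^esub> z \<otimes>\<^bsub>SL2\<^esub> y \<in> carrier SL2" using z(1) y(1) by (simp del: mult_SL2)
        have "z \<otimes>\<^bsub>SL2\<^esub> (inv\<^bsub>SL2\<^esub> z \<otimes>\<^bsub>SL2\<^esub> y) = y" using z(1) y(1) by (simp add: SL2.m_assoc[symmetric] del: mult_SL2 one_SL2)
        then have "X = conj_set SL2 (conj_set SL2 R z) (inv\<^bsub>SL2\<^esub> z \<otimes>\<^bsub>SL2\<^esub> y)"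
          using SL2.conj_set_conj_set[OF good_subgroup[OF good_RS(1)] z(1) iy] y(2) by simp
        then show "X \<in> conj_set SL2 (conj_set SL2 R z) ` carrier SL2" using iy by blast
      qed
      then have N: "2 * card (conj_set SL2 R ` carrier SL2) = t * (t + 1)"
        using card_conjugates_split[OF two odd_sylow_conj_set[OF R(1) z(1)] dvd(1) z(2)] card_t by simp
      have N': "2 * card (conj_set SL2 S ` carrier SL2) = t * (t - 1)"
        using card_conjugates_nonsplit[OF two S(1) dvd(2)] card_t by simp
      have eq: "q ^ w = 1 + card (conj_set SL2 R ` carrier SL2) * (q ^ c - 1)
          + card (conj_set SL2 S ` carrier SL2) * (q ^ e - 1)"
        using card_V_mixed unfolding c e cV .
      obtain g where g: "g \<in> carrier SL2" "(trace2 g)\<^sup>2 \<noteq> 4" "R \<subseteq> centr g"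
        using odd_sylow_regular_center[OF R(1)] by blast
      obtain h where h: "h \<in> carrier SL2" "(trace2 h)\<^sup>2 \<noteq> 4" "S \<subseteq> centr h"
        using odd_sylow_regular_center[OF S(1)] by blast
      have bound: "w \<le> q * x" if "q ^ w \<le> (q ^ x) ^ q" for x
      proof -
        have "q ^ w \<le> q ^ (x * q)" using that by (simp add: power_mult)
        then show ?thesis using q1 by (simp add: mult.commute)
      qed
      have "w \<le> q * c" if "q dvd t - 1"
        using card_V_le_Fix_power[OF good_RS(1) g q] card_centr_minus[OF two R(1) dvd(1) g] that card_t cV c bound by simp
      moreover have "w \<le> q * e" if "q dvd t + 1"
        using card_V_le_Fix_power[OF good_RS(2) h q] card_centr_plus[OF two S(1) dvd(2) h] that card_t cV e bound by simp
      ultimately have False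
        using mixed_equation_no_solution_odd[OF prime_t t_ge_5 r R(2) s S(2) prime_q q q_neq_t N N' eq 3 cw ew wf(4)] by blast
      then show ?thesis ..
    qed
  qed
qed

end

subsection \<open>The exceptional groups\<close>

lemma SL2_iso:
  fixes h :: "'f::comm_ring_1 \<Rightarrow> 'g::comm_ring_1"
  assumes bij: "bij h" and h1: "h 1 = 1" and add: "\<And>x y. h (x + y) = h x + h y" and mult: "\<And>x y. h (x * y) = h x * h y"
  shows "(SL2 :: ('f ^ 2 ^ 2) monoid) \<cong> (SL2 :: ('g ^ 2 ^ 2) monoid)"
proof (rule is_isoI[OF isoI])
  define H :: "'f ^ 2 ^ 2 \<Rightarrow> 'g ^ 2 ^ 2" where "H A = mat2 (h (A $ 1 $ 1)) (h (A $ 1 $ 2)) (h (A $ 2 $ 1)) (h (A $ 2 $ 2))" for A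
  have H: "H (mat2 a b c d) = mat2 (h a) (h b) (h c) (h d)" for a b c d by (simp add: H_def)
  have diff: "h (x - y) = h x - h y" for x y using add[of "x - y" y] by simp
  have inj: "h x = h y \<longleftrightarrow> x = y" for x y using bij by (simp add: bij_def inj_eq)
  have det: "H (mat2 a b c d) \<in> carrier SL2 \<longleftrightarrow> mat2 a b c d \<in> carrier SL2" for a b c d
  proof -
    have "h a * h d - h b * h c = 1 \<longleftrightarrow> h (a * d - b * c) = h 1" by (simp add: h1 diff mult)
    then show ?thesis by (simp add: H inj)
  qed
  have HSL2: "H A \<in> carrier SL2 \<longleftrightarrow> A \<in> carrier SL2" for A by (cases A rule: mat2_exhaust) (use det in blast)
  show "H \<in> hom SL2 SL2"
  proof (rule homI)
    fix A B :: "'f ^ 2 ^ 2"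
    show "H (A \<otimes>\<^bsub>SL2\<^esub> B) = H A \<otimes>\<^bsub>SL2\<^esub> H B"
      by (cases A rule: mat2_exhaust; cases B rule: mat2_exhaust) (simp add: H add mult)
  qed (simp add: HSL2)
  show "bij_betw H (carrier SL2) (carrier SL2)"
  proof (rule bij_betw_imageI)
    show "inj_on H (carrier SL2)"
    proof (rule inj_onI)
      fix A B assume "H A = H B"
      then show "A = B" by (cases A rule: mat2_exhaust; cases B rule: mat2_exhaust) (simp add: H inj)
    qed
    have surj: "\<exists>x. y = h x" for y using bij by (simp add: bij_def surj_def)
    show "H ` carrier SL2 = carrier SL2"
    proof (intro equalityI subsetI)
      fix B :: "'g ^ 2 ^ 2" assume B: "B \<in> carrier SL2"
      obtain a' b' c' d' where B': "B = mat2 a' b' c' d'" by (rule mat2_exhaust)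
      obtain a b c d where "a' = h a" "b' = h b" "c' = h c" "d' = h d" using surj by metis
      then have "B = H (mat2 a b c d)" by (simp add: B' H)
      then show "B \<in> H ` carrier SL2" using B HSL2 by blast
    qed (auto simp: HSL2)
  qed
qed

text \<open>Both rings are quotients of the integers with the same characteristic, so sending
  \<open>of_nat k\<close> to \<open>of_nat k\<close> is well defined and bijective. Working over
  commutative rings admits the numeral types \<open>5\<close> and \<open>13\<close>.\<close>

lemma SL2_iso_prime_field:
  assumes f: "\<And>x::'f::comm_ring_1. \<exists>k. x = of_nat k" and g: "\<And>x::'g::comm_ring_1. \<exists>k. x = of_nat k"
    and char: "CHAR('f) = CHAR('g)"
  shows "(SL2 :: ('f ^ 2 ^ 2) monoid) \<cong> (SL2 :: ('g ^ 2 ^ 2) monoid)"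
proof -
  define h :: "'f \<Rightarrow> 'g" where "h x = of_nat (SOME k. x = of_nat k)" for x
  have h: "h (of_nat k) = of_nat k" for k
  proof -
    have "of_nat k = (of_nat (SOME l. of_nat k = (of_nat l :: 'f)) :: 'f)" by (rule someI) simp
    then show ?thesis unfolding h_def of_nat_eq_iff_cong_CHAR char by (simp add: of_nat_eq_iff_cong_CHAR cong_sym_eq)
  qed
  show ?thesis
  proof (rule SL2_iso[of h])
    show "bij h"
    proof (rule bijI)
      show "inj h"
      proof (rule injI)
        fix x y assume "h x = h y"
        moreover obtain k l where "x = of_nat k" "y = of_nat l" using f by metis
        ultimately show "x = y" by (simp add: h of_nat_eq_iff_cong_CHAR char)
      qed
      show "surj h" using g h by (metis surjI surj_def)
    qed
    show "h 1 = 1" using h[of 1] by simp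
    fix x y :: 'f
    obtain k l where "x = of_nat k" "y = of_nat l" using f by metis
    then show "h (x + y) = h x + h y" "h (x * y) = h x * h y"
      using h by (simp_all flip: of_nat_add of_nat_mult)
  qed
qed

lemma of_nat_surj_5: "\<exists>k. (x::5) = of_nat k"
  by (cases x) (metis of_int_of_nat_eq zero_le_imp_eq_int)

lemma of_nat_surj_13: "\<exists>k. (x::13) = of_nat k"
  by (cases x) (metis of_int_of_nat_eq zero_le_imp_eq_int)

context sl2_prime_module
begin

lemma CHAR_f: "CHAR('f) = t"
proof (rule CHAR_eqI)
  show "of_nat t = (0::'f)" using of_nat_eq_0_iff_CARD_prime_power[OF prime_t card_f] by simp
  show "t dvd k" if "of_nat k = (0::'f)" for k using of_nat_eq_0_iff_CARD_prime_power[OF prime_t card_f] that by simp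
qed

lemma exception_13:
  assumes "t = 13" "prime r" "odd r" "r dvd t - 1"
  shows "(SL2 :: ('f ^ 2 ^ 2) monoid) \<cong> (SL2 :: (13 ^ 2 ^ 2) monoid) \<and> r = 3"
proof
  show "(SL2 :: ('f ^ 2 ^ 2) monoid) \<cong> (SL2 :: (13 ^ 2 ^ 2) monoid)"
    by (rule SL2_iso_prime_field[OF surj_of_nat of_nat_surj_13]) (simp add: CHAR_f assms(1))
  have "r dvd 2 * (2 * 3)" using assms by simp
  then have "r dvd 2 \<or> r dvd 3" using assms(2) by (simp only: prime_dvd_mult_iff) blast
  then show "r = 3" using primes_dvd_imp_eq[OF assms(2), of 2] primes_dvd_imp_eq[OF assms(2), of 3] assms(3) by auto
qed

lemma exception_5:
  assumes "t = 5" "prime s" "odd s" "s dvd t + 1"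
  shows "(SL2 :: ('f ^ 2 ^ 2) monoid) \<cong> (SL2 :: (5 ^ 2 ^ 2) monoid) \<and> s = 3"
proof
  show "(SL2 :: ('f ^ 2 ^ 2) monoid) \<cong> (SL2 :: (5 ^ 2 ^ 2) monoid)"
    by (rule SL2_iso_prime_field[OF surj_of_nat of_nat_surj_5]) (simp add: CHAR_f assms(1))
  have "s dvd 2 * 3" using assms by simp
  then have "s dvd 2 \<or> s dvd 3" using assms(2) by (simp only: prime_dvd_mult_iff)
  then show "s = 3" using primes_dvd_imp_eq[OF assms(2), of 2] primes_dvd_imp_eq[OF assms(2), of 3] assms(3) by auto
qed

end

context sl2_module
begin

text \<open>\<open>X\<close> and \<open>Y\<close> stand for any two of the three sets, so that each
  pair enters the prime field setting through the same lemma.\<close>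

lemma prime_module_if_covered:
  assumes "UNIV - {0} \<subseteq> X \<union> Y"
    and "\<And>v Z. v \<in> Z \<Longrightarrow> Z \<in> {X, Y} \<Longrightarrow> (\<exists>p P. odd_sylow p P \<and> v \<in> NV P) \<or>
      (\<exists>z\<in>carrier SL2. v \<in> NV (conj_set SL2 unip_group z))"
  shows "sl2_prime_module act scale t a q"
proof -
  have "CARD('f) = t \<and> (2::'f) \<noteq> 0"
  proof (rule prime_field_if_covered)
    fix v :: 'v assume "v \<noteq> 0"
    then have "v \<in> X \<or> v \<in> Y" using assms(1) by blast
    then show "(\<exists>r P. odd_sylow r P \<and> v \<in> NV P) \<or> (\<exists>z\<in>carrier SL2. v \<in> NV (conj_set SL2 unip_group z))"
      using assms(2)[of v X] assms(2)[of v Y] by blast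
  qed
  then show ?thesis by (intro sl2_prime_module.intro sl2_prime_module_axioms.intro sl2_module_axioms) simp_all
qed

lemma CNV_odd_sylow_covered: "odd_sylow p P \<Longrightarrow> v \<in> CNV P \<Longrightarrow> \<exists>p P. odd_sylow p P \<and> v \<in> NV P"
  using CNV_odd_sylowE by metis

lemma CNV_unip_covered: "v \<in> CNV unip_group \<Longrightarrow> \<exists>z\<in>carrier SL2. v \<in> NV (conj_set SL2 unip_group z)"
  using CNV_unipE by metis

lemma zero_notin_CNV_odd_sylow: "odd_sylow p P \<Longrightarrow> 0 \<notin> CNV P"
  by (rule zero_notin_CNV[OF odd_sylow_subgroup zero_notin_NV_odd_sylow])

lemma zero_notin_CNV_unip: "0 \<notin> CNV unip_group"
  by (rule zero_notin_CNV[OF subgroup_unip_group zero_notin_NV_unip])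

lemma split_exception:
  assumes R: "odd_sylow r R" "r dvd CARD('f) - 1"
    and not: "\<not> CNV R \<union> CNV unip_group \<subset> UNIV - {0}"
  shows "(SL2 :: ('f ^ 2 ^ 2) monoid) \<cong> (SL2 :: (13 ^ 2 ^ 2) monoid) \<and> r = 3 \<and> CARD('v) = 3 ^ 6 \<and> UNIV - {0} = CNV R"
proof -
  have cover: "UNIV - {0} \<subseteq> CNV R \<union> CNV unip_group"
    using not zero_notin_CNV_odd_sylow[OF R(1)] zero_notin_CNV_unip by blast
  interpret sl2_prime_module act scale t a q
    by (rule prime_module_if_covered[OF cover]) (use CNV_odd_sylow_covered[OF R(1)] CNV_unip_covered in blast)
  have rt: "r dvd t - 1" "prime r" "odd r" using R card_t by (simp_all add: odd_sylow_def)
  show ?thesis using split_case[OF R(1) rt(1) cover] exception_13[OF _ rt(2,3,1)] by simp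
qed

lemma nonsplit_exception:
  assumes S: "odd_sylow s S" "s dvd CARD('f) + 1"
    and not: "\<not> CNV S \<union> CNV unip_group \<subset> UNIV - {0}"
  shows "(SL2 :: ('f ^ 2 ^ 2) monoid) \<cong> (SL2 :: (5 ^ 2 ^ 2) monoid) \<and> s = 3 \<and> CARD('v) = 3 ^ 4 \<and> UNIV - {0} = CNV S"
proof -
  have cover: "UNIV - {0} \<subseteq> CNV S \<union> CNV unip_group"
    using not zero_notin_CNV_odd_sylow[OF S(1)] zero_notin_CNV_unip by blast
  interpret sl2_prime_module act scale t a q
    by (rule prime_module_if_covered[OF cover]) (use CNV_odd_sylow_covered[OF S(1)] CNV_unip_covered in blast)
  have st: "s dvd t + 1" "prime s" "odd s" using S card_t by (simp_all add: odd_sylow_def)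
  show ?thesis using nonsplit_case[OF S(1) st(1) cover] exception_5[OF _ st(2,3,1)] by simp
qed

lemma mixed_exception:
  assumes R: "odd_sylow r R" "r dvd CARD('f) - 1" and S: "odd_sylow s S" "s dvd CARD('f) + 1"
    and not: "\<not> CNV R \<union> CNV S \<subset> UNIV - {0}"
  shows "((SL2 :: ('f ^ 2 ^ 2) monoid) \<cong> (SL2 :: (5 ^ 2 ^ 2) monoid) \<and> s = 3 \<and> CARD('v) = 3 ^ 4 \<and> UNIV - {0} = CNV S) \<or>
    ((SL2 :: ('f ^ 2 ^ 2) monoid) \<cong> (SL2 :: (13 ^ 2 ^ 2) monoid) \<and> r = 3 \<and> CARD('v) = 3 ^ 6 \<and> UNIV - {0} = CNV R)"
proof -
  have cover: "UNIV - {0} \<subseteq> CNV R \<union> CNV S"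
    using not zero_notin_CNV_odd_sylow[OF R(1)] zero_notin_CNV_odd_sylow[OF S(1)] by blast
  interpret sl2_prime_module act scale t a q
    by (rule prime_module_if_covered[OF cover])
      (use CNV_odd_sylow_covered[OF R(1)] CNV_odd_sylow_covered[OF S(1)] in blast)
  have rt: "r dvd t - 1" "prime r" "odd r" using R card_t by (simp_all add: odd_sylow_def)
  have st: "s dvd t + 1" "prime s" "odd s" using S card_t by (simp_all add: odd_sylow_def)
  interpret sl2_mixed_cover act scale t a q r s R S
    by (intro sl2_mixed_cover.intro sl2_mixed_cover_axioms.intro sl2_prime_module_axioms R(1) S(1) rt(1) st(1) cover)
  show ?thesis using mixed_case exception_5[OF _ st(2,3,1)] exception_13[OF _ rt(2,3,1)] by auto
qed

end

theorem theorem3p3: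
  fixes t a q r s :: nat
    and act :: "'f::{field,finite} ^ 2 ^ 2 \<Rightarrow> 'v::ab_group_add \<Rightarrow> 'v"
    and scale :: "'k::{field,finite} \<Rightarrow> 'v \<Rightarrow> 'v"
    and R S T :: "('f ^ 2 ^ 2) set"
  assumes "prime t" and "CARD('f) = t ^ a" and "t ^ a \<ge> 4"
    and "prime q" and "q \<noteq> t" and "CARD('k) = q"
    and "irreducible_linear_group_action SL2 act scale"
    and "\<not> trivial_action SL2 act"
    and "odd_prime_divisors (t ^ a - 1) \<noteq> {} \<Longrightarrow>
           r \<in> odd_prime_divisors (t ^ a - 1) \<and> sylow_subgroup SL2 r R"
    and "odd_prime_divisors (t ^ a + 1) \<noteq> {} \<Longrightarrow>
           s \<in> odd_prime_divisors (t ^ a + 1) \<and> sylow_subgroup SL2 s S"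
    and "sylow_subgroup SL2 t T"
  shows
    "((odd_prime_divisors (t ^ a - 1) \<noteq> {} \<longrightarrow>
         conj_normal_vectors SL2 act R \<union> conj_normal_vectors SL2 act T \<subset> UNIV - {0}) \<and>
      (odd_prime_divisors (t ^ a + 1) \<noteq> {} \<longrightarrow>
         conj_normal_vectors SL2 act S \<union> conj_normal_vectors SL2 act T \<subset> UNIV - {0}) \<and>
      (odd_prime_divisors (t ^ a - 1) \<noteq> {} \<and> odd_prime_divisors (t ^ a + 1) \<noteq> {} \<longrightarrow>
         conj_normal_vectors SL2 act R \<union> conj_normal_vectors SL2 act S \<subset> UNIV - {0})) \<or>
     ((SL2 :: ('f ^ 2 ^ 2) monoid) \<cong> (SL2 :: (5 ^ 2 ^ 2) monoid) \<and> s = 3 \<and>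
        CARD('v) = 3 ^ 4 \<and> UNIV - {0} = conj_normal_vectors SL2 act S) \<or>
     ((SL2 :: ('f ^ 2 ^ 2) monoid) \<cong> (SL2 :: (13 ^ 2 ^ 2) monoid) \<and> r = 3 \<and>
        CARD('v) = 3 ^ 6 \<and> UNIV - {0} = conj_normal_vectors SL2 act R)"
proof -
  interpret sl2_module act scale t a q
    by (intro sl2_module.intro sl2_module_axioms.intro) (use assms(1-8) in simp_all)
  have dvd: "p dvd (CARD('f))\<^sup>2 - 1" if "p dvd CARD('f) - 1 \<or> p dvd CARD('f) + 1" for p
    unfolding square_minus_1_nat using that by (metis dvd_mult dvd_mult2)
  have R: "odd_sylow r R" "r dvd CARD('f) - 1" if "odd_prime_divisors (t ^ a - 1) \<noteq> {}"
    using assms(9)[OF that] dvd[of r] by (simp_all add: odd_prime_divisors_def odd_sylow_def card_f in_prime_factors_iff)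
  have S: "odd_sylow s S" "s dvd CARD('f) + 1" if "odd_prime_divisors (t ^ a + 1) \<noteq> {}"
    using assms(10)[OF that] dvd[of s] by (simp_all add: odd_prime_divisors_def odd_sylow_def card_f in_prime_factors_iff)
  \<comment> \<open>All Sylow subgroups for \<open>t\<close> are conjugate and define the same set
    of vectors, so \<open>T\<close> may be taken to be \<open>unip_group\<close>.\<close>
  obtain z where z: "z \<in> carrier SL2" "T = conj_set SL2 unip_group z"
    using sylow_conj_unip_group[OF assms(1,2,11)] by blast
  have T: "CNV T = CNV unip_group"
    unfolding z(2) by (rule conj_normal_vectors_conj_set[OF refl subgroup_unip_group z(1)])
  let ?m = "odd_prime_divisors (t ^ a - 1) \<noteq> {}" and ?p = "odd_prime_divisors (t ^ a + 1) \<noteq> {}"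
  consider (split) ?m "\<not> CNV R \<union> CNV unip_group \<subset> UNIV - {0}"
    | (nonsplit) ?p "\<not> CNV S \<union> CNV unip_group \<subset> UNIV - {0}"
    | (mixed) ?m ?p "\<not> CNV R \<union> CNV S \<subset> UNIV - {0}"
    | (none) "(?m \<longrightarrow> CNV R \<union> CNV unip_group \<subset> UNIV - {0}) \<and>
        (?p \<longrightarrow> CNV S \<union> CNV unip_group \<subset> UNIV - {0}) \<and>
        (?m \<and> ?p \<longrightarrow> CNV R \<union> CNV S \<subset> UNIV - {0})"
    by argo
  then show ?thesis
  proof cases
    case split
    show ?thesis unfolding T by (rule disjI2, rule disjI2) (rule split_exception[OF R[OF split(1)] split(2)])
  next
    case nonsplit
    show ?thesis unfolding T by (rule disjI2, rule disjI1) (rule nonsplit_exception[OF S[OF nonsplit(1)] nonsplit(2)])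
  next
    case mixed
    show ?thesis unfolding T by (rule disjI2) (rule mixed_exception[OF R[OF mixed(1)] S[OF mixed(2)] mixed(3)])
  next
    case none
    then show ?thesis unfolding T by (rule disjI1)
  qed
qed

end
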